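(* Let $E$ be a finite dimensional Hilbert space and $\mathcal{H}=L^2(\mathbb{R}^n)\otimes E$. Let $H_0$ be a bounded from below self-adjoint operator on $\mathcal{H}$ with form domain equal to $\mathcal{H}^m$ for some real $m>0$ and satisfying $\lim_{k\to0} V_k H_0 V_k^*=H_0$ in norm in $B(\mathcal{H}^m,\mathcal{H}^{-m})$. Let $V$ be a positive locally integrable function on $\mathbb{R}^n$ such that $\lim_{a\to\infty}|\{x\in B_a \mid V(x)<\lambda\}|=0$ for each $\lambda>0$. Then the self-adjoint operator $H$ associated to the form sum $H_0+V$ has purely discrete spectrum.
   Context: For real $s$, $\mathcal{H}^s$ denotes the Sobolev space of order $s$ of $E$-valued functions (distributions) on $\mathbb{R}^n$, with $\mathcal{H}^0=\mathcal{H}$ and $\mathcal{H}^{-m}$ identified with the adjoint space of $\mathcal{H}^m$. Since $H_0$ has form domain $\mathcal{H}^m$, it extends to a continuous operator $\mathcal{H}^m\to\mathcal{H}^{-m}$, also denoted $H_0$. For $k\in\mathbb{R}^n$, $V_k$ is the operator $(V_kf)(x)=e^{ik\cdot x}f(x)$, which is unitary on $\mathcal{H}$ and acts continuously in each $\mathcal{H}^{s}$. $B(\mathcal{H}^m,\mathcal{H}^{-m})$ is the space of bounded operators with the operator norm. "Positive" means $V\geq0$ (scalar valued, acting by multiplication). $B_a=\{x\in\mathbb{R}^n\mid |x-a|\leq1\}$, $|M|$ is the Lebesgue measure of $M$, and $a\to\infty$ means $|a|\to\infty$. The form sum $H_0+V$ is the closed, bounded from below form obtained as the sum of the form of $H_0$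 and of $f\mapsto\int V\|f(x)\|_E^2\,\mathrm{d}x$, with domain $\{f\in\mathcal{H}^m\mid V^{1/2}f\in\mathcal{H}\}$. Purely discrete spectrum means that the essential spectrum is empty. *)

theory Defs
  imports "HOL-Analysis.Analysis"
begin

section \<open>Complex inner product spaces\<close>

text \<open>The inner product is antilinear in the first and linear in the second argument.\<close>

class complex_inner = real_inner +
  fixes scaleC :: "complex \<Rightarrow> 'a \<Rightarrow> 'a" (infixr "*\<^sub>C" 75)
    and cinner :: "'a \<Rightarrow> 'a \<Rightarrow> complex"
  assumes scaleC_add_right: "a *\<^sub>C (x + y) = a *\<^sub>C x + a *\<^sub>C y"
    and scaleC_add_left: "(a + b) *\<^sub>C x = a *\<^sub>C x + b *\<^sub>C x"
    and scaleC_scaleC: "a *\<^sub>C (b *\<^sub>C x) = (a * b) *\<^sub>C x"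
    and scaleC_of_real: "complex_of_real r *\<^sub>C x = r *\<^sub>R x"
    and cinner_commute: "cinner x y = cnj (cinner y x)"
    and cinner_add_right: "cinner x (y + z) = cinner x y + cinner x z"
    and cinner_scaleC_right: "cinner x (a *\<^sub>C y) = a * cinner x y"
    and Re_cinner: "Re (cinner x y) = inner x y"

text \<open>
  The superclasses \<^class>\<open>banach\<close> and \<^class>\<open>second_countable_topology\<close> follow from finite
  dimension; they are listed because the Bochner integral requires them. The zero space is allowed.
\<close>

class finite_dim_hilbert = complex_inner + banach + second_countable_topology +
  assumes finite_dim: "\<exists>B. finite B \<and> (\<forall>x. \<exists>c. x = (\<Sum>b\<in>B. c b *\<^sub>C b))"

instantiation complex :: finite_dim_hilbert
begin

definition "scaleC_complex = ((*) :: complex \<Rightarrow> complex \<Rightarrow> complex)"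

definition "cinner_complex = (\<lambda>x y :: complex. cnj x * y)"

instance
proof
  show "\<exists>B. finite B \<and> (\<forall>x::complex. \<exists>c. x = (\<Sum>b\<in>B. c b *\<^sub>C b))"
    by (intro exI[of _ "{1}"] conjI allI, simp, rule_tac x = "\<lambda>_. x" in exI)
       (simp add: scaleC_complex_def)
qed (auto simp: scaleC_complex_def cinner_complex_def algebra_simps scaleR_conv_of_real
        inner_complex_def)

end

lemma scaleC_one: "1 *\<^sub>C x = (x :: 'a::complex_inner)"
  by (metis of_real_1 scaleC_of_real scaleR_one)

lemma scaleC_scaleR: "a *\<^sub>C (r *\<^sub>R x) = r *\<^sub>R (a *\<^sub>C (x :: 'a::complex_inner))"
  by (metis mult.commute scaleC_of_real scaleC_scaleC)

lemma cinner_scaleC_left: "cinner (a *\<^sub>C x) (y :: 'a::complex_inner) = cnj a * cinner x y"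
  by (metis cinner_commute cinner_scaleC_right complex_cnj_mult)

lemma cinner_eq: "cinner x (y :: 'a::complex_inner) = Complex (inner x y) (inner (\<i> *\<^sub>C x) y)"
proof -
  have "inner (\<i> *\<^sub>C x) y = Re (cnj \<i> * cinner x y)"
    by (metis Re_cinner cinner_scaleC_left)
  then show ?thesis
    by (simp add: complex_eq_iff Re_cinner)
qed

lemma norm_scaleC: "norm (a *\<^sub>C (x :: 'a::complex_inner)) = cmod a * norm x"
proof -
  have "inner (a *\<^sub>C x) (a *\<^sub>C x) = Re (cnj a * a * cinner x x)"
    by (metis Re_cinner cinner_scaleC_left cinner_scaleC_right mult.assoc mult.commute)
  also have "cnj a * a = of_real ((cmod a)\<^sup>2)"
    by (simp only: mult.commute[of "cnj a"] complex_norm_square)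
  also have "Re (of_real ((cmod a)\<^sup>2) * cinner x x) = (cmod a)\<^sup>2 * inner x x"
    by (simp add: Re_cinner)
  finally have "(norm (a *\<^sub>C x))\<^sup>2 = (cmod a * norm x)\<^sup>2"
    by (simp add: power2_norm_eq_inner power_mult_distrib)
  then show ?thesis
    by (simp add: power2_eq_iff_nonneg)
qed

lemma bounded_linear_scaleC: "bounded_linear (\<lambda>x :: 'a::complex_inner. a *\<^sub>C x)"
  by (rule bounded_linear_intro[where K = "cmod a"])
     (simp_all add: scaleC_add_right scaleC_scaleR norm_scaleC)


section \<open>The Hilbert space of square integrable functions\<close>

text \<open>
  Classes of Borel functions modulo equality almost everywhere; every Lebesgue measurable function
  is almost everywhere equal to a Borel function.
\<close>

definition square_integrable :: "(real^'n \<Rightarrow> 'e::finite_dim_hilbert) \<Rightarrow> bool" where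
  "square_integrable f \<longleftrightarrow>
     f \<in> borel_measurable lborel \<and> integrable lborel (\<lambda>x. (norm (f x))\<^sup>2)"

definition L2_rel ::
  "(real^'n \<Rightarrow> 'e::finite_dim_hilbert) \<Rightarrow> (real^'n \<Rightarrow> 'e) \<Rightarrow> bool" where
  "L2_rel f g \<longleftrightarrow> square_integrable f \<and> square_integrable g \<and> (AE x in lborel. f x = g x)"

lemma square_integrable_zero: "square_integrable (\<lambda>x. 0)"
  by (simp add: square_integrable_def)

lemma square_integrable_measurable:
  "square_integrable f \<Longrightarrow> f \<in> borel_measurable lborel"
  by (simp add: square_integrable_def)

lemma square_integrable_add:
  assumes "square_integrable f" "square_integrable g"
  shows "square_integrable (\<lambda>x. f x + g x)"
proof -
  note [measurable] = assms[THEN square_integrable_measurable]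
  have "integrable lborel (\<lambda>x. 2 * (norm (f x))\<^sup>2 + 2 * (norm (g x))\<^sup>2)"
    using assms by (auto simp: square_integrable_def)
  then have "integrable lborel (\<lambda>x. (norm (f x + g x))\<^sup>2)"
  proof (rule Bochner_Integration.integrable_bound)
    show "AE x in lborel. norm ((norm (f x + g x))\<^sup>2)
            \<le> norm (2 * (norm (f x))\<^sup>2 + 2 * (norm (g x))\<^sup>2)"
    proof (intro AE_I2)
      fix x
      have "(norm (f x + g x))\<^sup>2 \<le> (norm (f x) + norm (g x))\<^sup>2"
        by (intro power_mono norm_triangle_ineq) simp
      also have "\<dots> \<le> 2 * (norm (f x))\<^sup>2 + 2 * (norm (g x))\<^sup>2"
        using sum_squares_bound[of "norm (f x)" "norm (g x)"] by (simp add: power2_sum)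
      finally show "norm ((norm (f x + g x))\<^sup>2)
            \<le> norm (2 * (norm (f x))\<^sup>2 + 2 * (norm (g x))\<^sup>2)" by simp
    qed
  qed measurable
  then show ?thesis by (simp add: square_integrable_def)
qed

lemma square_integrable_scaleC:
  assumes "square_integrable f"
  shows "square_integrable (\<lambda>x. a *\<^sub>C f x)"
proof -
  note [measurable] = assms[THEN square_integrable_measurable]
  have "(\<lambda>x. a *\<^sub>C f x) \<in> borel_measurable lborel"
    by (rule borel_measurable_continuous_on[OF _ square_integrable_measurable[OF assms]])
       (rule linear_continuous_on[OF bounded_linear_scaleC])
  then show ?thesis
    using assms by (auto simp: square_integrable_def norm_scaleC power_mult_distrib)
qed

lemma square_integrable_scaleR:
  "square_integrable f \<Longrightarrow> square_integrable (\<lambda>x. r *\<^sub>R f x)"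
  using square_integrable_scaleC[of f "complex_of_real r"] by (simp add: scaleC_of_real)

lemma integrable_inner:
  assumes "square_integrable f" "square_integrable g"
  shows "integrable lborel (\<lambda>x. inner (f x) (g x))"
proof -
  note [measurable] = assms[THEN square_integrable_measurable]
  have "integrable lborel (\<lambda>x. (norm (f x))\<^sup>2 + (norm (g x))\<^sup>2)"
    using assms by (auto simp: square_integrable_def)
  then show ?thesis
  proof (rule Bochner_Integration.integrable_bound)
    show "AE x in lborel. norm (inner (f x) (g x)) \<le> norm ((norm (f x))\<^sup>2 + (norm (g x))\<^sup>2)"
    proof (intro AE_I2)
      fix x
      have "2 * (norm (f x) * norm (g x)) \<le> (norm (f x))\<^sup>2 + (norm (g x))\<^sup>2"
        using sum_squares_bound[of "norm (f x)" "norm (g x)"] by simp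
      moreover have "0 \<le> norm (f x) * norm (g x)" by simp
      ultimately show "norm (inner (f x) (g x)) \<le> norm ((norm (f x))\<^sup>2 + (norm (g x))\<^sup>2)"
        using Cauchy_Schwarz_ineq2[of "f x" "g x"] by simp
    qed
  qed measurable
qed

lemma integrable_cinner:
  assumes "square_integrable f" "square_integrable g"
  shows "integrable lborel (\<lambda>x. cinner (f x) (g x))"
  using integrable_inner[OF assms] integrable_inner[OF square_integrable_scaleC[OF assms(1)] assms(2)]
  by (auto simp: cinner_eq Complex_eq)

quotient_type (overloaded) ('n, 'e) L2 =
    "real^'n \<Rightarrow> 'e::finite_dim_hilbert" / partial: L2_rel
proof (rule part_equivpI)
  show "\<exists>f::real^'n \<Rightarrow> 'e. L2_rel f f"
    by (rule exI[of _ "\<lambda>x. 0"]) (simp add: L2_rel_def square_integrable_zero)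
  show "symp (L2_rel :: (real^'n \<Rightarrow> 'e) \<Rightarrow> _)"
    by (rule sympI) (auto simp: L2_rel_def)
  show "transp (L2_rel :: (real^'n \<Rightarrow> 'e) \<Rightarrow> _)"
    by (rule transpI) (auto simp: L2_rel_def)
qed

lemma L2_rel_rep_abs: "square_integrable f \<Longrightarrow> L2_rel (rep_L2 (abs_L2 f)) f"
  using Quotient3_rep_abs[OF Quotient3_L2, of f] by (simp add: L2_rel_def)

lemma L2_rel_rep: "L2_rel (rep_L2 f) (rep_L2 f)"
  using Quotient3_rep_reflp[OF Quotient3_L2] .

instantiation L2 :: (finite, finite_dim_hilbert) complex_inner
begin

lift_definition zero_L2 :: "('a, 'b) L2" is "\<lambda>x. 0"
  by (simp add: L2_rel_def square_integrable_zero)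

lift_definition plus_L2 :: "('a, 'b) L2 \<Rightarrow> ('a, 'b) L2 \<Rightarrow> ('a, 'b) L2" is "\<lambda>f g x. f x + g x"
  by (auto simp: L2_rel_def square_integrable_add)

lift_definition scaleR_L2 :: "real \<Rightarrow> ('a, 'b) L2 \<Rightarrow> ('a, 'b) L2" is "\<lambda>r f x. r *\<^sub>R f x"
  by (auto simp: L2_rel_def square_integrable_scaleR)

lift_definition scaleC_L2 :: "complex \<Rightarrow> ('a, 'b) L2 \<Rightarrow> ('a, 'b) L2" is "\<lambda>r f x. r *\<^sub>C f x"
  by (auto simp: L2_rel_def square_integrable_scaleC)

definition "uminus_L2 (f :: ('a, 'b) L2) = (-1) *\<^sub>R f"

definition "minus_L2 (f :: ('a, 'b) L2) g = f + - g"

lift_definition inner_L2 :: "('a, 'b) L2 \<Rightarrow> ('a, 'b) L2 \<Rightarrow> real"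
  is "\<lambda>f g. integral\<^sup>L lborel (\<lambda>x. inner (f x) (g x))"
  unfolding L2_rel_def
  by (intro integral_cong_AE)
     (auto dest: integrable_inner[THEN borel_measurable_integrable] simp del: measurable_lborel1)

lift_definition cinner_L2 :: "('a, 'b) L2 \<Rightarrow> ('a, 'b) L2 \<Rightarrow> complex"
  is "\<lambda>f g. integral\<^sup>L lborel (\<lambda>x. cinner (f x) (g x))"
  unfolding L2_rel_def
  by (intro integral_cong_AE)
     (auto dest: integrable_cinner[THEN borel_measurable_integrable] simp del: measurable_lborel1)

definition "norm_L2 (f :: ('a, 'b) L2) = sqrt (inner f f)"

definition "sgn_L2 (f :: ('a, 'b) L2) = inverse (norm f) *\<^sub>R f"

definition "dist_L2 (f :: ('a, 'b) L2) g = norm (f - g)"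

definition "(uniformity :: (('a, 'b) L2 \<times> ('a, 'b) L2) filter) =
  (INF e\<in>{0<..}. principal {(x, y). dist x y < e})"

definition "open (U :: ('a, 'b) L2 set) \<longleftrightarrow>
  (\<forall>x\<in>U. eventually (\<lambda>(x', y). x' = x \<longrightarrow> y \<in> U) uniformity)"

instance
proof
  fix f g h :: "('a, 'b) L2" and r s :: real and a b :: complex
  show "f + g + h = f + (g + h)"
    by transfer (auto simp: L2_rel_def square_integrable_add add.assoc)
  show "f + g = g + f"
    by transfer (auto simp: L2_rel_def square_integrable_add add.commute)
  show "0 + f = f"
    by transfer (auto simp: L2_rel_def)
  show "- f + f = 0"
    unfolding uminus_L2_def
    by transfer (auto simp: L2_rel_def square_integrable_zero)
  show "f - g = f + - g"
    by (simp add: minus_L2_def)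
  show "r *\<^sub>R (f + g) = r *\<^sub>R f + r *\<^sub>R g"
    by transfer (auto simp: L2_rel_def square_integrable_add square_integrable_scaleR scaleR_add_right)
  show "(r + s) *\<^sub>R f = r *\<^sub>R f + s *\<^sub>R f"
    by transfer (auto simp: L2_rel_def square_integrable_add square_integrable_scaleR scaleR_add_left)
  show "r *\<^sub>R s *\<^sub>R f = (r * s) *\<^sub>R f"
    by transfer (auto simp: L2_rel_def square_integrable_scaleR)
  show "1 *\<^sub>R f = f"
    by transfer (auto simp: L2_rel_def)
  show "dist f g = norm (f - g)" "sgn f = inverse (norm f) *\<^sub>R f" "norm f = sqrt (inner f f)"
    by (simp_all add: dist_L2_def sgn_L2_def norm_L2_def)
  show "(uniformity :: (('a, 'b) L2 \<times> ('a, 'b) L2) filter) =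
      (INF e\<in>{0<..}. principal {(x, y). dist x y < e})"
    by (rule uniformity_L2_def)
  show "open U \<longleftrightarrow> (\<forall>x\<in>U. eventually (\<lambda>(x', y). x' = x \<longrightarrow> y \<in> U) uniformity)"
    for U :: "('a, 'b) L2 set"
    by (rule open_L2_def)
  show "inner f g = inner g f"
    by transfer (simp add: inner_commute)
  show "inner (f + g) h = inner f h + inner g h"
    by transfer (auto simp: L2_rel_def inner_add_left integrable_inner)
  show "inner (r *\<^sub>R f) g = r * inner f g"
    by transfer simp
  show "0 \<le> inner f f"
    by transfer simp
  show "inner f f = 0 \<longleftrightarrow> f = 0"
  proof transfer
    fix f :: "real^'a \<Rightarrow> 'b" assume "L2_rel f f"
    then have f: "square_integrable f" by (simp add: L2_rel_def)
    have "integral\<^sup>L lborel (\<lambda>x. inner (f x) (f x)) = 0 \<longleftrightarrow> (AE x in lborel. inner (f x) (f x) = 0)"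
      by (rule integral_nonneg_eq_0_iff_AE) (auto simp: integrable_inner f)
    then show "integral\<^sup>L lborel (\<lambda>x. inner (f x) (f x)) = 0 \<longleftrightarrow> L2_rel f (\<lambda>x. 0)"
      by (simp add: L2_rel_def f square_integrable_zero)
  qed
  show "a *\<^sub>C (f + g) = a *\<^sub>C f + a *\<^sub>C g"
    by transfer (auto simp: L2_rel_def square_integrable_add square_integrable_scaleC scaleC_add_right)
  show "(a + b) *\<^sub>C f = a *\<^sub>C f + b *\<^sub>C f"
    by transfer (auto simp: L2_rel_def square_integrable_add square_integrable_scaleC scaleC_add_left)
  show "a *\<^sub>C (b *\<^sub>C f) = (a * b) *\<^sub>C f"
    by transfer (auto simp: L2_rel_def square_integrable_scaleC scaleC_scaleC)
  show "complex_of_real r *\<^sub>C f = r *\<^sub>R f"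
    by transfer (auto simp: L2_rel_def square_integrable_scaleC square_integrable_scaleR scaleC_of_real)
  show "cinner f g = cnj (cinner g f)"
  proof transfer
    fix f g :: "real^'a \<Rightarrow> 'b"
    show "integral\<^sup>L lborel (\<lambda>x. cinner (f x) (g x)) = cnj (integral\<^sup>L lborel (\<lambda>x. cinner (g x) (f x)))"
      by (subst cinner_commute) (rule Bochner_Integration.integral_cnj)
  qed
  show "cinner f (g + h) = cinner f g + cinner f h"
    by transfer (auto simp: L2_rel_def cinner_add_right integrable_cinner)
  show "cinner f (a *\<^sub>C g) = a * cinner f g"
    by transfer (simp add: cinner_scaleC_right)
  show "Re (cinner f g) = inner f g"
  proof transfer
    fix f g :: "real^'a \<Rightarrow> 'b" assume "L2_rel f f" "L2_rel g g"
    then have "integrable lborel (\<lambda>x. cinner (f x) (g x))"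
      by (simp add: L2_rel_def integrable_cinner)
    then show "Re (integral\<^sup>L lborel (\<lambda>x. cinner (f x) (g x)))
        = integral\<^sup>L lborel (\<lambda>x. inner (f x) (g x))"
      by (simp add: Re_cinner flip: integral_Re)
  qed
qed

end

lemma square_integrable_modulation:
  assumes "square_integrable f"
  shows "square_integrable (\<lambda>x. cis (inner k x) *\<^sub>C f x)"
proof -
  note [measurable] = assms[THEN square_integrable_measurable]
  have eq: "cis t *\<^sub>C y = cos t *\<^sub>R y + sin t *\<^sub>R (\<i> *\<^sub>C y)" for t and y :: 'b
  proof -
    have "cis t = complex_of_real (cos t) + complex_of_real (sin t) * \<i>"
      by (simp add: complex_eq_iff)
    then have "cis t *\<^sub>C y = complex_of_real (cos t) *\<^sub>C y + complex_of_real (sin t) *\<^sub>C (\<i> *\<^sub>C y)"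
      by (simp only: scaleC_add_left scaleC_scaleC)
    then show ?thesis by (simp only: scaleC_of_real)
  qed
  have [measurable]: "(\<lambda>x. \<i> *\<^sub>C f x) \<in> borel_measurable lborel"
    by (rule square_integrable_measurable[OF square_integrable_scaleC[OF assms]])
  have "(\<lambda>x. cis (inner k x) *\<^sub>C f x) \<in> borel_measurable lborel"
    unfolding eq by measurable
  then show ?thesis
    using assms by (simp add: square_integrable_def norm_scaleC)
qed

text \<open>The unitary operator of multiplication by the function \<open>x \<mapsto> exp (i k x)\<close>.\<close>

lift_definition modulation ::
    "real^'n \<Rightarrow> ('n, 'e::finite_dim_hilbert) L2 \<Rightarrow> ('n, 'e) L2"
  is "\<lambda>k f x. cis (inner k x) *\<^sub>C f x"
  by (auto simp: L2_rel_def square_integrable_modulation)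

lemma modulation_adjoint: "cinner (modulation k f) g = cinner f (modulation (- k) g)"
  by transfer (simp add: cinner_scaleC_left cinner_scaleC_right cis_cnj)

lemma modulation_inverse: "modulation (- k) (modulation k f) = f"
  by transfer (auto simp: L2_rel_def square_integrable_modulation scaleC_scaleC scaleC_one cis_mult)


section \<open>Fourier transform and Sobolev spaces\<close>

definition fourier_integral ::
    "(real^'n \<Rightarrow> 'e::finite_dim_hilbert) \<Rightarrow> real^'n \<Rightarrow> 'e" where
  "fourier_integral f \<xi> =
     ((2 * pi) powr (- real CARD('n) / 2)) *\<^sub>R integral\<^sup>L lborel (\<lambda>x. cis (- inner \<xi> x) *\<^sub>C f x)"

text \<open>
  The Fourier transform on the whole space is the extension by continuity of the one given by the
  integral on integrable functions, that is, its graph is the closure of \<open>fourier_graph\<close>.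
\<close>

definition fourier_graph :: "(('n::finite, 'e::finite_dim_hilbert) L2 \<times> ('n, 'e) L2) set" where
  "fourier_graph = {(f, g). integrable lborel (rep_L2 f) \<and>
     (AE \<xi> in lborel. rep_L2 g \<xi> = fourier_integral (rep_L2 f) \<xi>)}"

definition fourier :: "('n::finite, 'e::finite_dim_hilbert) L2 \<Rightarrow> ('n, 'e) L2" where
  "fourier f = (THE g. (f, g) \<in> closure fourier_graph)"

text \<open>Sobolev spaces of nonnegative order.\<close>

definition sobolev :: "real \<Rightarrow> ('n::finite, 'e::finite_dim_hilbert) L2 set" where
  "sobolev s =
     {f. integrable lborel (\<lambda>\<xi>. (1 + (norm \<xi>)\<^sup>2) powr s * (norm (rep_L2 (fourier f) \<xi>))\<^sup>2)}"

definition sobolev_norm :: "real \<Rightarrow> ('n::finite, 'e::finite_dim_hilbert) L2 \<Rightarrow> real" where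
  "sobolev_norm s f =
     sqrt (integral\<^sup>L lborel (\<lambda>\<xi>. (1 + (norm \<xi>)\<^sup>2) powr s * (norm (rep_L2 (fourier f) \<xi>))\<^sup>2))"

text \<open>
  The space of order \<open>- s\<close> is the adjoint space (continuous antilinear functionals) of the space of
  order \<open>s\<close>, with its norm as adjoint space. A functional is given by its values on \<open>sobolev s\<close>,
  and the duality extends \<open>cinner\<close>: \<open>u\<close> corresponds to \<open>\<lambda>f. cinner f u\<close>.
\<close>

definition sobolev_dual_norm ::
    "real \<Rightarrow> (('n::finite, 'e::finite_dim_hilbert) L2 \<Rightarrow> complex) \<Rightarrow> ennreal" where
  "sobolev_dual_norm s \<phi> = (SUP f\<in>{f\<in>sobolev s. sobolev_norm s f \<le> 1}. ennreal (cmod (\<phi> f)))"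

text \<open>The operator norm of operators from order \<open>s\<close> to order \<open>- s\<close>.\<close>

definition sobolev_operator_norm ::
    "real \<Rightarrow> (('n::finite, 'e::finite_dim_hilbert) L2 \<Rightarrow> ('n, 'e) L2 \<Rightarrow> complex) \<Rightarrow> ennreal" where
  "sobolev_operator_norm s T =
     (SUP g\<in>{g\<in>sobolev s. sobolev_norm s g \<le> 1}. sobolev_dual_norm s (T g))"

text \<open>The extension of \<open>modulation k\<close> to the adjoint space, obtained by transposing its adjoint.\<close>

definition modulation_dual ::
    "real^'n \<Rightarrow> (('n, 'e::finite_dim_hilbert) L2 \<Rightarrow> complex) \<Rightarrow> ('n, 'e) L2 \<Rightarrow> complex"
  where "modulation_dual k \<phi> = (\<lambda>f. \<phi> (modulation (- k) f))"

definition modulation_conj ::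
    "real^'n \<Rightarrow> (('n, 'e::finite_dim_hilbert) L2 \<Rightarrow> ('n, 'e) L2 \<Rightarrow> complex) \<Rightarrow>
     ('n, 'e) L2 \<Rightarrow> ('n, 'e) L2 \<Rightarrow> complex"
  where "modulation_conj k T = (\<lambda>g. modulation_dual k (T (modulation (- k) g)))"


section \<open>Unbounded operators\<close>

text \<open>Unbounded operators are given by their graphs.\<close>

definition adjoint_graph :: "('h::complex_inner \<times> 'h) set \<Rightarrow> ('h \<times> 'h) set" where
  "adjoint_graph A = {(f, u). \<forall>(g, v)\<in>A. cinner f v = cinner u g}"

text \<open>Density of the domain makes the adjoint single-valued, and adjoints are linear and closed.\<close>

definition self_adjoint :: "('h::complex_inner \<times> 'h) set \<Rightarrow> bool" where
  "self_adjoint A \<longleftrightarrow> closure (Domain A) = UNIV \<and> adjoint_graph A = A"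

definition bounded_from_below :: "('h::complex_inner \<times> 'h) set \<Rightarrow> bool" where
  "bounded_from_below A \<longleftrightarrow> (\<exists>c. \<forall>(f, u)\<in>A. c * (norm f)\<^sup>2 \<le> Re (cinner f u))"

definition resolvent_set :: "('h::complex_inner \<times> 'h) set \<Rightarrow> complex set" where
  "resolvent_set A = {z. (\<forall>v. \<exists>!f. (f, v + z *\<^sub>C f) \<in> A) \<and>
     (\<exists>C. \<forall>(f, u)\<in>A. norm f \<le> C * norm (u - z *\<^sub>C f))}"

definition spectrum :: "('h::complex_inner \<times> 'h) set \<Rightarrow> complex set" where
  "spectrum A = - resolvent_set A"

definition eigenspace :: "('h::complex_inner \<times> 'h) set \<Rightarrow> complex \<Rightarrow> 'h set" where
  "eigenspace A z = {f. (f, z *\<^sub>C f) \<in> A}"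

text \<open>
  The discrete spectrum consists of the isolated points of the spectrum that are eigenvalues of
  finite multiplicity; finite dimension over the reals and over the complex numbers agree.
\<close>

definition discrete_spectrum :: "('h::complex_inner \<times> 'h) set \<Rightarrow> complex set" where
  "discrete_spectrum A = {z. z isolated_in spectrum A \<and> eigenspace A z \<noteq> {0} \<and>
     (\<exists>B. finite B \<and> eigenspace A z \<subseteq> span B)}"

definition essential_spectrum :: "('h::complex_inner \<times> 'h) set \<Rightarrow> complex set" where
  "essential_spectrum A = spectrum A - discrete_spectrum A"

definition purely_discrete_spectrum :: "('h::complex_inner \<times> 'h) set \<Rightarrow> bool" where
  "purely_discrete_spectrum A \<longleftrightarrow> essential_spectrum A = {}"


section \<open>Forms\<close>

text \<open>
  The form of a self-adjoint operator \<open>A\<close> bounded from below is the closure of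
  \<open>\<lambda>f g. cinner f (A g)\<close>. In \<open>form_approx A f S\<close> the sequence \<open>S\<close> of pairs \<open>(f\<^sub>k, A f\<^sub>k)\<close> is such
  that \<open>f\<^sub>k\<close> tends to \<open>f\<close> and is a Cauchy sequence for the form.
\<close>

definition form_approx ::
    "('h::complex_inner \<times> 'h) set \<Rightarrow> 'h \<Rightarrow> (nat \<Rightarrow> 'h \<times> 'h) \<Rightarrow> bool" where
  "form_approx A f S \<longleftrightarrow> range S \<subseteq> A \<and> (\<lambda>k. fst (S k)) \<longlonglongrightarrow> f \<and>
     (\<forall>\<epsilon>>0. \<exists>N. \<forall>j\<ge>N. \<forall>k\<ge>N. cmod (cinner (fst (S j) - fst (S k)) (snd (S j) - snd (S k))) < \<epsilon>)"

definition form_domain :: "('h::complex_inner \<times> 'h) set \<Rightarrow> 'h set" where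
  "form_domain A = {f. \<exists>S. form_approx A f S}"

definition form_of :: "('h::complex_inner \<times> 'h) set \<Rightarrow> 'h \<Rightarrow> 'h \<Rightarrow> complex" where
  "form_of A f g = (THE c. \<forall>S T. form_approx A f S \<longrightarrow> form_approx A g T \<longrightarrow>
     (\<lambda>k. cinner (fst (S k)) (snd (T k))) \<longlonglongrightarrow> c)"

text \<open>The extension of \<open>A\<close> to an operator from the form domain to its adjoint space.\<close>

definition form_extension :: "('h::complex_inner \<times> 'h) set \<Rightarrow> 'h \<Rightarrow> ('h \<Rightarrow> complex)" where
  "form_extension A g = (\<lambda>f. form_of A f g)"

text \<open>The operator associated to a sesquilinear form \<open>t\<close> with domain \<open>D\<close>.\<close>

definition form_operator :: "'h::complex_inner set \<Rightarrow> ('h \<Rightarrow> 'h \<Rightarrow> complex) \<Rightarrow> ('h \<times> 'h) set" where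
  "form_operator D t = {(f, u). f \<in> D \<and> (\<forall>g\<in>D. t g f = cinner g u)}"

definition form_sum_domain ::
    "(('n::finite, 'e::finite_dim_hilbert) L2 \<times> ('n, 'e) L2) set \<Rightarrow> (real^'n \<Rightarrow> real) \<Rightarrow>
     ('n, 'e) L2 set" where
  "form_sum_domain A V =
     {f\<in>form_domain A. integrable lebesgue (\<lambda>x. (norm (sqrt (V x) *\<^sub>R rep_L2 f x))\<^sup>2)}"

definition form_sum ::
    "(('n::finite, 'e::finite_dim_hilbert) L2 \<times> ('n, 'e) L2) set \<Rightarrow> (real^'n \<Rightarrow> real) \<Rightarrow>
     ('n, 'e) L2 \<Rightarrow> ('n, 'e) L2 \<Rightarrow> complex" where
  "form_sum A V f g =
     form_of A f g + integral\<^sup>L lebesgue (\<lambda>x. complex_of_real (V x) * cinner (rep_L2 f x) (rep_L2 g x))"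

definition form_sum_operator ::
    "(('n::finite, 'e::finite_dim_hilbert) L2 \<times> ('n, 'e) L2) set \<Rightarrow> (real^'n \<Rightarrow> real) \<Rightarrow>
     (('n, 'e) L2 \<times> ('n, 'e) L2) set" where
  "form_sum_operator A V = form_operator (form_sum_domain A V) (form_sum A V)"

end

theory Submission
  imports Defs "HOL-Probability.Probability"
begin

text \<open>By the uniform boundedness principle the form norm of \<open>H\<^sub>0\<close> dominates the Sobolev norm of order
  \<open>m\<close>, because the two have the same domain. A ball \<open>S\<close> for the norm of the form sum is therefore
  bounded in the Sobolev space, which by Plancherel makes \<open>translation h f - f\<close> small uniformly over
  \<open>S\<close>, and \<open>\<integral> V \<bar>f\<bar>\<^sup>2\<close> is bounded on \<open>S\<close>. Far out \<open>V\<close> is large except on a set occupying a small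
  part of every ball: off that set the weight controls the mass of \<open>f\<close>, and on it \<open>f\<close> is compared
  with its translates, most of which fall off the set. So the mass of \<open>f\<close> is uniformly small outside
  a large ball. Inside it \<open>f\<close> is approximated by its means over the cubes of a fine grid, and hence
  \<open>S\<close> is totally bounded. The Riesz representation theorem in the form domain gives the resolvent
  of the operator of the form sum, self-adjointness following from the density of the form domain,
  and its resolvent is compact. A spectral point which is no eigenvalue would have approximate
  eigenvectors converging to an eigenvector, and orthonormal eigenvectors to bounded eigenvalues
  are finitely many, so the spectrum consists of isolated eigenvalues of finite multiplicity.\<close>

text \<open>The equality \<open>form_domain H0 = sobolev m\<close> is one of sets and carries no
  estimate. The estimate comes from cutting the Sobolev weight off at radius j in frequency: each
  truncated seminorm is trivially bounded by the Hilbert space norm, and the family is pointwise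
  bounded because the form domain consists of Sobolev functions. \<open>fourier\<close> is given
  only through the closure of a graph, so isometry and covariance under translations have to be
  proved for integrable functions and carried over to the closure; a Gaussian damping makes Fubini
  available for the isometry. Density of the form domain of the sum asks for functions of arbitrary
  Sobolev order that are bounded with compact support, since V is merely locally integrable.
  Products of the polynomials \<open>(r\<^sup>2 - t\<^sup>2) ^ N\<close>, cut off at their zeros,
  serve as soon as \<open>m + 1 \<le> N\<close>, and modulating them by all frequencies reduces
  their totality to Plancherel's identity. V is Lebesgue measurable and nonnegative only almost
  everywhere; a Borel version W, nonnegative everywhere, replaces it.\<close>

lemma cinner_add_left: "cinner (x + y) (z :: 'a::complex_inner) = cinner x z + cinner y z"
  by (metis cinner_add_right cinner_commute complex_cnj_add)

lemma cinner_zero_left [simp]: "cinner 0 (x :: 'a::complex_inner) = 0"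
  and cinner_zero_right [simp]: "cinner (x :: 'a::complex_inner) 0 = 0"
  using cinner_add_left[of 0 0 x] cinner_add_right[of x 0 0] by auto

lemma scaleC_zero_right [simp]: "a *\<^sub>C (0 :: 'a::complex_inner) = 0"
  by (metis mult_zero_right norm_eq_zero norm_scaleC norm_zero)

lemma scaleC_minus1: "(-1) *\<^sub>C (x :: 'a::complex_inner) = - x"
  using scaleC_of_real[of "-1" x] by simp


lemma scaleC_diff_right: "a *\<^sub>C (x - y :: 'a::complex_inner) = a *\<^sub>C x - a *\<^sub>C y"
  using linear_diff[OF bounded_linear.linear[OF bounded_linear_scaleC]] .

lemma cinner_minus_left: "cinner (- x) (y :: 'a::complex_inner) = - cinner x y"
  by (metis cinner_add_left cinner_zero_left eq_neg_iff_add_eq_0 left_minus)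

lemma cinner_minus_right: "cinner x (- y :: 'a::complex_inner) = - cinner x y"
  by (metis cinner_add_right cinner_zero_right eq_neg_iff_add_eq_0 left_minus)

lemma scaleC_conv_scaleR: "a *\<^sub>C (x :: 'a::complex_inner) = Re a *\<^sub>R x + Im a *\<^sub>R (\<i> *\<^sub>C x)"
proof -
  have "a = complex_of_real (Re a) + complex_of_real (Im a) * \<i>"
    by (simp add: complex_eq_iff)
  then have "a *\<^sub>C x = complex_of_real (Re a) *\<^sub>C x + complex_of_real (Im a) *\<^sub>C (\<i> *\<^sub>C x)"
    by (metis scaleC_add_left scaleC_scaleC)
  then show ?thesis by (simp only: scaleC_of_real)
qed

lemma cinner_diff_left: "cinner (x - y) (z :: 'a::complex_inner) = cinner x z - cinner y z"
  using cinner_add_left[of x "- y" z] by (simp add: cinner_minus_left)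

lemma cinner_diff_right: "cinner z (x - y :: 'a::complex_inner) = cinner z x - cinner z y"
  using cinner_add_right[of z x "- y"] by (simp add: cinner_minus_right)

lemma cinner_self: "cinner x (x :: 'a::complex_inner) = of_real ((norm x)\<^sup>2)"
proof -
  have "Im (cinner x x) = 0"
    using arg_cong[OF cinner_commute[of x x], of Im] by simp
  then show ?thesis
    by (simp add: complex_eq_iff Re_cinner power2_norm_eq_inner)
qed

lemma Im_cinner: "Im (cinner x (y :: 'a::complex_inner)) = inner (\<i> *\<^sub>C x) y"
  by (simp add: cinner_eq)

lemma cinner_eq_0I:
  assumes "inner x (y :: 'a::complex_inner) = 0" "inner (\<i> *\<^sub>C x) y = 0"
  shows "cinner x y = 0"
  using assms by (simp add: cinner_eq complex_eq_iff)

text \<open>A phase factor \<open>c\<close> turns the complex inner product into its modulus, so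
  that the real Cauchy-Schwarz inequality yields the complex one.\<close>

lemma cmod_cinner_le: "cmod (cinner x (y :: 'a::complex_inner)) \<le> norm x * norm y"
proof (cases "cinner x y = 0")
  case False
  define c where "c = cnj (cinner x y) / of_real (cmod (cinner x y))"
  have c: "cmod c = 1" using False by (simp add: c_def norm_divide)
  have "c * cinner x y = cnj (cinner x y) * cinner x y / of_real (cmod (cinner x y))"
    by (simp add: c_def)
  also have "\<dots> = of_real (cmod (cinner x y))"
    using False by (simp add: mult.commute complex_norm_square[symmetric] power2_eq_square)
  finally have "inner x (c *\<^sub>C y) = cmod (cinner x y)"
    by (metis Re_cinner Re_complex_of_real cinner_scaleC_right)
  with Cauchy_Schwarz_ineq2[of x "c *\<^sub>C y"] c show ?thesis
    by (simp add: norm_scaleC)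
qed simp

lemma tendsto_cinner [tendsto_intros]:
  fixes f g :: "'b \<Rightarrow> 'a::complex_inner"
  assumes "(f \<longlongrightarrow> x) F" "(g \<longlongrightarrow> y) F"
  shows "((\<lambda>t. cinner (f t) (g t)) \<longlongrightarrow> cinner x y) F"
  unfolding cinner_eq
  by (intro tendsto_Complex tendsto_inner assms bounded_linear.tendsto[OF bounded_linear_scaleC])

lemma tendsto_scaleC [tendsto_intros]:
  fixes f :: "'b \<Rightarrow> 'a::complex_inner"
  shows "(f \<longlongrightarrow> x) F \<Longrightarrow> ((\<lambda>t. c *\<^sub>C f t) \<longlongrightarrow> c *\<^sub>C x) F"
  by (rule bounded_linear.tendsto[OF bounded_linear_scaleC])

text \<open>The library's \<open>subspace\<close> knows only real scalars; closure under
  multiplication by \<i> is what turns real orthogonality into complex orthogonality.\<close>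

definition csubspace :: "'h::complex_inner set \<Rightarrow> bool" where
  "csubspace D \<longleftrightarrow> 0 \<in> D \<and> (\<forall>x\<in>D. \<forall>y\<in>D. x + y \<in> D) \<and> (\<forall>c. \<forall>x\<in>D. c *\<^sub>C x \<in> D)"

lemma csubspace_scaleC: "csubspace D \<Longrightarrow> x \<in> D \<Longrightarrow> c *\<^sub>C x \<in> D"
  by (simp add: csubspace_def)

lemma csubspace_imp_subspace: "csubspace D \<Longrightarrow> subspace D"
  unfolding csubspace_def subspace_def by (metis scaleC_of_real)

section \<open>Quadratic forms on subspaces\<close>

text \<open>Definiteness is not demanded. The instances are \<open>inner\<close> on a closed
  subspace, the shifted form of an operator on its graph, the closure of that form, and the shifted
  form of a \<open>closed_form\<close>.\<close>

locale real_form =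
  fixes D :: "'h::real_vector set" and q :: "'h \<Rightarrow> 'h \<Rightarrow> real"
  assumes subspace_D: "subspace D"
    and sym: "f \<in> D \<Longrightarrow> g \<in> D \<Longrightarrow> q f g = q g f"
    and add_left: "f \<in> D \<Longrightarrow> g \<in> D \<Longrightarrow> h \<in> D \<Longrightarrow> q (f + g) h = q f h + q g h"
    and scale_left: "f \<in> D \<Longrightarrow> g \<in> D \<Longrightarrow> q (r *\<^sub>R f) g = r * q f g"
    and nonneg: "f \<in> D \<Longrightarrow> 0 \<le> q f f"
begin

lemmas D_add = subspace_add[OF subspace_D]
  and D_diff = subspace_diff[OF subspace_D]
  and D_scale = subspace_scale[OF subspace_D]
  and D_zero = subspace_0[OF subspace_D]

lemma add_right: "f \<in> D \<Longrightarrow> g \<in> D \<Longrightarrow> h \<in> D \<Longrightarrow> q h (f + g) = q h f + q h g"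
  by (metis D_add add_left sym)

lemma scale_right: "f \<in> D \<Longrightarrow> g \<in> D \<Longrightarrow> q f (r *\<^sub>R g) = r * q f g"
  by (metis D_scale scale_left sym)

lemma minus_left: "f \<in> D \<Longrightarrow> g \<in> D \<Longrightarrow> q (- f) g = - q f g"
  using scale_left[of f g "-1"] by simp

lemma minus_right: "f \<in> D \<Longrightarrow> g \<in> D \<Longrightarrow> q f (- g) = - q f g"
  using scale_right[of f g "-1"] by simp

lemma diff_left: "f \<in> D \<Longrightarrow> g \<in> D \<Longrightarrow> h \<in> D \<Longrightarrow> q (f - g) h = q f h - q g h"
  using add_left[of f "- g" h] minus_left[of g h] subspace_neg[OF subspace_D, of g] by simp

lemma diff_right: "f \<in> D \<Longrightarrow> g \<in> D \<Longrightarrow> h \<in> D \<Longrightarrow> q h (f - g) = q h f - q h g"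
  using add_right[of f "- g" h] minus_right[of h g] subspace_neg[OF subspace_D, of g] by simp

lemmas expand = D_add D_diff D_scale D_zero add_left add_right scale_left scale_right
  diff_left diff_right

lemma Cauchy_Schwarz:
  assumes [simp]: "f \<in> D" "g \<in> D"
  shows "(q f g)\<^sup>2 \<le> q f f * q g g"
proof (cases "q g g = 0")
  case True
  \<comment> \<open>With \<open>q g g = 0\<close> the quadratic polynomial in \<open>t\<close>
    degenerates to an affine one. A nonzero slope is refuted at the \<open>t\<close> where its value
    is -1.\<close>
  have *: "0 \<le> q f f - 2 * t * q f g" for t
    using nonneg[of "f - t *\<^sub>R g"] True sym[of g f] by (simp add: expand algebra_simps)
  have "q f g = 0"
  proof (rule ccontr)
    assume "q f g \<noteq> 0"
    then show False
      using *[of "(q f f + 1) / (2 * q f g)"] by simp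
  qed
  then show ?thesis by (simp add: nonneg)
next
  case False
  then have pos: "q g g > 0" using nonneg[of g] by simp
  \<comment> \<open>The vector is \<open>q g g\<close> times the component of \<open>f\<close>
    orthogonal to \<open>g\<close>.\<close>
  have "0 \<le> q (q g g *\<^sub>R f - q f g *\<^sub>R g) (q g g *\<^sub>R f - q f g *\<^sub>R g)"
    by (intro nonneg) (simp add: expand)
  also have "\<dots> = q g g * (q f f * q g g - (q f g)\<^sup>2)"
    using sym[of g f] by (simp add: expand power2_eq_square algebra_simps)
  finally show ?thesis using pos by (simp add: zero_le_mult_iff)
qed

lemma triangle:
  assumes [simp]: "f \<in> D" "g \<in> D"
  shows "sqrt (q (f + g) (f + g)) \<le> sqrt (q f f) + sqrt (q g g)"
proof (rule real_le_lsqrt)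
  have "q f g \<le> sqrt (q f f) * sqrt (q g g)"
    using real_le_rsqrt[OF Cauchy_Schwarz[of f g]] by (simp add: real_sqrt_mult)
  then show "q (f + g) (f + g) \<le> (sqrt (q f f) + sqrt (q g g))\<^sup>2"
    using sym[of g f] by (simp add: expand power2_sum nonneg)
qed (simp_all add: nonneg)

end

text \<open>Completeness for the seminorm \<open>sqrt (q f f)\<close>, phrased with sequences
  because \<open>D\<close> carries no topology of its own that belongs to \<open>q\<close>.\<close>

definition form_complete :: "'h::real_vector set \<Rightarrow> ('h \<Rightarrow> 'h \<Rightarrow> real) \<Rightarrow> bool" where
  "form_complete D q \<longleftrightarrow> (\<forall>X. range X \<subseteq> D \<longrightarrow>
     (\<forall>e>0. \<exists>N. \<forall>i\<ge>N. \<forall>j\<ge>N. q (X i - X j) (X i - X j) < e) \<longrightarrow>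
     (\<exists>f\<in>D. (\<lambda>j::nat. q (X j - f) (X j - f)) \<longlonglongrightarrow> 0))"

context real_form
begin

lemma tendsto_left:
  assumes X: "range X \<subseteq> D" and f: "f \<in> D" and lim: "(\<lambda>j::nat. q (X j - f) (X j - f)) \<longlonglongrightarrow> 0"
    and g: "g \<in> D"
  shows "(\<lambda>j. q (X j) g) \<longlonglongrightarrow> q f g"
proof -
  have D: "X j \<in> D" for j using X by auto
  have "(\<lambda>j. sqrt (q (X j - f) (X j - f) * q g g)) \<longlonglongrightarrow> sqrt (0 * q g g)"
    by (intro tendsto_intros lim)
  then have "(\<lambda>j. q (X j - f) g) \<longlonglongrightarrow> 0"
    by (intro Lim_null_comparison[of "\<lambda>j. q (X j - f) g" "\<lambda>j. sqrt (q (X j - f) (X j - f) * q g g)"]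
        always_eventually allI)
       (auto intro!: real_le_rsqrt Cauchy_Schwarz D_diff simp: D f g)
  then have "(\<lambda>j. q (X j) g - q f g) \<longlonglongrightarrow> 0"
    by (simp add: diff_left D f g)
  then show ?thesis by (simp add: LIM_zero_iff)
qed

text \<open>The representing vector minimises \<open>f \<mapsto> q f f - 2 * l f\<close>.\<close>

lemma Riesz_representation:
  assumes complete: "form_complete D q"
    and l_add: "\<And>f g. f \<in> D \<Longrightarrow> g \<in> D \<Longrightarrow> l (f + g) = l f + l g"
    and l_scale: "\<And>f r. f \<in> D \<Longrightarrow> l (r *\<^sub>R f) = r * l f"
    and l_bound: "\<And>f. f \<in> D \<Longrightarrow> \<bar>l f\<bar> \<le> C * sqrt (q f f)"
  shows "\<exists>f\<in>D. \<forall>g\<in>D. q f g = l g"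
proof -
  define F where "F = (\<lambda>f. q f f - 2 * l f)"
  have low: "- C\<^sup>2 \<le> F f" if "f \<in> D" for f
  proof -
    have "2 * l f \<le> 2 * (C * sqrt (q f f))" using l_bound[OF that] by simp
    also have "\<dots> \<le> C\<^sup>2 + (sqrt (q f f))\<^sup>2" using sum_squares_bound[of C "sqrt (q f f)"] by simp
    finally show ?thesis using nonneg[OF that] by (simp add: F_def)
  qed
  define m where "m = (INF f\<in>D. F f)"
  have bdd: "bdd_below (F ` D)" using low by (auto simp: bdd_below_def)
  have m_le: "m \<le> F f" if "f \<in> D" for f
    unfolding m_def by (rule cINF_lower[OF bdd that])
  have "\<exists>f\<in>D. F f < m + inverse (Suc j)" for j :: nat
    using cINF_less_iff[of D F "m + inverse (Suc j)"] bdd D_zero by (auto simp: m_def)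
  then obtain X where X: "\<And>j. X j \<in> D" "\<And>j. F (X j) < m + inverse (Suc j)"
    by metis
  \<comment> \<open>The parallelogram identity: \<open>F\<close> at the midpoint is still at least
    \<open>m\<close>, which forces a minimising sequence to be Cauchy.\<close>
  have par: "q (X i - X j) (X i - X j) \<le> 2 * inverse (Suc i) + 2 * inverse (Suc j)" for i j
  proof -
    have "m \<le> F ((1/2) *\<^sub>R (X i + X j))"
      by (intro m_le D_scale D_add X)
    then have "4 * m \<le> q (X i) (X i) + q (X j) (X j) + 2 * q (X i) (X j) - 4 * l (X i) - 4 * l (X j)"
      using sym[OF X(1)[of j] X(1)[of i]]
      by (simp add: F_def expand X l_add l_scale algebra_simps)
    moreover have "q (X i - X j) (X i - X j) = q (X i) (X i) + q (X j) (X j) - 2 * q (X i) (X j)"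
      using sym[OF X(1)[of j] X(1)[of i]] by (simp add: expand X)
    ultimately show ?thesis
      using X(2)[of i] X(2)[of j] by (simp add: F_def)
  qed
  have inv: "(\<lambda>j. inverse (real (Suc j))) \<longlonglongrightarrow> 0"
    by (rule LIMSEQ_inverse_real_of_nat)
  have "\<exists>N. \<forall>i\<ge>N. \<forall>j\<ge>N. q (X i - X j) (X i - X j) < e" if "e > 0" for e
  proof -
    obtain N where N: "inverse (real (Suc N)) < e / 4"
      using reals_Archimedean[of "e/4"] \<open>e > 0\<close> by auto
    have "q (X i - X j) (X i - X j) < e" if "i \<ge> N" "j \<ge> N" for i j
    proof -
      have "inverse (real (Suc i)) \<le> inverse (Suc N)" "inverse (real (Suc j)) \<le> inverse (Suc N)"
        using that by (auto intro!: le_imp_inverse_le)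
      then show ?thesis using par[of i j] N by linarith
    qed
    then show ?thesis by blast
  qed
  then obtain f where f: "f \<in> D" "(\<lambda>j. q (X j - f) (X j - f)) \<longlonglongrightarrow> 0"
    using complete X(1) unfolding form_complete_def by blast
  have "q f g = l g" if g: "g \<in> D" for g
  proof -
    \<comment> \<open>The first variation. The inequality holds at \<open>X j\<close> up to the
      error \<open>inverse (Suc j)\<close> and passes to the limit, so \<open>F\<close> need not be
      evaluated at \<open>f\<close>.\<close>
    have *: "0 \<le> 2 * t * (q f g - l g) + t\<^sup>2 * q g g" for t
    proof (rule LIMSEQ_le)
      show "(\<lambda>j. - inverse (real (Suc j))) \<longlonglongrightarrow> 0"
        using tendsto_minus[OF inv] by simp
      show "(\<lambda>j. 2 * t * (q (X j) g - l g) + t\<^sup>2 * q g g) \<longlonglongrightarrow> 2 * t * (q f g - l g) + t\<^sup>2 * q g g"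
        by (intro tendsto_intros tendsto_left[OF _ f g]) (use X in auto)
      show "\<exists>N. \<forall>j\<ge>N. - inverse (real (Suc j)) \<le> 2 * t * (q (X j) g - l g) + t\<^sup>2 * q g g"
      proof (intro exI allI impI)
        fix j
        have "m \<le> F (X j + t *\<^sub>R g)" by (intro m_le D_add D_scale X g)
        also have "\<dots> = F (X j) + 2 * t * (q (X j) g - l g) + t\<^sup>2 * q g g"
          using sym[OF g X(1)[of j]]
          by (simp add: F_def expand X g l_add l_scale power2_eq_square algebra_simps)
        finally show "- inverse (real (Suc j)) \<le> 2 * t * (q (X j) g - l g) + t\<^sup>2 * q g g"
          using X(2)[of j] by linarith
      qed
    qed
    show ?thesis
    proof (rule ccontr)
      assume ne: "q f g \<noteq> l g"
      define d where "d = q f g - l g"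
      \<comment> \<open>This minimises \<open>2 * t * d + t\<^sup>2 * (q g g + 1)\<close>; the
        summand 1 avoids dividing by a vanishing \<open>q g g\<close>.\<close>
      define t where "t = - d / (q g g + 1)"
      have p: "q g g + 1 > 0" using nonneg[OF g] by simp
      have "t\<^sup>2 * q g g \<le> t\<^sup>2 * (q g g + 1)" by (intro mult_left_mono) auto
      also have "\<dots> = - t * d" using p by (simp add: t_def power2_eq_square)
      finally have "2 * t * d + t\<^sup>2 * q g g \<le> t * d" by (simp add: algebra_simps)
      also have "\<dots> = - (d\<^sup>2 / (q g g + 1))" by (simp add: t_def power2_eq_square)
      also have "\<dots> < 0" using p ne by (simp add: d_def)
      finally show False using *[of t] by (simp add: d_def)
    qed
  qed
  then show ?thesis using f(1) by blast
qed

end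

text \<open>The projection of \<open>v\<close> is the vector that represents the functional
  \<open>inner v\<close> on the complete subspace \<open>M\<close>.\<close>

lemma Hilbert_projection:
  fixes M :: "'h::{real_inner,complete_space} set"
  assumes "closed M" "subspace M"
  shows "\<exists>f\<in>M. \<forall>g\<in>M. inner g (v - f) = 0"
proof -
  interpret real_form M inner
    by (unfold_locales, rule assms, rule inner_commute) (simp_all add: inner_add_left)
  have "form_complete M inner"
    unfolding form_complete_def
  proof (intro allI impI)
    fix X :: "nat \<Rightarrow> 'h"
    assume X: "range X \<subseteq> M"
      and C: "\<forall>e>0. \<exists>N. \<forall>i\<ge>N. \<forall>j\<ge>N. inner (X i - X j) (X i - X j) < e"
    have "Cauchy X"
    proof (rule CauchyI)
      fix e :: real assume "e > 0"
      then obtain N where "\<forall>i\<ge>N. \<forall>j\<ge>N. inner (X i - X j) (X i - X j) < e\<^sup>2"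
        using C by (meson zero_less_power)
      then show "\<exists>N. \<forall>i\<ge>N. \<forall>j\<ge>N. norm (X i - X j) < e"
        using \<open>e > 0\<close>
        by (auto simp flip: power2_norm_eq_inner intro!: exI[of _ N] power2_less_imp_less[of _ e])
    qed
    then obtain f where f: "X \<longlonglongrightarrow> f" using Cauchy_convergent_iff convergentD by blast
    moreover have "f \<in> M" using closed_sequentially[OF assms(1) _ f] X by auto
    moreover have "(\<lambda>j. inner (X j - f) (X j - f)) \<longlonglongrightarrow> inner (f - f) (f - f)"
      by (intro tendsto_intros f)
    ultimately show "\<exists>f\<in>M. (\<lambda>j. inner (X j - f) (X j - f)) \<longlonglongrightarrow> 0" by auto
  qed
  then have "\<exists>f\<in>M. \<forall>g\<in>M. inner f g = inner v g"
    by (rule Riesz_representation[where C = "norm v"])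
       (auto simp: inner_add_right norm_eq_sqrt_inner[symmetric] Cauchy_Schwarz_ineq2)
  then show ?thesis by (metis inner_commute inner_diff_right right_minus_eq)
qed

text \<open>All density arguments below have this form: \<open>v\<close> minus its projection to
  \<open>M\<close> is orthogonal to \<open>M\<close>, hence zero.\<close>

lemma closed_subspace_eq_UNIV:
  fixes M :: "'h::{real_inner,complete_space} set"
  assumes "closed M" "subspace M" "\<And>v. (\<And>g. g \<in> M \<Longrightarrow> inner g v = 0) \<Longrightarrow> v = 0"
  shows "M = UNIV"
proof -
  have "v \<in> M" for v
  proof -
    obtain f where "f \<in> M" "\<forall>g\<in>M. inner g (v - f) = 0"
      using Hilbert_projection[OF assms(1,2)] by blast
    with assms(3)[of "v - f"] show ?thesis by simp
  qed
  then show ?thesis by auto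
qed

lemma closure_subspace:
  fixes S :: "'a::real_normed_vector set"
  assumes "subspace S"
  shows "subspace (closure S)"
  unfolding subspace_def
proof (intro conjI ballI allI)
  show "0 \<in> closure S" using subspace_0[OF assms] closure_subset by blast
next
  fix x y assume "x \<in> closure S" "y \<in> closure S"
  then obtain X Y where "\<And>n. X n \<in> S" "X \<longlonglongrightarrow> x" "\<And>n. Y n \<in> S" "Y \<longlonglongrightarrow> y"
    unfolding closure_sequential by blast
  then show "x + y \<in> closure S"
    unfolding closure_sequential
    by (intro exI[of _ "\<lambda>n. X n + Y n"] conjI allI tendsto_intros subspace_add[OF assms])
next
  fix x c assume "x \<in> closure S"
  then obtain X where "\<And>n. X n \<in> S" "X \<longlonglongrightarrow> x"
    unfolding closure_sequential by blast
  then show "c *\<^sub>R x \<in> closure S"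
    unfolding closure_sequential
    by (intro exI[of _ "\<lambda>n. c *\<^sub>R X n"] conjI allI tendsto_intros subspace_scale[OF assms])
qed

section \<open>Self-adjoint operators with compact resolvent\<close>

lemma self_adjointD:
  assumes "self_adjoint A"
  shows "(f, u) \<in> A \<longleftrightarrow> (\<forall>(g, v)\<in>A. cinner f v = cinner u g)"
proof -
  have "(f, u) \<in> A \<longleftrightarrow> (f, u) \<in> adjoint_graph A" using assms by (simp add: self_adjoint_def)
  then show ?thesis by (simp add: adjoint_graph_def)
qed

lemma self_adjoint_symmetric:
  assumes "self_adjoint A" "(f, u) \<in> A" "(g, v) \<in> A"
  shows "cinner f v = cinner u g"
  using self_adjointD[OF assms(1)] assms(2,3) by blast

lemma self_adjoint_add:
  assumes "self_adjoint A" "(f, u) \<in> A" "(g, v) \<in> A"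
  shows "(f + g, u + v) \<in> A"
  using assms(2,3) unfolding self_adjointD[OF assms(1)]
  by (fastforce simp: cinner_add_left)

lemma self_adjoint_scaleC:
  assumes "self_adjoint A" "(f, u) \<in> A"
  shows "(c *\<^sub>C f, c *\<^sub>C u) \<in> A"
  using assms(2) unfolding self_adjointD[OF assms(1)]
  by (auto simp: cinner_scaleC_left)

lemma self_adjoint_zero:
  assumes "self_adjoint A"
  shows "(0, 0) \<in> A"
  unfolding self_adjointD[OF assms] by auto

lemma self_adjoint_diff:
  assumes "self_adjoint A" "(f, u) \<in> A" "(g, v) \<in> A"
  shows "(f - g, u - v) \<in> A"
  using self_adjoint_add[OF assms(1,2) self_adjoint_scaleC[OF assms(1,3), of "-1"]]
  by (simp add: scaleC_minus1)

lemma self_adjoint_closed: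
  assumes "self_adjoint A" "\<And>j::nat. (f j, u j) \<in> A" "f \<longlonglongrightarrow> f'" "u \<longlonglongrightarrow> u'"
  shows "(f', u') \<in> A"
  unfolding self_adjointD[OF assms(1)]
proof clarify
  fix g v assume gv: "(g, v) \<in> A"
  have "(\<lambda>j. cinner (f j) v) \<longlonglongrightarrow> cinner f' v" "(\<lambda>j. cinner (u j) g) \<longlonglongrightarrow> cinner u' g"
    by (intro tendsto_intros assms)+
  moreover have "cinner (f j) v = cinner (u j) g" for j
    by (rule self_adjoint_symmetric[OF assms(1,2) gv])
  ultimately show "cinner f' v = cinner u' g"
    by (simp add: LIMSEQ_unique)
qed


text \<open>Distinct orthonormal vectors have distance sqrt 2, so an infinite family has no limit
  point, although it sits in a compact set.\<close>

lemma orthonormal_compact_imp_finite: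
  fixes S :: "'h::real_inner set"
  assumes "S \<subseteq> K" "compact (closure K)" "\<And>x. x \<in> S \<Longrightarrow> norm x = 1"
    and "\<And>x y. x \<in> S \<Longrightarrow> y \<in> S \<Longrightarrow> x \<noteq> y \<Longrightarrow> inner x y = 0"
  shows "finite S"
proof (rule ccontr)
  assume "infinite S"
  then obtain l where l: "l islimpt S"
    using assms(1,2) closure_subset[of K] unfolding compact_eq_Bolzano_Weierstrass
    by (meson subset_trans)
  have "y = x" if "x \<in> S" "y \<in> S" "dist y x < 1" for x y
  proof (rule ccontr)
    assume "y \<noteq> x"
    then have "(norm (y - x))\<^sup>2 = 2"
      using assms(3)[OF that(1)] assms(3)[OF that(2)] assms(4)[OF that(1,2)] assms(4)[OF that(2,1)]
      by (simp add: power2_norm_eq_inner inner_diff_left inner_diff_right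
          flip: power2_norm_eq_inner[of x] power2_norm_eq_inner[of y])
    moreover have "(norm (y - x))\<^sup>2 < 1\<^sup>2"
      using that(3) by (intro power_strict_mono) (auto simp: dist_norm)
    ultimately show False by simp
  qed
  then have "\<not> l islimpt S"
    by (intro discrete_imp_not_islimpt[of 1]) auto
  with l show False by simp
qed

text \<open>Riesz's argument: finitely many balls of radius 1 cover the unit ball of
  \<open>E\<close>, whereas a unit vector of \<open>E\<close> orthogonal to all centres has distance
  at least 1 from each of them.\<close>

lemma compact_unit_ball_imp_finite_dim:
  fixes E :: "'h::real_inner set"
  assumes E: "subspace E" "closed E" and K: "{x\<in>E. norm x \<le> 1} \<subseteq> K" "compact (closure K)"
  shows "\<exists>B. finite B \<and> E \<subseteq> span B"
proof -
  let ?S = "{x\<in>E. norm x \<le> 1}"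
  have "closed ?S"
    using closed_Int[OF E(2) closed_Collect_le[of norm "\<lambda>_. 1", OF continuous_on_norm_id continuous_on_const]]
    by (simp add: Int_def)
  then have "compact (closure K \<inter> ?S)" by (rule compact_Int_closed[OF K(2)])
  moreover have "closure K \<inter> ?S = ?S" using K(1) closure_subset[of K] by blast
  ultimately have "compact ?S" by simp
  then obtain B where B: "finite B" "B \<subseteq> ?S" "?S \<subseteq> (\<Union>x\<in>B. ball x 1)"
    using seq_compact_imp_totally_bounded[OF compact_imp_seq_compact[OF \<open>compact ?S\<close>], rule_format, of 1]
    by auto
  \<comment> \<open>Orthogonal generators give the projection to \<open>span B\<close> by an
    explicit formula, the vector \<open>p\<close> below.\<close>
  obtain C where C: "finite C" "span C = span B" "pairwise orthogonal C"
    using basis_orthogonal[OF B(1)] by blast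
  have BE: "span B \<subseteq> E" using B(2) E(1) by (intro span_minimal) auto
  have "E \<subseteq> span B"
  proof (rule ccontr)
    assume "\<not> E \<subseteq> span B"
    then obtain f where f: "f \<in> E" "f \<notin> span B" by auto
    define p where "p = (\<Sum>c\<in>C. (inner c f / inner c c) *\<^sub>R c)"
    have p: "p \<in> span B"
      unfolding p_def C(2)[symmetric] by (intro span_sum span_scale span_base)
    have orth: "inner x (f - p) = 0" if "x \<in> span B" for x
    proof -
      have "inner c (f - p) = 0" if "c \<in> C" for c
      proof -
        have "inner c p = (\<Sum>d\<in>C. if d = c then inner c f / inner c c * inner c c else 0)"
          unfolding p_def inner_sum_right inner_scaleR_right
          by (rule sum.cong) (use C(3) that in \<open>auto simp: pairwise_def orthogonal_def\<close>)
        also have "\<dots> = inner c f" using C(1) that by simp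
        finally show ?thesis by (simp add: inner_diff_right)
      qed
      moreover have "x \<in> span C" using that C(2) by simp
      ultimately show ?thesis
        by (metis inner_commute orthogonal_def orthogonal_to_span)
    qed
    have ne: "norm (f - p) > 0" using f p by auto
    define u where "u = (1 / norm (f - p)) *\<^sub>R (f - p)"
    have u: "norm u = 1" using ne by (simp add: u_def)
    have "u \<in> ?S"
      using u f p BE E(1) by (auto simp: u_def intro!: subspace_scale subspace_diff)
    then obtain x where x: "x \<in> B" "dist x u < 1" using B(3) by auto
    have "inner x u = 0"
      using orth[OF span_base[OF x(1)]] by (simp add: u_def)
    then have "(norm (x - u))\<^sup>2 = (norm x)\<^sup>2 + 1"
      using u by (simp add: power2_norm_eq_inner inner_diff_left inner_diff_right inner_commute[of u x]
          flip: power2_norm_eq_inner[of u])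
    moreover have "(norm (x - u))\<^sup>2 < 1"
      using x(2) power_strict_mono[of "norm (x - u)" 1 2] by (simp add: dist_norm)
    ultimately show False using zero_le_power2[of "norm x"] by linarith
  qed
  then show ?thesis using B(1) by blast
qed

lemma eigenvalue_real:
  assumes "self_adjoint A" "(f, z *\<^sub>C f) \<in> A" "f \<noteq> 0"
  shows "cnj z = z"
  using self_adjoint_symmetric[OF assms(1,2,2)] assms(3)
  by (simp add: cinner_scaleC_left cinner_scaleC_right cinner_self)

lemma eigenvectors_orthogonal:
  assumes "self_adjoint A" "(f, z *\<^sub>C f) \<in> A" "(g, w *\<^sub>C g) \<in> A" "z \<noteq> w"
  shows "cinner f g = 0"
proof (cases "f = 0")
  case False
  have "w * cinner f g = z * cinner f g"
    using self_adjoint_symmetric[OF assms(1,2,3)] eigenvalue_real[OF assms(1,2) False]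
    by (simp add: cinner_scaleC_left cinner_scaleC_right)
  then show ?thesis using assms(4) by simp
qed simp

lemma self_adjoint_bounded_below:
  assumes sa: "self_adjoint A"
    and K: "\<And>C. compact (closure {f. \<exists>u. (f, u) \<in> A \<and> norm f \<le> C \<and> norm u \<le> C})"
    and z: "eigenspace A z \<subseteq> {0}"
  shows "\<exists>C. \<forall>(f, u)\<in>A. norm f \<le> C * norm (u - z *\<^sub>C f)"
proof (rule ccontr)
  assume "\<not> ?thesis"
  then have "\<exists>f u. (f, u) \<in> A \<and> real (Suc n) * norm (u - z *\<^sub>C f) < norm f" for n
    by (force simp: not_le)
  then obtain f u where fu: "\<And>n. (f n, u n) \<in> A" "\<And>n. real (Suc n) * norm (u n - z *\<^sub>C f n) < norm (f n)"
    by metis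
  have pos: "norm (f n) > 0" for n
    using fu(2)[of n] by (meson le_less_trans mult_nonneg_nonneg norm_ge_zero of_nat_0_le_iff)
  define c where "c n = complex_of_real (1 / norm (f n))" for n
  define F U where "F n = c n *\<^sub>C f n" and "U n = c n *\<^sub>C u n" for n
  have FU: "(F n, U n) \<in> A" for n
    unfolding F_def U_def by (rule self_adjoint_scaleC[OF sa fu(1)])
  have nF: "norm (F n) = 1" for n
    using pos[of n] by (simp add: F_def c_def norm_scaleC norm_divide)
  have "norm (U n - z *\<^sub>C F n) < inverse (real (Suc n))" for n
  proof -
    have "U n - z *\<^sub>C F n = c n *\<^sub>C (u n - z *\<^sub>C f n)"
      by (simp add: U_def F_def scaleC_diff_right scaleC_scaleC mult.commute)
    then have "norm (U n - z *\<^sub>C F n) = norm (u n - z *\<^sub>C f n) / norm (f n)"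
      by (simp add: norm_scaleC c_def norm_divide)
    also have "\<dots> < inverse (real (Suc n))"
      using fu(2)[of n] pos[of n] by (simp add: field_simps del: of_nat_Suc)
    finally show ?thesis .
  qed
  then have lim: "(\<lambda>n. U n - z *\<^sub>C F n) \<longlonglongrightarrow> 0"
    by (intro Lim_null_comparison[OF _ LIMSEQ_inverse_real_of_nat] always_eventually allI less_imp_le)
  then obtain C where C: "\<And>n. norm (U n - z *\<^sub>C F n) \<le> C"
    using convergent_imp_Bseq[OF convergentI[OF lim]] by (auto elim!: BseqE)
  have "norm (U n) \<le> C + cmod z" for n
    using norm_triangle_ineq[of "U n - z *\<^sub>C F n" "z *\<^sub>C F n"] C[of n] nF[of n] by (simp add: norm_scaleC)
  \<comment> \<open>\<open>F n\<close> has norm 1 and \<open>U n\<close> differs from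
    \<open>z *\<^sub>C F n\<close> by at most \<open>C\<close>, so one constant bounds both
    components and compactness applies.\<close>
  then have "F n \<in> {f. \<exists>u. (f, u) \<in> A \<and> norm f \<le> max 1 (C + cmod z) \<and> norm u \<le> max 1 (C + cmod z)}" for n
    using FU[of n] nF[of n] by (auto simp: le_max_iff_disj)
  then have "\<forall>n. F n \<in> closure {f. \<exists>u. (f, u) \<in> A \<and> norm f \<le> max 1 (C + cmod z) \<and> norm u \<le> max 1 (C + cmod z)}"
    using closure_subset by blast
  then obtain l r where r: "strict_mono (r :: nat \<Rightarrow> nat)" "(F \<circ> r) \<longlonglongrightarrow> l"
    using K[of "max 1 (C + cmod z)"] unfolding compact_def by meson
  have "(\<lambda>n. U (r n) - z *\<^sub>C F (r n)) \<longlonglongrightarrow> 0"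
    using LIMSEQ_subseq_LIMSEQ[OF lim r(1)] by (simp add: o_def)
  then have "(\<lambda>n. (U (r n) - z *\<^sub>C F (r n)) + z *\<^sub>C F (r n)) \<longlonglongrightarrow> 0 + z *\<^sub>C l"
    using r(2) by (intro tendsto_intros) (simp_all add: o_def)
  then have "(l, z *\<^sub>C l) \<in> A"
    using r(2) by (intro self_adjoint_closed[OF sa FU, of "r"]) (simp_all add: o_def)
  then have "l = 0" using z by (auto simp: eigenspace_def)
  moreover have "norm l = 1"
    using tendsto_norm[OF r(2)] nF by (simp add: o_def LIMSEQ_const_iff)
  ultimately show False by simp
qed

text \<open>The lower bound makes the range \<open>Y\<close> of \<open>A - z\<close> closed. A
  vector orthogonal to \<open>Y\<close> is an eigenvector for \<open>cnj z\<close>; if it were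
  nonzero, self-adjointness would make \<open>z\<close> real and the vector an eigenvector for
  \<open>z\<close> itself.\<close>

lemma eigenspace_trivial_imp_resolvent:
  fixes A :: "('h::{complex_inner,banach} \<times> 'h) set"
  assumes sa: "self_adjoint A"
    and K: "\<And>C. compact (closure {f. \<exists>u. (f, u) \<in> A \<and> norm f \<le> C \<and> norm u \<le> C})"
    and z: "eigenspace A z \<subseteq> {0}"
  shows "z \<in> resolvent_set A"
proof -
  obtain C where C: "\<And>f u. (f, u) \<in> A \<Longrightarrow> norm f \<le> C * norm (u - z *\<^sub>C f)"
    using self_adjoint_bounded_below[OF assms] by blast
  define Y where "Y = {v. \<exists>f. (f, v + z *\<^sub>C f) \<in> A}"
  have Y: "csubspace Y"
    unfolding csubspace_def
  proof (intro conjI ballI allI)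
    show "0 \<in> Y" using self_adjoint_zero[OF sa] by (auto simp: Y_def intro!: exI[of _ 0])
  next
    fix x y assume "x \<in> Y" "y \<in> Y"
    then obtain f g where "(f, x + z *\<^sub>C f) \<in> A" "(g, y + z *\<^sub>C g) \<in> A" by (auto simp: Y_def)
    from self_adjoint_add[OF sa this] show "x + y \<in> Y"
      by (auto simp: Y_def scaleC_add_right algebra_simps intro!: exI[of _ "f + g"])
  next
    fix x c assume "x \<in> Y"
    then obtain f where "(f, x + z *\<^sub>C f) \<in> A" by (auto simp: Y_def)
    from self_adjoint_scaleC[OF sa this, of c] show "c *\<^sub>C x \<in> Y"
      by (auto simp: Y_def scaleC_add_right scaleC_scaleC mult.commute intro!: exI[of _ "c *\<^sub>C f"])
  qed
  have "closed Y"
    unfolding closed_sequential_limits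
  proof safe
    fix v l assume "\<forall>n. v n \<in> Y" and lim: "v \<longlonglongrightarrow> l"
    then obtain f where f: "\<And>n. (f n, v n + z *\<^sub>C f n) \<in> A" unfolding Y_def by simp metis
    have *: "norm (f i - f j) \<le> C * norm (v i - v j)" for i j
      using C[OF self_adjoint_diff[OF sa f f], of i j]
      by (simp add: scaleC_diff_right algebra_simps)
    have "Cauchy f"
    proof (rule CauchyI)
      fix e :: real assume e: "e > 0"
      have "Cauchy v" using lim convergent_Cauchy convergentI by blast
      \<comment> \<open>\<open>C\<close> may be zero or negative; \<open>\<bar>C\<bar> + 1\<close>
        is a positive substitute.\<close>
      then obtain N where N: "\<And>i j. i \<ge> N \<Longrightarrow> j \<ge> N \<Longrightarrow> norm (v i - v j) < e / (\<bar>C\<bar> + 1)"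
        using e by (meson CauchyD abs_add_one_gt_zero add.commute divide_pos_pos add_pos_nonneg abs_ge_zero zero_less_one add_nonneg_pos)
      have "norm (f i - f j) < e" if "i \<ge> N" "j \<ge> N" for i j
      proof -
        have "norm (f i - f j) \<le> (\<bar>C\<bar> + 1) * norm (v i - v j)"
          by (rule order_trans[OF *]) (intro mult_right_mono, auto)
        also have "\<dots> < e" using N[OF that] by (simp add: field_simps)
        finally show ?thesis .
      qed
      then show "\<exists>N. \<forall>i\<ge>N. \<forall>j\<ge>N. norm (f i - f j) < e" by blast
    qed
    then obtain g where g: "f \<longlonglongrightarrow> g" using Cauchy_convergent_iff convergentD by blast
    have "(g, l + z *\<^sub>C g) \<in> A"
      by (rule self_adjoint_closed[OF sa f g]) (intro tendsto_intros lim g)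
    then show "l \<in> Y" by (auto simp: Y_def)
  qed
  have "Y = UNIV"
  proof (rule closed_subspace_eq_UNIV[OF \<open>closed Y\<close> csubspace_imp_subspace[OF Y]])
    fix w assume w: "\<And>g. g \<in> Y \<Longrightarrow> inner g w = 0"
    have *: "cinner g w = 0" if "g \<in> Y" for g
      by (intro cinner_eq_0I w csubspace_scaleC[OF Y] that)
    \<comment> \<open>Orthogonality to \<open>Y\<close>, rewritten, is the identity that places the
      pair in the adjoint graph.\<close>
    have "(w, cnj z *\<^sub>C w) \<in> A"
      unfolding self_adjointD[OF sa]
    proof clarify
      fix g v assume "(g, v) \<in> A"
      then have "v - z *\<^sub>C g \<in> Y" by (auto simp: Y_def intro!: exI[of _ g])
      from *[OF this] have "cinner v w = cinner (z *\<^sub>C g) w" by (simp add: cinner_diff_left)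
      then show "cinner w v = cinner (cnj z *\<^sub>C w) g"
        by (metis cinner_commute cinner_scaleC_left cinner_scaleC_right)
    qed
    then show "w = 0"
      using eigenvalue_real[OF sa, of w "cnj z"] z by (auto simp: eigenspace_def)
  qed
  have "\<exists>!f. (f, v + z *\<^sub>C f) \<in> A" for v
  proof -
    obtain f where f: "(f, v + z *\<^sub>C f) \<in> A" using \<open>Y = UNIV\<close> by (auto simp: Y_def)
    moreover have "g = f" if "(g, v + z *\<^sub>C g) \<in> A" for g
      using C[OF self_adjoint_diff[OF sa that f]] by (simp add: scaleC_diff_right)
    ultimately show ?thesis by blast
  qed
  moreover have "\<exists>C. \<forall>(f, u)\<in>A. norm f \<le> C * norm (u - z *\<^sub>C f)" using C by blast
  ultimately show ?thesis unfolding resolvent_set_def by simp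
qed

lemma self_adjoint_compact_purely_discrete:
  fixes A :: "('h::{complex_inner,banach} \<times> 'h) set"
  assumes sa: "self_adjoint A"
    and K: "\<And>C. compact (closure {f. \<exists>u. (f, u) \<in> A \<and> norm f \<le> C \<and> norm u \<le> C})"
  shows "purely_discrete_spectrum A"
proof -
  have ev: "\<exists>f. (f, y *\<^sub>C f) \<in> A \<and> norm f = 1" if y: "y \<in> spectrum A" for y
  proof -
    obtain f where f: "(f, y *\<^sub>C f) \<in> A" "f \<noteq> 0"
      using eigenspace_trivial_imp_resolvent[OF assms, of y] y by (auto simp: spectrum_def eigenspace_def)
    have "(complex_of_real (1 / norm f) *\<^sub>C f, y *\<^sub>C complex_of_real (1 / norm f) *\<^sub>C f) \<in> A"
      using self_adjoint_scaleC[OF sa f(1), of "complex_of_real (1 / norm f)"]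
      by (simp add: scaleC_scaleC mult.commute)
    then show ?thesis using f(2)
      by (intro exI[of _ "complex_of_real (1 / norm f) *\<^sub>C f"]) (auto simp: norm_scaleC norm_divide)
  qed
  have "z \<in> discrete_spectrum A" if z: "z \<in> spectrum A" for z
  proof -
    \<comment> \<open>One unit eigenvector is chosen for each spectral point near \<open>z\<close>.
      Orthogonality of eigenvectors to different eigenvalues makes their family orthonormal, and
      their images under \<open>A\<close> are bounded by \<open>cmod z + 1\<close>.\<close>
    define S where "S = spectrum A \<inter> ball z 1"
    obtain e where e: "\<And>y. y \<in> spectrum A \<Longrightarrow> (e y, y *\<^sub>C e y) \<in> A"
      "\<And>y. y \<in> spectrum A \<Longrightarrow> norm (e y) = 1"
      using ev by metis
    have orth: "inner (e y) (e w) = 0" if "y \<in> S" "w \<in> S" "y \<noteq> w" for y w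
      using eigenvectors_orthogonal[OF sa e(1) e(1) that(3)] that
      by (metis IntE Re_cinner S_def zero_complex.simps(1))
    have "finite (e ` S)"
    proof (rule orthonormal_compact_imp_finite[OF _ K[of "cmod z + 1"]])
      show "e ` S \<subseteq> {f. \<exists>u. (f, u) \<in> A \<and> norm f \<le> cmod z + 1 \<and> norm u \<le> cmod z + 1}"
      proof (clarify, intro exI conjI)
        fix y assume y: "y \<in> S"
        show "(e y, y *\<^sub>C e y) \<in> A" "norm (e y) \<le> cmod z + 1"
          using e[of y] y by (auto simp: S_def)
        have "cmod y \<le> cmod z + 1"
          using y norm_triangle_ineq2[of y z] by (auto simp: S_def dist_norm norm_minus_commute)
        then show "norm (y *\<^sub>C e y) \<le> cmod z + 1"
          using e(2)[of y] y by (simp add: norm_scaleC S_def)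
      qed
    next
      fix x y assume "x \<in> e ` S" "y \<in> e ` S" "x \<noteq> y"
      then show "inner x y = 0" using orth by blast
    qed (use e(2) in \<open>auto simp: S_def\<close>)
    \<comment> \<open>Injectivity carries finiteness from the eigenvectors back to the spectral
      points.\<close>
    moreover have "inj_on e S"
    proof (rule inj_onI, rule ccontr)
      fix x y assume "x \<in> S" "y \<in> S" "e x = e y" "x \<noteq> y"
      then have "inner (e x) (e x) = 0" using orth[of x y] by simp
      then show False using e(2)[of x] \<open>x \<in> S\<close> by (auto simp: S_def)
    qed
    ultimately have "finite S" by (rule finite_imageD)
    then have "open (ball z 1 - (S - {z}))"
      by (intro open_Diff open_ball finite_imp_closed) auto
    moreover have "(ball z 1 - (S - {z})) \<inter> spectrum A = {z}"
      using z by (auto simp: S_def)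
    ultimately have "z isolated_in spectrum A"
      using z unfolding isolated_in_def by blast
    moreover have "e z \<in> eigenspace A z" "e z \<noteq> 0"
      using e(1)[OF z] e(2)[OF z] by (simp_all add: eigenspace_def) auto
    moreover have "\<exists>B. finite B \<and> eigenspace A z \<subseteq> span B"
    proof (rule compact_unit_ball_imp_finite_dim)
      have "csubspace (eigenspace A z)"
        unfolding csubspace_def eigenspace_def mem_Collect_eq
      proof (intro conjI ballI allI)
        show "(0, z *\<^sub>C 0) \<in> A" using self_adjoint_zero[OF sa] by simp
      next
        fix x y assume "x \<in> {f. (f, z *\<^sub>C f) \<in> A}" "y \<in> {f. (f, z *\<^sub>C f) \<in> A}"
        then show "(x + y, z *\<^sub>C (x + y)) \<in> A" using self_adjoint_add[OF sa, of x _ y] by (simp add: scaleC_add_right)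
      next
        fix x c assume "x \<in> {f. (f, z *\<^sub>C f) \<in> A}"
        then have "(c *\<^sub>C x, c *\<^sub>C z *\<^sub>C x) \<in> A"
          using self_adjoint_scaleC[OF sa, of x "z *\<^sub>C x" c] by simp
        then show "(c *\<^sub>C x, z *\<^sub>C c *\<^sub>C x) \<in> A"
          by (simp add: scaleC_scaleC mult.commute)
      qed
      then show "subspace (eigenspace A z)" by (rule csubspace_imp_subspace)
      show "closed (eigenspace A z)"
        unfolding closed_sequential_limits eigenspace_def
      proof safe
        fix x l assume x: "\<forall>n. x n \<in> {f. (f, z *\<^sub>C f) \<in> A}" and lim: "x \<longlonglongrightarrow> l"
        have "\<And>n. (x n, z *\<^sub>C x n) \<in> A" using x by simp
        then show "(l, z *\<^sub>C l) \<in> A"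
          by (rule self_adjoint_closed[OF sa _ lim tendsto_scaleC[OF lim]])
      qed
      show "{x \<in> eigenspace A z. norm x \<le> 1} \<subseteq>
          {f. \<exists>u. (f, u) \<in> A \<and> norm f \<le> cmod z + 1 \<and> norm u \<le> cmod z + 1}"
      proof (clarify, intro exI conjI)
        fix x assume x: "x \<in> eigenspace A z" "norm x \<le> 1"
        show "(x, z *\<^sub>C x) \<in> A" using x by (simp add: eigenspace_def)
        show "norm x \<le> cmod z + 1" using x norm_ge_zero[of z] by linarith
        have "cmod z * norm x \<le> cmod z * 1" using x by (intro mult_left_mono) auto
        then show "norm (z *\<^sub>C x) \<le> cmod z + 1" by (simp add: norm_scaleC)
      qed
    qed (rule K)
    ultimately show ?thesis unfolding discrete_spectrum_def by blast
  qed
  then show ?thesis by (auto simp: purely_discrete_spectrum_def essential_spectrum_def)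
qed

section \<open>The operator associated to a closed form\<close>

text \<open>The closed subspace criterion works with real orthogonality; on a complex subspace this
  already implies complex orthogonality.\<close>

lemma closure_csubspace_dense:
  fixes M :: "'h::{complex_inner,banach} set"
  assumes M: "csubspace M" and orth: "\<And>v. (\<And>g. g \<in> M \<Longrightarrow> cinner g v = 0) \<Longrightarrow> v = 0"
  shows "closure M = UNIV"
proof (rule closed_subspace_eq_UNIV)
  show "subspace (closure M)" by (rule closure_subspace[OF csubspace_imp_subspace[OF M]])
  fix v assume *: "\<And>g. g \<in> closure M \<Longrightarrow> inner g v = 0"
  have "cinner g v = 0" if "g \<in> M" for g
    using that closure_subset csubspace_scaleC[OF M] by (intro cinner_eq_0I *) blast+
  then show "v = 0" by (rule orth)
qed simp

text \<open>The shift \<open>a\<close> lifts the form above the squared norm, and completeness for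
  the shifted form is closedness of \<open>t\<close>. As \<open>t\<close> is a total function,
  everything is required on \<open>D\<close> only.\<close>

locale closed_form =
  fixes D :: "'h::{complex_inner,banach} set" and t :: "'h \<Rightarrow> 'h \<Rightarrow> complex" and a :: real
  assumes csubspace_D: "csubspace D"
    and t_add: "f \<in> D \<Longrightarrow> g \<in> D \<Longrightarrow> h \<in> D \<Longrightarrow> t f (g + h) = t f g + t f h"
    and t_scale: "f \<in> D \<Longrightarrow> g \<in> D \<Longrightarrow> t f (c *\<^sub>C g) = c * t f g"
    and t_sym: "f \<in> D \<Longrightarrow> g \<in> D \<Longrightarrow> t f g = cnj (t g f)"
    and t_bound: "f \<in> D \<Longrightarrow> (norm f)\<^sup>2 \<le> Re (t f f) + a * (norm f)\<^sup>2"
    and t_complete: "form_complete D (\<lambda>f g. Re (t f g) + a * inner f g)"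
begin

abbreviation "q \<equiv> \<lambda>f g. Re (t f g) + a * inner f g"

lemma t_bound': "f \<in> D \<Longrightarrow> (norm f)\<^sup>2 \<le> q f f"
  using t_bound[of f] by (simp add: power2_norm_eq_inner)

lemma real_form: "real_form D q"
proof
  show "subspace D" by (rule csubspace_imp_subspace[OF csubspace_D])
  fix f g h r assume D: "f \<in> D" "g \<in> D" "h \<in> D"
  have "f + g \<in> D" "r *\<^sub>R f \<in> D"
    using D csubspace_D by (metis csubspace_def scaleC_of_real)+
  note D = D this
  show "q f g = q g f" using t_sym[OF D(1,2)] by (simp add: inner_commute)
  show "q (f + g) h = q f h + q g h"
    using D by (simp add: t_sym[of _ h] t_add inner_add_left algebra_simps)
  show "q (r *\<^sub>R f) g = r * q f g"
    using D t_scale[of g f "of_real r"]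
    by (simp add: t_sym[of _ g] scaleC_of_real algebra_simps)
  show "0 \<le> q f f"
    using t_bound'[OF D(1)] zero_le_power2[of "norm f"] by linarith
qed

sublocale real_form D q by (rule real_form)

text \<open>Riesz representation for the real form \<open>q\<close> gives the real part of the
  identity; replacing \<open>g\<close> by \<open>\<i> *\<^sub>C g\<close> gives the imaginary
  part.\<close>

lemma resolvent_exists: "\<exists>f\<in>D. \<forall>g\<in>D. t g f + of_real a * cinner g f = cinner g v"
proof -
  have "\<exists>f\<in>D. \<forall>g\<in>D. q f g = inner g v"
  proof (rule Riesz_representation[OF t_complete, where C = "norm v"])
    fix g assume g: "g \<in> D"
    have "\<bar>inner g v\<bar> \<le> norm g * norm v" by (rule Cauchy_Schwarz_ineq2)
    also have "\<dots> \<le> sqrt (q g g) * norm v"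
      using t_bound'[OF g] by (intro mult_right_mono real_le_rsqrt) auto
    finally show "\<bar>inner g v\<bar> \<le> norm v * sqrt (q g g)" by (simp add: mult.commute)
  qed (simp_all add: inner_add_left)
  then obtain f where f: "f \<in> D" "\<And>g. g \<in> D \<Longrightarrow> q f g = inner g v" by blast
  have "t g f + of_real a * cinner g f = cinner g v" if g: "g \<in> D" for g
  proof -
    have ig: "\<i> *\<^sub>C g \<in> D" by (rule csubspace_scaleC[OF csubspace_D g])
    have "t (\<i> *\<^sub>C g) f = - \<i> * t g f"
      using t_sym[OF ig f(1)] t_scale[OF f(1) g] t_sym[OF g f(1)] by simp
    then have "Im (t g f) + a * Im (cinner g f) = Im (cinner g v)"
      using f(2)[OF ig] sym[OF f(1) ig] by (simp add: Im_cinner)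
    moreover have "Re (t g f) + a * Re (cinner g f) = Re (cinner g v)"
      using f(2)[OF g] sym[OF f(1) g] by (simp add: Re_cinner)
    ultimately show ?thesis by (simp add: complex_eq_iff)
  qed
  then show ?thesis using f(1) by blast
qed

text \<open>The inverse of the operator of \<open>t\<close> plus \<open>a\<close>, that is, its
  resolvent at the point \<open>- a\<close>, defined on the whole space.\<close>

definition resolvent :: "'h \<Rightarrow> 'h" where
  "resolvent v = (SOME f. f \<in> D \<and> (\<forall>g\<in>D. t g f + of_real a * cinner g f = cinner g v))"

lemma resolvent_in_D: "resolvent v \<in> D"
  and resolvent: "g \<in> D \<Longrightarrow> t g (resolvent v) + of_real a * cinner g (resolvent v) = cinner g v"
  using someI_ex[OF resolvent_exists[of v, unfolded Bex_def], folded resolvent_def] by auto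

lemma resolvent_eqI:
  assumes f: "f \<in> D" and eq: "\<And>g. g \<in> D \<Longrightarrow> t g f + of_real a * cinner g f = cinner g v"
  shows "f = resolvent v"
proof -
  let ?d = "f - resolvent v"
  note R = resolvent_in_D[of v]
  have d: "?d \<in> D" by (rule D_diff[OF f R])
  have eqR: "q g f = q g (resolvent v)" if "g \<in> D" for g
    using arg_cong[OF eq[OF that], of Re] arg_cong[OF resolvent[OF that, of v], of Re]
    by (simp add: Re_cinner)
  have "q ?d ?d = q ?d f - q ?d (resolvent v)"
    by (rule diff_right[OF f R d])
  then have "q ?d ?d = 0" using eqR[OF d] by simp
  then show ?thesis using t_bound'[OF d] by simp
qed

lemma form_operator_iff: "(f, u) \<in> form_operator D t \<longleftrightarrow> f = resolvent (u + of_real a *\<^sub>C f)"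
proof
  assume "(f, u) \<in> form_operator D t"
  then show "f = resolvent (u + of_real a *\<^sub>C f)"
    by (intro resolvent_eqI) (auto simp: form_operator_def cinner_add_right cinner_scaleC_right)
next
  assume *: "f = resolvent (u + of_real a *\<^sub>C f)"
  have "f \<in> D" by (subst *) (rule resolvent_in_D)
  moreover have "t g f = cinner g u" if "g \<in> D" for g
    using resolvent[OF that, of "u + of_real a *\<^sub>C f", folded *]
    by (simp add: cinner_add_right cinner_scaleC_right)
  ultimately show "(f, u) \<in> form_operator D t" by (auto simp: form_operator_def)
qed

text \<open>Both sides are values of the shifted form at the two resolvent vectors, once in either
  order.\<close>

lemma resolvent_symmetric: "cinner (resolvent v) w = cinner v (resolvent w)"
proof -
  have "cinner (resolvent v) w = t (resolvent v) (resolvent w) + of_real a * cinner (resolvent v) (resolvent w)"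
    by (rule resolvent[OF resolvent_in_D, symmetric])
  also have "\<dots> = cnj (t (resolvent w) (resolvent v) + of_real a * cinner (resolvent w) (resolvent v))"
    by (simp add: t_sym[OF resolvent_in_D resolvent_in_D, of v w] cinner_commute[of "resolvent v" "resolvent w"])
  also have "\<dots> = cnj (cinner (resolvent w) v)"
    by (subst resolvent[OF resolvent_in_D]) simp
  also have "\<dots> = cinner v (resolvent w)" by (metis cinner_commute)
  finally show ?thesis .
qed

lemma resolvent_graph: "(resolvent v, v - of_real a *\<^sub>C resolvent v) \<in> form_operator D t"
  by (simp add: form_operator_iff)

lemma csubspace_range_resolvent: "csubspace (range resolvent)"
  unfolding csubspace_def
proof (intro conjI ballI allI)
  show "0 \<in> range resolvent"
    using resolvent_eqI[OF D_zero, of 0] t_scale[OF _ D_zero, of _ 0] scaleC_zero_right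
    by (metis add.right_neutral cinner_zero_right mult_zero_left mult_zero_right rangeI)
next
  fix x y assume "x \<in> range resolvent" "y \<in> range resolvent"
  then obtain v w where vw: "x = resolvent v" "y = resolvent w" by auto
  have "resolvent v + resolvent w = resolvent (v + w)"
  proof (rule resolvent_eqI)
    show "resolvent v + resolvent w \<in> D" by (intro D_add resolvent_in_D)
    fix g assume g: "g \<in> D"
    show "t g (resolvent v + resolvent w) + of_real a * cinner g (resolvent v + resolvent w) = cinner g (v + w)"
      using resolvent[OF g, of v] resolvent[OF g, of w] t_add[OF g resolvent_in_D resolvent_in_D, of v w]
      by (simp add: cinner_add_right algebra_simps)
  qed
  then show "x + y \<in> range resolvent" using vw by auto
next
  fix x c assume "x \<in> range resolvent"
  then obtain v where v: "x = resolvent v" by auto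
  have "c *\<^sub>C resolvent v = resolvent (c *\<^sub>C v)"
  proof (rule resolvent_eqI)
    show "c *\<^sub>C resolvent v \<in> D" by (intro csubspace_scaleC[OF csubspace_D] resolvent_in_D)
    fix g assume g: "g \<in> D"
    show "t g (c *\<^sub>C resolvent v) + of_real a * cinner g (c *\<^sub>C resolvent v) = cinner g (c *\<^sub>C v)"
      by (simp add: resolvent[OF g, of v, symmetric] t_scale[OF g resolvent_in_D] cinner_scaleC_right algebra_simps)
  qed
  then show "c *\<^sub>C x \<in> range resolvent" using v by auto
qed

text \<open>The domain contains the range of the resolvent. A vector \<open>v\<close> orthogonal to
  that range has \<open>resolvent v = 0\<close> by symmetry, hence is orthogonal to \<open>D\<close>
  and vanishes by assumption.\<close>

lemma form_operator_self_adjoint: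
  assumes dense: "\<And>v. (\<And>f. f \<in> D \<Longrightarrow> cinner f v = 0) \<Longrightarrow> v = 0"
  shows "self_adjoint (form_operator D t)"
  unfolding self_adjoint_def
proof
  have "closure (range resolvent) = UNIV"
  proof (rule closure_csubspace_dense[OF csubspace_range_resolvent])
    fix v assume v: "\<And>g. g \<in> range resolvent \<Longrightarrow> cinner g v = 0"
    have "cinner w (resolvent v) = 0" for w
      using v[of "resolvent w"] by (simp add: resolvent_symmetric)
    then have R: "resolvent v = 0"
      by (metis cinner_self norm_eq_zero of_real_eq_0_iff power2_eq_iff_nonneg zero_power2 norm_ge_zero order_refl)
    show "v = 0"
    proof (rule dense)
      fix f assume f: "f \<in> D"
      have "t f 0 = 0" using t_scale[OF f D_zero, of 0] by simp
      then show "cinner f v = 0" using resolvent[OF f, of v] R by simp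
    qed
  qed
  moreover have "range resolvent \<subseteq> Domain (form_operator D t)"
    using resolvent_graph by auto
  ultimately show "closure (Domain (form_operator D t)) = UNIV"
    using closure_mono by blast
next
  show "adjoint_graph (form_operator D t) = form_operator D t"
  proof (intro set_eqI iffI; clarify)
    fix f u assume fu: "(f, u) \<in> adjoint_graph (form_operator D t)"
    \<comment> \<open>Testing the adjoint pair against all pairs of \<open>resolvent_graph\<close>
      identifies \<open>f\<close> as a resolvent vector, which is membership in the
      operator.\<close>
    have "cinner (f - resolvent (u + of_real a *\<^sub>C f)) v = 0" for v
    proof -
      have "cinner f (v - of_real a *\<^sub>C resolvent v) = cinner u (resolvent v)"
        using fu resolvent_graph[of v] unfolding adjoint_graph_def by blast
      then show ?thesis
        by (simp add: cinner_diff_left cinner_diff_right resolvent_symmetric cinner_add_left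
            cinner_scaleC_left cinner_scaleC_right algebra_simps)
    qed
    from this[of "f - resolvent (u + of_real a *\<^sub>C f)"] show "(f, u) \<in> form_operator D t"
      by (simp add: cinner_self form_operator_iff)
  next
    fix f u assume fu: "(f, u) \<in> form_operator D t"
    show "(f, u) \<in> adjoint_graph (form_operator D t)"
      unfolding adjoint_graph_def
    proof clarify
      fix g v assume gv: "(g, v) \<in> form_operator D t"
      then have "cinner f v = t f g" using fu by (auto simp: form_operator_def)
      also have "\<dots> = cnj (t g f)" using fu gv by (intro t_sym) (auto simp: form_operator_def)
      also have "\<dots> = cnj (cinner g u)" using fu gv by (auto simp: form_operator_def)
      also have "\<dots> = cinner u g" by (metis cinner_commute)
      finally show "cinner f v = cinner u g" .
    qed
  qed
qed

text \<open>Since \<open>t f f = cinner f u\<close> for a pair \<open>(f, u)\<close> of the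
  operator, bounds on \<open>f\<close> and \<open>u\<close> bound the form. The sets required for
  compact resolvent thus lie in sublevel sets of \<open>q\<close>.\<close>

lemma form_operator_purely_discrete:
  assumes sa: "self_adjoint (form_operator D t)"
    and compact: "\<And>M. compact (closure {f\<in>D. q f f \<le> M})"
  shows "purely_discrete_spectrum (form_operator D t)"
proof (rule self_adjoint_compact_purely_discrete[OF sa])
  fix C :: real
  let ?S = "{f. \<exists>u. (f, u) \<in> form_operator D t \<and> norm f \<le> C \<and> norm u \<le> C}"
  have "?S \<subseteq> {f\<in>D. q f f \<le> C * C + \<bar>a\<bar> * (C * C)}"
  proof clarify
    fix f u assume fu: "(f, u) \<in> form_operator D t" "norm f \<le> C" "norm u \<le> C"
    have f: "f \<in> D" "t f f = cinner f u" using fu(1) by (auto simp: form_operator_def)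
    have C: "C \<ge> 0" using fu(2) norm_ge_zero[of f] by linarith
    have "Re (t f f) \<le> norm f * norm u"
      using complex_Re_le_cmod[of "cinner f u"] cmod_cinner_le[of f u] f(2) by simp
    also have "\<dots> \<le> C * C" using fu C by (intro mult_mono) auto
    finally have 1: "Re (t f f) \<le> C * C" .
    have "a * inner f f \<le> \<bar>a\<bar> * (norm f * norm f)"
      by (simp add: mult_right_mono flip: power2_norm_eq_inner power2_eq_square)
    also have "\<dots> \<le> \<bar>a\<bar> * (C * C)" using fu C by (intro mult_left_mono mult_mono) auto
    finally show "f \<in> D \<and> q f f \<le> C * C + \<bar>a\<bar> * (C * C)" using 1 f by simp
  qed
  then have "closure {f\<in>D. q f f \<le> C * C + \<bar>a\<bar> * (C * C)} \<inter> closure ?S = closure ?S"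
    using closure_mono by blast
  moreover have "compact (closure {f\<in>D. q f f \<le> C * C + \<bar>a\<bar> * (C * C)} \<inter> closure ?S)"
    by (rule compact_Int_closed[OF compact closed_closure])
  ultimately show "compact (closure ?S)" by simp
qed

end

section \<open>Completeness of the space of square integrable functions\<close>

lemma abs_rep_L2 [simp]: "abs_L2 (rep_L2 f) = f"
  by (rule Quotient3_abs_rep[OF Quotient3_L2])

lemma square_integrable_rep [simp]: "square_integrable (rep_L2 f)"
  using L2_rel_rep[of f] by (simp add: L2_rel_def)

lemma measurable_rep_L2 [measurable]: "rep_L2 f \<in> borel_measurable borel"
  using square_integrable_measurable[OF square_integrable_rep[of f]] by simp

lemma rep_abs_L2: "square_integrable f \<Longrightarrow> AE x in lborel. rep_L2 (abs_L2 f) x = f x"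
  using L2_rel_rep_abs[of f] by (simp add: L2_rel_def)


lemma L2_eqI: "AE x in lborel. rep_L2 f x = rep_L2 g x \<Longrightarrow> f = g"
  using Quotient3_rel_rep[OF Quotient3_L2, of f g] by (simp add: L2_rel_def)

lemma rep_L2_zero: "AE x in lborel. rep_L2 (0 :: ('n::finite, 'e::finite_dim_hilbert) L2) x = 0"
  unfolding zero_L2_def by (rule rep_abs_L2[OF square_integrable_zero])

lemma L2_eq_0_iff: "f = (0 :: ('n::finite, 'e::finite_dim_hilbert) L2) \<longleftrightarrow> (AE x in lborel. rep_L2 f x = 0)"
  using rep_L2_zero[where 'n='n and 'e='e] by (auto intro!: L2_eqI)

lemma rep_L2_add: "AE x in lborel. rep_L2 (f + g) x = rep_L2 f x + rep_L2 g x"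
proof -
  have "f + g = abs_L2 (\<lambda>x. rep_L2 f x + rep_L2 g x)"
    using plus_L2.abs_eq[OF L2_rel_rep L2_rel_rep, of f g] by simp
  then show ?thesis
    by (metis rep_abs_L2 square_integrable_add square_integrable_rep)
qed

lemma rep_L2_scaleC: "AE x in lborel. rep_L2 (c *\<^sub>C f) x = c *\<^sub>C rep_L2 f x"
proof -
  have "c *\<^sub>C f = abs_L2 (\<lambda>x. c *\<^sub>C rep_L2 f x)"
    using scaleC_L2.abs_eq[OF L2_rel_rep, of c f] by simp
  then show ?thesis
    by (metis rep_abs_L2 square_integrable_scaleC square_integrable_rep)
qed

lemma rep_L2_scaleR: "AE x in lborel. rep_L2 (c *\<^sub>R f) x = c *\<^sub>R rep_L2 f x"
  using rep_L2_scaleC[of "of_real c" f] by (simp add: scaleC_of_real)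

lemma rep_L2_diff: "AE x in lborel. rep_L2 (f - g) x = rep_L2 f x - rep_L2 g x"
  using rep_L2_add[of f "- g"] rep_L2_scaleR[of "-1" g] by eventually_elim simp

lemma inner_L2_eq: "inner f g = (\<integral>x. inner (rep_L2 f x) (rep_L2 g x) \<partial>lborel)"
  using inner_L2.abs_eq[OF L2_rel_rep L2_rel_rep, of f g] by simp

lemma cinner_L2_eq: "cinner f g = (\<integral>x. cinner (rep_L2 f x) (rep_L2 g x) \<partial>lborel)"
  using cinner_L2.abs_eq[OF L2_rel_rep L2_rel_rep, of f g] by simp

lemma power2_norm_L2: "(norm f)\<^sup>2 = (\<integral>x. (norm (rep_L2 f x))\<^sup>2 \<partial>lborel)"
  for f :: "('n::finite, 'e::finite_dim_hilbert) L2"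
  by (simp add: power2_norm_eq_inner inner_L2_eq)

lemma integrable_norm_rep_L2: "integrable lborel (\<lambda>x. (norm (rep_L2 f x))\<^sup>2)"
  using square_integrable_rep[of f] by (simp add: square_integrable_def)

lemma nn_integral_norm_L2:
  "(\<integral>\<^sup>+x. ennreal ((norm (rep_L2 f x))\<^sup>2) \<partial>lborel) = ennreal ((norm f)\<^sup>2)"
  for f :: "('n::finite, 'e::finite_dim_hilbert) L2"
  unfolding power2_norm_L2 by (rule nn_integral_eq_integral[OF integrable_norm_rep_L2]) simp

lemma square_integrableI:
  assumes [measurable]: "f \<in> borel_measurable borel" and "(\<integral>\<^sup>+x. ennreal ((norm (f x))\<^sup>2) \<partial>lborel) < \<infinity>"
  shows "square_integrable f"
  using assms(2) by (auto simp: square_integrable_def integrable_iff_bounded)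

lemma nn_integral_abs_L2:
  assumes "square_integrable f"
  shows "ennreal ((norm (abs_L2 f))\<^sup>2) = (\<integral>\<^sup>+x. ennreal ((norm (f x))\<^sup>2) \<partial>lborel)"
  unfolding nn_integral_norm_L2[symmetric]
  by (rule nn_integral_cong_AE) (use rep_abs_L2[OF assms] in eventually_elim, simp)

text \<open>Fatou's lemma for squared norms. Working with extended values yields integrability of
  the limit together with the bound.\<close>

lemma nn_integral_norm_AE_limit:
  assumes [measurable]: "\<And>j::nat. u j \<in> borel_measurable lborel"
    and "AE x in lborel. (\<lambda>j. u j x) \<longlonglongrightarrow> G x"
    and "\<And>j. j \<ge> N \<Longrightarrow> (\<integral>\<^sup>+x. ennreal ((norm (u j x))\<^sup>2) \<partial>lborel) \<le> C"
  shows "(\<integral>\<^sup>+x. ennreal ((norm (G x))\<^sup>2) \<partial>lborel) \<le> C"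
proof -
  have "(\<integral>\<^sup>+x. ennreal ((norm (G x))\<^sup>2) \<partial>lborel)
      = (\<integral>\<^sup>+x. liminf (\<lambda>j. ennreal ((norm (u j x))\<^sup>2)) \<partial>lborel)"
  proof (rule nn_integral_cong_AE, use assms(2) in eventually_elim)
    fix x assume "(\<lambda>j. u j x) \<longlonglongrightarrow> G x"
    then have "(\<lambda>j. ennreal ((norm (u j x))\<^sup>2)) \<longlonglongrightarrow> ennreal ((norm (G x))\<^sup>2)"
      by (intro tendsto_intros tendsto_ennrealI)
    then show "ennreal ((norm (G x))\<^sup>2) = liminf (\<lambda>j. ennreal ((norm (u j x))\<^sup>2))"
      using lim_imp_Liminf[of sequentially] by force
  qed
  also have "\<dots> \<le> liminf (\<lambda>j. \<integral>\<^sup>+x. ennreal ((norm (u j x))\<^sup>2) \<partial>lborel)"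
    by (rule nn_integral_liminf) measurable
  also have "\<dots> \<le> C"
  proof -
    have "liminf (\<lambda>j. \<integral>\<^sup>+x. ennreal ((norm (u j x))\<^sup>2) \<partial>lborel) \<le> liminf (\<lambda>j. C)"
      by (rule Liminf_mono) (use assms(3) in \<open>auto simp: eventually_sequentially\<close>)
    then show ?thesis by (simp add: Liminf_const)
  qed
  finally show ?thesis .
qed

text \<open>A finite sum bounds the j-th increment by a constant times \<open>(1/2) ^ j\<close>; the
  weight \<open>4 ^ j\<close> replaces the Cauchy-Schwarz inequality for series.\<close>

lemma convergent_if_weighted_sum_finite:
  fixes y :: "nat \<Rightarrow> 'a::banach"
  assumes "(\<Sum>j. ennreal (4 ^ j * (norm (y (Suc j) - y j))\<^sup>2)) < \<infinity>"
  shows "convergent y"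
proof -
  define a where "a j = ennreal (4 ^ j * (norm (y (Suc j) - y j))\<^sup>2)" for j
  have "suminf a < top" using assms by (simp add: a_def[abs_def])
  then obtain M where M: "suminf a = ennreal M" "M \<ge> 0"
    unfolding less_top_ennreal by blast
  have "norm (y (Suc j) - y j) \<le> sqrt M * (1/2) ^ j" for j
  proof -
    have "sum a {j} \<le> suminf a" by (rule sum_le_suminf) auto
    then have "ennreal (4 ^ j * (norm (y (Suc j) - y j))\<^sup>2) \<le> ennreal M"
      by (simp add: M(1) a_def)
    then have "4 ^ j * (norm (y (Suc j) - y j))\<^sup>2 \<le> M"
      using M(2) by (simp add: ennreal_le_iff)
    moreover have "(4::real) ^ j = (2 ^ j)\<^sup>2" by (simp add: power2_eq_square flip: power_mult_distrib)
    ultimately have "(2 ^ j * norm (y (Suc j) - y j))\<^sup>2 \<le> M" by (simp add: power_mult_distrib)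
    then have "2 ^ j * norm (y (Suc j) - y j) \<le> sqrt M" by (rule real_le_rsqrt)
    then show ?thesis by (simp add: field_simps power_divide)
  qed
  moreover have "summable (\<lambda>j. sqrt M * (1/2) ^ j)"
    by (intro summable_mult summable_geometric) simp
  ultimately have "summable (\<lambda>j. y (Suc j) - y j)"
    by (intro summable_comparison_test'[of "\<lambda>j. sqrt M * (1/2) ^ j" 0 "\<lambda>j. y (Suc j) - y j"])
  then show ?thesis by (simp add: summable_iff_convergent sum_lessThan_telescope convergent_diff_const_right_iff)
qed

text \<open>The Riesz-Fischer theorem. Increments of size \<open>(1/4) ^ j\<close> leave the j-th
  weighted squared increment at \<open>4 ^ j * (1/16) ^ j = (1/4) ^ j\<close>, which is summable, so
  the subsequence converges almost everywhere.\<close>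

lemma L2_Cauchy_limit:
  fixes f :: "nat \<Rightarrow> ('n::finite, 'e::finite_dim_hilbert) L2"
  assumes "Cauchy f"
  shows "\<exists>g r. strict_mono r \<and> f \<longlonglongrightarrow> g \<and> (AE x in lborel. (\<lambda>j. rep_L2 (f (r j)) x) \<longlonglongrightarrow> rep_L2 g x)"
proof -
  have "\<exists>N. \<forall>i\<ge>N. \<forall>k\<ge>N. norm (f i - f k) < (1/4) ^ j" for j :: nat
    using assms by (intro CauchyD) simp_all
  then obtain N where N: "\<And>j i k. i \<ge> N j \<Longrightarrow> k \<ge> N j \<Longrightarrow> norm (f i - f k) < (1/4) ^ j" by metis
  \<comment> \<open>The sum dominates \<open>N j\<close>, and the summand \<open>j\<close> makes the
    indices strictly increasing.\<close>
  define r where "r j = (\<Sum>i\<le>j. N i) + j" for j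
  have r: "strict_mono r" by (auto simp: strict_mono_Suc_iff r_def)
  have rN: "N j \<le> r j" for j using member_le_sum[of j "{..j}" N] by (auto simp: r_def)
  have step: "norm (f (r (Suc j)) - f (r j)) \<le> (1/4) ^ j" for j
  proof -
    have "r j \<le> r (Suc j)" using r by (simp add: strict_mono_less_eq)
    then show ?thesis using N[of j "r (Suc j)" "r j"] rN[of j] by simp
  qed
  let ?u = "\<lambda>j. rep_L2 (f (r j))"
  have int: "(\<integral>\<^sup>+x. ennreal (4 ^ j * (norm (?u (Suc j) x - ?u j x))\<^sup>2) \<partial>lborel) \<le> ennreal ((1/4) ^ j)" for j
  proof -
    have "(\<integral>\<^sup>+x. ennreal (4 ^ j * (norm (?u (Suc j) x - ?u j x))\<^sup>2) \<partial>lborel)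
        = (\<integral>\<^sup>+x. ennreal (4 ^ j) * ennreal ((norm (rep_L2 (f (r (Suc j)) - f (r j)) x))\<^sup>2) \<partial>lborel)"
      by (rule nn_integral_cong_AE)
         (use rep_L2_diff[of "f (r (Suc j))" "f (r j)"] in eventually_elim, simp add: ennreal_mult)
    also have "\<dots> = ennreal (4 ^ j) * ennreal ((norm (f (r (Suc j)) - f (r j)))\<^sup>2)"
      by (simp add: nn_integral_cmult nn_integral_norm_L2)
    also have "\<dots> \<le> ennreal (4 ^ j) * ennreal (((1/4) ^ j)\<^sup>2)"
      by (intro mult_left_mono ennreal_leI power_mono step) auto
    also have "\<dots> = ennreal ((1/4) ^ j)"
      by (simp add: ennreal_mult[symmetric] power2_eq_square power_divide)
    finally show ?thesis .
  qed
  have "(\<integral>\<^sup>+x. (\<Sum>j. ennreal (4 ^ j * (norm (?u (Suc j) x - ?u j x))\<^sup>2)) \<partial>lborel)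
      = (\<Sum>j. \<integral>\<^sup>+x. ennreal (4 ^ j * (norm (?u (Suc j) x - ?u j x))\<^sup>2) \<partial>lborel)"
    by (rule nn_integral_suminf) measurable
  also have "\<dots> \<le> (\<Sum>j. ennreal ((1/4) ^ j))"
    by (intro suminf_le int summableI)
  also have "\<dots> = ennreal (\<Sum>j. (1/4) ^ j)"
    by (rule suminf_ennreal2) (auto intro: summable_geometric)
  also have "\<dots> < \<infinity>" by simp
  finally have "AE x in lborel. (\<Sum>j. ennreal (4 ^ j * (norm (?u (Suc j) x - ?u j x))\<^sup>2)) \<noteq> \<infinity>"
    by (intro nn_integral_PInf_AE) auto
  then have conv: "AE x in lborel. convergent (\<lambda>j. ?u j x)"
    by eventually_elim (auto intro: convergent_if_weighted_sum_finite simp: less_top)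
  define G where "G x = lim (\<lambda>j. ?u j x)" for x
  have lim: "AE x in lborel. (\<lambda>j. ?u j x) \<longlonglongrightarrow> G x"
    using conv by eventually_elim (simp add: G_def convergent_LIMSEQ_iff)
  have [measurable]: "G \<in> borel_measurable borel"
    unfolding G_def by (rule borel_measurable_lim_metric) measurable
  \<comment> \<open>Fatou carries a Cauchy estimate over to the pointwise limit \<open>G\<close>. It
    serves twice: for square integrability of \<open>G\<close>, with bound
    \<open>1 = (1/4) ^ 0\<close>, and for convergence of the whole sequence.\<close>
  have tail: "(\<integral>\<^sup>+x. ennreal ((norm (G x - rep_L2 (f k) x))\<^sup>2) \<partial>lborel) \<le> ennreal (e\<^sup>2)"
    if K: "\<And>i. i \<ge> K \<Longrightarrow> norm (f i - f k) \<le> e" for K k e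
  proof (rule nn_integral_norm_AE_limit[where N = K])
    show "AE x in lborel. (\<lambda>j. ?u j x - rep_L2 (f k) x) \<longlonglongrightarrow> G x - rep_L2 (f k) x"
      using lim by eventually_elim (intro tendsto_intros)
    fix j assume "j \<ge> K"
    then have "r j \<ge> K" using seq_suble[OF r, of j] by simp
    have "(\<integral>\<^sup>+x. ennreal ((norm (?u j x - rep_L2 (f k) x))\<^sup>2) \<partial>lborel)
        = (\<integral>\<^sup>+x. ennreal ((norm (rep_L2 (f (r j) - f k) x))\<^sup>2) \<partial>lborel)"
      by (rule nn_integral_cong_AE) (use rep_L2_diff[of "f (r j)" "f k"] in eventually_elim, simp)
    also have "\<dots> = ennreal ((norm (f (r j) - f k))\<^sup>2)" by (rule nn_integral_norm_L2)
    also have "\<dots> \<le> ennreal (e\<^sup>2)" by (intro ennreal_leI power_mono K \<open>r j \<ge> K\<close>) simp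
    finally show "(\<integral>\<^sup>+x. ennreal ((norm (?u j x - rep_L2 (f k) x))\<^sup>2) \<partial>lborel) \<le> ennreal (e\<^sup>2)" .
  qed measurable
  have sq: "square_integrable G"
  proof -
    have "square_integrable (\<lambda>x. G x - rep_L2 (f (N 0)) x)"
      using tail[of "N 0" "N 0" 1] N[where j=0 and k="N 0"]
      by (intro square_integrableI) (auto simp: less_imp_le elim: le_less_trans)
    from square_integrable_add[OF this square_integrable_rep[of "f (N 0)"]]
    show ?thesis by simp
  qed
  define g where "g = abs_L2 G"
  have gG: "AE x in lborel. rep_L2 g x = G x" unfolding g_def by (rule rep_abs_L2[OF sq])
  have "f \<longlonglongrightarrow> g"
  proof (rule LIMSEQ_I)
    fix e :: real assume e: "e > 0"
    then obtain K where K: "\<And>i k. i \<ge> K \<Longrightarrow> k \<ge> K \<Longrightarrow> norm (f i - f k) < e / 2"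
      using CauchyD[OF assms, of "e/2"] by auto
    have "norm (f k - g) < e" if "k \<ge> K" for k
    proof -
      have "ennreal ((norm (g - f k))\<^sup>2) = (\<integral>\<^sup>+x. ennreal ((norm (rep_L2 (g - f k) x))\<^sup>2) \<partial>lborel)"
        by (simp add: nn_integral_norm_L2)
      also have "\<dots> = (\<integral>\<^sup>+x. ennreal ((norm (G x - rep_L2 (f k) x))\<^sup>2) \<partial>lborel)"
        by (rule nn_integral_cong_AE) (use rep_L2_diff[of g "f k"] gG in eventually_elim, simp)
      also have "\<dots> \<le> ennreal ((e/2)\<^sup>2)"
        by (rule tail[of K]) (use K[OF _ that] in \<open>auto intro: less_imp_le\<close>)
      finally have "(norm (g - f k))\<^sup>2 \<le> (e/2)\<^sup>2" by (simp add: ennreal_le_iff)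
      then have "norm (g - f k) \<le> e/2" by (rule power2_le_imp_le) (use e in simp)
      then show ?thesis using e by (simp add: norm_minus_commute)
    qed
    then show "\<exists>no. \<forall>n\<ge>no. norm (f n - g) < e" by blast
  qed
  moreover have "AE x in lborel. (\<lambda>j. rep_L2 (f (r j)) x) \<longlonglongrightarrow> rep_L2 g x"
    using lim gG by eventually_elim simp
  ultimately show ?thesis using r by blast
qed

instance L2 :: (finite, finite_dim_hilbert) banach
proof
  fix X :: "nat \<Rightarrow> ('a, 'b) L2" assume "Cauchy X"
  then show "convergent X" using L2_Cauchy_limit[of X] convergentI by blast
qed

lemma L2_limit_AE_subseq:
  fixes f :: "nat \<Rightarrow> ('n::finite, 'e::finite_dim_hilbert) L2"
  assumes "f \<longlonglongrightarrow> g"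
  obtains r where "strict_mono r" "AE x in lborel. (\<lambda>j. rep_L2 (f (r j)) x) \<longlonglongrightarrow> rep_L2 g x"
proof -
  have "Cauchy f" using assms convergent_Cauchy convergentI by blast
  then obtain g' r where "strict_mono r" "f \<longlonglongrightarrow> g'" "AE x in lborel. (\<lambda>j. rep_L2 (f (r j)) x) \<longlonglongrightarrow> rep_L2 g' x"
    using L2_Cauchy_limit by blast
  moreover have "g' = g" using LIMSEQ_unique[OF assms] \<open>f \<longlonglongrightarrow> g'\<close> by simp
  ultimately show ?thesis using that by simp
qed

section \<open>Translations\<close>

lemma lborel_distr_shift: "distr lborel borel (\<lambda>x. x + h) = (lborel :: 'a::euclidean_space measure)"
proof -
  have "(\<lambda>x. x + h) = (+) h" by (auto simp: add.commute)
  then show ?thesis using lborel_distr_plus[of h] by simp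
qed

lemma AE_lborel_shift:
  fixes h :: "'a::euclidean_space"
  assumes "AE x in lborel. P x"
  shows "AE x in lborel. P (x + h)"
proof -
  have "AE x in distr lborel borel (\<lambda>x. x + h). P x" using assms by (subst lborel_distr_shift)
  then show ?thesis by (rule AE_distrD[rotated]) simp
qed

lemma nn_integral_lborel_shift:
  fixes h :: "'a::euclidean_space"
  assumes "f \<in> borel_measurable borel"
  shows "(\<integral>\<^sup>+x. f (x + h) \<partial>lborel) = (\<integral>\<^sup>+x. f x \<partial>lborel)"
  by (subst (2) lborel_distr_shift[of h, symmetric]) (use assms in \<open>simp add: nn_integral_distr\<close>)

lemma integrable_lborel_shift:
  fixes h :: "'a::euclidean_space" and f :: "_ \<Rightarrow> 'b::{banach, second_countable_topology}"
  assumes "integrable lborel f"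
  shows "integrable lborel (\<lambda>x. f (x + h))"
  using assms by (subst (asm) lborel_distr_shift[of h, symmetric]) (auto intro: integrable_distr[rotated])

lemma integral_lborel_shift:
  fixes h :: "'a::euclidean_space" and f :: "_ \<Rightarrow> 'b::{banach, second_countable_topology}"
  assumes "f \<in> borel_measurable borel"
  shows "(\<integral>x. f (x + h) \<partial>lborel) = (\<integral>x. f x \<partial>lborel)"
  by (subst (2) lborel_distr_shift[of h, symmetric]) (use assms in \<open>simp add: integral_distr\<close>)

lemma square_integrable_shift:
  assumes "square_integrable f"
  shows "square_integrable (\<lambda>x. f (x + h))"
proof -
  have [measurable]: "f \<in> borel_measurable borel" using square_integrable_measurable[OF assms] by simp
  show ?thesis
    using assms integrable_lborel_shift[of "\<lambda>x. (norm (f x))\<^sup>2" h] by (simp add: square_integrable_def)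
qed

lift_definition translation :: "real^'n \<Rightarrow> ('n, 'e::finite_dim_hilbert) L2 \<Rightarrow> ('n, 'e) L2"
  is "\<lambda>h f x. f (x + h)"
  unfolding L2_rel_def using square_integrable_shift AE_lborel_shift[of "\<lambda>x. f x = g x" for f g] by blast

lemma rep_translation: "AE x in lborel. rep_L2 (translation h f) x = rep_L2 f (x + h)"
proof -
  have "translation h f = abs_L2 (\<lambda>x. rep_L2 f (x + h))"
    using translation.abs_eq[OF L2_rel_rep, of h f] by simp
  then show ?thesis by (metis rep_abs_L2 square_integrable_rep square_integrable_shift)
qed

lemma translation_add: "translation h (f + g) = translation h f + translation h g"
  by transfer (auto simp: L2_rel_def square_integrable_shift square_integrable_add)

lemma translation_scaleR: "translation h (c *\<^sub>R f) = c *\<^sub>R translation h f"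
  by transfer (auto simp: L2_rel_def square_integrable_shift square_integrable_scaleR)

lemma translation_zero [simp]: "translation h 0 = (0 :: ('n::finite, 'e::finite_dim_hilbert) L2)"
  using translation_scaleR[of h 0 "0 :: ('n, 'e) L2"] by simp

lemma translation_diff: "translation h (f - g) = translation h f - translation h g"
  using translation_add[of h f "- g"] translation_scaleR[of h "-1" g] by simp

lemma norm_translation: "norm (translation h f) = norm f"
proof -
  have "ennreal ((norm (translation h f))\<^sup>2) = (\<integral>\<^sup>+x. ennreal ((norm (rep_L2 f (x + h)))\<^sup>2) \<partial>lborel)"
    unfolding nn_integral_norm_L2[symmetric]
    by (rule nn_integral_cong_AE) (use rep_translation[of h f] in eventually_elim, simp)
  also have "\<dots> = ennreal ((norm f)\<^sup>2)"
    unfolding nn_integral_norm_L2[symmetric] by (rule nn_integral_lborel_shift) measurable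
  finally show ?thesis by (simp add: ennreal_inj power2_eq_iff_nonneg)
qed

lemma integrable_indicator_rep:
  assumes "square_integrable f" "bounded A" and [measurable]: "A \<in> sets borel"
  shows "integrable lborel (\<lambda>x. indicator A x *\<^sub>R f x)"
proof -
  have [measurable]: "f \<in> borel_measurable borel" using square_integrable_measurable[OF assms(1)] by simp
  have "integrable lborel (\<lambda>x. indicator A x + (norm (f x))\<^sup>2)"
    using assms emeasure_bounded_finite[OF assms(2)]
    by (intro Bochner_Integration.integrable_add) (auto simp: square_integrable_def integrable_indicator_iff)
  then show ?thesis
  proof (rule Bochner_Integration.integrable_bound)
    show "AE x in lborel. norm (indicator A x *\<^sub>R f x) \<le> norm (indicator A x + (norm (f x))\<^sup>2)"
    proof (rule AE_I2)
      fix x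
      have "0 \<le> norm (f x)" "2 * norm (f x) \<le> 1 + (norm (f x))\<^sup>2"
        using sum_squares_bound[of 1 "norm (f x)"] by simp_all
      then have "norm (f x) \<le> 1 + (norm (f x))\<^sup>2" by linarith
      then show "norm (indicator A x *\<^sub>R f x) \<le> norm (indicator A x + (norm (f x))\<^sup>2)"
        by (auto simp: indicator_def)
    qed
  qed measurable
qed

lemma square_integrable_indicator:
  assumes "bounded A" and [measurable]: "A \<in> sets borel"
  shows "square_integrable (\<lambda>x. indicator A x *\<^sub>R e)"
proof -
  have "integrable lborel (\<lambda>x. indicator A x * (norm e)\<^sup>2)"
    using emeasure_bounded_finite[OF assms(1)]
    by (intro integrable_mult_left integrable_real_indicator) auto
  moreover have "(norm (indicator A x *\<^sub>R e))\<^sup>2 = indicator A x * (norm e)\<^sup>2" for x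
    by (simp add: indicator_def)
  ultimately show ?thesis by (simp add: square_integrable_def)
qed

text \<open>Components of integrals over bounded sets are continuous functionals, represented by an
  element of the space itself. This serves for totality and for the finite net of cube
  means.\<close>

lemma inner_indicator_L2:
  fixes g :: "('n::finite, 'e::finite_dim_hilbert) L2"
  assumes B: "bounded A" "A \<in> sets borel"
  shows "inner (abs_L2 (\<lambda>x. indicator A x *\<^sub>R e)) g = inner e (\<integral>x. indicator A x *\<^sub>R rep_L2 g x \<partial>lborel)"
proof -
  have int: "integrable lborel (\<lambda>x. indicator A x *\<^sub>R rep_L2 g x)"
    by (rule integrable_indicator_rep[OF _ B]) simp
  have "inner e (\<integral>x. indicator A x *\<^sub>R rep_L2 g x \<partial>lborel)
      = (\<integral>x. inner e (indicator A x *\<^sub>R rep_L2 g x) \<partial>lborel)"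
    by (subst integral_inner_right) (use int in simp_all)
  also have "\<dots> = inner (abs_L2 (\<lambda>x. indicator A x *\<^sub>R e)) g"
    unfolding inner_L2_eq
  proof (rule integral_cong_AE)
    show "AE x in lborel. inner e (indicator A x *\<^sub>R rep_L2 g x)
        = inner (rep_L2 (abs_L2 (\<lambda>x. indicator A x *\<^sub>R e)) x) (rep_L2 g x)"
      using rep_abs_L2[OF square_integrable_indicator[OF B, of e]] by eventually_elim simp
    show "(\<lambda>x. inner e (indicator A x *\<^sub>R rep_L2 g x)) \<in> borel_measurable lborel"
      "(\<lambda>x. inner (rep_L2 (abs_L2 (\<lambda>x. indicator A x *\<^sub>R e)) x) (rep_L2 g x)) \<in> borel_measurable lborel"
      by (intro borel_measurable_inner borel_measurable_scaleR borel_measurable_indicator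
          measurable_const; use B in simp)+
  qed
  finally show ?thesis ..
qed

text \<open>Vanishing integrals over all Borel subsets make an integrable function zero almost
  everywhere. Integrability holds on balls, hence the exhaustion by
  \<open>ball 0 (real N)\<close>.\<close>

lemma L2_eq_0I:
  fixes g :: "('n::finite, 'e::finite_dim_hilbert) L2"
  assumes "\<And>A e. bounded A \<Longrightarrow> A \<in> sets borel \<Longrightarrow>
    inner (abs_L2 (\<lambda>x. indicator A x *\<^sub>R e)) g = 0"
  shows "g = 0"
proof -
  have "AE x in lborel. indicator (ball 0 (real N)) x *\<^sub>R rep_L2 g x = 0" for N :: nat
  proof (rule sigma_finite_measure.density_zero[OF sigma_finite_lborel])
    show "integrable lborel (\<lambda>x. indicator (ball 0 (real N)) x *\<^sub>R rep_L2 g x)"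
      by (rule integrable_indicator_rep) auto
    fix A :: "(real^'n) set" assume "A \<in> sets lborel"
    then have [measurable]: "A \<in> sets borel" by simp
    let ?B = "A \<inter> ball 0 (real N)"
    have B: "bounded ?B" "?B \<in> sets borel" by auto
    have "inner e (\<integral>x. indicator ?B x *\<^sub>R rep_L2 g x \<partial>lborel) = 0" for e
      using inner_indicator_L2[OF B, of e g] assms[OF B, of e] by simp
    \<comment> \<open>With \<open>e\<close> equal to the integral itself the inner product is its
      squared norm.\<close>
    from this[of "\<integral>x. indicator ?B x *\<^sub>R rep_L2 g x \<partial>lborel"]
    show "set_lebesgue_integral lborel A (\<lambda>x. indicator (ball 0 (real N)) x *\<^sub>R rep_L2 g x) = 0"
      by (simp add: set_lebesgue_integral_def indicator_inter_arith)
  qed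
  then have "AE x in lborel. \<forall>N::nat. indicator (ball 0 (real N)) x *\<^sub>R rep_L2 g x = 0"
    unfolding AE_all_countable by blast
  then have "AE x in lborel. rep_L2 g x = 0"
  proof eventually_elim
    fix x :: "real^'n" assume *: "\<forall>N::nat. indicator (ball 0 (real N)) x *\<^sub>R rep_L2 g x = 0"
    obtain N :: nat where "norm x < real N" using reals_Archimedean2 by blast
    then show "rep_L2 g x = 0" using *[rule_format, of N] by simp
  qed
  then show ?thesis by (simp add: L2_eq_0_iff)
qed

text \<open>Regularity gives \<open>K \<subseteq> A \<subseteq> U\<close> with \<open>K\<close>
  compact and \<open>U\<close> open. For \<open>h\<close> so small that \<open>K\<close> stays in
  \<open>U\<close>, the indicators at \<open>x\<close> and \<open>x + h\<close> differ only if one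
  of the two points lies in \<open>A - K\<close> or in \<open>U - A\<close>: four sets of measure
  below \<epsilon>, hence the factor 4.\<close>

lemma translation_indicator_bound:
  fixes A :: "(real^'n) set" and e :: "'e::finite_dim_hilbert"
  assumes A: "bounded A" "A \<in> sets borel" and \<epsilon>: "\<epsilon> > 0"
  shows "\<exists>\<delta>>0. \<forall>h. norm h < \<delta> \<longrightarrow>
    (norm (translation h (abs_L2 (\<lambda>x. indicator A x *\<^sub>R e)) - abs_L2 (\<lambda>x. indicator A x *\<^sub>R e)))\<^sup>2
      \<le> 4 * \<epsilon> * (norm e)\<^sup>2"
proof -
  note [measurable] = A(2)
  obtain U where U: "open U" "A \<subseteq> U" "emeasure lborel (U - A) < ennreal \<epsilon>"
    using outer_regular_lborel[OF A(2) \<epsilon>] by blast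
  have "A \<in> sets lebesgue" using A(2) by simp
  then obtain K where K: "closed K" "K \<subseteq> A" "A - K \<in> lmeasurable" "emeasure lebesgue (A - K) < ennreal \<epsilon>"
    by (rule sets_lebesgue_inner_closed[OF _ \<epsilon>])
  have "bounded K" using bounded_subset[OF A(1) K(2)] .
  then have cK: "compact K" using K(1) by (simp add: compact_eq_bounded_closed)
  have "K \<subseteq> U" using U(2) K(2) by simp
  then obtain \<delta> where \<delta>: "\<delta> > 0" "(\<Union>x\<in>K. ball x \<delta>) \<subseteq> U"
    by (rule compact_subset_open_imp_ball_epsilon_subset[OF cK U(1)])
  have [measurable]: "U \<in> sets borel" "K \<in> sets borel" using U K by auto
  have eK: "emeasure lborel (A - K) < ennreal \<epsilon>"
    using K(4) by (simp add: emeasure_completion)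
  let ?f = "abs_L2 (\<lambda>x. indicator A x *\<^sub>R e)"
  have sq: "square_integrable (\<lambda>x. indicator A x *\<^sub>R e)" by (rule square_integrable_indicator[OF A])
  have "(norm (translation h ?f - ?f))\<^sup>2 \<le> 4 * \<epsilon> * (norm e)\<^sup>2" if h: "norm h < \<delta>" for h
  proof -
    have "ennreal ((norm (translation h ?f - ?f))\<^sup>2)
        = (\<integral>\<^sup>+x. ennreal ((norm (indicator A (x + h) *\<^sub>R e - indicator A x *\<^sub>R e))\<^sup>2) \<partial>lborel)"
      unfolding nn_integral_norm_L2[symmetric]
      by (rule nn_integral_cong_AE)
         (use rep_L2_diff[of "translation h ?f" ?f] rep_translation[of h ?f] rep_abs_L2[OF sq]
            AE_lborel_shift[OF rep_abs_L2[OF sq], of h] in eventually_elim, simp)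
    also have "\<dots> \<le> (\<integral>\<^sup>+x. ennreal ((norm e)\<^sup>2) * (indicator (A - K) x + indicator (A - K) (x + h)
        + indicator (U - A) x + indicator (U - A) (x + h)) \<partial>lborel)"
    proof (rule nn_integral_mono)
      fix x
      have "x + h \<in> U" if "x \<in> K" using \<delta>(2) that h by (force simp: dist_norm)
      moreover have "x \<in> U" if "x + h \<in> K"
      proof -
        have "x \<in> ball (x + h) \<delta>" using h by (simp add: dist_norm)
        then show ?thesis using \<delta>(2) that by blast
      qed
      ultimately show "ennreal ((norm (indicator A (x + h) *\<^sub>R e - indicator A x *\<^sub>R e))\<^sup>2)
          \<le> ennreal ((norm e)\<^sup>2) * (indicator (A - K) x + indicator (A - K) (x + h)
            + indicator (U - A) x + indicator (U - A) (x + h))"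
        by (cases "x \<in> A"; cases "x + h \<in> A") (auto simp: indicator_def distrib_left add_increasing2)
    qed
    also have "\<dots> = ennreal ((norm e)\<^sup>2) * (emeasure lborel (A - K) + emeasure lborel (A - K)
        + emeasure lborel (U - A) + emeasure lborel (U - A))"
      using nn_integral_lborel_shift[of "indicator (A - K)" h] nn_integral_lborel_shift[of "indicator (U - A)" h]
      by (simp add: nn_integral_cmult nn_integral_add)
    also have "\<dots> \<le> ennreal ((norm e)\<^sup>2) * (ennreal \<epsilon> + ennreal \<epsilon> + ennreal \<epsilon> + ennreal \<epsilon>)"
      using eK U(3) by (intro mult_left_mono add_mono) auto
    also have "\<dots> = ennreal (4 * \<epsilon> * (norm e)\<^sup>2)"
      using \<epsilon> by (simp add: ennreal_mult[symmetric] ennreal_plus[symmetric] algebra_simps del: ennreal_plus)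
    finally show ?thesis using \<epsilon> by (simp add: ennreal_le_iff)
  qed
  then show ?thesis using \<delta>(1) by blast
qed

text \<open>Translations are isometries, so the vectors with continuous translates form a closed
  subspace, and it contains the total family of indicators.\<close>

lemma tendsto_translation:
  fixes f :: "('n::finite, 'e::finite_dim_hilbert) L2"
  shows "((\<lambda>h. translation h f) \<longlongrightarrow> f) (at 0)"
proof -
  define T where "T = {f :: ('n, 'e) L2. ((\<lambda>h. translation h f) \<longlongrightarrow> f) (at 0)}"
  have "T = UNIV"
  proof (rule closed_subspace_eq_UNIV)
    show "subspace T"
      unfolding subspace_def T_def
      by (auto simp: translation_add translation_scaleR intro!: tendsto_intros)
    show "closed T"
      unfolding closed_sequential_limits
    proof safe
      fix F f assume F: "\<forall>n. F n \<in> T" and lim: "F \<longlonglongrightarrow> f"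
      show "f \<in> T"
        unfolding T_def mem_Collect_eq
      proof (rule tendstoI)
        fix e :: real assume e: "e > 0"
        then obtain n where n: "norm (F n - f) < e / 3"
          using LIMSEQ_D[OF lim, of "e/3"] by auto
        have "((\<lambda>h. translation h (F n)) \<longlongrightarrow> F n) (at 0)" using F by (simp add: T_def)
        then have "\<forall>\<^sub>F h in at 0. dist (translation h (F n)) (F n) < e / 3"
          using e by (intro tendstoD) auto
        then show "\<forall>\<^sub>F h in at 0. dist (translation h f) f < e"
        proof eventually_elim
          fix h assume h: "dist (translation h (F n)) (F n) < e / 3"
          have "translation h f - f = (translation h (F n) - F n) + (F n - f) - translation h (F n - f)"
            by (simp add: translation_diff)
          also have "norm \<dots> \<le> norm (translation h (F n) - F n) + norm (F n - f) + norm (translation h (F n - f))"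
            by (meson add_mono norm_triangle_ineq norm_triangle_ineq4 order_trans order_refl)
          also have "\<dots> < e" using h n by (simp add: dist_norm norm_translation)
          finally show "dist (translation h f) f < e" by (simp add: dist_norm)
        qed
      qed
    qed
    fix v :: "('n, 'e) L2" assume v: "\<And>g. g \<in> T \<Longrightarrow> inner g v = 0"
    show "v = 0"
    proof (rule L2_eq_0I, rule v)
      fix A :: "(real^'n) set" and e :: 'e assume A: "bounded A" "A \<in> sets borel"
      let ?f = "abs_L2 (\<lambda>x. indicator A x *\<^sub>R e)"
      show "?f \<in> T"
        unfolding T_def mem_Collect_eq
      proof (rule tendstoI)
        fix c :: real assume c: "c > 0"
        define \<epsilon> where "\<epsilon> = c\<^sup>2 / (4 * ((norm e)\<^sup>2 + 1))"
        have den: "(norm e)\<^sup>2 + 1 > 0" by (simp add: add_nonneg_pos)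
        then have "\<epsilon> > 0" using c by (simp add: \<epsilon>_def)
        then obtain \<delta> where \<delta>: "\<delta> > 0" "\<And>h. norm h < \<delta> \<Longrightarrow> (norm (translation h ?f - ?f))\<^sup>2 \<le> 4 * \<epsilon> * (norm e)\<^sup>2"
          using translation_indicator_bound[OF A, of \<epsilon> e] by blast
        have "4 * \<epsilon> * (norm e)\<^sup>2 < c\<^sup>2" using den c by (simp add: \<epsilon>_def field_simps)
        then have "norm (translation h ?f - ?f) < c" if "norm h < \<delta>" for h
          using \<delta>(2)[OF that] c by (intro power2_less_imp_less[of _ c]) auto
        then show "\<forall>\<^sub>F h in at 0. dist (translation h ?f) ?f < c"
          unfolding eventually_at using \<delta>(1) by (auto simp: dist_norm)
      qed
    qed
  qed
  then show ?thesis by (auto simp: T_def)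
qed

section \<open>Plancherel's theorem\<close>

lemma borel_measurable_scaleC [measurable (raw)]:
  fixes f :: "'a \<Rightarrow> 'b::{complex_inner, second_countable_topology}"
  assumes [measurable]: "c \<in> borel_measurable M" "f \<in> borel_measurable M"
  shows "(\<lambda>x. c x *\<^sub>C f x) \<in> borel_measurable M"
proof -
  have eq: "(\<lambda>x. c x *\<^sub>C f x) = (\<lambda>x. Re (c x) *\<^sub>R f x + Im (c x) *\<^sub>R (\<i> *\<^sub>C f x))"
    by (rule ext) (rule scaleC_conv_scaleR)
  have [measurable]: "(\<lambda>x. \<i> *\<^sub>C f x) \<in> borel_measurable M"
    by (rule borel_measurable_continuous_on[OF linear_continuous_on[OF bounded_linear_scaleC] assms(2)])
  show ?thesis unfolding eq by measurable
qed

lemma borel_measurable_cinner [measurable (raw)]: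
  fixes f g :: "'a \<Rightarrow> 'b::{complex_inner, second_countable_topology}"
  assumes [measurable]: "f \<in> borel_measurable M" "g \<in> borel_measurable M"
  shows "(\<lambda>x. cinner (f x) (g x)) \<in> borel_measurable M"
  unfolding cinner_eq Complex_eq by measurable

lemma borel_measurable_cis [measurable (raw)]:
  assumes [measurable]: "f \<in> borel_measurable M"
  shows "(\<lambda>x. cis (f x)) \<in> borel_measurable M"
  unfolding cis.ctr Complex_eq by measurable

lemma bounded_linear_cinner_right: "bounded_linear (\<lambda>y. cinner x (y :: 'a::complex_inner))"
proof (rule bounded_linear_intro[where K = "norm x"])
  show "cinner x (r *\<^sub>R y) = r *\<^sub>R cinner x y" for r y
    by (metis cinner_scaleC_right scaleC_of_real scaleR_conv_of_real)
qed (use cmod_cinner_le[of x] in \<open>simp_all add: cinner_add_right mult.commute\<close>)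

lemma bounded_linear_cinner_left: "bounded_linear (\<lambda>x. cinner x (y :: 'a::complex_inner))"
proof (rule bounded_linear_intro[where K = "norm y"])
  show "cinner (r *\<^sub>R x) y = r *\<^sub>R cinner x y" for r x
    by (metis cinner_scaleC_left scaleC_of_real scaleR_conv_of_real complex_cnj_complex_of_real)
qed (use cmod_cinner_le[of _ y] in \<open>simp_all add: cinner_add_left\<close>)

lemma integrable_scaleC_bounded:
  fixes f :: "'a \<Rightarrow> 'b::{complex_inner, banach, second_countable_topology}"
  assumes "integrable M f" "c \<in> borel_measurable M" "\<And>x. cmod (c x) \<le> 1"
  shows "integrable M (\<lambda>x. c x *\<^sub>C f x)"
proof (rule Bochner_Integration.integrable_bound[OF assms(1)])
  have "norm (c x *\<^sub>C f x) \<le> norm (f x)" for x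
    using mult_right_mono[OF assms(3)[of x], of "norm (f x)"] by (simp add: norm_scaleC)
  then show "AE x in M. norm (c x *\<^sub>C f x) \<le> norm (f x)" by simp
qed (use assms in measurable)

lemma integrable_cis_scaleC:
  fixes f :: "'a \<Rightarrow> 'b::{complex_inner, banach, second_countable_topology}"
  assumes "integrable M f" "t \<in> borel_measurable M"
  shows "integrable M (\<lambda>x. cis (t x) *\<^sub>C f x)"
  by (rule integrable_scaleC_bounded[OF assms(1)]) (use assms(2) in \<open>auto intro!: borel_measurable_cis\<close>)

text \<open>Fubini for products of functions of one coordinate each; it reduces Gaussians and bumps
  to dimension one.\<close>

lemma integrable_lborel_Basis_prod:
  fixes f :: "'a::euclidean_space \<Rightarrow> real \<Rightarrow> complex"
  assumes "\<And>b. b \<in> Basis \<Longrightarrow> integrable lborel (f b)"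
  shows "integrable lborel (\<lambda>x::'a. \<Prod>b\<in>Basis. f b (x \<bullet> b))"
    and "(\<integral>x. (\<Prod>b\<in>Basis. f b (x \<bullet> b)) \<partial>lborel) = (\<Prod>b\<in>Basis. integral\<^sup>L lborel (f b))"
proof -
  interpret product_sigma_finite "\<lambda>_::'a. lborel :: real measure" ..
  let ?g = "\<lambda>x::'a. \<Prod>b\<in>Basis. f b (x \<bullet> b)"
  have [measurable]: "f b \<in> borel_measurable borel" if "b \<in> Basis" for b
    using borel_measurable_integrable[OF assms[OF that]] by simp
  have m: "?g \<in> borel_measurable borel"
    by (intro borel_measurable_prod) measurable
  have eq: "(\<lambda>y. ?g (\<Sum>b\<in>Basis. y b *\<^sub>R b)) = (\<lambda>y. \<Prod>b\<in>Basis. f b (y b))"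
    by (intro ext prod.cong) simp_all
  have m': "(\<lambda>y. \<Sum>b\<in>Basis. y b *\<^sub>R b) \<in> measurable (Pi\<^sub>M Basis (\<lambda>_::'a. lborel :: real measure)) (borel :: 'a measure)"
    by measurable
  show "integrable lborel ?g"
    by (subst lborel_eq, subst integrable_distr_eq[OF m' m], subst eq)
       (rule product_integrable_prod, auto intro: assms)
  show "integral\<^sup>L lborel ?g = (\<Prod>b\<in>Basis. integral\<^sup>L lborel (f b))"
    by (subst (1) lborel_eq, subst integral_distr[OF m' m], subst eq)
       (rule product_integral_prod, auto intro: assms)
qed

section \<open>Gaussians and their Fourier integrals\<close>

definition gauss :: "'a::euclidean_space \<Rightarrow> real" where
  "gauss x = exp (- (norm x)\<^sup>2 / 2)"

lemma gauss_pos: "gauss x > 0"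
  and gauss_nonneg [simp]: "0 \<le> gauss x"
  and abs_gauss [simp]: "\<bar>gauss x\<bar> = gauss x"
  and gauss_le_1: "gauss x \<le> 1"
  and gauss_0 [simp]: "gauss 0 = 1"
  by (simp_all add: gauss_def)

lemma borel_measurable_gauss [measurable]: "gauss \<in> borel_measurable borel"
  unfolding gauss_def[abs_def] by measurable

lemma gauss_prod: "gauss x = (\<Prod>b\<in>Basis. exp (- (x \<bullet> b)\<^sup>2 / 2))"
proof -
  have "(norm x)\<^sup>2 = (\<Sum>b\<in>Basis. (x \<bullet> b)\<^sup>2)"
    unfolding power2_norm_eq_inner by (subst euclidean_inner) (simp add: power2_eq_square)
  then show ?thesis
    by (simp add: gauss_def exp_sum[symmetric] sum_negf sum_divide_distrib)
qed

lemma cis_sum: "finite I \<Longrightarrow> cis (\<Sum>i\<in>I. f i) = (\<Prod>i\<in>I. cis (f i))"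
  by (induction I rule: finite_induct) (simp_all add: cis_mult[symmetric])

text \<open>Up to the normalising factor \<open>sqrt (2 * pi)\<close> this is the characteristic
  function of the standard normal distribution.\<close>

lemma gauss_Fourier_real:
  fixes s :: real
  shows "integrable lborel (\<lambda>t. of_real (exp (- t\<^sup>2 / 2)) * cis (- (s * t)))"
    and "(\<integral>t. of_real (exp (- t\<^sup>2 / 2)) * cis (- (s * t)) \<partial>lborel) = of_real (sqrt (2 * pi) * exp (- s\<^sup>2 / 2))"
proof -
  have eq: "of_real (exp (- t\<^sup>2 / 2)) * cis (- (s * t))
      = of_real (sqrt (2 * pi)) * (std_normal_density t *\<^sub>R iexp (- s * t))" for t
    by (simp add: std_normal_density_def scaleR_conv_of_real cis_conv_exp field_simps)
  have int: "integrable lborel (\<lambda>t. std_normal_density t *\<^sub>R iexp (- s * t))"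
  proof (rule Bochner_Integration.integrable_bound[OF integrable_std_normal_moment[of 0]])
  qed (auto simp: norm_mult)
  then show "integrable lborel (\<lambda>t. of_real (exp (- t\<^sup>2 / 2)) * cis (- (s * t)))"
    unfolding eq by (rule integrable_mult_right)
  have "char std_normal_distribution (- s) = (\<integral>t. std_normal_density t *\<^sub>R iexp (- s * t) \<partial>lborel)"
    unfolding char_def by (subst integral_density) (auto simp: normal_density_nonneg)
  then have "(\<integral>t. std_normal_density t *\<^sub>R iexp (- s * t) \<partial>lborel) = of_real (exp (- s\<^sup>2 / 2))"
    by (simp add: char_std_normal_distribution)
  then show "(\<integral>t. of_real (exp (- t\<^sup>2 / 2)) * cis (- (s * t)) \<partial>lborel) = of_real (sqrt (2 * pi) * exp (- s\<^sup>2 / 2))"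
    unfolding eq by (subst integral_mult_right_zero) simp
qed

lemma gauss_Fourier:
  fixes y :: "'a::euclidean_space"
  shows "integrable lborel (\<lambda>x. of_real (gauss x) * cis (- (y \<bullet> x)))"
    and "(\<integral>x. of_real (gauss x) * cis (- (y \<bullet> x)) \<partial>lborel) = of_real (sqrt (2 * pi) ^ DIM('a) * gauss y)"
proof -
  have eq: "of_real (gauss x) * cis (- (y \<bullet> x))
      = (\<Prod>b\<in>Basis. of_real (exp (- (x \<bullet> b)\<^sup>2 / 2)) * cis (- ((y \<bullet> b) * (x \<bullet> b))))" for x
  proof -
    have "y \<bullet> x = (\<Sum>b\<in>Basis. (y \<bullet> b) * (x \<bullet> b))" by (rule euclidean_inner)
    then show ?thesis
      by (simp add: gauss_prod prod.distrib of_real_prod cis_sum[symmetric] sum_negf)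
  qed
  show "integrable lborel (\<lambda>x. of_real (gauss x) * cis (- (y \<bullet> x)))"
    unfolding eq by (rule integrable_lborel_Basis_prod(1)) (rule gauss_Fourier_real)
  show "(\<integral>x. of_real (gauss x) * cis (- (y \<bullet> x)) \<partial>lborel) = of_real (sqrt (2 * pi) ^ DIM('a) * gauss y)"
  proof -
    have "(\<integral>x. of_real (gauss x) * cis (- (y \<bullet> x)) \<partial>lborel)
        = (\<Prod>b\<in>Basis. \<integral>t. of_real (exp (- t\<^sup>2 / 2)) * cis (- ((y \<bullet> b) * t)) \<partial>lborel)"
      unfolding eq by (rule integrable_lborel_Basis_prod(2)) (rule gauss_Fourier_real(1))
    also have "\<dots> = of_real (\<Prod>b\<in>Basis. sqrt (2 * pi) * exp (- (y \<bullet> b)\<^sup>2 / 2))"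
      by (simp only: gauss_Fourier_real(2) of_real_prod)
    also have "\<dots> = of_real (sqrt (2 * pi) ^ DIM('a) * gauss y)"
      by (simp only: gauss_prod prod.distrib prod_constant)
    finally show ?thesis .
  qed
qed

lemma gauss_integral:
  shows "integrable lborel (gauss :: 'a::euclidean_space \<Rightarrow> real)"
    and "integral\<^sup>L lborel (\<lambda>x::'a. complex_of_real (gauss x)) = of_real (sqrt (2 * pi) ^ DIM('a))"
  using gauss_Fourier[of "0::'a"] by (simp_all add: complex_of_real_integrable_eq)

lemma integral_lborel_scale:
  fixes g :: "'a::euclidean_space \<Rightarrow> 'b::{banach, second_countable_topology}"
  assumes [measurable]: "g \<in> borel_measurable borel" and c: "c > 0"
  shows "(\<integral>x. g x \<partial>lborel) = c ^ DIM('a) *\<^sub>R (\<integral>x. g (c *\<^sub>R x) \<partial>lborel)"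
  by (subst lborel_affine[of c 0])
     (use c in \<open>simp_all add: integral_density integral_distr\<close>)

lemma integrable_lborel_scale:
  fixes g :: "'a::euclidean_space \<Rightarrow> 'b::{banach, second_countable_topology}"
  assumes "integrable lborel g" and c: "c > 0"
  shows "integrable lborel (\<lambda>x. g (c *\<^sub>R x))"
proof -
  have [measurable]: "g \<in> borel_measurable borel" using borel_measurable_integrable[OF assms(1)] by simp
  have "integrable (density (distr lborel borel (\<lambda>x. 0 + c *\<^sub>R x)) (\<lambda>_. \<bar>c\<bar>^DIM('a))) g"
    using assms(1) by (subst lborel_affine[of c 0, symmetric]) (use c in auto)
  then have "integrable lborel (\<lambda>x. c ^ DIM('a) *\<^sub>R g (c *\<^sub>R x))"
    using c by (simp add: integrable_density integrable_distr_eq)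
  then have "integrable lborel (\<lambda>x. inverse (c ^ DIM('a)) *\<^sub>R c ^ DIM('a) *\<^sub>R g (c *\<^sub>R x))"
    by (rule integrable_scaleR_right)
  then show ?thesis using c by simp
qed

section \<open>Autocorrelation and Plancherel's identity for integrable functions\<close>

lemma integrable_shift_product:
  fixes f :: "'a::euclidean_space \<Rightarrow> 'b::{complex_inner, banach, second_countable_topology}"
  assumes f: "integrable lborel f"
  shows "integrable (lborel \<Otimes>\<^sub>M lborel) (\<lambda>(x, z). cinner (f x) (f (x + z)))"
proof (rule integrableI_bounded)
  have [measurable]: "f \<in> borel_measurable borel" using borel_measurable_integrable[OF f] by simp
  show "(\<lambda>(x, z). cinner (f x) (f (x + z))) \<in> borel_measurable (lborel \<Otimes>\<^sub>M lborel)" by measurable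
  have m: "(\<lambda>(x, z). ennreal (norm (f x)) * ennreal (norm (f (x + z)))) \<in> borel_measurable (lborel \<Otimes>\<^sub>M lborel)"
    by measurable
  have fin: "(\<integral>\<^sup>+x. norm (f x) \<partial>lborel) < \<infinity>" using f by (simp add: integrable_iff_bounded)
  have "(\<integral>\<^sup>+p. norm (case p of (x, z) \<Rightarrow> cinner (f x) (f (x + z))) \<partial>(lborel \<Otimes>\<^sub>M lborel))
      \<le> (\<integral>\<^sup>+p. (case p of (x, z) \<Rightarrow> ennreal (norm (f x)) * ennreal (norm (f (x + z)))) \<partial>(lborel \<Otimes>\<^sub>M lborel))"
    by (intro nn_integral_mono) (auto simp: ennreal_mult[symmetric] intro!: ennreal_leI cmod_cinner_le)
  also have "\<dots> = (\<integral>\<^sup>+x. \<integral>\<^sup>+z. ennreal (norm (f x)) * ennreal (norm (f (x + z))) \<partial>lborel \<partial>lborel)"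
    using lborel.nn_integral_fst[OF m] by simp
  \<comment> \<open>Translation invariance frees the inner integral of \<open>x\<close>, and the
    total is the square of the L1 norm of \<open>f\<close>.\<close>
  also have "\<dots> = (\<integral>\<^sup>+x. ennreal (norm (f x)) * (\<integral>\<^sup>+z. norm (f z) \<partial>lborel) \<partial>lborel)"
  proof (rule nn_integral_cong)
    fix x
    have "(\<integral>\<^sup>+z. ennreal (norm (f (x + z))) \<partial>lborel) = (\<integral>\<^sup>+z. norm (f z) \<partial>lborel)"
      using nn_integral_lborel_shift[of "\<lambda>z. ennreal (norm (f z))" x] by (simp add: add.commute)
    then show "(\<integral>\<^sup>+z. ennreal (norm (f x)) * ennreal (norm (f (x + z))) \<partial>lborel)
        = ennreal (norm (f x)) * (\<integral>\<^sup>+z. norm (f z) \<partial>lborel)"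
      by (subst nn_integral_cmult) auto
  qed
  also have "\<dots> = (\<integral>\<^sup>+z. norm (f z) \<partial>lborel) * (\<integral>\<^sup>+z. norm (f z) \<partial>lborel)"
    by (subst nn_integral_multc) auto
  also have "\<dots> < \<infinity>" using fin by (simp add: ennreal_mult_less_top)
  finally show "(\<integral>\<^sup>+p. norm (case p of (x, z) \<Rightarrow> cinner (f x) (f (x + z))) \<partial>(lborel \<Otimes>\<^sub>M lborel)) < \<infinity>" .
qed

lemma borel_measurable_fourier_integral [measurable]:
  assumes [measurable]: "f \<in> borel_measurable borel"
  shows "fourier_integral f \<in> borel_measurable borel"
proof -
  have "(\<lambda>\<xi>. \<integral>x. cis (- (\<xi> \<bullet> x)) *\<^sub>C f x \<partial>lborel) \<in> borel_measurable borel"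
    by (rule lborel.borel_measurable_lebesgue_integral) measurable
  then show ?thesis unfolding fourier_integral_def[abs_def] by simp
qed

lemma norm_fourier_integral_le:
  "norm (fourier_integral f \<xi>) \<le> (2 * pi) powr (- real CARD('n) / 2) * (\<integral>x. norm (f x) \<partial>lborel)"
  for f :: "real^'n \<Rightarrow> 'e::finite_dim_hilbert"
proof -
  have "norm (\<integral>x. cis (- (\<xi> \<bullet> x)) *\<^sub>C f x \<partial>lborel) \<le> (\<integral>x. norm (cis (- (\<xi> \<bullet> x)) *\<^sub>C f x) \<partial>lborel)"
    by (rule integral_norm_bound)
  then show ?thesis
    by (auto simp: fourier_integral_def norm_scaleC intro!: mult_left_mono)
qed

text \<open>The autocorrelation \<open>z \<mapsto> \<integral>x. cinner (f x) (f (x + z))\<close> has Fourier transform proportional to the squared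
  norm of the Fourier transform of \<open>f\<close>.\<close>

lemma power2_norm_fourier_integral:
  fixes f :: "real^'n \<Rightarrow> 'e::finite_dim_hilbert"
  assumes f: "integrable lborel f"
  shows "of_real ((norm (fourier_integral f \<xi>))\<^sup>2) = of_real (((2 * pi) powr (- real CARD('n) / 2))\<^sup>2) *
    (\<integral>z. cis (- (\<xi> \<bullet> z)) * (\<integral>x. cinner (f x) (f (x + z)) \<partial>lborel) \<partial>lborel)"
proof -
  have [measurable]: "f \<in> borel_measurable borel" using borel_measurable_integrable[OF f] by simp
  let ?I = "\<integral>x. cis (- (\<xi> \<bullet> x)) *\<^sub>C f x \<partial>lborel"
  have int: "integrable lborel (\<lambda>x. cis (- (\<xi> \<bullet> x)) *\<^sub>C f x)"
    by (rule integrable_cis_scaleC[OF f]) simp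
  have cc: "cinner (cis (- (\<xi> \<bullet> x)) *\<^sub>C f x) (cis (- (\<xi> \<bullet> (x + z))) *\<^sub>C f (x + z))
      = cis (- (\<xi> \<bullet> z)) * cinner (f x) (f (x + z))" for x z
    by (simp add: cinner_scaleC_left cinner_scaleC_right cis_cnj cis_mult inner_add_right mult.assoc[symmetric])
  \<comment> \<open>The shift of variables produces \<open>z + x\<close>, where \<open>cc\<close>
    has \<open>x + z\<close>.\<close>
  have cc': "cinner (cis (- (\<xi> \<bullet> x)) *\<^sub>C f x) (cis (- (\<xi> \<bullet> (z + x))) *\<^sub>C f (z + x))
      = cis (- (\<xi> \<bullet> z)) * cinner (f x) (f (x + z))" for x z
    using cc[of x z] by (simp only: add.commute)
  have prod: "integrable (lborel \<Otimes>\<^sub>M lborel) (\<lambda>(x, z). cis (- (\<xi> \<bullet> z)) * cinner (f x) (f (x + z)))"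
    by (rule Bochner_Integration.integrable_bound[OF integrable_shift_product[OF f]])
       (measurable, auto simp: norm_mult)
  have "cinner ?I ?I = (\<integral>x. cinner (cis (- (\<xi> \<bullet> x)) *\<^sub>C f x) ?I \<partial>lborel)"
    by (rule integral_bounded_linear[OF bounded_linear_cinner_left int, symmetric])
  also have "\<dots> = (\<integral>x. \<integral>z. cis (- (\<xi> \<bullet> z)) * cinner (f x) (f (x + z)) \<partial>lborel \<partial>lborel)"
  proof (rule Bochner_Integration.integral_cong[OF refl])
    fix x
    let ?h = "\<lambda>y. cinner (cis (- (\<xi> \<bullet> x)) *\<^sub>C f x) (cis (- (\<xi> \<bullet> y)) *\<^sub>C f y)"
    have "cinner (cis (- (\<xi> \<bullet> x)) *\<^sub>C f x) ?I = (\<integral>y. ?h y \<partial>lborel)"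
      by (rule integral_bounded_linear[OF bounded_linear_cinner_right int, symmetric])
    also have "\<dots> = (\<integral>z. ?h (z + x) \<partial>lborel)"
      by (rule integral_lborel_shift[symmetric]) measurable
    finally show "cinner (cis (- (\<xi> \<bullet> x)) *\<^sub>C f x) ?I = (\<integral>z. cis (- (\<xi> \<bullet> z)) * cinner (f x) (f (x + z)) \<partial>lborel)"
      by (simp only: cc')
  qed
  also have "\<dots> = (\<integral>z. \<integral>x. cis (- (\<xi> \<bullet> z)) * cinner (f x) (f (x + z)) \<partial>lborel \<partial>lborel)"
    by (rule lborel_pair.Fubini_integral[OF prod, symmetric])
  also have "\<dots> = (\<integral>z. cis (- (\<xi> \<bullet> z)) * (\<integral>x. cinner (f x) (f (x + z)) \<partial>lborel) \<partial>lborel)"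
    by simp
  finally have "cinner ?I ?I = (\<integral>z. cis (- (\<xi> \<bullet> z)) * (\<integral>x. cinner (f x) (f (x + z)) \<partial>lborel) \<partial>lborel)" .
  then show ?thesis
    by (simp add: fourier_integral_def power_mult_distrib cinner_self)
qed

text \<open>The Gaussian makes the double integral over \<xi> and z absolutely convergent, so Fubini
  lets the Fourier integral act on the Gaussian instead of on the autocorrelation.\<close>

lemma gauss_weighted_fourier_integral:
  fixes f :: "real^'n \<Rightarrow> 'e::finite_dim_hilbert"
  assumes f: "integrable lborel f" and \<epsilon>: "\<epsilon> > 0"
  shows "integrable lborel (\<lambda>\<xi>. gauss (\<epsilon> *\<^sub>R \<xi>) * (norm (fourier_integral f \<xi>))\<^sup>2)"
    and "of_real (\<integral>\<xi>. gauss (\<epsilon> *\<^sub>R \<xi>) * (norm (fourier_integral f \<xi>))\<^sup>2 \<partial>lborel)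
      = of_real ((2 * pi) powr (- real CARD('n)) * sqrt (2 * pi) ^ CARD('n)) *
        (\<integral>y. of_real (gauss y) * (\<integral>x. cinner (f x) (f (x + \<epsilon> *\<^sub>R y)) \<partial>lborel) \<partial>lborel)"
proof -
  have [measurable]: "f \<in> borel_measurable borel" using borel_measurable_integrable[OF f] by simp
  define c where "c = (2 * pi) powr (- real CARD('n) / 2)"
  have c2: "c\<^sup>2 = (2 * pi) powr (- real CARD('n))"
    by (simp add: c_def power2_eq_square powr_add[symmetric])
  define A where "A z = (\<integral>x. cinner (f x) (f (x + z)) \<partial>lborel)" for z
  have [measurable]: "A \<in> borel_measurable borel"
    unfolding A_def[abs_def] by (rule lborel.borel_measurable_lebesgue_integral) measurable
  have A: "integrable lborel A"
    unfolding A_def[abs_def] using lborel_pair.integrable_snd[OF integrable_shift_product[OF f]] by simp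
  have gint: "integrable lborel (\<lambda>\<xi>::real^'n. gauss (\<epsilon> *\<^sub>R \<xi>))"
    by (rule integrable_lborel_scale[OF gauss_integral(1) \<epsilon>])
  show i1: "integrable lborel (\<lambda>\<xi>. gauss (\<epsilon> *\<^sub>R \<xi>) * (norm (fourier_integral f \<xi>))\<^sup>2)"
  proof (rule Bochner_Integration.integrable_bound)
    let ?C = "(c * (\<integral>x. norm (f x) \<partial>lborel))\<^sup>2"
    show "integrable lborel (\<lambda>\<xi>::real^'n. gauss (\<epsilon> *\<^sub>R \<xi>) * ?C)" using gint by simp
    show "AE \<xi> in lborel. norm (gauss (\<epsilon> *\<^sub>R \<xi>) * (norm (fourier_integral f \<xi>))\<^sup>2) \<le> norm (gauss (\<epsilon> *\<^sub>R \<xi>) * ?C)"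
      using norm_fourier_integral_le[of f] gauss_pos
      by (auto simp: c_def abs_mult less_imp_le intro!: mult_left_mono power_mono)
  qed measurable
  let ?g = "\<lambda>\<xi>::real^'n. gauss (\<epsilon> *\<^sub>R \<xi>)"
  have prod: "integrable (lborel \<Otimes>\<^sub>M lborel) (\<lambda>(\<xi>, z). of_real (?g \<xi>) * (cis (- (\<xi> \<bullet> z)) * A z))"
  proof (rule integrableI_bounded)
    have m: "(\<lambda>(\<xi>, z). ennreal (?g \<xi>) * ennreal (norm (A z))) \<in> borel_measurable (lborel \<Otimes>\<^sub>M lborel)"
      by measurable
    have "(\<integral>\<^sup>+p. norm (case p of (\<xi>, z) \<Rightarrow> of_real (?g \<xi>) * (cis (- (\<xi> \<bullet> z)) * A z)) \<partial>(lborel \<Otimes>\<^sub>M lborel))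
        = (\<integral>\<^sup>+p. (case p of (\<xi>, z) \<Rightarrow> ennreal (?g \<xi>) * ennreal (norm (A z))) \<partial>(lborel \<Otimes>\<^sub>M lborel))"
      using gauss_pos by (intro nn_integral_cong) (auto simp: ennreal_mult[symmetric] norm_mult less_imp_le)
    also have "\<dots> = (\<integral>\<^sup>+\<xi>. \<integral>\<^sup>+z. ennreal (?g \<xi>) * ennreal (norm (A z)) \<partial>lborel \<partial>lborel)"
      using lborel.nn_integral_fst[OF m] by simp
    also have "\<dots> = (\<integral>\<^sup>+\<xi>. ennreal (?g \<xi>) \<partial>lborel) * (\<integral>\<^sup>+z. norm (A z) \<partial>lborel)"
      by (simp add: nn_integral_cmult nn_integral_multc)
    also have "\<dots> < \<infinity>"
      using gint A gauss_pos by (simp add: integrable_iff_bounded ennreal_mult_less_top less_imp_le)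
    finally show "(\<integral>\<^sup>+p. norm (case p of (\<xi>, z) \<Rightarrow> of_real (?g \<xi>) * (cis (- (\<xi> \<bullet> z)) * A z)) \<partial>(lborel \<Otimes>\<^sub>M lborel)) < \<infinity>" .
  qed measurable
  \<comment> \<open>Rescaling \<xi> by \<epsilon> reduces to the unit Gaussian; the Jacobian leaves
    the power of \<open>inverse \<epsilon>\<close>.\<close>
  have inner: "(\<integral>\<xi>. of_real (?g \<xi>) * cis (- (\<xi> \<bullet> z)) \<partial>lborel)
      = of_real (inverse \<epsilon> ^ CARD('n) * (sqrt (2 * pi) ^ CARD('n) * gauss (inverse \<epsilon> *\<^sub>R z)))" for z
  proof -
    have "(\<integral>\<xi>. of_real (?g \<xi>) * cis (- (\<xi> \<bullet> z)) \<partial>lborel)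
        = inverse \<epsilon> ^ DIM(real^'n) *\<^sub>R (\<integral>\<xi>. of_real (?g (inverse \<epsilon> *\<^sub>R \<xi>)) * cis (- ((inverse \<epsilon> *\<^sub>R \<xi>) \<bullet> z)) \<partial>lborel)"
      by (rule integral_lborel_scale) (use \<epsilon> in auto)
    also have "(\<integral>\<xi>. of_real (?g (inverse \<epsilon> *\<^sub>R \<xi>)) * cis (- ((inverse \<epsilon> *\<^sub>R \<xi>) \<bullet> z)) \<partial>lborel)
        = (\<integral>\<xi>. of_real (gauss \<xi>) * cis (- ((inverse \<epsilon> *\<^sub>R z) \<bullet> \<xi>)) \<partial>lborel)"
      using \<epsilon> by (simp add: inner_commute)
    also have "\<dots> = of_real (sqrt (2 * pi) ^ DIM(real^'n) * gauss (inverse \<epsilon> *\<^sub>R z))"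
      by (rule gauss_Fourier)
    finally show ?thesis by (simp add: scaleR_conv_of_real)
  qed
  have "of_real (\<integral>\<xi>. ?g \<xi> * (norm (fourier_integral f \<xi>))\<^sup>2 \<partial>lborel)
      = (\<integral>\<xi>. complex_of_real (?g \<xi> * (norm (fourier_integral f \<xi>))\<^sup>2) \<partial>lborel)"
    by (rule integral_complex_of_real[symmetric])
  also have "\<dots> = (\<integral>\<xi>. of_real (c\<^sup>2) * (\<integral>z. of_real (?g \<xi>) * (cis (- (\<xi> \<bullet> z)) * A z) \<partial>lborel) \<partial>lborel)"
  proof (rule Bochner_Integration.integral_cong[OF refl])
    fix \<xi>
    show "complex_of_real (?g \<xi> * (norm (fourier_integral f \<xi>))\<^sup>2)
        = of_real (c\<^sup>2) * (\<integral>z. of_real (?g \<xi>) * (cis (- (\<xi> \<bullet> z)) * A z) \<partial>lborel)"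
      unfolding of_real_mult[of "?g \<xi>"] power2_norm_fourier_integral[OF f] A_def c_def
      by simp
  qed
  also have "\<dots> = of_real (c\<^sup>2) * (\<integral>\<xi>. \<integral>z. of_real (?g \<xi>) * (cis (- (\<xi> \<bullet> z)) * A z) \<partial>lborel \<partial>lborel)"
    by simp
  also have "(\<integral>\<xi>. \<integral>z. of_real (?g \<xi>) * (cis (- (\<xi> \<bullet> z)) * A z) \<partial>lborel \<partial>lborel)
      = (\<integral>z. \<integral>\<xi>. of_real (?g \<xi>) * (cis (- (\<xi> \<bullet> z)) * A z) \<partial>lborel \<partial>lborel)"
    by (rule lborel_pair.Fubini_integral[OF prod, symmetric])
  also have "\<dots> = (\<integral>z. of_real (inverse \<epsilon> ^ CARD('n) * (sqrt (2 * pi) ^ CARD('n) * gauss (inverse \<epsilon> *\<^sub>R z))) * A z \<partial>lborel)"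
  proof (rule Bochner_Integration.integral_cong[OF refl])
    fix z
    have "(\<integral>\<xi>. of_real (?g \<xi>) * (cis (- (\<xi> \<bullet> z)) * A z) \<partial>lborel)
        = (\<integral>\<xi>. of_real (?g \<xi>) * cis (- (\<xi> \<bullet> z)) \<partial>lborel) * A z"
      by (simp only: mult.assoc[symmetric] integral_mult_left_zero)
    then show "(\<integral>\<xi>. of_real (?g \<xi>) * (cis (- (\<xi> \<bullet> z)) * A z) \<partial>lborel)
        = of_real (inverse \<epsilon> ^ CARD('n) * (sqrt (2 * pi) ^ CARD('n) * gauss (inverse \<epsilon> *\<^sub>R z))) * A z"
      by (simp only: inner)
  qed
  \<comment> \<open>The substitution z = \<epsilon> y: its Jacobian cancels the power of
    \<open>inverse \<epsilon>\<close>, and only the translation by \<epsilon> y still depends on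
    \<epsilon>.\<close>
  also have "\<dots> = \<epsilon> ^ DIM(real^'n) *\<^sub>R (\<integral>y. of_real (inverse \<epsilon> ^ CARD('n) * (sqrt (2 * pi) ^ CARD('n) *
      gauss (inverse \<epsilon> *\<^sub>R (\<epsilon> *\<^sub>R y)))) * A (\<epsilon> *\<^sub>R y) \<partial>lborel)"
    by (rule integral_lborel_scale) (use \<epsilon> in auto)
  also have "\<dots> = \<epsilon> ^ DIM(real^'n) *\<^sub>R (\<integral>y. of_real (inverse \<epsilon> ^ CARD('n) * sqrt (2 * pi) ^ CARD('n)) *
      (of_real (gauss y) * A (\<epsilon> *\<^sub>R y)) \<partial>lborel)"
    using \<epsilon> by (simp add: mult.assoc)
  also have "\<dots> = of_real (sqrt (2 * pi) ^ CARD('n)) * (\<integral>y. of_real (gauss y) * A (\<epsilon> *\<^sub>R y) \<partial>lborel)"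
    unfolding integral_mult_right_zero using \<epsilon>
    by (simp add: scaleR_conv_of_real power_inverse[symmetric] field_simps)
  finally show "of_real (\<integral>\<xi>. ?g \<xi> * (norm (fourier_integral f \<xi>))\<^sup>2 \<partial>lborel)
      = of_real ((2 * pi) powr (- real CARD('n)) * sqrt (2 * pi) ^ CARD('n)) *
        (\<integral>y. of_real (gauss y) * (\<integral>x. cinner (f x) (f (x + \<epsilon> *\<^sub>R y)) \<partial>lborel) \<partial>lborel)"
    by (simp add: c2 A_def mult.assoc)
qed

lemma autocorrelation_eq_cinner:
  "(\<integral>x. cinner (rep_L2 f x) (rep_L2 f (x + h)) \<partial>lborel) = cinner f (translation h f)"
  unfolding cinner_L2_eq
proof (rule integral_cong_AE)
  show "AE x in lborel. cinner (rep_L2 f x) (rep_L2 f (x + h)) = cinner (rep_L2 f x) (rep_L2 (translation h f) x)"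
    using rep_translation[of h f] by eventually_elim simp
qed measurable

text \<open>The damping is removed along \<epsilon> tending to 0, by monotone convergence on the
  frequency side and by dominated convergence with continuity of translations on the other. The
  identity between extended values contains the square integrability of the Fourier
  integral.\<close>

lemma Plancherel:
  fixes f :: "('n::finite, 'e::finite_dim_hilbert) L2"
  assumes int: "integrable lborel (rep_L2 f)"
  shows "(\<integral>\<^sup>+\<xi>. ennreal ((norm (fourier_integral (rep_L2 f) \<xi>))\<^sup>2) \<partial>lborel) = ennreal ((norm f)\<^sup>2)"
proof -
  define F where "F = (\<lambda>\<xi>. (norm (fourier_integral (rep_L2 f) \<xi>))\<^sup>2)"
  define \<epsilon> where "\<epsilon> j = inverse (real (Suc j))" for j
  have \<epsilon>: "\<epsilon> j > 0" for j by (simp add: \<epsilon>_def)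
  have \<epsilon>0: "\<epsilon> \<longlonglongrightarrow> 0" unfolding \<epsilon>_def by (rule LIMSEQ_inverse_real_of_nat)
  have [measurable]: "F \<in> borel_measurable borel" unfolding F_def by measurable
  define J where "J j = (\<integral>\<xi>. gauss (\<epsilon> j *\<^sub>R \<xi>) * F \<xi> \<partial>lborel)" for j
  let ?K = "(2 * pi) powr (- real CARD('n)) * sqrt (2 * pi) ^ CARD('n)"
  have J: "complex_of_real (J j)
      = of_real ?K * (\<integral>y. of_real (gauss y) * cinner f (translation (\<epsilon> j *\<^sub>R y) f) \<partial>lborel)" for j
    unfolding J_def F_def gauss_weighted_fourier_integral(2)[OF int \<epsilon>] autocorrelation_eq_cinner ..
  \<comment> \<open>The two factors \<open>sqrt (2 * pi) ^ CARD('n)\<close>, one from transforming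
    the Gaussian and one from its total integral, cancel the squared normalisation of
    \<open>fourier_integral\<close>.\<close>
  have K1: "?K * sqrt (2 * pi) ^ CARD('n) = 1"
  proof -
    have "sqrt (2 * pi) ^ CARD('n) * sqrt (2 * pi) ^ CARD('n) = (2 * pi) ^ CARD('n)"
      unfolding power_mult_distrib[symmetric] by simp
    moreover have "(2 * pi) powr (- real CARD('n)) = inverse ((2 * pi) ^ CARD('n))"
      by (simp only: powr_minus, subst powr_realpow) simp_all
    ultimately show ?thesis by (simp only: mult.assoc) (rule left_inverse, simp)
  qed
  have meas: "(\<lambda>y. cinner f (translation (c *\<^sub>R y) f)) \<in> borel_measurable lborel" for c
    unfolding autocorrelation_eq_cinner[symmetric]
    by (rule lborel.borel_measurable_lebesgue_integral) measurable
  have "(\<lambda>j. \<integral>y. of_real (gauss y) * cinner f (translation (\<epsilon> j *\<^sub>R y) f) \<partial>lborel)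
      \<longlonglongrightarrow> (\<integral>y. of_real (gauss y) * cinner f f \<partial>(lborel :: (real^'n) measure))"
  proof (rule integral_dominated_convergence)
    show "integrable lborel (\<lambda>y::real^'n. gauss y * (norm f)\<^sup>2)"
      by (intro integrable_mult_left gauss_integral)
    show "AE y in lborel. (\<lambda>j. of_real (gauss y) * cinner f (translation (\<epsilon> j *\<^sub>R y) f))
        \<longlonglongrightarrow> of_real (gauss y) * cinner f f"
    proof (rule AE_I2)
      fix y :: "real^'n"
      have tr: "isCont (\<lambda>h. translation h f) 0"
      proof -
        have "translation 0 f = f" by transfer (simp add: L2_rel_def)
        then show ?thesis using tendsto_translation[of f] by (simp add: isCont_def)
      qed
      have "(\<lambda>j. \<epsilon> j *\<^sub>R y) \<longlonglongrightarrow> 0 *\<^sub>R y" by (intro tendsto_intros \<epsilon>0)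
      then have "(\<lambda>j. translation (\<epsilon> j *\<^sub>R y) f) \<longlonglongrightarrow> translation 0 f"
        using isCont_tendsto_compose[OF tr] by simp
      moreover have "translation 0 f = f" by transfer (simp add: L2_rel_def)
      ultimately show "(\<lambda>j. of_real (gauss y) * cinner f (translation (\<epsilon> j *\<^sub>R y) f))
        \<longlonglongrightarrow> of_real (gauss y) * cinner f f"
        by (intro tendsto_intros) simp
    qed
    show "AE y in lborel. cmod (of_real (gauss y) * cinner f (translation (\<epsilon> j *\<^sub>R y) f)) \<le> gauss y * (norm f)\<^sup>2" for j
    proof (rule AE_I2)
      fix y :: "real^'n"
      have "cmod (cinner f (translation (\<epsilon> j *\<^sub>R y) f)) \<le> (norm f)\<^sup>2"
        using cmod_cinner_le[of f "translation (\<epsilon> j *\<^sub>R y) f"] by (simp add: norm_translation power2_eq_square)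
      then show "cmod (of_real (gauss y) * cinner f (translation (\<epsilon> j *\<^sub>R y) f)) \<le> gauss y * (norm f)\<^sup>2"
        by (simp add: norm_mult mult_left_mono)
    qed
    show "(\<lambda>y. of_real (gauss y) * cinner f (translation (\<epsilon> j *\<^sub>R y) f)) \<in> borel_measurable lborel" for j
      by (rule borel_measurable_times[OF _ meas]) measurable
  qed measurable
  then have "(\<lambda>j. complex_of_real (J j)) \<longlonglongrightarrow> of_real ?K * (\<integral>y. of_real (gauss y) * cinner f f \<partial>(lborel :: (real^'n) measure))"
    unfolding J by (intro tendsto_intros)
  also have "(\<integral>y. of_real (gauss y) * cinner f f \<partial>(lborel :: (real^'n) measure)) = of_real (sqrt (2 * pi) ^ CARD('n) * (norm f)\<^sup>2)"
    using gauss_integral(2)[where 'a="real^'n"] by (simp add: cinner_self)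
  also have "of_real ?K * \<dots> = complex_of_real ((norm f)\<^sup>2)"
    unfolding of_real_mult[symmetric] mult.assoc[symmetric] K1 by simp
  finally have lim1: "J \<longlonglongrightarrow> (norm f)\<^sup>2" by (simp only: tendsto_of_real_iff)
  have JJ: "(\<integral>\<^sup>+\<xi>. ennreal (gauss (\<epsilon> j *\<^sub>R \<xi>) * F \<xi>) \<partial>lborel) = ennreal (J j)" for j
    unfolding J_def
    by (rule nn_integral_eq_integral)
       (use gauss_weighted_fourier_integral(1)[OF int \<epsilon>] in \<open>simp_all add: F_def\<close>)
  have "(\<lambda>j. \<integral>\<^sup>+\<xi>. ennreal (gauss (\<epsilon> j *\<^sub>R \<xi>) * F \<xi>) \<partial>lborel) \<longlonglongrightarrow> (\<integral>\<^sup>+\<xi>. ennreal (F \<xi>) \<partial>lborel)"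
  proof (rule nn_integral_LIMSEQ)
    \<comment> \<open>As \<epsilon> decreases the Gaussians increase to 1, so no integrability of
      \<open>F\<close> has to be known in advance.\<close>
    show "incseq (\<lambda>j \<xi>. ennreal (gauss (\<epsilon> j *\<^sub>R \<xi>) * F \<xi>))"
    proof (intro incseq_SucI le_funI ennreal_leI mult_right_mono)
      fix j and \<xi> :: "real^'n"
      have "\<epsilon> (Suc j) \<le> \<epsilon> j" by (simp add: \<epsilon>_def le_imp_inverse_le)
      then have "norm (\<epsilon> (Suc j) *\<^sub>R \<xi>) \<le> norm (\<epsilon> j *\<^sub>R \<xi>)"
        using \<epsilon>[of j] \<epsilon>[of "Suc j"] by (simp add: mult_right_mono)
      then have "(norm (\<epsilon> (Suc j) *\<^sub>R \<xi>))\<^sup>2 \<le> (norm (\<epsilon> j *\<^sub>R \<xi>))\<^sup>2"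
        by (rule power_mono) simp
      then show "gauss (\<epsilon> j *\<^sub>R \<xi>) \<le> gauss (\<epsilon> (Suc j) *\<^sub>R \<xi>)" by (simp add: gauss_def)
    qed (simp add: F_def)
    fix \<xi> :: "real^'n"
    have "(\<lambda>j. ennreal (gauss (\<epsilon> j *\<^sub>R \<xi>) * F \<xi>)) \<longlonglongrightarrow> ennreal (exp (- (norm (0 *\<^sub>R \<xi>))\<^sup>2 / 2) * F \<xi>)"
      unfolding gauss_def by (intro tendsto_ennrealI tendsto_intros \<epsilon>0) simp
    then show "(\<lambda>j. ennreal (gauss (\<epsilon> j *\<^sub>R \<xi>) * F \<xi>)) \<longlonglongrightarrow> ennreal (F \<xi>)" by simp
  qed measurable
  moreover have "(\<lambda>j. ennreal (J j)) \<longlonglongrightarrow> ennreal ((norm f)\<^sup>2)" by (intro tendsto_ennrealI lim1)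
  ultimately have "(\<integral>\<^sup>+\<xi>. ennreal (F \<xi>) \<partial>lborel) = ennreal ((norm f)\<^sup>2)"
    unfolding JJ by (rule LIMSEQ_unique)
  then show ?thesis by (simp add: F_def)
qed

lemma square_integrable_fourier_integral:
  assumes "integrable lborel (rep_L2 f)"
  shows "square_integrable (fourier_integral (rep_L2 f))"
  by (rule square_integrableI) (simp_all add: Plancherel[OF assms])

lemma fourier_integral_cong_AE:
  assumes "AE x in lborel. f x = g x" and [measurable]: "f \<in> borel_measurable borel" "g \<in> borel_measurable borel"
  shows "fourier_integral f = fourier_integral g"
proof
  fix \<xi>
  have "(\<integral>x. cis (- (\<xi> \<bullet> x)) *\<^sub>C f x \<partial>lborel) = (\<integral>x. cis (- (\<xi> \<bullet> x)) *\<^sub>C g x \<partial>lborel)"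
    by (rule integral_cong_AE) (measurable, use assms(1) in eventually_elim, simp)
  then show "fourier_integral f \<xi> = fourier_integral g \<xi>" by (simp add: fourier_integral_def)
qed

lemma integrable_rep_abs_L2:
  assumes "square_integrable f" "integrable lborel f"
  shows "integrable lborel (rep_L2 (abs_L2 f))"
proof -
  have [measurable]: "f \<in> borel_measurable borel" using square_integrable_measurable[OF assms(1)] by simp
  show ?thesis
    by (rule integrable_cong_AE_imp[OF assms(2)]) (measurable, use rep_abs_L2[OF assms(1)] in eventually_elim, simp)
qed

section \<open>The Fourier transform as the closure of an isometric graph\<close>

lemma fourier_graphI:
  fixes f :: "('n::finite, 'e::finite_dim_hilbert) L2"
  shows "integrable lborel (rep_L2 f) \<Longrightarrow> (f, abs_L2 (fourier_integral (rep_L2 f))) \<in> fourier_graph"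
  using rep_abs_L2[OF square_integrable_fourier_integral] by (auto simp: fourier_graph_def)

lemma fourier_graph_eq:
  assumes "(f, g) \<in> fourier_graph"
  shows "g = abs_L2 (fourier_integral (rep_L2 f))" "integrable lborel (rep_L2 f)"
    "AE \<xi> in lborel. rep_L2 g \<xi> = fourier_integral (rep_L2 f) \<xi>"
proof -
  show int: "integrable lborel (rep_L2 f)" and ae: "AE \<xi> in lborel. rep_L2 g \<xi> = fourier_integral (rep_L2 f) \<xi>"
    using assms by (auto simp: fourier_graph_def)
  show "g = abs_L2 (fourier_integral (rep_L2 f))"
    by (rule L2_eqI) (use ae rep_abs_L2[OF square_integrable_fourier_integral[OF int]] in eventually_elim, simp)
qed

lemma fourier_graph_isometric:
  assumes "(f, g) \<in> fourier_graph"
  shows "norm g = norm f"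
proof -
  note * = fourier_graph_eq[OF assms]
  have "ennreal ((norm g)\<^sup>2) = ennreal ((norm f)\<^sup>2)"
    unfolding *(1) nn_integral_abs_L2[OF square_integrable_fourier_integral[OF *(2)]] by (rule Plancherel[OF *(2)])
  then show ?thesis by (simp add: ennreal_inj power2_eq_iff_nonneg)
qed

lemma fourier_integral_add:
  assumes "integrable lborel f" "integrable lborel g"
  shows "fourier_integral (\<lambda>x. f x + g x) \<xi> = fourier_integral f \<xi> + fourier_integral g \<xi>"
proof -
  have [measurable]: "f \<in> borel_measurable borel" "g \<in> borel_measurable borel"
    using assms borel_measurable_integrable by force+
  show ?thesis
    using integrable_cis_scaleC[OF assms(1), of "\<lambda>x. - (\<xi> \<bullet> x)"] integrable_cis_scaleC[OF assms(2), of "\<lambda>x. - (\<xi> \<bullet> x)"]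
    by (simp add: fourier_integral_def scaleC_add_right scaleR_add_right)
qed

lemma fourier_integral_scaleR:
  "fourier_integral (\<lambda>x. c *\<^sub>R f x) \<xi> = c *\<^sub>R fourier_integral f \<xi>"
  by (simp add: fourier_integral_def scaleC_scaleR mult.commute)

lemma subspace_fourier_graph: "subspace (fourier_graph :: (('n::finite, 'e::finite_dim_hilbert) L2 \<times> ('n, 'e) L2) set)"
  unfolding subspace_def
proof (intro conjI ballI allI)
  have z: "AE x in lborel. rep_L2 (0 :: ('n, 'e) L2) x = (\<lambda>_. 0) x" using rep_L2_zero by simp
  have "integrable lborel (rep_L2 (0 :: ('n, 'e) L2))"
    by (rule integrable_cong_AE_imp[of _ "\<lambda>_. 0"]) (use z in simp_all)
  moreover have "fourier_integral (rep_L2 (0 :: ('n, 'e) L2)) = (\<lambda>\<xi>. 0)"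
    by (subst fourier_integral_cong_AE[OF z]) (auto simp: fourier_integral_def)
  ultimately show "(0 :: ('n, 'e) L2 \<times> ('n, 'e) L2) \<in> fourier_graph"
    using z by (simp add: fourier_graph_def zero_prod_def)
next
  fix p q :: "('n, 'e) L2 \<times> ('n, 'e) L2" assume "p \<in> fourier_graph" "q \<in> fourier_graph"
  then obtain f g f' g' where p: "p = (f, g)" "(f, g) \<in> fourier_graph" and q: "q = (f', g')" "(f', g') \<in> fourier_graph"
    by (metis surj_pair)
  note P = fourier_graph_eq(2,3)[OF p(2)] and Q = fourier_graph_eq(2,3)[OF q(2)]
  have int: "integrable lborel (rep_L2 (f + f'))"
    by (rule integrable_cong_AE_imp[OF Bochner_Integration.integrable_add[OF P(1) Q(1)]])
       (measurable, use rep_L2_add[of f f'] in eventually_elim, simp)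
  have eq: "fourier_integral (rep_L2 (f + f')) = fourier_integral (\<lambda>x. rep_L2 f x + rep_L2 f' x)"
    by (rule fourier_integral_cong_AE[OF rep_L2_add]) measurable
  have "AE \<xi> in lborel. rep_L2 (g + g') \<xi> = fourier_integral (rep_L2 (f + f')) \<xi>"
    using rep_L2_add[of g g'] P(2) Q(2) by eventually_elim (simp add: eq fourier_integral_add[OF P(1) Q(1)])
  then show "p + q \<in> fourier_graph" using int by (simp add: p q fourier_graph_def)
next
  fix c :: real and p :: "('n, 'e) L2 \<times> ('n, 'e) L2" assume "p \<in> fourier_graph"
  then obtain f g where p: "p = (f, g)" "(f, g) \<in> fourier_graph" by (metis surj_pair)
  note P = fourier_graph_eq(2,3)[OF p(2)]
  have int: "integrable lborel (rep_L2 (c *\<^sub>R f))"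
    by (rule integrable_cong_AE_imp[OF integrable_scaleR_right[OF P(1), of c]])
       (measurable, use rep_L2_scaleR[of c f] in eventually_elim, simp)
  have eq: "fourier_integral (rep_L2 (c *\<^sub>R f)) = fourier_integral (\<lambda>x. c *\<^sub>R rep_L2 f x)"
    by (rule fourier_integral_cong_AE[OF rep_L2_scaleR]) measurable
  have "AE \<xi> in lborel. rep_L2 (c *\<^sub>R g) \<xi> = fourier_integral (rep_L2 (c *\<^sub>R f)) \<xi>"
    using rep_L2_scaleR[of c g] P(2) by eventually_elim (simp add: eq fourier_integral_scaleR)
  then show "c *\<^sub>R p \<in> fourier_graph" using int by (simp add: p fourier_graph_def)
qed

lemma closure_fourier_graph_isometric:
  assumes "(f, g) \<in> closure fourier_graph"
  shows "norm g = norm f"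
proof -
  obtain S where S: "\<And>j. S j \<in> fourier_graph" "S \<longlonglongrightarrow> (f, g)"
    using assms unfolding closure_sequential by blast
  have "(\<lambda>j. norm (fst (S j))) \<longlonglongrightarrow> norm f" "(\<lambda>j. norm (snd (S j))) \<longlonglongrightarrow> norm g"
    using tendsto_norm[OF tendsto_fst[OF S(2)]] tendsto_norm[OF tendsto_snd[OF S(2)]] by simp_all
  moreover have "norm (snd (S j)) = norm (fst (S j))" for j
    using fourier_graph_isometric[of "fst (S j)" "snd (S j)"] S(1) by simp
  ultimately show ?thesis by (simp add: LIMSEQ_unique)
qed

text \<open>A linear isometric relation is single-valued: the difference of the pairs relates 0 to
  \<open>g - g'\<close>.\<close>

lemma closure_fourier_graph_unique:
  assumes "(f, g) \<in> closure fourier_graph" "(f, g') \<in> closure fourier_graph"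
  shows "g = g'"
  using closure_fourier_graph_isometric[of 0 "g - g'"]
    subspace_diff[OF closure_subspace[OF subspace_fourier_graph] assms] by simp

lemma dense_Domain_fourier_graph:
  "closure (Domain fourier_graph) = (UNIV :: ('n::finite, 'e::finite_dim_hilbert) L2 set)"
proof (rule closed_subspace_eq_UNIV)
  have "Domain fourier_graph = fst ` (fourier_graph :: (('n, 'e) L2 \<times> ('n, 'e) L2) set)"
    by (auto simp: Domain_fst)
  moreover have "subspace (fst ` (fourier_graph :: (('n, 'e) L2 \<times> ('n, 'e) L2) set))"
    by (rule linear_subspace_image[OF bounded_linear.linear[OF bounded_linear_fst] subspace_fourier_graph])
  ultimately show "subspace (closure (Domain (fourier_graph :: (('n, 'e) L2 \<times> ('n, 'e) L2) set)))"
    by (simp add: closure_subspace)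
  fix v :: "('n, 'e) L2" assume v: "\<And>g. g \<in> closure (Domain fourier_graph) \<Longrightarrow> inner g v = 0"
  show "v = 0"
  proof (rule L2_eq_0I, rule v)
    fix A :: "(real^'n) set" and e :: 'e assume A: "bounded A" "A \<in> sets borel"
    have "integrable lborel (\<lambda>x. indicator A x *\<^sub>R e)"
      using emeasure_bounded_finite[OF A(1)] A(2)
      by (intro integrable_scaleR_left integrable_real_indicator) auto
    from integrable_rep_abs_L2[OF square_integrable_indicator[OF A] this]
    have "abs_L2 (\<lambda>x. indicator A x *\<^sub>R e) \<in> Domain fourier_graph"
      using fourier_graphI by blast
    then show "abs_L2 (\<lambda>x. indicator A x *\<^sub>R e) \<in> closure (Domain fourier_graph)"
      by (rule subsetD[OF closure_subset])
  qed
qed simp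

text \<open>Isometry turns an approximation of \<open>f\<close> into a Cauchy sequence of images,
  whose limit exists by completeness.\<close>

lemma fourier_graph_total: "\<exists>g. (f, g) \<in> closure fourier_graph"
proof -
  have "f \<in> closure (Domain fourier_graph)" by (simp add: dense_Domain_fourier_graph)
  then obtain F where F: "\<And>j. F j \<in> Domain fourier_graph" "F \<longlonglongrightarrow> f"
    unfolding closure_sequential by blast
  have "\<exists>g. (F j, g) \<in> fourier_graph" for j using F(1)[of j] by blast
  then obtain G where G: "\<And>j. (F j, G j) \<in> fourier_graph" by metis
  have norm: "norm (G i - G j) = norm (F i - F j)" for i j
    using fourier_graph_isometric subspace_diff[OF subspace_fourier_graph G[of i] G[of j]] by simp
  have "Cauchy F" using F(2) convergent_Cauchy convergentI by blast
  then have "Cauchy G" unfolding Cauchy_def dist_norm norm .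
  then obtain g where "G \<longlonglongrightarrow> g" using Cauchy_convergent_iff convergentD by blast
  then have "(\<lambda>j. (F j, G j)) \<longlonglongrightarrow> (f, g)" using F(2) by (intro tendsto_Pair)
  then show ?thesis
    unfolding closure_sequential by (intro exI[of _ g] exI[of _ "\<lambda>j. (F j, G j)"] conjI allI G)
qed

lemma fourier_closure: "(f, fourier f) \<in> closure fourier_graph"
  unfolding fourier_def
  by (rule theI') (use fourier_graph_total[of f] closure_fourier_graph_unique in blast)

lemma fourier_eqI: "(f, g) \<in> closure fourier_graph \<Longrightarrow> fourier f = g"
  by (rule closure_fourier_graph_unique[OF fourier_closure])

lemma fourier_eq_fourier_integral:
  assumes "integrable lborel (rep_L2 f)"
  shows "AE \<xi> in lborel. rep_L2 (fourier f) \<xi> = fourier_integral (rep_L2 f) \<xi>"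
proof -
  have "fourier f = abs_L2 (fourier_integral (rep_L2 f))"
    using fourier_graphI[OF assms] closure_subset by (intro fourier_eqI) blast
  then show ?thesis using rep_abs_L2[OF square_integrable_fourier_integral[OF assms]] by simp
qed

lemma norm_fourier: "norm (fourier f) = norm f"
  by (rule closure_fourier_graph_isometric[OF fourier_closure])

lemma fourier_add: "fourier (f + g) = fourier f + fourier g"
  using subspace_add[OF closure_subspace[OF subspace_fourier_graph] fourier_closure[of f] fourier_closure[of g]]
  by (intro fourier_eqI) simp

lemma fourier_scaleR: "fourier (c *\<^sub>R f) = c *\<^sub>R fourier f"
  using subspace_scale[OF closure_subspace[OF subspace_fourier_graph] fourier_closure[of f]]
  by (intro fourier_eqI) simp

lemma fourier_diff: "fourier (f - g) = fourier f - fourier g"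
  using fourier_add[of f "- g"] fourier_scaleR[of "-1" g] by simp


lemma rep_modulation: "AE x in lborel. rep_L2 (modulation k f) x = cis (inner k x) *\<^sub>C rep_L2 f x"
proof -
  have "modulation k f = abs_L2 (\<lambda>x. cis (inner k x) *\<^sub>C rep_L2 f x)"
    using modulation.abs_eq[OF L2_rel_rep, of k f] by simp
  then show ?thesis by (metis rep_abs_L2 square_integrable_modulation square_integrable_rep)
qed

lemma modulation_diff: "modulation k (f - g) = modulation k f - modulation k g"
  by (rule L2_eqI)
     (use rep_L2_diff[of f g] rep_L2_diff[of "modulation k f" "modulation k g"] rep_modulation[of k f]
        rep_modulation[of k g] rep_modulation[of k "f - g"] in eventually_elim, simp add: scaleC_diff_right)

lemma norm_modulation: "norm (modulation k f) = norm f"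
proof -
  have "ennreal ((norm (modulation k f))\<^sup>2) = ennreal ((norm f)\<^sup>2)"
    unfolding nn_integral_norm_L2[symmetric]
    by (rule nn_integral_cong_AE) (use rep_modulation[of k f] in eventually_elim, simp add: norm_scaleC)
  then show ?thesis by (simp add: ennreal_inj power2_eq_iff_nonneg)
qed

text \<open>For general \<open>f\<close> there is no integral to manipulate. The map that translates
  the first and modulates the second component is continuous and preserves the graph of the Fourier
  integral, hence its closure.\<close>

lemma fourier_translation:
  fixes f :: "('n::finite, 'e::finite_dim_hilbert) L2"
  shows "fourier (translation h f) = modulation h (fourier f)"
proof (rule fourier_eqI)
  let ?T = "\<lambda>(f :: ('n, 'e) L2, g :: ('n, 'e) L2). (translation h f, modulation h g)"
  have "?T ` closure fourier_graph \<subseteq> closure fourier_graph"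
  proof (rule image_closure_subset)
    have "continuous_on UNIV (translation h)" "continuous_on UNIV (modulation h)"
      by (auto simp: continuous_on_iff dist_norm norm_translation norm_modulation
          simp flip: translation_diff modulation_diff)
    then have "continuous_on UNIV (\<lambda>p. (translation h (fst p), modulation h (snd p)))"
      by (intro continuous_on_Pair continuous_on_compose2[OF _ continuous_on_fst[OF continuous_on_id]]
          continuous_on_compose2[OF _ continuous_on_snd[OF continuous_on_id]]) auto
    then show "continuous_on (closure fourier_graph) ?T"
      by (rule continuous_on_subset[OF continuous_on_cong[THEN iffD1, rotated 2]]) auto
    show "?T ` fourier_graph \<subseteq> closure fourier_graph"
    proof clarify
      fix f g :: "('n, 'e) L2" assume fg: "(f, g) \<in> fourier_graph"
      note F = fourier_graph_eq(2,3)[OF fg]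
      have "integrable lborel (\<lambda>x. rep_L2 f (x + h))" by (rule integrable_lborel_shift[OF F(1)])
      then have int: "integrable lborel (rep_L2 (translation h f))"
        by (rule integrable_cong_AE_imp) (measurable, use rep_translation[of h f] in eventually_elim, simp)
      have "fourier_integral (rep_L2 (translation h f)) = fourier_integral (\<lambda>x. rep_L2 f (x + h))"
        by (rule fourier_integral_cong_AE[OF rep_translation]) measurable
      also have "\<dots> = (\<lambda>\<xi>. cis (inner h \<xi>) *\<^sub>C fourier_integral (rep_L2 f) \<xi>)"
      proof
        fix \<xi>
        \<comment> \<open>Writing \<open>x\<close> as \<open>(x + h) - h\<close> exhibits the
          integrand as a shifted function.\<close>
        have "(\<integral>x. cis (- (\<xi> \<bullet> x)) *\<^sub>C rep_L2 f (x + h) \<partial>lborel)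
            = (\<integral>x. cis (- (\<xi> \<bullet> ((x + h) - h))) *\<^sub>C rep_L2 f (x + h) \<partial>lborel)" by simp
        also have "\<dots> = (\<integral>x. cis (- (\<xi> \<bullet> (x - h))) *\<^sub>C rep_L2 f x \<partial>lborel)"
          by (rule integral_lborel_shift[where f = "\<lambda>x. cis (- (\<xi> \<bullet> (x - h))) *\<^sub>C rep_L2 f x"]) measurable
        also have "\<dots> = (\<integral>x. cis (inner h \<xi>) *\<^sub>C (cis (- (\<xi> \<bullet> x)) *\<^sub>C rep_L2 f x) \<partial>lborel)"
          by (rule Bochner_Integration.integral_cong[OF refl])
             (simp add: scaleC_scaleC cis_mult inner_diff_right inner_commute)
        also have "\<dots> = cis (inner h \<xi>) *\<^sub>C (\<integral>x. cis (- (\<xi> \<bullet> x)) *\<^sub>C rep_L2 f x \<partial>lborel)"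
          by (rule integral_bounded_linear[OF bounded_linear_scaleC]) (rule integrable_cis_scaleC[OF F(1)], simp)
        finally show "fourier_integral (\<lambda>x. rep_L2 f (x + h)) \<xi> = cis (inner h \<xi>) *\<^sub>C fourier_integral (rep_L2 f) \<xi>"
          by (simp add: fourier_integral_def scaleC_scaleR)
      qed
      finally have eq: "fourier_integral (rep_L2 (translation h f))
          = (\<lambda>\<xi>. cis (inner h \<xi>) *\<^sub>C fourier_integral (rep_L2 f) \<xi>)" .
      have "AE \<xi> in lborel. rep_L2 (modulation h g) \<xi> = fourier_integral (rep_L2 (translation h f)) \<xi>"
        using rep_modulation[of h g] F(2) by eventually_elim (simp add: eq)
      with int have "(translation h f, modulation h g) \<in> fourier_graph" by (simp add: fourier_graph_def)
      then show "(translation h f, modulation h g) \<in> closure fourier_graph" using closure_subset by blast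
    qed
  qed simp
  then show "(translation h f, modulation h (fourier f)) \<in> closure fourier_graph"
    using fourier_closure[of f] by force
qed

section \<open>A compactness criterion for square integrable functions\<close>

text \<open>Halving the radius leaves room to pass to closed balls, whose finite union also covers
  the closure.\<close>

lemma totally_bounded_imp_compact_closure:
  fixes S :: "'a::complete_space set"
  assumes "\<And>e. e > 0 \<Longrightarrow> \<exists>T. finite T \<and> S \<subseteq> (\<Union>x\<in>T. ball x e)"
  shows "compact (closure S)"
  unfolding compact_eq_totally_bounded complete_eq_closed
proof (intro conjI allI impI)
  show "closed (closure S)" by simp
  fix e :: real assume e: "e > 0"
  then obtain T where T: "finite T" "S \<subseteq> (\<Union>x\<in>T. ball x (e/2))" using assms[of "e/2"] by auto
  have "closed (\<Union>x\<in>T. cball x (e/2))" using T(1) by (intro closed_UN) auto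
  moreover have "S \<subseteq> (\<Union>x\<in>T. cball x (e/2))"
  proof
    fix y assume "y \<in> S"
    then obtain x where "x \<in> T" "dist x y < e/2" using T(2) by auto
    then show "y \<in> (\<Union>x\<in>T. cball x (e/2))" by (intro UN_I[of x]) auto
  qed
  ultimately have "closure S \<subseteq> (\<Union>x\<in>T. cball x (e/2))" by (rule closure_minimal[rotated])
  also have "\<dots> \<subseteq> (\<Union>x\<in>T. ball x e)" using e by fastforce
  finally show "\<exists>k. finite k \<and> closure S \<subseteq> (\<Union>x\<in>k. ball x e)" using T(1) by (intro exI[of _ T] conjI)
qed

text \<open>The values of each functional are sorted into intervals of length \<theta>. Boundedness
  leaves finitely many patterns \<kappa>, and one member of \<open>S\<close> is kept for each
  pattern that occurs.\<close>

lemma finite_net_of_functionals: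
  fixes S :: "'a::real_inner set"
  assumes bound: "\<And>f. f \<in> S \<Longrightarrow> norm f \<le> C" and W: "finite W" and \<theta>: "\<theta> > 0"
  shows "\<exists>T. finite T \<and> T \<subseteq> S \<and> (\<forall>f\<in>S. \<exists>g\<in>T. \<forall>w\<in>W. \<bar>inner w (f - g)\<bar> \<le> \<theta>)"
proof -
  define \<kappa> where "\<kappa> f = (\<lambda>w\<in>W. \<lfloor>inner w f / \<theta>\<rfloor>)" for f
  define A where "A w = {\<lfloor>- (norm w * C) / \<theta>\<rfloor> .. \<lfloor>norm w * C / \<theta>\<rfloor>}" for w :: 'a
  have "\<kappa> f \<in> PiE W A" if f: "f \<in> S" for f
  proof (rule PiE_I)
    fix w assume w: "w \<in> W"
    have "\<bar>inner w f\<bar> \<le> norm w * C"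
      using Cauchy_Schwarz_ineq2[of w f] mult_left_mono[OF bound[OF f], of "norm w"] by simp
    then have "- (norm w * C) \<le> inner w f" "inner w f \<le> norm w * C" by linarith+
    from this[THEN divide_right_mono, OF less_imp_le[OF \<theta>]]
    have "- (norm w * C) / \<theta> \<le> inner w f / \<theta>" "inner w f / \<theta> \<le> norm w * C / \<theta>" .
    then show "\<kappa> f w \<in> A w" using w by (auto simp: \<kappa>_def A_def intro!: floor_mono)
  qed (simp add: \<kappa>_def)
  moreover have "finite (PiE W A)" by (rule finite_PiE[OF W]) (simp add: A_def)
  ultimately have "finite (\<kappa> ` S)" by (meson finite_subset image_subsetI)
  then obtain T where T: "T \<subseteq> S" "finite T" "\<kappa> ` S = \<kappa> ` T"
    using finite_subset_image[of "\<kappa> ` S" \<kappa> S] by auto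
  have "\<exists>g\<in>T. \<forall>w\<in>W. \<bar>inner w (f - g)\<bar> \<le> \<theta>" if f: "f \<in> S" for f
  proof -
    have "\<kappa> f \<in> \<kappa> ` T" using f T(3) by blast
    then obtain g where g: "g \<in> T" "\<kappa> f = \<kappa> g" by blast
    have "\<bar>inner w (f - g)\<bar> \<le> \<theta>" if w: "w \<in> W" for w
    proof -
      have "\<lfloor>inner w f / \<theta>\<rfloor> = \<lfloor>inner w g / \<theta>\<rfloor>"
        using fun_cong[OF g(2), of w] w by (simp add: \<kappa>_def)
      then have "\<bar>inner w f / \<theta> - inner w g / \<theta>\<bar> < 1" by linarith
      then have "\<bar>inner w (f - g) / \<theta>\<bar> < 1" by (simp add: inner_diff_right diff_divide_distrib)
      then show ?thesis using \<theta> by (simp add: abs_divide)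
    qed
    then show ?thesis using g(1) by blast
  qed
  then show ?thesis using T by blast
qed

text \<open>An orthonormal basis over the reals: a complex spanning set together with its multiples
  by \<i> is orthogonalised, and zero vectors are dropped before normalising.\<close>

lemma finite_dim_orthonormal_basis:
  obtains C :: "'e::finite_dim_hilbert set" where "finite C" "\<And>y. (norm y)\<^sup>2 = (\<Sum>c\<in>C. (inner c y)\<^sup>2)"
proof -
  obtain B :: "'e set" where B: "finite B" "\<And>x. \<exists>c. x = (\<Sum>b\<in>B. c b *\<^sub>C b)"
    using finite_dim by blast
  let ?B = "B \<union> (\<lambda>b. \<i> *\<^sub>C b) ` B"
  have span: "span ?B = UNIV"
  proof -
    have "x \<in> span ?B" for x
    proof -
      obtain c where c: "x = (\<Sum>b\<in>B. c b *\<^sub>C b)" using B(2) by blast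
      show ?thesis unfolding c scaleC_conv_scaleR[of "c _"]
        by (intro span_sum span_add span_scale span_base) auto
    qed
    then show ?thesis by auto
  qed
  obtain C0 where C0: "finite C0" "span C0 = (UNIV :: 'e set)" "pairwise orthogonal C0"
    using basis_orthogonal[of ?B] B(1) span by auto
  define C where "C = (\<lambda>c. (1 / norm c) *\<^sub>R c) ` (C0 - {0})"
  have inj: "inj_on (\<lambda>c. (1 / norm c) *\<^sub>R c) (C0 - {0})"
  proof (rule inj_onI, rule ccontr)
    fix x y assume xy: "x \<in> C0 - {0}" "y \<in> C0 - {0}" "(1 / norm x) *\<^sub>R x = (1 / norm y) *\<^sub>R y" "x \<noteq> y"
    then have "inner x y = 0" using C0(3) by (auto simp: pairwise_def orthogonal_def)
    then have "inner ((1 / norm x) *\<^sub>R x) ((1 / norm y) *\<^sub>R y) = 0" by simp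
    then have "inner ((1 / norm y) *\<^sub>R y) ((1 / norm y) *\<^sub>R y) = 0" using xy(3) by simp
    then show False using xy by simp
  qed
  have "(norm y)\<^sup>2 = (\<Sum>c\<in>C. (inner c y)\<^sup>2)" for y :: 'e
  proof -
    define p where "p = (\<Sum>c\<in>C0. (inner c y / inner c c) *\<^sub>R c)"
    have orth: "inner c (y - p) = 0" if "c \<in> C0" for c
    proof -
      have "inner c p = (\<Sum>d\<in>C0. if d = c then inner c y / inner c c * inner c c else 0)"
        unfolding p_def inner_sum_right inner_scaleR_right
        by (rule sum.cong) (use C0(3) that in \<open>auto simp: pairwise_def orthogonal_def\<close>)
      also have "\<dots> = inner c y" using C0(1) that by simp
      finally show ?thesis by (simp add: inner_diff_right)
    qed
    have "y - p \<in> span C0" using C0(2) by simp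
    then have "inner (y - p) (y - p) = 0"
      using orthogonal_to_span[of "y - p" C0 "y - p"] orth
      by (auto simp: orthogonal_def inner_commute)
    then have yp: "y = p" by simp
    have "(norm y)\<^sup>2 = inner y p" using yp by (simp add: power2_norm_eq_inner)
    also have "\<dots> = (\<Sum>c\<in>C0. (inner c y)\<^sup>2 / inner c c)"
      unfolding p_def inner_sum_right by (rule sum.cong) (auto simp: power2_eq_square inner_commute)
    also have "\<dots> = (\<Sum>c\<in>C0 - {0}. (inner c y)\<^sup>2 / inner c c)"
      by (rule sum.mono_neutral_right) (use C0(1) in auto)
    also have "\<dots> = (\<Sum>c\<in>C0 - {0}. (inner ((1 / norm c) *\<^sub>R c) y)\<^sup>2)"
      by (rule sum.cong) (auto simp: power_divide power2_norm_eq_inner power_mult_distrib)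
    also have "\<dots> = (\<Sum>c\<in>C. (inner c y)\<^sup>2)"
      unfolding C_def by (subst sum.reindex[OF inj]) simp
    finally show ?thesis .
  qed
  then show ?thesis using that[of C] C0(1) by (auto simp: C_def)
qed

section \<open>Local mass, translation differences and thin sets\<close>

definition mass :: "('n::finite, 'e::finite_dim_hilbert) L2 \<Rightarrow> (real^'n) set \<Rightarrow> real" where
  "mass f A = (\<integral>x. indicator A x * (norm (rep_L2 f x))\<^sup>2 \<partial>lborel)"

lemma integrable_mass:
  assumes [measurable]: "A \<in> sets borel"
  shows "integrable lborel (\<lambda>x. indicator A x * (norm (rep_L2 f x))\<^sup>2)"
  using integrable_mult_indicator[OF _ integrable_norm_rep_L2[of f], of A] by simp

lemma ennreal_mass:
  assumes "A \<in> sets borel"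
  shows "ennreal (mass f A) = (\<integral>\<^sup>+x. indicator A x * ennreal ((norm (rep_L2 f x))\<^sup>2) \<partial>lborel)"
  unfolding mass_def
  by (subst nn_integral_eq_integral[OF integrable_mass[OF assms], symmetric])
     (auto intro!: nn_integral_cong simp: indicator_def)

lemma mass_nonneg: "0 \<le> mass f A"
  unfolding mass_def by (rule Bochner_Integration.integral_nonneg) simp

lemma mass_UNIV: "mass f UNIV = (norm f)\<^sup>2"
  by (simp add: mass_def power2_norm_L2)

lemma mass_mono:
  assumes "A \<subseteq> B" "A \<in> sets borel" "B \<in> sets borel"
  shows "mass f A \<le> mass f B"
  unfolding mass_def
  by (rule integral_mono[OF integrable_mass integrable_mass]) (use assms in \<open>auto simp: indicator_def\<close>)

lemma mass_Un_le:
  assumes "A \<in> sets borel" "B \<in> sets borel"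
  shows "mass f (A \<union> B) \<le> mass f A + mass f B"
proof -
  have "mass f (A \<union> B) \<le> (\<integral>x. indicator A x * (norm (rep_L2 f x))\<^sup>2 + indicator B x * (norm (rep_L2 f x))\<^sup>2 \<partial>lborel)"
    unfolding mass_def
    by (rule integral_mono[OF integrable_mass Bochner_Integration.integrable_add[OF integrable_mass integrable_mass]])
       (use assms in \<open>auto simp: indicator_def\<close>)
  then show ?thesis using assms by (simp add: mass_def integrable_mass)
qed

lemma mass_diff_le:
  assumes A: "A \<in> sets borel"
  shows "mass (f - g) A \<le> 2 * mass f A + 2 * mass g A"
proof -
  have "mass (f - g) A \<le> (\<integral>x. 2 * (indicator A x * (norm (rep_L2 f x))\<^sup>2) + 2 * (indicator A x * (norm (rep_L2 g x))\<^sup>2) \<partial>lborel)"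
    unfolding mass_def
  proof (rule integral_mono_AE)
    show "AE x in lborel. indicator A x * (norm (rep_L2 (f - g) x))\<^sup>2
        \<le> 2 * (indicator A x * (norm (rep_L2 f x))\<^sup>2) + 2 * (indicator A x * (norm (rep_L2 g x))\<^sup>2)"
      using rep_L2_diff[of f g]
    proof eventually_elim
      fix x assume eq: "rep_L2 (f - g) x = rep_L2 f x - rep_L2 g x"
      have "(norm (rep_L2 f x - rep_L2 g x))\<^sup>2 \<le> (norm (rep_L2 f x) + norm (rep_L2 g x))\<^sup>2"
        by (intro power_mono norm_triangle_ineq4) simp
      also have "\<dots> \<le> 2 * (norm (rep_L2 f x))\<^sup>2 + 2 * (norm (rep_L2 g x))\<^sup>2"
        using sum_squares_bound[of "norm (rep_L2 f x)" "norm (rep_L2 g x)"] by (simp add: power2_sum)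
      finally show "indicator A x * (norm (rep_L2 (f - g) x))\<^sup>2
        \<le> 2 * (indicator A x * (norm (rep_L2 f x))\<^sup>2) + 2 * (indicator A x * (norm (rep_L2 g x))\<^sup>2)"
        by (simp add: eq indicator_def)
    qed
  qed (use A in \<open>auto intro!: integrable_mass\<close>)
  then show ?thesis using A by (simp add: mass_def integrable_mass)
qed

text \<open>An averaging kernel. Its values are extended nonnegative numbers, so that Tonelli's
  theorem applies without integrability conditions.\<close>

definition near :: "real \<Rightarrow> 'a::euclidean_space \<Rightarrow> 'a \<Rightarrow> ennreal" where
  "near \<delta> x y = (if dist x y < \<delta> then 1 else 0)"

lemma borel_measurable_near [measurable (raw)]:
  "f \<in> borel_measurable M \<Longrightarrow> g \<in> borel_measurable M \<Longrightarrow> (\<lambda>p. near \<delta> (f p) (g p)) \<in> borel_measurable M"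
  unfolding near_def by measurable

lemma nn_integral_near:
  fixes x :: "'a::euclidean_space"
  shows "(\<integral>\<^sup>+y. near \<delta> x y \<partial>lborel) = emeasure lborel (ball (0::'a) \<delta>)"
proof -
  have "(\<integral>\<^sup>+y. near \<delta> x y \<partial>lborel) = (\<integral>\<^sup>+y. near \<delta> x (y + x) \<partial>lborel)"
    by (rule nn_integral_lborel_shift[symmetric]) measurable
  also have "\<dots> = (\<integral>\<^sup>+y. indicator (ball (0::'a) \<delta>) y \<partial>lborel)"
    by (intro nn_integral_cong) (auto simp: indicator_def near_def dist_norm)
  finally show ?thesis by simp
qed

text \<open>With \<open>y = x + h\<close> and the order of integration exchanged, the left side
  integrates the squared norm of \<open>translation h f - f\<close> over the ball of radius
  \<delta>.\<close>

lemma double_difference_bound: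
  fixes f :: "('n::finite, 'e::finite_dim_hilbert) L2"
  assumes "\<And>h. norm h < \<delta> \<Longrightarrow> norm (translation h f - f) \<le> \<eta>"
  shows "(\<integral>\<^sup>+x. \<integral>\<^sup>+y. near \<delta> x y * ennreal ((norm (rep_L2 f x - rep_L2 f y))\<^sup>2) \<partial>lborel \<partial>lborel)
    \<le> emeasure lborel (ball (0::real^'n) \<delta>) * ennreal (\<eta>\<^sup>2)"
proof -
  let ?f = "rep_L2 f"
  have "(\<integral>\<^sup>+x. \<integral>\<^sup>+y. near \<delta> x y * ennreal ((norm (?f x - ?f y))\<^sup>2) \<partial>lborel \<partial>lborel)
      = (\<integral>\<^sup>+x. \<integral>\<^sup>+h. near \<delta> 0 h * ennreal ((norm (?f (x + h) - ?f x))\<^sup>2) \<partial>lborel \<partial>lborel)"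
  proof (rule nn_integral_cong)
    fix x :: "real^'n"
    have "(\<integral>\<^sup>+y. near \<delta> x y * ennreal ((norm (?f x - ?f y))\<^sup>2) \<partial>lborel)
        = (\<integral>\<^sup>+h. near \<delta> x (h + x) * ennreal ((norm (?f x - ?f (h + x)))\<^sup>2) \<partial>lborel)"
      by (rule nn_integral_lborel_shift[symmetric]) measurable
    also have "\<dots> = (\<integral>\<^sup>+h. near \<delta> 0 h * ennreal ((norm (?f (x + h) - ?f x))\<^sup>2) \<partial>lborel)"
      by (intro nn_integral_cong) (auto simp: near_def dist_norm add.commute norm_minus_commute)
    finally show "(\<integral>\<^sup>+y. near \<delta> x y * ennreal ((norm (?f x - ?f y))\<^sup>2) \<partial>lborel)
        = (\<integral>\<^sup>+h. near \<delta> 0 h * ennreal ((norm (?f (x + h) - ?f x))\<^sup>2) \<partial>lborel)" .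
  qed
  also have "\<dots> = (\<integral>\<^sup>+h. \<integral>\<^sup>+x. near \<delta> 0 h * ennreal ((norm (?f (x + h) - ?f x))\<^sup>2) \<partial>lborel \<partial>lborel)"
    by (rule lborel_pair.Fubini') measurable
  also have "\<dots> \<le> (\<integral>\<^sup>+h. ennreal (\<eta>\<^sup>2) * near \<delta> (0::real^'n) h \<partial>lborel)"
  proof (rule nn_integral_mono)
    fix h :: "real^'n"
    have "(\<integral>\<^sup>+x. ennreal ((norm (?f (x + h) - ?f x))\<^sup>2) \<partial>lborel) = ennreal ((norm (translation h f - f))\<^sup>2)"
      unfolding nn_integral_norm_L2[symmetric]
      by (rule nn_integral_cong_AE)
         (use rep_L2_diff[of "translation h f" f] rep_translation[of h f] in eventually_elim, simp)
    then show "(\<integral>\<^sup>+x. near \<delta> 0 h * ennreal ((norm (?f (x + h) - ?f x))\<^sup>2) \<partial>lborel)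
        \<le> ennreal (\<eta>\<^sup>2) * near \<delta> 0 h"
      using assms[of h] by (auto simp: near_def dist_norm intro!: ennreal_leI power_mono)
  qed
  also have "\<dots> = emeasure lborel (ball (0::real^'n) \<delta>) * ennreal (\<eta>\<^sup>2)"
    by (subst nn_integral_cmult) (simp_all add: nn_integral_near mult.commute)
  finally show ?thesis .
qed

lemma norm_diff_power2_bound: "(norm (a::'a::real_normed_vector))\<^sup>2 \<le> 2 * (norm (a - b))\<^sup>2 + 2 * (norm b)\<^sup>2"
proof -
  have "(norm a)\<^sup>2 \<le> (norm (a - b) + norm b)\<^sup>2"
    using norm_triangle_ineq[of "a - b" b] by (intro power_mono) simp_all
  also have "\<dots> \<le> 2 * (norm (a - b))\<^sup>2 + 2 * (norm b)\<^sup>2"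
    using sum_squares_bound[of "norm (a - b)" "norm b"] by (simp add: power2_sum)
  finally show ?thesis .
qed

text \<open>For \<open>x\<close> in \<open>M\<close> the value at \<open>x\<close> is compared with
  the values at all \<open>y\<close> within \<delta>. The differences are controlled by
  translations; in the remaining term the order of integration is exchanged, and for fixed
  \<open>y\<close> the points \<open>x\<close> of \<open>M\<close> near \<open>y\<close> have
  measure at most \<kappa>.\<close>

lemma mass_thin_set:
  fixes f :: "('n::finite, 'e::finite_dim_hilbert) L2"
  assumes tr: "\<And>h. norm h < \<delta> \<Longrightarrow> norm (translation h f - f) \<le> \<eta>"
    and M[measurable]: "M \<in> sets borel" and \<delta>: "\<delta> > 0" and \<kappa>: "\<kappa> \<ge> 0"
    and thin: "\<And>y. emeasure lborel (M \<inter> ball y \<delta>) \<le> ennreal \<kappa>"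
  shows "measure lborel (ball (0::real^'n) \<delta>) * mass f M
    \<le> 2 * measure lborel (ball (0::real^'n) \<delta>) * \<eta>\<^sup>2 + 2 * \<kappa> * (norm f)\<^sup>2"
proof -
  let ?f = "rep_L2 f"
  let ?\<beta> = "emeasure lborel (ball (0::real^'n) \<delta>)"
  have \<beta>: "?\<beta> = ennreal (measure lborel (ball (0::real^'n) \<delta>))"
    by (rule emeasure_eq_ennreal_measure) (use emeasure_bounded_finite[OF bounded_ball] in \<open>simp add: top.not_eq_extremum\<close>)
  have "?\<beta> * ennreal (mass f M) = (\<integral>\<^sup>+x. ?\<beta> * (indicator M x * ennreal ((norm (?f x))\<^sup>2)) \<partial>lborel)"
    by (subst nn_integral_cmult) (auto simp: ennreal_mass)
  also have "\<dots> = (\<integral>\<^sup>+x. \<integral>\<^sup>+y. near \<delta> x y * (indicator M x * ennreal ((norm (?f x))\<^sup>2)) \<partial>lborel \<partial>lborel)"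
    by (simp add: nn_integral_multc nn_integral_near)
  also have "\<dots> \<le> (\<integral>\<^sup>+x. \<integral>\<^sup>+y. 2 * (near \<delta> x y * ennreal ((norm (?f x - ?f y))\<^sup>2))
      + 2 * (near \<delta> x y * (indicator M x * ennreal ((norm (?f y))\<^sup>2))) \<partial>lborel \<partial>lborel)"
  proof (intro nn_integral_mono)
    fix x y
    have "ennreal ((norm (?f x))\<^sup>2) \<le> ennreal (2 * (norm (?f x - ?f y))\<^sup>2 + 2 * (norm (?f y))\<^sup>2)"
      by (intro ennreal_leI norm_diff_power2_bound)
    also have "\<dots> = 2 * ennreal ((norm (?f x - ?f y))\<^sup>2) + 2 * ennreal ((norm (?f y))\<^sup>2)"
      by (simp add: ennreal_mult)
    finally show "near \<delta> x y * (indicator M x * ennreal ((norm (?f x))\<^sup>2))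
        \<le> 2 * (near \<delta> x y * ennreal ((norm (?f x - ?f y))\<^sup>2))
          + 2 * (near \<delta> x y * (indicator M x * ennreal ((norm (?f y))\<^sup>2)))"
      by (auto simp: indicator_def near_def)
  qed
  also have "\<dots> = 2 * (\<integral>\<^sup>+x. \<integral>\<^sup>+y. near \<delta> x y * ennreal ((norm (?f x - ?f y))\<^sup>2) \<partial>lborel \<partial>lborel)
      + 2 * (\<integral>\<^sup>+x. \<integral>\<^sup>+y. near \<delta> x y * (indicator M x * ennreal ((norm (?f y))\<^sup>2)) \<partial>lborel \<partial>lborel)"
    by (simp add: nn_integral_add nn_integral_cmult)
  also have "\<dots> \<le> 2 * (?\<beta> * ennreal (\<eta>\<^sup>2)) + 2 * (ennreal \<kappa> * ennreal ((norm f)\<^sup>2))"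
  proof (intro add_mono mult_left_mono double_difference_bound tr)
    have "(\<integral>\<^sup>+x. \<integral>\<^sup>+y. near \<delta> x y * (indicator M x * ennreal ((norm (?f y))\<^sup>2)) \<partial>lborel \<partial>lborel)
        = (\<integral>\<^sup>+y. \<integral>\<^sup>+x. near \<delta> x y * (indicator M x * ennreal ((norm (?f y))\<^sup>2)) \<partial>lborel \<partial>lborel)"
      by (rule lborel_pair.Fubini') measurable
    also have "\<dots> \<le> (\<integral>\<^sup>+y. ennreal \<kappa> * ennreal ((norm (?f y))\<^sup>2) \<partial>lborel)"
    proof (rule nn_integral_mono)
      fix y
      have "(\<integral>\<^sup>+x. near \<delta> x y * (indicator M x * ennreal ((norm (?f y))\<^sup>2)) \<partial>lborel)
          = (\<integral>\<^sup>+x. indicator (M \<inter> ball y \<delta>) x * ennreal ((norm (?f y))\<^sup>2) \<partial>lborel)"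
        by (intro nn_integral_cong) (auto simp: indicator_def near_def dist_commute)
      also have "\<dots> = emeasure lborel (M \<inter> ball y \<delta>) * ennreal ((norm (?f y))\<^sup>2)"
      proof (subst nn_integral_multc)
        have mb: "M \<inter> ball y \<delta> \<in> sets borel" using M by (intro sets.Int) auto
        then show "indicator (M \<inter> ball y \<delta>) \<in> borel_measurable lborel"
          using borel_measurable_indicator[of "M \<inter> ball y \<delta>" lborel] by simp
        show "integral\<^sup>N lborel (indicator (M \<inter> ball y \<delta>)) * ennreal ((norm (?f y))\<^sup>2)
            = emeasure lborel (M \<inter> ball y \<delta>) * ennreal ((norm (?f y))\<^sup>2)"
          using mb by simp
      qed
      also have "\<dots> \<le> ennreal \<kappa> * ennreal ((norm (?f y))\<^sup>2)"
        by (intro mult_right_mono thin) simp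
      finally show "(\<integral>\<^sup>+x. near \<delta> x y * (indicator M x * ennreal ((norm (?f y))\<^sup>2)) \<partial>lborel)
          \<le> ennreal \<kappa> * ennreal ((norm (?f y))\<^sup>2)" .
    qed
    also have "\<dots> = ennreal \<kappa> * ennreal ((norm f)\<^sup>2)"
      by (simp add: nn_integral_cmult nn_integral_norm_L2)
    finally show "(\<integral>\<^sup>+x. \<integral>\<^sup>+y. near \<delta> x y * (indicator M x * ennreal ((norm (?f y))\<^sup>2)) \<partial>lborel \<partial>lborel)
        \<le> ennreal \<kappa> * ennreal ((norm f)\<^sup>2)" .
  qed auto
  finally have "ennreal (measure lborel (ball (0::real^'n) \<delta>) * mass f M)
      \<le> ennreal (2 * measure lborel (ball (0::real^'n) \<delta>) * \<eta>\<^sup>2 + 2 * \<kappa> * (norm f)\<^sup>2)"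
    using \<kappa> by (simp add: \<beta> ennreal_mult mass_nonneg mult.assoc)
  then show ?thesis using \<kappa> by (subst (asm) ennreal_le_iff) auto
qed

lemma mass_tail_uniform:
  fixes S :: "('n::finite, 'e::finite_dim_hilbert) L2 set" and W :: "real^'n \<Rightarrow> real"
  assumes bound: "\<And>f. f \<in> S \<Longrightarrow> norm f \<le> C"
    and equi: "\<And>\<epsilon>. \<epsilon> > 0 \<Longrightarrow> \<exists>\<delta>>0. \<forall>f\<in>S. \<forall>h. norm h < \<delta> \<longrightarrow> norm (translation h f - f) \<le> \<epsilon>"
    and W[measurable]: "W \<in> borel_measurable borel"
    and weight: "\<And>f. f \<in> S \<Longrightarrow> (\<integral>\<^sup>+x. ennreal (W x) * ennreal ((norm (rep_L2 f x))\<^sup>2) \<partial>lborel) \<le> ennreal D"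
    and thin: "\<And>c. c > 0 \<Longrightarrow> ((\<lambda>a. measure lborel {x \<in> cball a 1. W x < c}) \<longlongrightarrow> 0) at_infinity"
    and \<epsilon>: "\<epsilon> > 0"
  shows "\<exists>R. \<forall>f\<in>S. mass f (- cball 0 R) \<le> \<epsilon>"
proof -
  define C' where "C' = \<bar>C\<bar> + 1"
  have C': "C' > 0" "\<And>f. f \<in> S \<Longrightarrow> norm f \<le> C'" using bound by (force simp: C'_def)+
  \<comment> \<open>Where W is at least \<open>c\<close>, the weighted bound leaves mass at most
    \<epsilon> / 3; \<open>\<bar>D\<bar> + 1\<close> is positive whatever the sign of
    \<open>D\<close>.\<close>
  define c where "c = 3 * (\<bar>D\<bar> + 1) / \<epsilon>"
  have c: "c > 0" using \<epsilon> by (simp add: c_def)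
  define \<eta> where "\<eta> = sqrt (\<epsilon> / 6)"
  have \<eta>: "\<eta> > 0" "\<eta>\<^sup>2 = \<epsilon> / 6" using \<epsilon> by (simp_all add: \<eta>_def)
  obtain \<delta>' where \<delta>': "\<delta>' > 0" "\<And>f h. f \<in> S \<Longrightarrow> norm h < \<delta>' \<Longrightarrow> norm (translation h f - f) \<le> \<eta>"
    using equi[OF \<eta>(1)] by blast
  \<comment> \<open>With \<delta> at most 1, balls of radius \<delta> fit into the unit balls of the
    hypothesis \<open>thin\<close>.\<close>
  define \<delta> where "\<delta> = min \<delta>' 1"
  have \<delta>: "\<delta> > 0" "\<delta> \<le> 1" "\<delta> \<le> \<delta>'" using \<delta>'(1) by (auto simp: \<delta>_def)
  define \<beta> where "\<beta> = measure lborel (ball (0::real^'n) \<delta>)"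
  have \<beta>: "\<beta> > 0" using \<delta>(1) content_ball_pos[of \<delta> "0::real^'n"] by (simp add: \<beta>_def)
  \<comment> \<open>Both terms of \<open>mass_thin_set\<close> become \<epsilon> / 3 after division
    by \<beta>: \<open>2 * \<eta>\<^sup>2\<close> by the choice of \<eta>, and
    \<open>2 * \<kappa> * C'\<^sup>2 / \<beta>\<close> by this one.\<close>
  define \<kappa> where "\<kappa> = \<epsilon> * \<beta> / (6 * C'\<^sup>2)"
  have \<kappa>: "\<kappa> > 0" using \<epsilon> \<beta> C' by (simp add: \<kappa>_def)
  have "\<forall>\<^sub>F a in at_infinity. measure lborel {x \<in> cball a 1. W x < c} < \<kappa>"
    using order_tendstoD(2)[OF thin[OF c] \<kappa>] .
  then obtain R where R: "\<And>a. norm a \<ge> R \<Longrightarrow> measure lborel {x \<in> cball a 1. W x < c} < \<kappa>"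
    by (auto simp: eventually_at_infinity)
  \<comment> \<open>Beyond radius \<open>R + 1\<close> a point of \<open>M\<close> within \<delta>
    of \<open>y\<close> forces \<open>norm y \<ge> R\<close>, where thinness is available; for other
    \<open>y\<close> the intersection is empty.\<close>
  have "mass f (- cball 0 (R + 1)) \<le> \<epsilon>" if f: "f \<in> S" for f
  proof -
    define M where "M = {x. norm x > R + 1 \<and> W x < c}"
    define N where "N = {x. c \<le> W x}"
    have [measurable]: "M \<in> sets borel" "N \<in> sets borel" unfolding M_def N_def by measurable
    have "emeasure lborel (M \<inter> ball y \<delta>) \<le> ennreal \<kappa>" for y
    proof (cases "norm y \<ge> R")
      case True
      have [measurable]: "{x \<in> cball y 1. W x < c} \<in> sets borel" by measurable
      have "M \<inter> ball y \<delta> \<subseteq> {x \<in> cball y 1. W x < c}" using \<delta>(2) by (auto simp: M_def)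
      then have "emeasure lborel (M \<inter> ball y \<delta>) \<le> emeasure lborel {x \<in> cball y 1. W x < c}"
        by (rule emeasure_mono) simp
      also have "\<dots> = ennreal (measure lborel {x \<in> cball y 1. W x < c})"
      proof (rule emeasure_eq_ennreal_measure)
        have "bounded {x \<in> cball y 1. W x < c}" by (rule bounded_subset[OF bounded_cball]) auto
        from emeasure_bounded_finite[OF this] show "emeasure lborel {x \<in> cball y 1. W x < c} \<noteq> top" by simp
      qed
      also have "\<dots> \<le> ennreal \<kappa>" using R[OF True] by (simp add: ennreal_leI)
      finally show ?thesis .
    next
      case False
      have "M \<inter> ball y \<delta> = {}"
      proof (rule equals0I)
        fix x assume "x \<in> M \<inter> ball y \<delta>"
        then have "norm x > R + 1" "norm (y - x) < 1" using \<delta>(2) by (auto simp: M_def dist_norm)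
        then show False using False norm_triangle_ineq2[of x y] by (simp add: norm_minus_commute)
      qed
      then show ?thesis by simp
    qed
    then have "\<beta> * mass f M \<le> 2 * \<beta> * \<eta>\<^sup>2 + 2 * \<kappa> * (norm f)\<^sup>2"
      unfolding \<beta>_def
      by (intro mass_thin_set \<delta>'(2)[OF f]) (use \<delta> \<kappa> in auto)
    also have "\<dots> \<le> 2 * \<beta> * \<eta>\<^sup>2 + 2 * \<kappa> * C'\<^sup>2"
      using C'(2)[OF f] \<kappa> by (intro add_left_mono mult_left_mono power_mono) auto
    also have "\<dots> = \<beta> * (2 * \<epsilon> / 3)"
      using C'(1) by (simp add: \<eta>(2) \<kappa>_def field_simps)
    finally have MM: "mass f M \<le> 2 * \<epsilon> / 3" using \<beta> by simp
    have "ennreal c * ennreal (mass f N) = (\<integral>\<^sup>+x. ennreal c * (indicator N x * ennreal ((norm (rep_L2 f x))\<^sup>2)) \<partial>lborel)"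
      by (subst nn_integral_cmult) (auto simp: ennreal_mass)
    also have "\<dots> \<le> (\<integral>\<^sup>+x. ennreal (W x) * ennreal ((norm (rep_L2 f x))\<^sup>2) \<partial>lborel)"
      by (intro nn_integral_mono) (auto simp: indicator_def N_def intro!: mult_right_mono ennreal_leI)
    also have "\<dots> \<le> ennreal (\<bar>D\<bar> + 1)"
      by (rule order_trans[OF weight[OF f]]) (rule ennreal_leI, simp)
    finally have "c * mass f N \<le> \<bar>D\<bar> + 1"
      using c by (simp add: ennreal_mult[symmetric] mass_nonneg ennreal_le_iff del: ennreal_plus)
    then have "mass f N \<le> (\<bar>D\<bar> + 1) / c" using c by (simp add: field_simps)
    also have "\<dots> = \<epsilon> / 3"
    proof -
      have "\<bar>D\<bar> + 1 \<noteq> 0" by linarith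
      moreover have "K / (3 * K / \<epsilon>) = \<epsilon> / 3" if "K \<noteq> 0" for K
        using that \<epsilon> by (simp add: field_simps)
      ultimately show ?thesis unfolding c_def by blast
    qed
    finally have NN: "mass f N \<le> \<epsilon> / 3" .
    have "mass f (- cball 0 (R + 1)) \<le> mass f (M \<union> N)"
      by (rule mass_mono) (auto simp: M_def N_def)
    also have "\<dots> \<le> mass f M + mass f N" by (rule mass_Un_le) auto
    finally show ?thesis using MM NN by simp
  qed
  then show ?thesis by blast
qed

section \<open>Grid cubes\<close>

definition grid_index :: "real \<Rightarrow> real^'n \<Rightarrow> int^'n" where
  "grid_index s x = (\<chi> i. \<lfloor>x $ i / s\<rfloor>)"

text \<open>Being fibres of a function, the cubes are disjoint and cover the space by construction;
  they are half-open.\<close>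

definition grid_cube :: "real \<Rightarrow> int^'n \<Rightarrow> (real^'n) set" where
  "grid_cube s k = {x. grid_index s x = k}"

lemma mem_grid_cube:
  assumes "s > 0"
  shows "x \<in> grid_cube s k \<longleftrightarrow> (\<forall>i. s * of_int (k $ i) \<le> x $ i \<and> x $ i < s * of_int (k $ i) + s)"
  using assms by (auto simp: grid_cube_def grid_index_def vec_eq_iff floor_eq_iff field_simps)

lemma sets_grid_cube [measurable]: "grid_cube s k \<in> sets borel"
proof -
  have "grid_cube s k = {x \<in> space borel. \<forall>i. \<lfloor>x $ i / s\<rfloor> = k $ i}"
    by (auto simp: grid_cube_def grid_index_def vec_eq_iff)
  also have "\<dots> \<in> sets borel" by measurable
  finally show ?thesis .
qed

lemma bounded_grid_cube:
  assumes "s > 0" shows "bounded (grid_cube s k)"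
proof (rule bounded_subset[OF bounded_cbox])
  show "grid_cube s k \<subseteq> cbox (\<chi> i. s * of_int (k $ i)) (\<chi> i. s * of_int (k $ i) + s)"
    by (auto simp: mem_box_cart mem_grid_cube[OF assms] less_imp_le)
qed

text \<open>The half-open cube lies between the open and the closed box, whose measures
  agree.\<close>

lemma measure_grid_cube:
  fixes k :: "int^'n"
  assumes "s > 0" shows "measure lborel (grid_cube s k) = s ^ CARD('n)"
proof -
  let ?a = "(\<chi> i. s * of_int (k $ i)) :: real^'n" and ?b = "(\<chi> i. s * of_int (k $ i) + s) :: real^'n"
  have le: "?a \<bullet> b \<le> ?b \<bullet> b" if "b \<in> Basis" for b
    using that assms by (auto simp: Basis_vec_def inner_axis)
  have prod: "(\<Prod>b\<in>Basis. (?b - ?a) \<bullet> b) = s ^ CARD('n)"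
  proof -
    have "(?b - ?a) \<bullet> b = s" if "b \<in> Basis" for b
      using that by (auto simp: Basis_vec_def inner_axis)
    then have "(\<Prod>b\<in>Basis. (?b - ?a) \<bullet> b) = (\<Prod>b\<in>(Basis :: (real^'n) set). s)" by (rule prod.cong[OF refl])
    then show ?thesis by simp
  qed
  have fin: "emeasure lborel (grid_cube s k) < top" using emeasure_bounded_finite[OF bounded_grid_cube[OF assms]] by simp
  have "measure lborel (box ?a ?b) \<le> measure lborel (grid_cube s k)"
    by (rule measure_mono_fmeasurable)
       (use fin in \<open>auto simp: mem_box_cart mem_grid_cube[OF assms] less_imp_le fmeasurable_def\<close>)
  moreover have "measure lborel (grid_cube s k) \<le> measure lborel (cbox ?a ?b)"
    by (rule measure_mono_fmeasurable)
       (auto simp: mem_box_cart mem_grid_cube[OF assms] less_imp_le)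
  moreover have "measure lborel (box ?a ?b) = s ^ CARD('n)" "measure lborel (cbox ?a ?b) = s ^ CARD('n)"
    using le prod by (simp_all add: measure_lborel_box_eq measure_lborel_cbox_eq)
  ultimately show ?thesis by linarith
qed

lemma grid_cube_diameter:
  fixes s :: real
  assumes "s > 0" "x \<in> grid_cube s k" "y \<in> grid_cube s (k :: int^'n)"
  shows "dist x y \<le> CARD('n) * s"
proof -
  have "\<bar>(x - y) $ i\<bar> \<le> s" for i
  proof -
    have "s * of_int (k $ i) \<le> x $ i" "x $ i < s * of_int (k $ i) + s"
      "s * of_int (k $ i) \<le> y $ i" "y $ i < s * of_int (k $ i) + s"
      using assms by (auto simp: mem_grid_cube)
    then show ?thesis by simp
  qed
  then have "(\<Sum>i\<in>UNIV. \<bar>(x - y) $ i\<bar>) \<le> (\<Sum>i\<in>(UNIV :: 'n set). s)" by (intro sum_mono)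
  then show ?thesis using norm_le_l1_cart[of "x - y"] by (simp add: dist_norm)
qed

lemma finite_grid_index_image:
  assumes "s > 0" "bounded A"
  shows "finite (grid_index s ` (A :: (real^'n) set))"
proof -
  obtain R where R: "\<And>x. x \<in> A \<Longrightarrow> norm x \<le> R" using assms(2) by (auto simp: bounded_iff)
  let ?I = "{\<lfloor>- R / s\<rfloor> .. \<lfloor>R / s\<rfloor>}"
  have "grid_index s ` A \<subseteq> vec_lambda ` PiE UNIV (\<lambda>_. ?I)"
  proof clarify
    fix x assume "x \<in> A"
    have "\<lfloor>x $ i / s\<rfloor> \<in> ?I" for i
    proof -
      have "- R \<le> x $ i" "x $ i \<le> R"
        using component_le_norm_cart[of x i] R[OF \<open>x \<in> A\<close>] by linarith+
      from this[THEN divide_right_mono, OF less_imp_le[OF assms(1)]] show ?thesis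
        by (auto intro!: floor_mono)
    qed
    then show "grid_index s x \<in> vec_lambda ` PiE UNIV (\<lambda>_. ?I)"
      unfolding grid_index_def by (intro image_eqI[where x = "\<lambda>i. \<lfloor>x $ i / s\<rfloor>"]) auto
  qed
  moreover have "finite (vec_lambda ` PiE (UNIV :: 'n set) (\<lambda>_. ?I))"
    by (intro finite_imageI finite_PiE) auto
  ultimately show ?thesis by (rule finite_subset)
qed

text \<open>Expanding the square gives
  \<open>2 \<bar>Q\<bar> \<integral>\<^sub>Q \<bar>u\<bar>\<^sup>2 = \<integral>\<^sub>Q\<integral>\<^sub>Q \<bar>u x - u y\<bar>\<^sup>2 + 2 \<bar>\<integral>\<^sub>Q u\<bar>\<^sup>2\<close>.\<close>

lemma mass_eq_double_difference:
  fixes u :: "('n::finite, 'e::finite_dim_hilbert) L2"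
  assumes Q[measurable]: "Q \<in> sets borel" and bd: "bounded Q"
  shows "ennreal (2 * measure lborel Q * mass u Q - 2 * (norm (\<integral>x. indicator Q x *\<^sub>R rep_L2 u x \<partial>lborel))\<^sup>2)
    = (\<integral>\<^sup>+x. \<integral>\<^sup>+y. indicator Q x * (indicator Q y * ennreal ((norm (rep_L2 u x - rep_L2 u y))\<^sup>2)) \<partial>lborel \<partial>lborel)"
proof -
  let ?u = "rep_L2 u"
  define q where "q = measure lborel Q"
  define I where "I = (\<integral>x. indicator Q x *\<^sub>R ?u x \<partial>lborel)"
  have intQ: "integrable lborel (indicator Q :: _ \<Rightarrow> real)"
    using emeasure_bounded_finite[OF bd] by (intro integrable_real_indicator) auto
  have Qi: "(\<integral>y. indicator Q y \<partial>lborel) = q" by (simp add: q_def)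
  have intu: "integrable lborel (\<lambda>x. indicator Q x *\<^sub>R ?u x)"
    by (rule integrable_indicator_rep) (auto simp: bd)
  define m where "m = mass u Q"
  have mi: "integrable lborel (\<lambda>y. indicator Q y * (norm (?u y))\<^sup>2)" "(\<integral>y. indicator Q y * (norm (?u y))\<^sup>2 \<partial>lborel) = m"
    by (simp_all add: integrable_mass mass_def m_def)
  have point: "indicator Q x * (indicator Q y * (norm (?u x - ?u y))\<^sup>2)
      = indicator Q x * (norm (?u x))\<^sup>2 * indicator Q y + indicator Q x * (indicator Q y * (norm (?u y))\<^sup>2)
        - 2 * inner (indicator Q x *\<^sub>R ?u x) (indicator Q y *\<^sub>R ?u y)" for x y
    by (simp add: indicator_def power2_norm_eq_inner inner_diff_left inner_diff_right inner_commute)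
  have inner1: "integrable lborel (\<lambda>y. indicator Q x * (indicator Q y * (norm (?u x - ?u y))\<^sup>2))" for x
    unfolding point
    by (intro Bochner_Integration.integrable_diff Bochner_Integration.integrable_add integrable_mult_right
        integrable_inner_right intQ mi intu)
  have inner2: "(\<integral>y. indicator Q x * (indicator Q y * (norm (?u x - ?u y))\<^sup>2) \<partial>lborel)
      = q * (indicator Q x * (norm (?u x))\<^sup>2) + m * indicator Q x - 2 * inner (indicator Q x *\<^sub>R ?u x) I" for x
  proof -
    have "(\<integral>y. indicator Q x * (norm (?u x))\<^sup>2 * indicator Q y + indicator Q x * (indicator Q y * (norm (?u y))\<^sup>2)
        - 2 * inner (indicator Q x *\<^sub>R ?u x) (indicator Q y *\<^sub>R ?u y) \<partial>lborel)
      = (\<integral>y. indicator Q x * (norm (?u x))\<^sup>2 * indicator Q y + indicator Q x * (indicator Q y * (norm (?u y))\<^sup>2) \<partial>lborel)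
        - (\<integral>y. 2 * inner (indicator Q x *\<^sub>R ?u x) (indicator Q y *\<^sub>R ?u y) \<partial>lborel)"
      by (intro Bochner_Integration.integral_diff Bochner_Integration.integrable_add integrable_mult_right
        integrable_inner_right intQ mi intu)
    also have "(\<integral>y. indicator Q x * (norm (?u x))\<^sup>2 * indicator Q y + indicator Q x * (indicator Q y * (norm (?u y))\<^sup>2) \<partial>lborel)
      = (\<integral>y. indicator Q x * (norm (?u x))\<^sup>2 * indicator Q y \<partial>lborel) + (\<integral>y. indicator Q x * (indicator Q y * (norm (?u y))\<^sup>2) \<partial>lborel)"
      by (intro Bochner_Integration.integral_add integrable_mult_right intQ mi)
    also have "(\<integral>y. indicator Q x * (norm (?u x))\<^sup>2 * indicator Q y \<partial>lborel) = indicator Q x * (norm (?u x))\<^sup>2 * q"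
      unfolding integral_mult_right_zero Qi ..
    also have "(\<integral>y. indicator Q x * (indicator Q y * (norm (?u y))\<^sup>2) \<partial>lborel) = indicator Q x * m"
      unfolding integral_mult_right_zero mi(2) ..
    also have "(\<integral>y. 2 * inner (indicator Q x *\<^sub>R ?u x) (indicator Q y *\<^sub>R ?u y) \<partial>lborel)
        = 2 * inner (indicator Q x *\<^sub>R ?u x) I"
      unfolding integral_mult_right_zero I_def by (subst integral_inner_right) (use intu in simp_all)
    finally show ?thesis unfolding point by (simp add: algebra_simps)
  qed
  have nn: "0 \<le> q * (indicator Q x * (norm (?u x))\<^sup>2) + m * indicator Q x - 2 * inner (indicator Q x *\<^sub>R ?u x) I" for x
    unfolding inner2[symmetric] by (rule Bochner_Integration.integral_nonneg) simp
  have outer1: "integrable lborel (\<lambda>x. q * (indicator Q x * (norm (?u x))\<^sup>2) + m * indicator Q x - 2 * inner (indicator Q x *\<^sub>R ?u x) I)"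
    by (intro Bochner_Integration.integrable_diff Bochner_Integration.integrable_add integrable_mult_right
        integrable_inner_left intQ mi intu)
  have outer2: "(\<integral>x. q * (indicator Q x * (norm (?u x))\<^sup>2) + m * indicator Q x - 2 * inner (indicator Q x *\<^sub>R ?u x) I \<partial>lborel)
      = 2 * q * m - 2 * (norm I)\<^sup>2"
  proof -
    have "(\<integral>x. q * (indicator Q x * (norm (?u x))\<^sup>2) + m * indicator Q x - 2 * inner (indicator Q x *\<^sub>R ?u x) I \<partial>lborel)
      = (\<integral>x. q * (indicator Q x * (norm (?u x))\<^sup>2) + m * indicator Q x \<partial>lborel)
        - (\<integral>x. 2 * inner (indicator Q x *\<^sub>R ?u x) I \<partial>lborel)"
      by (intro Bochner_Integration.integral_diff Bochner_Integration.integrable_add integrable_mult_right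
        integrable_inner_left intQ mi intu)
    also have "(\<integral>x. q * (indicator Q x * (norm (?u x))\<^sup>2) + m * indicator Q x \<partial>lborel)
      = (\<integral>x. q * (indicator Q x * (norm (?u x))\<^sup>2) \<partial>lborel) + (\<integral>x. m * indicator Q x \<partial>lborel)"
      by (intro Bochner_Integration.integral_add integrable_mult_right intQ mi)
    also have "(\<integral>x. q * (indicator Q x * (norm (?u x))\<^sup>2) \<partial>lborel) = q * m"
      unfolding integral_mult_right_zero mi(2) ..
    also have "(\<integral>x. m * indicator Q x \<partial>lborel) = m * q"
      unfolding integral_mult_right_zero Qi ..
    also have "(\<integral>x. 2 * inner (indicator Q x *\<^sub>R ?u x) I \<partial>lborel) = 2 * inner I I"
      unfolding integral_mult_right_zero by (subst integral_inner_left) (use intu in \<open>simp_all add: I_def\<close>)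
    finally show ?thesis by (simp add: power2_norm_eq_inner)
  qed
  have "(\<integral>\<^sup>+x. \<integral>\<^sup>+y. indicator Q x * (indicator Q y * ennreal ((norm (?u x - ?u y))\<^sup>2)) \<partial>lborel \<partial>lborel)
      = (\<integral>\<^sup>+x. ennreal (q * (indicator Q x * (norm (?u x))\<^sup>2) + m * indicator Q x - 2 * inner (indicator Q x *\<^sub>R ?u x) I) \<partial>lborel)"
  proof (rule nn_integral_cong)
    fix x
    have "(\<integral>\<^sup>+y. indicator Q x * (indicator Q y * ennreal ((norm (?u x - ?u y))\<^sup>2)) \<partial>lborel)
        = (\<integral>\<^sup>+y. ennreal (indicator Q x * (indicator Q y * (norm (?u x - ?u y))\<^sup>2)) \<partial>lborel)"
      by (intro nn_integral_cong) (auto simp: indicator_def)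
    also have "\<dots> = ennreal (\<integral>y. indicator Q x * (indicator Q y * (norm (?u x - ?u y))\<^sup>2) \<partial>lborel)"
      by (rule nn_integral_eq_integral[OF inner1]) auto
    finally show "(\<integral>\<^sup>+y. indicator Q x * (indicator Q y * ennreal ((norm (?u x - ?u y))\<^sup>2)) \<partial>lborel)
        = ennreal (q * (indicator Q x * (norm (?u x))\<^sup>2) + m * indicator Q x - 2 * inner (indicator Q x *\<^sub>R ?u x) I)"
      unfolding inner2 .
  qed
  also have "\<dots> = ennreal (2 * q * m - 2 * (norm I)\<^sup>2)"
    unfolding outer2[symmetric]
    by (rule nn_integral_eq_integral[OF outer1]) (rule AE_I2, rule nn)
  finally show ?thesis by (simp add: q_def m_def I_def)
qed

lemma mass_UN_le:
  assumes "finite K" "\<And>k. k \<in> K \<Longrightarrow> A k \<in> sets borel"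
  shows "mass f (\<Union>k\<in>K. A k) \<le> (\<Sum>k\<in>K. mass f (A k))"
  using assms
proof (induction K rule: finite_induct)
  case empty
  then show ?case by (simp add: mass_def)
next
  case (insert k K)
  have "mass f (\<Union>k\<in>insert k K. A k) \<le> mass f (A k) + mass f (\<Union>k\<in>K. A k)"
    using mass_Un_le[of "A k" "\<Union>k\<in>K. A k" f] insert by (simp add: sets.finite_UN)
  then show ?case using insert by simp
qed

text \<open>An inequality of Poincare type: the mass of a cube is a multiple of its double
  difference plus the contribution of its mean. Points of one cube have distance at most
  \<open>CARD('n) * s = \<delta> / 2\<close>, and each point lies in one cube, so the double
  differences of all cubes together are bounded by \<open>double_difference_bound\<close>.\<close>

lemma mass_grid_bound:
  fixes u :: "('n::finite, 'e::finite_dim_hilbert) L2"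
  assumes tr: "\<And>h. norm h < \<delta> \<Longrightarrow> norm (translation h u - u) \<le> \<eta>"
    and \<delta>: "\<delta> > 0" and s: "s = \<delta> / (2 * CARD('n))" and K: "finite K"
  shows "(\<Sum>k\<in>K. mass u (grid_cube s k)) \<le> (4 * CARD('n)) ^ CARD('n) / 2 * \<eta>\<^sup>2
    + (\<Sum>k\<in>K. (norm (\<integral>x. indicator (grid_cube s k) x *\<^sub>R rep_L2 u x \<partial>lborel))\<^sup>2) / s ^ CARD('n)"
proof -
  let ?u = "rep_L2 u" and ?Q = "grid_cube s"
  define I where "I k = (\<integral>x. indicator (?Q k) x *\<^sub>R ?u x \<partial>lborel)" for k
  define q where "q = s ^ CARD('n)"
  define \<beta> where "\<beta> = measure lborel (ball (0::real^'n) \<delta>)"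
  have s0: "s > 0" using \<delta> by (simp add: s)
  have q: "q > 0" using s0 by (simp add: q_def)
  have \<beta>: "emeasure lborel (ball (0::real^'n) \<delta>) = ennreal \<beta>"
    unfolding \<beta>_def using emeasure_bounded_finite[OF bounded_ball[of "0::real^'n" \<delta>]]
    by (intro emeasure_eq_ennreal_measure) auto
  define x where "x k = 2 * q * mass u (?Q k) - 2 * (norm (I k))\<^sup>2" for k
  have xk: "ennreal (x k)
      = (\<integral>\<^sup>+x. \<integral>\<^sup>+y. indicator (?Q k) x * (indicator (?Q k) y * ennreal ((norm (?u x - ?u y))\<^sup>2)) \<partial>lborel \<partial>lborel)" for k
    using mass_eq_double_difference[of "?Q k" u] bounded_grid_cube[OF s0, of k]
    by (simp add: x_def I_def q_def measure_grid_cube[OF s0])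
  have "(\<Sum>k\<in>K. ennreal (x k))
      = (\<integral>\<^sup>+x. \<integral>\<^sup>+y. (\<Sum>k\<in>K. indicator (?Q k) x * (indicator (?Q k) y * ennreal ((norm (?u x - ?u y))\<^sup>2))) \<partial>lborel \<partial>lborel)"
    unfolding xk by (simp add: nn_integral_sum)
  also have "\<dots> \<le> (\<integral>\<^sup>+x. \<integral>\<^sup>+y. near \<delta> x y * ennreal ((norm (?u x - ?u y))\<^sup>2) \<partial>lborel \<partial>lborel)"
  proof (intro nn_integral_mono)
    fix x y :: "real^'n"
    have "(\<Sum>k\<in>K. indicator (?Q k) x * (indicator (?Q k) y * ennreal ((norm (?u x - ?u y))\<^sup>2)))
        = (\<Sum>k\<in>K. if k = grid_index s x then indicator (?Q k) y * ennreal ((norm (?u x - ?u y))\<^sup>2) else 0)"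
      by (rule sum.cong) (auto simp: indicator_def grid_cube_def)
    also have "\<dots> \<le> indicator (?Q (grid_index s x)) y * ennreal ((norm (?u x - ?u y))\<^sup>2)"
      using K by simp
    also have "\<dots> \<le> near \<delta> x y * ennreal ((norm (?u x - ?u y))\<^sup>2)"
    proof (intro mult_right_mono)
      have "dist x y < \<delta>" if "y \<in> ?Q (grid_index s x)"
      proof -
        have "dist x y \<le> CARD('n) * s"
          by (rule grid_cube_diameter[OF s0 _ that]) (simp add: grid_cube_def)
        also have "\<dots> < \<delta>" using \<delta> by (simp add: s)
        finally show ?thesis .
      qed
      then show "indicator (?Q (grid_index s x)) y \<le> near \<delta> x y" by (simp add: near_def indicator_def)
    qed simp
    finally show "(\<Sum>k\<in>K. indicator (?Q k) x * (indicator (?Q k) y * ennreal ((norm (?u x - ?u y))\<^sup>2)))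
        \<le> near \<delta> x y * ennreal ((norm (?u x - ?u y))\<^sup>2)" .
  qed
  also have "\<dots> \<le> ennreal \<beta> * ennreal (\<eta>\<^sup>2)"
    using double_difference_bound[of \<delta> u \<eta>, OF tr] by (simp add: \<beta>)
  finally have "(\<Sum>k\<in>K. ennreal (x k)) \<le> ennreal (\<beta> * \<eta>\<^sup>2)"
    by (simp add: ennreal_mult \<beta>_def)
  \<comment> \<open>\<open>ennreal\<close> cuts negative arguments off at 0; \<open>max 0\<close>
    makes this visible and can only enlarge the sum.\<close>
  moreover have "(\<Sum>k\<in>K. ennreal (x k)) = ennreal (\<Sum>k\<in>K. max 0 (x k))"
  proof -
    have "(\<Sum>k\<in>K. ennreal (x k)) = (\<Sum>k\<in>K. ennreal (max 0 (x k)))"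
      by (rule sum.cong) (simp_all add: max_def ennreal_neg)
    also have "\<dots> = ennreal (\<Sum>k\<in>K. max 0 (x k))" by (rule sum_ennreal) simp
    finally show ?thesis .
  qed
  ultimately have "ennreal (\<Sum>k\<in>K. max 0 (x k)) \<le> ennreal (\<beta> * \<eta>\<^sup>2)" by simp
  then have "(\<Sum>k\<in>K. max 0 (x k)) \<le> \<beta> * \<eta>\<^sup>2"
    by (subst (asm) ennreal_le_iff) (auto simp: \<beta>_def)
  moreover have "(\<Sum>k\<in>K. x k) \<le> (\<Sum>k\<in>K. max 0 (x k))" by (intro sum_mono) simp
  ultimately have "(\<Sum>k\<in>K. x k) \<le> \<beta> * \<eta>\<^sup>2" by linarith
  \<comment> \<open>The ball lies in a cube of side \<open>2 * \<delta> = 4 * CARD('n) * s\<close>,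
    and \<open>q\<close> is the volume of a grid cube of side \<open>s\<close>.\<close>
  also have "\<dots> \<le> (4 * CARD('n)) ^ CARD('n) * q * \<eta>\<^sup>2"
  proof (rule mult_right_mono)
    have "\<beta> \<le> measure lborel (cbox (\<chi> i. - \<delta>) (\<chi> i. \<delta>) :: (real^'n) set)"
      unfolding \<beta>_def
    proof (rule measure_mono_fmeasurable)
      show "ball 0 \<delta> \<subseteq> (cbox (\<chi> i. - \<delta>) (\<chi> i. \<delta>) :: (real^'n) set)"
      proof
        fix x :: "real^'n" assume "x \<in> ball 0 \<delta>"
        then have "\<bar>x $ i\<bar> \<le> \<delta>" for i using component_le_norm_cart[of x i] by simp
        then show "x \<in> cbox (\<chi> i. - \<delta>) (\<chi> i. \<delta>)" by (auto simp: mem_box_cart abs_le_iff minus_le_iff)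
      qed
    qed auto
    also have "\<dots> = (2 * \<delta>) ^ CARD('n)"
    proof -
      have "(((\<chi> i. \<delta>) - (\<chi> i. - \<delta>)) :: real^'n) \<bullet> b = 2 * \<delta>" if "b \<in> Basis" for b
        using that by (auto simp: Basis_vec_def inner_axis)
      then have "(\<Prod>b\<in>Basis. (((\<chi> i. \<delta>) - (\<chi> i. - \<delta>)) :: real^'n) \<bullet> b) = (\<Prod>b\<in>(Basis :: (real^'n) set). 2 * \<delta>)"
        by (rule prod.cong[OF refl])
      moreover have "((\<chi> i. - \<delta>) :: real^'n) \<bullet> b \<le> (\<chi> i. \<delta>) \<bullet> b" if "b \<in> Basis" for b
        using that \<delta> by (auto simp: Basis_vec_def inner_axis)
      ultimately show ?thesis by (simp add: measure_lborel_cbox_eq)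
    qed
    also have "\<dots> = (4 * CARD('n)) ^ CARD('n) * q"
      unfolding q_def s of_nat_power power_mult_distrib[symmetric] by simp
    finally show "\<beta> \<le> (4 * CARD('n)) ^ CARD('n) * q" .
  qed simp
  finally have *: "2 * q * (\<Sum>k\<in>K. mass u (?Q k)) - 2 * (\<Sum>k\<in>K. (norm (I k))\<^sup>2) \<le> (4 * CARD('n)) ^ CARD('n) * q * \<eta>\<^sup>2"
    by (simp add: x_def sum_subtractf sum_distrib_left)
  have "(\<Sum>k\<in>K. mass u (?Q k)) \<le> ((4 * CARD('n)) ^ CARD('n) * q * \<eta>\<^sup>2 + 2 * (\<Sum>k\<in>K. (norm (I k))\<^sup>2)) / (2 * q)"
    using * q by (subst pos_le_divide_eq) (simp_all add: algebra_simps)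
  also have "\<dots> = (4 * CARD('n)) ^ CARD('n) / 2 * \<eta>\<^sup>2 + (\<Sum>k\<in>K. (norm (I k))\<^sup>2) / q"
    using q by (simp add: add_divide_distrib)
  finally show ?thesis by (simp add: q_def I_def)
qed

text \<open>A criterion of Kolmogorov-Riesz type, with the weight in place of uniform decay.
  Finitely many cubes meet the large ball, and the components of the means over them are inner
  products with finitely many vectors, for which a finite net exists.\<close>

lemma compact_closure_equicontinuous_weighted:
  fixes S :: "('n::finite, 'e::finite_dim_hilbert) L2 set" and W :: "real^'n \<Rightarrow> real"
  assumes bound: "\<And>f. f \<in> S \<Longrightarrow> norm f \<le> C"
    and equi: "\<And>\<epsilon>. \<epsilon> > 0 \<Longrightarrow> \<exists>\<delta>>0. \<forall>f\<in>S. \<forall>h. norm h < \<delta> \<longrightarrow> norm (translation h f - f) \<le> \<epsilon>"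
    and W: "W \<in> borel_measurable borel"
    and weight: "\<And>f. f \<in> S \<Longrightarrow> (\<integral>\<^sup>+x. ennreal (W x) * ennreal ((norm (rep_L2 f x))\<^sup>2) \<partial>lborel) \<le> ennreal D"
    and thin: "\<And>c. c > 0 \<Longrightarrow> ((\<lambda>a. measure lborel {x \<in> cball a 1. W x < c}) \<longlongrightarrow> 0) at_infinity"
  shows "compact (closure S)"
proof (rule totally_bounded_imp_compact_closure)
  fix e :: real assume e: "e > 0"
  define \<epsilon> where "\<epsilon> = e\<^sup>2"
  have \<epsilon>: "\<epsilon> > 0" using e by (simp add: \<epsilon>_def)
  define \<Gamma> :: real where "\<Gamma> = (4 * CARD('n)) ^ CARD('n)"
  have \<Gamma>: "\<Gamma> > 0" by (simp add: \<Gamma>_def)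
  \<comment> \<open>A difference \<open>f - g\<close> moves by at most \<open>2 * \<eta>\<close>
    under small translations, and \<open>\<Gamma> / 2 * (2 * \<eta>)\<^sup>2\<close> is \<epsilon> /
    8.\<close>
  define \<eta> where "\<eta> = sqrt (\<epsilon> / (16 * \<Gamma>))"
  have \<eta>: "\<eta> > 0" "\<eta>\<^sup>2 = \<epsilon> / (16 * \<Gamma>)" using \<epsilon> \<Gamma> by (simp_all add: \<eta>_def)
  obtain \<delta> where \<delta>: "\<delta> > 0" "\<And>f h. f \<in> S \<Longrightarrow> norm h < \<delta> \<Longrightarrow> norm (translation h f - f) \<le> \<eta>"
    using equi[OF \<eta>(1)] by blast
  \<comment> \<open>\<open>mass_diff_le\<close> doubles the tails of \<open>f\<close> and of
    \<open>g\<close>, which gives \<epsilon> / 8 for the tail of the difference.\<close>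
  obtain R where R: "\<And>f. f \<in> S \<Longrightarrow> mass f (- cball 0 R) \<le> \<epsilon> / 32"
    using mass_tail_uniform[OF bound equi W weight thin, of "\<epsilon> / 32"] \<epsilon> by auto
  define s where "s = \<delta> / (2 * CARD('n))"
  have s: "s > 0" using \<delta>(1) by (simp add: s_def)
  define q where "q = s ^ CARD('n)"
  have q: "q > 0" using s by (simp add: q_def)
  define K where "K = grid_index s ` (cball 0 R :: (real^'n) set)"
  have K: "finite K" unfolding K_def by (rule finite_grid_index_image[OF s bounded_cball])
  obtain B :: "'e set" where B: "finite B" "\<And>y. (norm y)\<^sup>2 = (\<Sum>c\<in>B. (inner c y)\<^sup>2)"
    using finite_dim_orthonormal_basis[where 'e='e] by blast
  let ?w = "\<lambda>k c. abs_L2 (\<lambda>x. indicator (grid_cube s k) x *\<^sub>R c) :: ('n, 'e) L2"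
  let ?W = "(\<lambda>(k, c). ?w k c) ` (K \<times> B)"
  define N where "N = real (card K) * real (card B) + 1"
  have N: "N > 0" unfolding N_def by (intro add_nonneg_pos) simp_all
  \<comment> \<open>\<open>N\<close> exceeds the number of pairs of a cube and a direction, so the
    squared means contribute at most \<epsilon> / 4. The three shares add up to \<epsilon> / 2,
    below \<open>\<epsilon> = e\<^sup>2\<close>.\<close>
  define \<theta> where "\<theta> = sqrt (\<epsilon> * q / (4 * N))"
  have \<theta>: "\<theta> > 0" "\<theta>\<^sup>2 = \<epsilon> * q / (4 * N)" using \<epsilon> q N by (simp_all add: \<theta>_def)
  have "finite ?W" using K B(1) by blast
  then obtain T where T: "finite T" "T \<subseteq> S" "\<And>f. f \<in> S \<Longrightarrow> \<exists>g\<in>T. \<forall>w\<in>?W. \<bar>inner w (f - g)\<bar> \<le> \<theta>"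
    using finite_net_of_functionals[OF bound _ \<theta>(1), of S ?W] by blast
  have "\<exists>g\<in>T. norm (f - g) < e" if f: "f \<in> S" for f
  proof -
    obtain g where g: "g \<in> T" "\<And>w. w \<in> ?W \<Longrightarrow> \<bar>inner w (f - g)\<bar> \<le> \<theta>" using T(3)[OF f] by blast
    have gS: "g \<in> S" using g(1) T(2) by blast
    define u where "u = f - g"
    define I where "I k = (\<integral>x. indicator (grid_cube s k) x *\<^sub>R rep_L2 u x \<partial>lborel)" for k
    have I: "(norm (I k))\<^sup>2 \<le> card B * \<theta>\<^sup>2" if k: "k \<in> K" for k
    proof -
      have "(inner c (I k))\<^sup>2 \<le> \<theta>\<^sup>2" if "c \<in> B" for c
      proof -
        have "inner c (I k) = inner (?w k c) u"
          unfolding I_def by (rule inner_indicator_L2[OF bounded_grid_cube[OF s] sets_grid_cube, symmetric])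
        moreover have "?w k c \<in> ?W" using k that by (intro image_eqI[of _ _ "(k, c)"]) auto
        then have "\<bar>inner (?w k c) u\<bar> \<le> \<theta>" unfolding u_def by (rule g(2))
        ultimately show ?thesis using \<theta>(1) abs_le_square_iff[of "inner c (I k)" \<theta>] by simp
      qed
      then have "(\<Sum>c\<in>B. (inner c (I k))\<^sup>2) \<le> (\<Sum>c\<in>B. \<theta>\<^sup>2)" by (rule sum_mono)
      then show ?thesis by (simp add: B(2)[of "I k"])
    qed
    have tr: "norm (translation h u - u) \<le> 2 * \<eta>" if h: "norm h < \<delta>" for h
    proof -
      have "translation h u - u = (translation h f - f) - (translation h g - g)"
        by (simp add: u_def translation_diff)
      also have "norm \<dots> \<le> norm (translation h f - f) + norm (translation h g - g)" by (rule norm_triangle_ineq4)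
      also have "\<dots> \<le> 2 * \<eta>" using \<delta>(2)[OF f h] \<delta>(2)[OF gS h] by simp
      finally show ?thesis .
    qed
    have "(\<Sum>k\<in>K. (norm (I k))\<^sup>2) \<le> (\<Sum>k\<in>K. card B * \<theta>\<^sup>2)" by (rule sum_mono[OF I])
    also have "\<dots> \<le> N * \<theta>\<^sup>2" by (simp add: N_def algebra_simps)
    also have "\<dots> = \<epsilon> / 4 * q" using N by (simp add: \<theta>(2))
    finally have I2: "(\<Sum>k\<in>K. (norm (I k))\<^sup>2) / q \<le> \<epsilon> / 4" using q by (simp add: divide_le_eq)
    have "(\<Sum>k\<in>K. mass u (grid_cube s k)) \<le> \<Gamma> / 2 * (2 * \<eta>)\<^sup>2 + (\<Sum>k\<in>K. (norm (I k))\<^sup>2) / q"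
      unfolding \<Gamma>_def q_def I_def
      using mass_grid_bound[OF tr \<delta>(1) s_def K] by simp
    also have "\<Gamma> / 2 * (2 * \<eta>)\<^sup>2 = \<epsilon> / 8" using \<Gamma> by (simp add: power_mult_distrib \<eta>(2))
    finally have grid: "(\<Sum>k\<in>K. mass u (grid_cube s k)) \<le> \<epsilon> / 8 + \<epsilon> / 4" using I2 by linarith
    have "(norm u)\<^sup>2 \<le> mass u ((\<Union>k\<in>K. grid_cube s k) \<union> - cball 0 R)"
      unfolding mass_UNIV[symmetric]
    proof (rule mass_mono)
      show "UNIV \<subseteq> (\<Union>k\<in>K. grid_cube s k) \<union> - cball 0 R" by (auto simp: K_def grid_cube_def)
    qed (use K in auto)
    also have "\<dots> \<le> mass u (\<Union>k\<in>K. grid_cube s k) + mass u (- cball 0 R)"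
      using K by (intro mass_Un_le) auto
    also have "\<dots> \<le> (\<Sum>k\<in>K. mass u (grid_cube s k)) + (2 * mass f (- cball 0 R) + 2 * mass g (- cball 0 R))"
      unfolding u_def by (intro add_mono mass_UN_le mass_diff_le K) auto
    also have "\<dots> < \<epsilon>" using grid R[OF f] R[OF gS] \<epsilon> by linarith
    finally have "norm u < e" using e unfolding \<epsilon>_def by (simp add: power2_less_imp_less)
    then show ?thesis using g(1) by (auto simp: u_def)
  qed
  then show "\<exists>T. finite T \<and> S \<subseteq> (\<Union>x\<in>T. ball x e)"
    using T(1) by (intro exI[of _ T]) (auto simp: dist_norm norm_minus_commute)
qed

section \<open>The form of a self-adjoint operator bounded from below\<close>

locale semibounded_operator =
  fixes A :: "('h::{complex_inner,banach} \<times> 'h) set" and c :: real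
  assumes sa: "self_adjoint A"
    and lower: "\<And>f u. (f, u) \<in> A \<Longrightarrow> c * (norm f)\<^sup>2 \<le> Re (cinner f u)"
begin

lemmas A_symmetric = self_adjoint_symmetric[OF sa]
  and A_add = self_adjoint_add[OF sa]
  and A_scaleC = self_adjoint_scaleC[OF sa]
  and A_zero = self_adjoint_zero[OF sa]
  and A_diff = self_adjoint_diff[OF sa]

lemma A_scaleC_pair: "p \<in> A \<Longrightarrow> (a *\<^sub>C fst p, a *\<^sub>C snd p) \<in> A"
  using A_scaleC[of "fst p" "snd p" a] by simp

text \<open>The shift by \<open>1 - c\<close> makes \<open>gform p p \<ge> \<parallel>fst p\<parallel>\<^sup>2\<close> on the graph of \<open>A\<close>.\<close>

definition gform :: "'h \<times> 'h \<Rightarrow> 'h \<times> 'h \<Rightarrow> complex" where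
  "gform p r = cinner (fst p) (snd r) + of_real (1 - c) * cinner (fst p) (fst r)"

lemma gform_sym: "p \<in> A \<Longrightarrow> r \<in> A \<Longrightarrow> gform p r = cnj (gform r p)"
  using A_symmetric[of "fst p" "snd p" "fst r" "snd r"] cinner_commute[of "fst p" "fst r"]
    cinner_commute[of "snd p" "fst r"]
  by (simp add: gform_def)

lemma gform_add: "gform p (r + s) = gform p r + gform p s"
  by (simp add: gform_def cinner_add_right algebra_simps)

lemma gform_scaleC: "gform p (a *\<^sub>C fst r, a *\<^sub>C snd r) = a * gform p r"
  by (simp add: gform_def cinner_scaleC_right algebra_simps)

lemma gform_lower: "p \<in> A \<Longrightarrow> (norm (fst p))\<^sup>2 \<le> Re (gform p p)"
  using lower[of "fst p" "snd p"] by (simp add: gform_def cinner_self algebra_simps)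

lemma subspace_A: "subspace A"
  unfolding subspace_def
proof (intro conjI ballI allI)
  show "0 \<in> A" using A_zero by (simp add: zero_prod_def)
  fix x y a assume "x \<in> A" "y \<in> A"
  then show "x + y \<in> A" using A_add[of "fst x" "snd x" "fst y" "snd y"] by (simp add: plus_prod_def)
next
  fix x and a :: real assume "x \<in> A"
  then show "a *\<^sub>R x \<in> A" using A_scaleC[of "fst x" "snd x" "of_real a"]
    by (simp add: scaleR_prod_def scaleC_of_real)
qed

lemma real_form_gform: "real_form A (\<lambda>p r. Re (gform p r))"
proof
  show "subspace A" by (rule subspace_A)
  fix p r s a assume p: "p \<in> A" "r \<in> A" "s \<in> A"
  then show sym: "Re (gform p r) = Re (gform r p)" using gform_sym[of p r] by simp
  have "p + r \<in> A" "a *\<^sub>R p \<in> A" using subspace_A p by (auto simp: subspace_def)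
  then show "Re (gform (p + r) s) = Re (gform p s) + Re (gform r s)"
    using p gform_sym[of "p + r" s] gform_sym[of p s] gform_sym[of r s] gform_add[of s p r] by simp
  show "Re (gform (a *\<^sub>R p) r) = a * Re (gform p r)"
    using p \<open>a *\<^sub>R p \<in> A\<close> gform_sym[of "a *\<^sub>R p" r] gform_sym[of p r] gform_scaleC[of r "of_real a" p]
    by (simp add: scaleR_prod_def scaleC_of_real)
  show "0 \<le> Re (gform p p)" using gform_lower[OF p(1)] zero_le_power2[of "norm (fst p)"] by linarith
qed

sublocale G: real_form A "\<lambda>p r. Re (gform p r)" by (rule real_form_gform)

lemma gform_minus_right: "gform p (- r) = - gform p r"
  using gform_scaleC[of p "-1" r] by (simp add: scaleC_minus1 uminus_prod_def)

lemma gform_diff: "gform p (r - s) = gform p r - gform p s"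
  using gform_add[of p r "- s"] gform_minus_right[of p s] by simp

text \<open>The real inequality is applied after \<open>r\<close> has been rotated by a phase that
  makes \<open>gform p r\<close> real; the rotation leaves \<open>gform r r\<close>
  unchanged.\<close>

lemma cmod_gform_le:
  assumes p: "p \<in> A" and r: "r \<in> A"
  shows "cmod (gform p r) \<le> sqrt (Re (gform p p)) * sqrt (Re (gform r r))"
proof (cases "gform p r = 0")
  case True
  then show ?thesis using G.nonneg[OF p] G.nonneg[OF r] by simp
next
  case False
  define z where "z = cnj (gform p r) / of_real (cmod (gform p r))"
  have z: "cmod z = 1" using False by (simp add: z_def norm_divide)
  let ?r = "(z *\<^sub>C fst r, z *\<^sub>C snd r)"
  have r': "?r \<in> A" using A_scaleC[of "fst r" "snd r" z] r by simp
  have "z * gform p r = of_real (cmod (gform p r))"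
    using False by (simp add: z_def mult.commute complex_norm_square[symmetric] power2_eq_square)
  then have pr: "gform p ?r = of_real (cmod (gform p r))" by (simp add: gform_scaleC)
  have "gform ?r ?r = z * gform ?r r" by (rule gform_scaleC)
  also have "gform ?r r = cnj z * cnj (gform r r)"
    using gform_sym[OF r' r] by (simp add: gform_scaleC)
  finally have "gform ?r ?r = gform r r"
    using gform_sym[OF r r] z by (simp add: mult.assoc[symmetric] complex_norm_square[symmetric])
  then have "(cmod (gform p r))\<^sup>2 \<le> Re (gform p p) * Re (gform r r)"
    using G.Cauchy_Schwarz[OF p r'] pr by simp
  then show ?thesis by (simp add: real_le_rsqrt real_sqrt_mult[symmetric])
qed

section \<open>Approximating sequences and closability\<close>

definition approx :: "'h \<Rightarrow> (nat \<Rightarrow> 'h \<times> 'h) \<Rightarrow> bool" where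
  "approx f S \<longleftrightarrow> range S \<subseteq> A \<and> (\<lambda>k. fst (S k)) \<longlonglongrightarrow> f \<and>
     (\<forall>\<epsilon>>0. \<exists>N. \<forall>j\<ge>N. \<forall>k\<ge>N. Re (gform (S j - S k) (S j - S k)) < \<epsilon>)"

text \<open>The Cauchy conditions for the form and for its nonnegative shift differ by a multiple of
  the squared distance of the first components, which converge. Symmetry of \<open>A\<close> makes
  the unshifted value real, so its modulus is an absolute value.\<close>

lemma form_approx_iff: "form_approx A f S \<longleftrightarrow> approx f S"
proof -
  have *: "(\<forall>\<epsilon>>0. \<exists>N. \<forall>j\<ge>N. \<forall>k\<ge>N. cmod (cinner (fst (S j) - fst (S k)) (snd (S j) - snd (S k))) < \<epsilon>)
      \<longleftrightarrow> (\<forall>\<epsilon>>0. \<exists>N. \<forall>j\<ge>N. \<forall>k\<ge>N. Re (gform (S j - S k) (S j - S k)) < \<epsilon>)" (is "?L \<longleftrightarrow> ?R")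
    if S: "range S \<subseteq> A" and lim: "(\<lambda>k. fst (S k)) \<longlonglongrightarrow> f"
  proof -
    have D: "S j - S k \<in> A" for j k using S subspace_diff[OF subspace_A] by blast
    define b where "b j k = cinner (fst (S j) - fst (S k)) (snd (S j) - snd (S k))" for j k
    define n where "n j k = (norm (fst (S j) - fst (S k)))\<^sup>2" for j k
    have bn: "Re (gform (S j - S k) (S j - S k)) = Re (b j k) + (1 - c) * n j k" for j k
      by (simp add: gform_def b_def n_def cinner_self)
    have breal: "b j k = of_real (Re (b j k))" for j k
    proof -
      have "(fst (S j) - fst (S k), snd (S j) - snd (S k)) \<in> A"
        using D[of j k] by (cases "S j"; cases "S k") simp
      from A_symmetric[OF this this] show ?thesis
        using cinner_commute[of "fst (S j) - fst (S k)" "snd (S j) - snd (S k)"]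
        by (simp add: b_def complex_eq_iff)
    qed
    have cb: "cmod (b j k) = \<bar>Re (b j k)\<bar>" for j k
      by (subst breal) simp
    have small: "\<exists>N. \<forall>j\<ge>N. \<forall>k\<ge>N. \<bar>1 - c\<bar> * n j k < \<epsilon>" if "\<epsilon> > 0" for \<epsilon>
    proof -
      define \<delta> where "\<delta> = sqrt (\<epsilon> / (\<bar>1 - c\<bar> + 1))"
      have \<delta>: "\<delta> > 0" "\<delta>\<^sup>2 = \<epsilon> / (\<bar>1 - c\<bar> + 1)" using that by (simp_all add: \<delta>_def)
      obtain N where N: "\<And>j k. j \<ge> N \<Longrightarrow> k \<ge> N \<Longrightarrow> norm (fst (S j) - fst (S k)) < \<delta>"
        using convergent_Cauchy[OF convergentI[OF lim]] \<delta>(1) by (meson CauchyD)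
      have "\<bar>1 - c\<bar> * n j k < \<epsilon>" if "j \<ge> N" "k \<ge> N" for j k
      proof -
        have "n j k < \<delta>\<^sup>2" unfolding n_def by (rule power_strict_mono[OF N[OF that]]) simp_all
        then have "n j k * (\<bar>1 - c\<bar> + 1) < \<epsilon>" using \<delta>(2) by (simp add: pos_less_divide_eq)
        moreover have "n j k * (\<bar>1 - c\<bar> + 1) = \<bar>1 - c\<bar> * n j k + n j k" by (simp add: algebra_simps)
        moreover have "n j k \<ge> 0" by (simp add: n_def)
        ultimately show ?thesis by linarith
      qed
      then show ?thesis by blast
    qed
    have abs: "\<bar>(1 - c) * n j k\<bar> = \<bar>1 - c\<bar> * n j k" for j k by (simp add: abs_mult n_def)
    show ?thesis
    proof
      assume L: ?L
      show ?R
      proof (intro allI impI)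
        fix \<epsilon> :: real assume "\<epsilon> > 0"
        then obtain N M where N: "\<forall>j\<ge>N. \<forall>k\<ge>N. cmod (b j k) < \<epsilon> / 2"
          and M: "\<forall>j\<ge>M. \<forall>k\<ge>M. \<bar>1 - c\<bar> * n j k < \<epsilon> / 2"
          using L[rule_format, of "\<epsilon>/2"] small[of "\<epsilon>/2"] unfolding b_def by auto
        have "Re (gform (S j - S k) (S j - S k)) < \<epsilon>" if "j \<ge> max N M" "k \<ge> max N M" for j k
          using N[rule_format, of j k] M[rule_format, of j k] that bn[of j k] cb[of j k] abs[of j k] by simp
        then show "\<exists>N. \<forall>j\<ge>N. \<forall>k\<ge>N. Re (gform (S j - S k) (S j - S k)) < \<epsilon>" by blast
      qed
    next
      assume R: ?R
      show ?L
      proof (intro allI impI)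
        fix \<epsilon> :: real assume "\<epsilon> > 0"
        then obtain N M where N: "\<forall>j\<ge>N. \<forall>k\<ge>N. Re (gform (S j - S k) (S j - S k)) < \<epsilon> / 2"
          and M: "\<forall>j\<ge>M. \<forall>k\<ge>M. \<bar>1 - c\<bar> * n j k < \<epsilon> / 2"
          using R[rule_format, of "\<epsilon>/2"] small[of "\<epsilon>/2"] by auto
        have "cmod (b j k) < \<epsilon>" if "j \<ge> max N M" "k \<ge> max N M" for j k
          using N[rule_format, of j k] M[rule_format, of j k] that bn[of j k] cb[of j k] abs[of j k]
            G.nonneg[OF D[of j k]] by simp
        then show "\<exists>N. \<forall>j\<ge>N. \<forall>k\<ge>N. cmod (cinner (fst (S j) - fst (S k)) (snd (S j) - snd (S k))) < \<epsilon>"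
          unfolding b_def by blast
      qed
    qed
  qed
  then show ?thesis unfolding form_approx_def approx_def by blast
qed

lemma approxD: "approx f S \<Longrightarrow> S k \<in> A" "approx f S \<Longrightarrow> (\<lambda>k. fst (S k)) \<longlonglongrightarrow> f"
  by (auto simp: approx_def)

lemma approx_const: "p \<in> A \<Longrightarrow> approx (fst p) (\<lambda>_. p)"
  using gform_scaleC[of 0 0 0] by (auto simp: approx_def gform_def)

lemma approx_lincomb:
  assumes S: "approx f S" and T: "approx g T"
  shows "approx (f + g) (\<lambda>k. S k + T k)" "approx (a *\<^sub>C f) (\<lambda>k. (a *\<^sub>C fst (S k), a *\<^sub>C snd (S k)))"
proof -
  note SA = approxD(1)[OF S] and TA = approxD(1)[OF T]
  have DS: "S j - S k \<in> A" and DT: "T j - T k \<in> A" for j k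
    using SA TA subspace_diff[OF subspace_A] by blast+
  show "approx (f + g) (\<lambda>k. S k + T k)"
    unfolding approx_def
  proof (intro conjI allI impI)
    show "range (\<lambda>k. S k + T k) \<subseteq> A" using SA TA subspace_add[OF subspace_A] by blast
    show "(\<lambda>k. fst (S k + T k)) \<longlonglongrightarrow> f + g" using approxD(2)[OF S] approxD(2)[OF T] by (simp add: tendsto_add)
    fix \<epsilon> :: real assume "\<epsilon> > 0"
    then have e4: "\<epsilon> / 4 > 0" by simp
    obtain N where N: "\<forall>j\<ge>N. \<forall>k\<ge>N. Re (gform (S j - S k) (S j - S k)) < \<epsilon> / 4"
      using S e4 unfolding approx_def by blast
    obtain M where M: "\<forall>j\<ge>M. \<forall>k\<ge>M. Re (gform (T j - T k) (T j - T k)) < \<epsilon> / 4"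
      using T e4 unfolding approx_def by blast
    have "Re (gform ((S j + T j) - (S k + T k)) ((S j + T j) - (S k + T k))) < \<epsilon>"
      if "j \<ge> max N M" "k \<ge> max N M" for j k
    proof -
      let ?x = "S j - S k" and ?y = "T j - T k"
      have eq: "(S j + T j) - (S k + T k) = ?x + ?y" by simp
      \<comment> \<open>The parallelogram identity replaces a triangle inequality with square roots;
        its factors 2 account for \<epsilon> / 4.\<close>
      have "Re (gform (?x + ?y) (?x + ?y)) + Re (gform (?x - ?y) (?x - ?y))
          = 2 * Re (gform ?x ?x) + 2 * Re (gform ?y ?y)"
        using G.sym[OF DS[of j k] DT[of j k]] by (simp add: G.expand DS DT)
      moreover have "0 \<le> Re (gform (?x - ?y) (?x - ?y))"
        by (rule G.nonneg[OF G.D_diff[OF DS DT]])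
      ultimately show ?thesis unfolding eq using N[rule_format, of j k] M[rule_format, of j k] that by simp
    qed
    then show "\<exists>N. \<forall>j\<ge>N. \<forall>k\<ge>N. Re (gform (S j + T j - (S k + T k)) (S j + T j - (S k + T k))) < \<epsilon>" by blast
  qed
  show "approx (a *\<^sub>C f) (\<lambda>k. (a *\<^sub>C fst (S k), a *\<^sub>C snd (S k)))"
    unfolding approx_def
  proof (intro conjI allI impI)
    show "range (\<lambda>k. (a *\<^sub>C fst (S k), a *\<^sub>C snd (S k))) \<subseteq> A" using SA A_scaleC by (auto simp: A_scaleC)
    show "(\<lambda>k. fst (a *\<^sub>C fst (S k), a *\<^sub>C snd (S k))) \<longlonglongrightarrow> a *\<^sub>C f"
      using tendsto_scaleC[OF approxD(2)[OF S]] by simp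
    fix \<epsilon> :: real assume \<epsilon>: "\<epsilon> > 0"
    \<comment> \<open>The summand 1 keeps the divisor positive when \<open>a = 0\<close>.\<close>
    define m where "m = (cmod a)\<^sup>2 + 1"
    have m: "m > 0" by (simp add: m_def add_nonneg_pos)
    then obtain N where N: "\<forall>j\<ge>N. \<forall>k\<ge>N. Re (gform (S j - S k) (S j - S k)) < \<epsilon> / m"
      using S[unfolded approx_def] \<epsilon> by (meson divide_pos_pos)
    have "Re (gform ((a *\<^sub>C fst (S j), a *\<^sub>C snd (S j)) - (a *\<^sub>C fst (S k), a *\<^sub>C snd (S k)))
        ((a *\<^sub>C fst (S j), a *\<^sub>C snd (S j)) - (a *\<^sub>C fst (S k), a *\<^sub>C snd (S k)))) < \<epsilon>"
      if "j \<ge> N" "k \<ge> N" for j k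
    proof -
      let ?x = "S j - S k"
      let ?y = "(a *\<^sub>C fst ?x, a *\<^sub>C snd ?x)"
      have eq: "(a *\<^sub>C fst (S j), a *\<^sub>C snd (S j)) - (a *\<^sub>C fst (S k), a *\<^sub>C snd (S k)) = ?y"
        by (simp add: scaleC_diff_right)
      have y: "?y \<in> A" by (rule A_scaleC_pair[OF DS])
      have "gform ?y ?y = a * cnj (gform ?x ?y)"
        unfolding gform_scaleC[of ?y] by (subst gform_sym[OF y DS]) simp
      also have "\<dots> = of_real ((cmod a)\<^sup>2) * cnj (gform ?x ?x)"
        unfolding gform_scaleC by (simp only: complex_cnj_mult mult.assoc[symmetric] complex_norm_square)
      finally have "Re (gform ?y ?y) = (cmod a)\<^sup>2 * Re (gform ?x ?x)" by simp
      also have "\<dots> \<le> m * Re (gform ?x ?x)" using G.nonneg[OF DS] by (simp add: m_def algebra_simps)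
      also have "\<dots> < \<epsilon>" using N that m by (simp add: pos_less_divide_eq mult.commute)
      finally show ?thesis unfolding eq .
    qed
    then show "\<exists>N. \<forall>j\<ge>N. \<forall>k\<ge>N. Re (gform ((a *\<^sub>C fst (S j), a *\<^sub>C snd (S j)) - (a *\<^sub>C fst (S k), a *\<^sub>C snd (S k)))
        ((a *\<^sub>C fst (S j), a *\<^sub>C snd (S j)) - (a *\<^sub>C fst (S k), a *\<^sub>C snd (S k)))) < \<epsilon>" by blast
  qed
qed

lemma approx_bounded:
  assumes S: "approx f S"
  shows "\<exists>B\<ge>0. \<forall>k. sqrt (Re (gform (S k) (S k))) \<le> B"
proof -
  note SA = approxD(1)[OF S]
  obtain N where N: "\<And>j k. j \<ge> N \<Longrightarrow> k \<ge> N \<Longrightarrow> Re (gform (S j - S k) (S j - S k)) < 1"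
    using S unfolding approx_def by (meson zero_less_one)
  define B where "B = Max ((\<lambda>k. sqrt (Re (gform (S k) (S k)))) ` {..N}) + 1"
  have le: "sqrt (Re (gform (S k) (S k))) \<le> B - 1" if "k \<le> N" for k
    unfolding B_def using that by (auto intro!: Max_ge)
  have "sqrt (Re (gform (S k) (S k))) \<le> B" for k
  proof (cases "k \<le> N")
    case False
    have "sqrt (Re (gform (S k) (S k))) = sqrt (Re (gform ((S k - S N) + S N) ((S k - S N) + S N)))" by simp
    also have "\<dots> \<le> sqrt (Re (gform (S k - S N) (S k - S N))) + sqrt (Re (gform (S N) (S N)))"
      by (rule G.triangle[OF G.D_diff[OF SA SA] SA])
    also have "\<dots> \<le> 1 + (B - 1)"
      using N[of k N] False le[of N] by (intro add_mono) (auto simp: real_sqrt_le_1_iff less_imp_le)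
    finally show ?thesis by simp
  qed (use le[of k] in simp)
  moreover have "0 \<le> sqrt (Re (gform (S 0) (S 0)))" by (intro real_sqrt_ge_zero G.nonneg SA)
  then have "B \<ge> 0" using le[of 0] by linarith
  ultimately show ?thesis by blast
qed

text \<open>Closability: a sequence that is Cauchy for the form and tends to 0 in norm tends to 0
  for the form. Cauchy-Schwarz carries this to the mixed term with a bounded second
  sequence.\<close>

lemma gform_tendsto_0:
  assumes S: "approx 0 S" and T: "approx g T"
  shows "(\<lambda>k. gform (S k) (T k)) \<longlonglongrightarrow> 0"
proof -
  note SA = approxD(1)[OF S] and TA = approxD(1)[OF T]
  have S0: "(\<lambda>k. sqrt (Re (gform (S k) (S k)))) \<longlonglongrightarrow> 0"
  proof (rule LIMSEQ_I)
    fix \<epsilon> :: real assume \<epsilon>: "\<epsilon> > 0"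
    obtain B where B: "B \<ge> 0" "\<And>k. sqrt (Re (gform (S k) (S k))) \<le> B" using approx_bounded[OF S] by blast
    \<comment> \<open>Chosen so that
      \<open>\<delta> * (B + 1) = \<epsilon>\<^sup>2 / 4\<close>.\<close>
    define \<delta> where "\<delta> = \<epsilon>\<^sup>2 / (4 * (B + 1))"
    have \<delta>: "\<delta> > 0" using B(1) \<epsilon> by (simp add: \<delta>_def)
    then obtain N where N: "\<And>j k. j \<ge> N \<Longrightarrow> k \<ge> N \<Longrightarrow> Re (gform (S j - S k) (S j - S k)) < \<delta>\<^sup>2"
      using S unfolding approx_def by (meson zero_less_power)
    have "sqrt (Re (gform (S k) (S k))) < \<epsilon>" if k: "k \<ge> N" for k
    proof -
      \<comment> \<open>For fixed \<open>k\<close> the second argument is a fixed pair of the graph,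
        so norm convergence of the first components to 0 is enough. Thus
        \<open>gform (S k) (S k)\<close> is a limit of terms with \<open>S k - S j\<close> in one
        slot.\<close>
      have lim: "(\<lambda>j. Re (gform (S j) (S k))) \<longlonglongrightarrow> Re (cinner 0 (snd (S k)) + of_real (1 - c) * cinner 0 (fst (S k)))"
        unfolding gform_def by (intro tendsto_intros approxD(2)[OF S])
      have "Re (gform (S k) (S k)) - Re (gform (S j) (S k)) \<le> \<delta> * (B + 1)" if "j \<ge> N" for j
      proof -
        have "Re (gform (S k) (S k)) - Re (gform (S j) (S k)) = Re (gform (S k - S j) (S k))"
          using G.diff_left[OF SA SA SA] by simp
        also have "\<dots> \<le> sqrt (Re (gform (S k - S j) (S k - S j))) * sqrt (Re (gform (S k) (S k)))"
          using cmod_gform_le[OF G.D_diff[OF SA SA] SA] complex_Re_le_cmod order_trans by blast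
        also have "\<dots> \<le> \<delta> * (B + 1)"
        proof (rule mult_mono)
          show "sqrt (Re (gform (S k - S j) (S k - S j))) \<le> \<delta>"
            using N[OF k that] \<delta> by (intro real_le_lsqrt) auto
          show "sqrt (Re (gform (S k) (S k))) \<le> B + 1" using B(2)[of k] by simp
        qed (use \<delta> G.nonneg[OF SA] in auto)
        finally show ?thesis .
      qed
      then have "Re (gform (S k) (S k)) - 0 \<le> \<delta> * (B + 1)"
        using tendsto_diff[OF tendsto_const lim]
        by (intro LIMSEQ_le_const2[of "\<lambda>j. Re (gform (S k) (S k)) - Re (gform (S j) (S k))"]) auto
      also have "\<delta> * (B + 1) = \<epsilon>\<^sup>2 / 4"
      proof -
        have "\<epsilon>\<^sup>2 / (4 * b) * b = \<epsilon>\<^sup>2 / 4" if "b \<noteq> 0" for b :: real using that by simp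
        moreover have "B + 1 \<noteq> 0" using B(1) by linarith
        ultimately show ?thesis unfolding \<delta>_def by blast
      qed
      also have "\<dots> < \<epsilon>\<^sup>2" using \<epsilon> by simp
      finally show ?thesis using \<epsilon> by (intro real_less_lsqrt) auto
    qed
    then show "\<exists>no. \<forall>n\<ge>no. norm (sqrt (Re (gform (S n) (S n))) - 0) < \<epsilon>"
      using G.nonneg[OF SA] by auto
  qed
  obtain B where B: "B \<ge> 0" "\<And>k. sqrt (Re (gform (T k) (T k))) \<le> B" using approx_bounded[OF T] by blast
  have "cmod (gform (S k) (T k)) \<le> sqrt (Re (gform (S k) (S k))) * B" for k
    by (rule order_trans[OF cmod_gform_le[OF SA TA]]) (use B G.nonneg[OF SA] in \<open>auto intro: mult_left_mono\<close>)
  moreover have "(\<lambda>k. sqrt (Re (gform (S k) (S k))) * B) \<longlonglongrightarrow> 0 * B" by (intro tendsto_intros S0)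
  ultimately show ?thesis
    by (intro Lim_null_comparison[of "\<lambda>k. gform (S k) (T k)" "\<lambda>k. sqrt (Re (gform (S k) (S k))) * B"]) auto
qed

lemma gform_convergent:
  assumes S: "approx f S" and T: "approx g T"
  shows "convergent (\<lambda>k. gform (S k) (T k))"
proof -
  note SA = approxD(1)[OF S] and TA = approxD(1)[OF T]
  obtain B1 where B1: "B1 \<ge> 0" "\<And>k. sqrt (Re (gform (S k) (S k))) \<le> B1" using approx_bounded[OF S] by blast
  obtain B2 where B2: "B2 \<ge> 0" "\<And>k. sqrt (Re (gform (T k) (T k))) \<le> B2" using approx_bounded[OF T] by blast
  have "Cauchy (\<lambda>k. gform (S k) (T k))"
  proof (rule CauchyI)
    fix \<epsilon> :: real assume \<epsilon>: "\<epsilon> > 0"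
    define \<delta> where "\<delta> = \<epsilon> / (2 * (B1 + B2 + 1))"
    have \<delta>: "\<delta> > 0" using B1 B2 \<epsilon> by (simp add: \<delta>_def)
    then obtain N M where N: "\<And>j k. j \<ge> N \<Longrightarrow> k \<ge> N \<Longrightarrow> Re (gform (S j - S k) (S j - S k)) < \<delta>\<^sup>2"
      and M: "\<And>j k. j \<ge> M \<Longrightarrow> k \<ge> M \<Longrightarrow> Re (gform (T j - T k) (T j - T k)) < \<delta>\<^sup>2"
      using S T unfolding approx_def by (meson zero_less_power)
    have "norm (gform (S j) (T j) - gform (S k) (T k)) < \<epsilon>" if "j \<ge> max N M" "k \<ge> max N M" for j k
    proof -
      have s: "sqrt (Re (gform (S j - S k) (S j - S k))) \<le> \<delta>"
        using N[of j k] that \<delta> by (intro real_le_lsqrt) auto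
      have t: "sqrt (Re (gform (T j - T k) (T j - T k))) \<le> \<delta>"
        using M[of j k] that \<delta> by (intro real_le_lsqrt) auto
      have "gform (S j) (T j) - gform (S k) (T k) = gform (S j) (T j - T k) + cnj (gform (T k) (S j - S k))"
        using gform_sym[OF SA TA, of j k] gform_sym[OF SA TA, of k k] by (simp add: gform_diff)
      also have "norm \<dots> \<le> cmod (gform (S j) (T j - T k)) + cmod (gform (T k) (S j - S k))"
        using norm_triangle_ineq[of "gform (S j) (T j - T k)" "cnj (gform (T k) (S j - S k))"] by simp
      also have "\<dots> \<le> B1 * \<delta> + B2 * \<delta>"
      proof (rule add_mono)
        show "cmod (gform (S j) (T j - T k)) \<le> B1 * \<delta>"
          by (rule order_trans[OF cmod_gform_le[OF SA G.D_diff[OF TA TA]] mult_mono[OF B1(2) t]])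
             (use B1 G.nonneg[OF G.D_diff[OF TA TA]] in auto)
        show "cmod (gform (T k) (S j - S k)) \<le> B2 * \<delta>"
          by (rule order_trans[OF cmod_gform_le[OF TA G.D_diff[OF SA SA]] mult_mono[OF B2(2) s]])
             (use B2 G.nonneg[OF G.D_diff[OF SA SA]] in auto)
      qed
      also have "\<dots> \<le> (B1 + B2 + 1) * \<delta>" using \<delta> by (simp add: algebra_simps)
      also have "\<dots> = \<epsilon> / 2"
      proof -
        have "b * (\<epsilon> / (2 * b)) = \<epsilon> / 2" if "b \<noteq> 0" for b :: real using that by simp
        moreover have "B1 + B2 + 1 \<noteq> 0" using B1(1) B2(1) by linarith
        ultimately show ?thesis unfolding \<delta>_def by blast
      qed
      also have "\<dots> < \<epsilon>" using \<epsilon> by simp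
      finally show ?thesis .
    qed
    then show "\<exists>N. \<forall>j\<ge>N. \<forall>k\<ge>N. norm (gform (S j) (T j) - gform (S k) (T k)) < \<epsilon>" by blast
  qed
  then show ?thesis by (rule Cauchy_convergent)
qed

end

lemma (in real_form) diff_commute: "f \<in> D \<Longrightarrow> g \<in> D \<Longrightarrow> q (f - g) (f - g) = q (g - f) (g - f)"
  using sym[of f g] by (simp add: diff_left diff_right D_diff)

context semibounded_operator
begin

abbreviation "FD \<equiv> form_domain A"

lemma form_domain_iff: "f \<in> FD \<longleftrightarrow> (\<exists>S. approx f S)"
  by (simp add: form_domain_def form_approx_iff)

lemma approx_diff:
  assumes "approx f S" "approx g T"
  shows "approx (f - g) (\<lambda>k. S k - T k)"
proof -
  have "(\<lambda>k. S k - T k) = (\<lambda>k. S k + ((-1) *\<^sub>C fst (T k), (-1) *\<^sub>C snd (T k)))"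
    by (simp add: fun_eq_iff prod_eq_iff scaleC_minus1)
  then show ?thesis
    using approx_lincomb(1)[OF assms(1) approx_lincomb(2)[OF assms(2,2), of "-1"]]
    by (simp add: scaleC_minus1)
qed

text \<open>Changing one argument at a time leaves two terms, each containing an approximating
  sequence of 0.\<close>

lemma gform_limit_unique:
  assumes "approx f S" "approx f S'" "approx g T" "approx g T'"
  shows "(\<lambda>k. gform (S k) (T k) - gform (S' k) (T' k)) \<longlonglongrightarrow> 0"
proof -
  note A = assms[THEN approxD(1)]
  have "(\<lambda>k. gform (S k - S' k) (T k)) \<longlonglongrightarrow> 0"
    by (rule gform_tendsto_0[OF _ assms(3)]) (use approx_diff[OF assms(1,2)] in simp)
  moreover have "(\<lambda>k. cnj (gform (T k - T' k) (S' k))) \<longlonglongrightarrow> cnj 0"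
    by (intro tendsto_cnj gform_tendsto_0[OF _ assms(2)]) (use approx_diff[OF assms(3,4)] in simp)
  ultimately have "(\<lambda>k. gform (S k - S' k) (T k) + cnj (gform (T k - T' k) (S' k))) \<longlonglongrightarrow> 0 + cnj 0"
    by (rule tendsto_add)
  moreover have "gform (S k - S' k) (T k) + cnj (gform (T k - T' k) (S' k)) = gform (S k) (T k) - gform (S' k) (T' k)" for k
  proof -
    have "gform (S k - S' k) (T k) = cnj (gform (T k) (S k - S' k))"
      by (rule gform_sym[OF G.D_diff[OF A(1,2)] A(3)])
    moreover have "cnj (gform (T k - T' k) (S' k)) = gform (S' k) (T k - T' k)"
      using gform_sym[OF A(2) G.D_diff[OF A(3,4)]] by simp
    ultimately show ?thesis
      using gform_sym[OF A(1) A(3), of k k] gform_sym[OF A(2) A(3), of k k] by (simp add: gform_diff)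
  qed
  ultimately show ?thesis by simp
qed

text \<open>The limit exists and depends on no choice of sequences, which justifies the definite
  description in \<open>form_of\<close>.\<close>

lemma form_of_tendsto:
  assumes S: "approx f S" and T: "approx g T"
  shows "(\<lambda>k. cinner (fst (S k)) (snd (T k))) \<longlonglongrightarrow> form_of A f g"
proof -
  have eq: "cinner (fst (S k)) (snd (T k)) = gform (S k) (T k) - of_real (1 - c) * cinner (fst (S k)) (fst (T k))"
    for S T :: "nat \<Rightarrow> 'h \<times> 'h" and k by (simp add: gform_def)
  obtain l where l: "(\<lambda>k. gform (S k) (T k)) \<longlonglongrightarrow> l" using gform_convergent[OF S T] convergentD by blast
  let ?l = "l - of_real (1 - c) * cinner f g"
  have lim: "(\<lambda>k. cinner (fst (S' k)) (snd (T' k))) \<longlonglongrightarrow> ?l" if S': "approx f S'" and T': "approx g T'" for S' T'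
  proof -
    have "(\<lambda>k. (gform (S' k) (T' k) - gform (S k) (T k)) + gform (S k) (T k)) \<longlonglongrightarrow> 0 + l"
      by (intro tendsto_add gform_limit_unique[OF S' S T' T] l)
    then have "(\<lambda>k. gform (S' k) (T' k)) \<longlonglongrightarrow> l" by simp
    then show ?thesis unfolding eq by (intro tendsto_intros approxD(2)[OF S'] approxD(2)[OF T'])
  qed
  have "form_of A f g = ?l"
    unfolding form_of_def form_approx_iff
  proof (rule the_equality)
    show "\<forall>S T. approx f S \<longrightarrow> approx g T \<longrightarrow> (\<lambda>k. cinner (fst (S k)) (snd (T k))) \<longlonglongrightarrow> ?l"
      using lim by blast
    fix l' assume "\<forall>S T. approx f S \<longrightarrow> approx g T \<longrightarrow> (\<lambda>k. cinner (fst (S k)) (snd (T k))) \<longlonglongrightarrow> l'"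
    then have "(\<lambda>k. cinner (fst (S k)) (snd (T k))) \<longlonglongrightarrow> l'" using S T by blast
    then show "l' = ?l" by (rule LIMSEQ_unique[OF _ lim[OF S T]])
  qed
  then show ?thesis using lim[OF S T] by simp
qed

text \<open>The closure of \<open>gform\<close>, that is, the inner product that makes the form
  domain a Hilbert space.\<close>

definition Q :: "'h \<Rightarrow> 'h \<Rightarrow> complex" where
  "Q f g = form_of A f g + of_real (1 - c) * cinner f g"

lemma Q_tendsto:
  assumes S: "approx f S" and T: "approx g T"
  shows "(\<lambda>k. gform (S k) (T k)) \<longlonglongrightarrow> Q f g"
  unfolding gform_def Q_def
  by (intro tendsto_intros form_of_tendsto[OF S T] approxD(2)[OF S] approxD(2)[OF T])

lemma csubspace_form_domain: "csubspace FD"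
  unfolding csubspace_def form_domain_iff
proof (intro conjI ballI allI)
  show "\<exists>S. approx 0 S" using approx_const[OF A_zero] by auto
next
  fix x y assume "x \<in> FD" "y \<in> FD"
  then show "\<exists>S. approx (x + y) S" unfolding form_domain_iff using approx_lincomb(1) by blast
next
  fix x a assume "x \<in> FD"
  then show "\<exists>S. approx (a *\<^sub>C x) S" unfolding form_domain_iff using approx_lincomb(2) by blast
qed

lemma form_of_add:
  assumes "f \<in> FD" "g \<in> FD" "h \<in> FD"
  shows "form_of A f (g + h) = form_of A f g + form_of A f h"
proof -
  obtain S T U where *: "approx f S" "approx g T" "approx h U" using assms unfolding form_domain_iff by blast
  have "(\<lambda>k. cinner (fst (S k)) (snd (T k + U k))) \<longlonglongrightarrow> form_of A f (g + h)"
    by (rule form_of_tendsto[OF *(1) approx_lincomb(1)[OF *(2,3)]])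
  moreover have "(\<lambda>k. cinner (fst (S k)) (snd (T k)) + cinner (fst (S k)) (snd (U k))) \<longlonglongrightarrow> form_of A f g + form_of A f h"
    by (intro tendsto_add form_of_tendsto *)
  ultimately show ?thesis by (simp add: cinner_add_right LIMSEQ_unique)
qed

lemma form_of_scaleC:
  assumes "f \<in> FD" "g \<in> FD"
  shows "form_of A f (a *\<^sub>C g) = a * form_of A f g"
proof -
  obtain S T where *: "approx f S" "approx g T" using assms unfolding form_domain_iff by blast
  have "(\<lambda>k. cinner (fst (S k)) (snd (a *\<^sub>C fst (T k), a *\<^sub>C snd (T k)))) \<longlonglongrightarrow> form_of A f (a *\<^sub>C g)"
    by (rule form_of_tendsto[OF *(1) approx_lincomb(2)[OF *(2,2)]])
  moreover have "(\<lambda>k. a * cinner (fst (S k)) (snd (T k))) \<longlonglongrightarrow> a * form_of A f g"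
    by (intro tendsto_mult tendsto_const form_of_tendsto *)
  ultimately show ?thesis by (simp add: cinner_scaleC_right LIMSEQ_unique)
qed

lemma form_of_sym:
  assumes "f \<in> FD" "g \<in> FD"
  shows "form_of A f g = cnj (form_of A g f)"
proof -
  obtain S T where *: "approx f S" "approx g T" using assms unfolding form_domain_iff by blast
  have "(\<lambda>k. cnj (cinner (fst (T k)) (snd (S k)))) \<longlonglongrightarrow> cnj (form_of A g f)"
    by (intro tendsto_cnj form_of_tendsto *)
  moreover have "cnj (cinner (fst (T k)) (snd (S k))) = cinner (fst (S k)) (snd (T k))" for k
    using A_symmetric[of "fst (S k)" "snd (S k)" "fst (T k)" "snd (T k)"]
      cinner_commute[of "snd (S k)" "fst (T k)"] approxD(1)[OF *(1)] approxD(1)[OF *(2)] by simp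
  ultimately show ?thesis using LIMSEQ_unique[OF form_of_tendsto[OF *]] by simp
qed

lemma Q_lower: "f \<in> FD \<Longrightarrow> (norm f)\<^sup>2 \<le> Re (Q f f)"
proof -
  assume "f \<in> FD"
  then obtain S where S: "approx f S" unfolding form_domain_iff by blast
  show ?thesis
  proof (rule LIMSEQ_le)
    show "(\<lambda>k. (norm (fst (S k)))\<^sup>2) \<longlonglongrightarrow> (norm f)\<^sup>2" by (intro tendsto_intros approxD(2)[OF S])
    show "(\<lambda>k. Re (gform (S k) (S k))) \<longlonglongrightarrow> Re (Q f f)" by (intro tendsto_Re Q_tendsto S)
  qed (use gform_lower[OF approxD(1)[OF S]] in blast)
qed

lemma real_form_Q: "real_form FD (\<lambda>f g. Re (Q f g))"
proof
  show sub: "subspace FD" by (rule csubspace_imp_subspace[OF csubspace_form_domain])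
  fix f g h a assume D: "f \<in> FD" "g \<in> FD" "h \<in> FD"
  have D': "f + g \<in> FD" "a *\<^sub>R f \<in> FD" using D sub by (auto simp: subspace_def)
  have sym: "Q x y = cnj (Q y x)" if "x \<in> FD" "y \<in> FD" for x y
    using form_of_sym[OF that] cinner_commute[of x y] by (simp add: Q_def)
  show "Re (Q f g) = Re (Q g f)" using sym[OF D(1,2)] by simp
  show "Re (Q (f + g) h) = Re (Q f h) + Re (Q g h)"
    using D D' by (simp add: sym[of _ h]) (simp add: Q_def form_of_add cinner_add_right algebra_simps)
  show "Re (Q (a *\<^sub>R f) g) = a * Re (Q f g)"
    using D D' form_of_scaleC[of g f "of_real a"]
    by (simp add: sym[of _ g]) (simp add: Q_def scaleC_of_real cinner_scaleC_right[of g "of_real a" f, unfolded scaleC_of_real] algebra_simps)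
  show "0 \<le> Re (Q f f)" using Q_lower[OF D(1)] zero_le_power2[of "norm f"] by linarith
qed

sublocale F: real_form FD "\<lambda>f g. Re (Q f g)" by (rule real_form_Q)

text \<open>The operator domain is a core: in the Cauchy estimate for \<open>S j - S k\<close> the
  index \<open>j\<close> tends to infinity while \<open>k\<close> stays fixed.\<close>

lemma Q_approx:
  assumes S: "approx f S" and \<epsilon>: "\<epsilon> > 0"
  shows "\<exists>N. \<forall>k\<ge>N. Re (Q (f - fst (S k)) (f - fst (S k))) \<le> \<epsilon>"
proof -
  obtain N where N: "\<And>j k. j \<ge> N \<Longrightarrow> k \<ge> N \<Longrightarrow> Re (gform (S j - S k) (S j - S k)) < \<epsilon>"
    using S \<epsilon> unfolding approx_def by meson
  have "Re (Q (f - fst (S k)) (f - fst (S k))) \<le> \<epsilon>" if k: "k \<ge> N" for k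
  proof -
    have ap: "approx (f - fst (S k)) (\<lambda>j. S j - S k)"
      by (rule approx_diff[OF S approx_const[OF approxD(1)[OF S]]])
    have "(\<lambda>j. Re (gform (S j - S k) (S j - S k))) \<longlonglongrightarrow> Re (Q (f - fst (S k)) (f - fst (S k)))"
      by (intro tendsto_Re Q_tendsto ap)
    then show ?thesis
      by (rule LIMSEQ_le_const2) (use N k less_imp_le in blast)
  qed
  then show ?thesis by blast
qed

lemma fst_A_form_domain: "p \<in> A \<Longrightarrow> fst p \<in> FD"
  using approx_const form_domain_iff by blast

lemma Q_graph: "p \<in> A \<Longrightarrow> Q (fst p) (fst p) = gform p p"
  using Q_tendsto[OF approx_const approx_const, of p p] by (simp add: LIMSEQ_const_iff)

text \<open>Each \<open>X j\<close> is replaced by a vector of the operator domain within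
  \<open>inverse (Suc j)\<close> in the form norm \<nu>. The new sequence is Cauchy in that norm,
  hence an approximating sequence for its own norm limit, and \<open>X\<close> has the same
  limit.\<close>

lemma form_complete_Q: "form_complete FD (\<lambda>f g. Re (Q f g))"
  unfolding form_complete_def
proof (intro allI impI)
  fix X :: "nat \<Rightarrow> 'h"
  assume XD: "range X \<subseteq> FD"
    and C: "\<forall>e>0. \<exists>N. \<forall>i\<ge>N. \<forall>j\<ge>N. Re (Q (X i - X j) (X i - X j)) < e"
  define \<nu> where "\<nu> f = sqrt (Re (Q f f))" for f
  have X: "X j \<in> FD" for j using XD by auto
  have tri: "\<nu> (f - h) \<le> \<nu> (f - g) + \<nu> (g - h)" if "f \<in> FD" "g \<in> FD" "h \<in> FD" for f g h
    using F.triangle[OF F.D_diff[OF that(1,2)] F.D_diff[OF that(2,3)]] by (simp add: \<nu>_def)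
  have sym: "\<nu> (f - g) = \<nu> (g - f)" if "f \<in> FD" "g \<in> FD" for f g
    unfolding \<nu>_def using F.diff_commute[OF that] by simp
  have pos: "\<nu> f \<ge> 0" if "f \<in> FD" for f using F.nonneg[OF that] by (simp add: \<nu>_def)
  have "\<exists>p\<in>A. \<nu> (X j - fst p) \<le> inverse (real (Suc j))" for j
  proof -
    obtain S where S: "approx (X j) S" using X form_domain_iff by blast
    have "inverse (real (Suc j)) ^ 2 > 0" by simp
    then obtain N where "Re (Q (X j - fst (S N)) (X j - fst (S N))) \<le> (inverse (real (Suc j)))\<^sup>2"
      using Q_approx[OF S] by blast
    then have "\<nu> (X j - fst (S N)) \<le> inverse (real (Suc j))"
      unfolding \<nu>_def by (intro real_le_lsqrt) auto
    then show ?thesis using approxD(1)[OF S] by blast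
  qed
  then obtain p where p: "\<And>j. p j \<in> A" "\<And>j. \<nu> (X j - fst (p j)) \<le> inverse (real (Suc j))" by metis
  note pD = fst_A_form_domain[OF p(1)]
  have small: "\<exists>N. \<forall>j\<ge>N. inverse (real (Suc j)) < e" if e: "e > 0" for e
  proof -
    obtain N where "inverse (real (Suc N)) < e" using reals_Archimedean[OF e] by blast
    moreover have "inverse (real (Suc j)) \<le> inverse (real (Suc N))" if "j \<ge> N" for j
      using that by (intro le_imp_inverse_le) auto
    ultimately have "inverse (real (Suc j)) < e" if "j \<ge> N" for j
      using that by (meson le_less_trans)
    then show ?thesis by blast
  qed
  have pC: "\<exists>N. \<forall>i\<ge>N. \<forall>j\<ge>N. \<nu> (fst (p i) - fst (p j)) < e" if e: "e > 0" for e
  proof -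
    obtain N where N: "\<And>j. j \<ge> N \<Longrightarrow> inverse (real (Suc j)) < e / 3" using small[of "e/3"] e by auto
    obtain M where M: "\<And>i j. i \<ge> M \<Longrightarrow> j \<ge> M \<Longrightarrow> Re (Q (X i - X j) (X i - X j)) < (e/3)\<^sup>2"
      using C[rule_format, of "(e/3)\<^sup>2"] e by auto
    have "\<nu> (fst (p i) - fst (p j)) < e" if "i \<ge> max N M" "j \<ge> max N M" for i j
    proof -
      have "\<nu> (X i - X j) < e / 3" unfolding \<nu>_def using M[of i j] that e by (intro real_less_lsqrt) auto
      moreover have "\<nu> (fst (p i) - X i) < e / 3" using p(2)[of i] N[of i] that sym[OF X pD, of i i] by auto
      moreover have "\<nu> (X j - fst (p j)) < e / 3" using p(2)[of j] N[of j] that by auto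
      ultimately show ?thesis
        using tri[of "fst (p i)" "X i" "fst (p j)"] tri[of "X i" "X j" "fst (p j)"] X pD by fastforce
    qed
    then show ?thesis by blast
  qed
  have nu_lower: "norm f \<le> \<nu> f" if "f \<in> FD" for f
    unfolding \<nu>_def using Q_lower[OF that] by (rule real_le_rsqrt)
  have "Cauchy (\<lambda>j. fst (p j))"
    unfolding Cauchy_iff using pC nu_lower[OF F.D_diff[OF pD pD]] by (meson le_less_trans)
  then obtain f where f: "(\<lambda>j. fst (p j)) \<longlonglongrightarrow> f" using Cauchy_convergent_iff convergentD by blast
  have ap: "approx f p"
    unfolding approx_def
  proof (intro conjI allI impI f)
    show "range p \<subseteq> A" using p(1) by blast
    fix e :: real assume e: "e > 0"
    then obtain N where N: "\<And>i j. i \<ge> N \<Longrightarrow> j \<ge> N \<Longrightarrow> \<nu> (fst (p i) - fst (p j)) < sqrt e"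
      using pC[of "sqrt e"] by auto
    have "Re (gform (p i - p j) (p i - p j)) < e" if "i \<ge> N" "j \<ge> N" for i j
      using N[OF that] Q_graph[OF G.D_diff[OF p(1) p(1)], of i j] by (simp add: \<nu>_def)
    then show "\<exists>N. \<forall>j\<ge>N. \<forall>k\<ge>N. Re (gform (p j - p k) (p j - p k)) < e" by blast
  qed
  have fD: "f \<in> FD" using ap form_domain_iff by blast
  have "(\<lambda>j. Re (Q (X j - f) (X j - f))) \<longlonglongrightarrow> 0"
  proof (rule LIMSEQ_I)
    fix e :: real assume e: "e > 0"
    define d where "d = sqrt e / 3"
    have d: "d > 0" using e by (simp add: d_def)
    obtain N where N: "\<And>j. j \<ge> N \<Longrightarrow> inverse (real (Suc j)) < d" using small[OF d] by blast
    obtain M where M: "\<And>k. k \<ge> M \<Longrightarrow> Re (Q (f - fst (p k)) (f - fst (p k))) \<le> d\<^sup>2"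
      using Q_approx[OF ap, of "d\<^sup>2"] d by auto
    have "Re (Q (X j - f) (X j - f)) < e" if j: "j \<ge> max N M" for j
    proof -
      have "\<nu> (fst (p j) - f) \<le> d"
        using M[of j] j d sym[OF fD pD, of j] unfolding \<nu>_def by (simp add: real_le_lsqrt)
      moreover have "\<nu> (X j - fst (p j)) < d" using p(2)[of j] N[of j] j by auto
      ultimately have "\<nu> (X j - f) < sqrt e"
        using tri[OF X pD fD, of j j] d unfolding d_def by linarith
      then show ?thesis by (simp add: \<nu>_def)
    qed
    then show "\<exists>no. \<forall>n\<ge>no. norm (Re (Q (X n - f) (X n - f)) - 0) < e"
      using F.nonneg[OF F.D_diff[OF X fD]] by (intro exI[of _ "max N M"]) simp
  qed
  then show "\<exists>f\<in>FD. (\<lambda>j. Re (Q (X j - f) (X j - f))) \<longlonglongrightarrow> 0" using fD by blast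
qed

end

section \<open>Uniform boundedness\<close>

text \<open>Gliding hump: a convergent series of multiples of vectors on which the seminorms are
  large yields a vector at which they are unbounded.\<close>

lemma (in real_form) uniform_boundedness:
  fixes p :: "nat \<Rightarrow> 'h \<Rightarrow> real"
  assumes complete: "form_complete D q"
    and tri: "\<And>R f g. f \<in> D \<Longrightarrow> g \<in> D \<Longrightarrow> p R (f + g) \<le> p R f + p R g"
    and scale: "\<And>R f a. f \<in> D \<Longrightarrow> p R (a *\<^sub>R f) = \<bar>a\<bar> * p R f"
    and bound: "\<And>R. \<exists>a. \<forall>f\<in>D. p R f \<le> a * sqrt (q f f)"
    and ptwise: "\<And>f. f \<in> D \<Longrightarrow> \<exists>C. \<forall>R. p R f \<le> C"
  shows "\<exists>C. \<forall>R. \<forall>f\<in>D. sqrt (q f f) \<le> 1 \<longrightarrow> p R f \<le> C"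
proof (rule ccontr)
  assume "\<not> ?thesis"
  then have big: "\<exists>R. \<exists>f\<in>D. sqrt (q f f) \<le> 1 \<and> C < p R f" for C by (auto simp: not_le)
  define \<nu> where "\<nu> f = sqrt (q f f)" for f
  have \<nu>_nonneg: "f \<in> D \<Longrightarrow> \<nu> f \<ge> 0" for f using nonneg by (simp add: \<nu>_def)
  define s where "s R = Sup (p R ` {f\<in>D. \<nu> f \<le> 1})" for R
  have bdd: "bdd_above (p R ` {f\<in>D. \<nu> f \<le> 1})" for R
  proof -
    obtain a where a: "\<And>f. f \<in> D \<Longrightarrow> p R f \<le> a * \<nu> f" using bound[of R] by (auto simp: \<nu>_def)
    have "p R f \<le> \<bar>a\<bar>" if "f \<in> D" "\<nu> f \<le> 1" for f
    proof -
      have "a * \<nu> f \<le> \<bar>a\<bar> * 1" using that \<nu>_nonneg[OF that(1)] by (intro mult_mono) auto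
      then show ?thesis using a[OF that(1)] by simp
    qed
    then show ?thesis by (auto intro!: bdd_aboveI)
  qed
  have s_upper: "p R f \<le> s R" if "f \<in> D" "\<nu> f \<le> 1" for R f
    unfolding s_def using that by (intro cSup_upper bdd) auto
  have \<nu>0: "\<nu> 0 = 0" using scale_left[of 0 0 0] D_zero by (simp add: \<nu>_def)
  have p0: "p R 0 = 0" for R using scale[OF D_zero, of R 0] by simp
  have s_nonneg: "s R \<ge> 0" for R using s_upper[OF D_zero, of R] \<nu>0 p0 by simp
  have s_bound: "p R f \<le> s R * \<nu> f" if f: "f \<in> D" for R f
  proof (cases "\<nu> f = 0")
    case True
    obtain a where "p R f \<le> a * sqrt (q f f)" using bound[of R] f by blast
    then show ?thesis using True by (simp add: \<nu>_def)
  next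
    case False
    then have pos: "\<nu> f > 0" using \<nu>_nonneg[OF f] by simp
    have D': "(1 / \<nu> f) *\<^sub>R f \<in> D" by (rule D_scale[OF f])
    have "q ((1 / \<nu> f) *\<^sub>R f) ((1 / \<nu> f) *\<^sub>R f) = 1"
      using f pos nonneg[OF f] by (simp add: scale_left scale_right D_scale \<nu>_def)
    then have "\<nu> ((1 / \<nu> f) *\<^sub>R f) \<le> 1" by (simp add: \<nu>_def)
    from s_upper[OF D' this, of R] show ?thesis
      using pos scale[OF f, of R "1 / \<nu> f"] by (simp add: field_simps)
  qed
  \<comment> \<open>Seminorms of size \<open>4 ^ n\<close> win against steps of length at most
    \<open>(1/3) ^ n\<close>.\<close>
  have "\<exists>R. s R > 4 ^ n" for n
  proof -
    obtain R f where "f \<in> D" "\<nu> f \<le> 1" "4 ^ n < p R f" using big[of "4 ^ n"] by (auto simp: \<nu>_def)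
    then show ?thesis using s_upper[of f R] by (intro exI[of _ R]) linarith
  qed
  then obtain R where R: "\<And>n::nat. s (R n) > 4 ^ n" by metis
  \<comment> \<open>The n-th step secures 3 / 4 and all later ones together can destroy at most 1 /
    2 of \<open>s (R n) * (1/3)^n\<close>, which leaves 1 / 4 for \<open>grow\<close>.\<close>
  have "\<exists>f\<in>D. \<nu> f \<le> 1 \<and> p (R n) f > 3 / 4 * s (R n)" for n
  proof -
    have "0 < s (R n)" using order.strict_trans[OF zero_less_power R[of n]] by simp
    then have lt: "3 / 4 * s (R n) < Sup (p (R n) ` {f\<in>D. \<nu> f \<le> 1})" by (fold s_def) simp
    have "p (R n) ` {f\<in>D. \<nu> f \<le> 1} \<noteq> {}" using D_zero \<nu>0 by force
    from iffD1[OF less_cSup_iff[OF this bdd] lt] show ?thesis by blast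
  qed
  then obtain h where h: "\<And>n. h n \<in> D" "\<And>n. \<nu> (h n) \<le> 1" "\<And>n. p (R n) (h n) > 3 / 4 * s (R n)" by metis
  \<comment> \<open>The sign of each step is chosen so that the vector reached so far cannot cancel
    the effect of the step on the seminorm \<open>p (R n)\<close>.\<close>
  define nxt where "nxt n x = (if p (R n) (x + (1/3)^n *\<^sub>R h n) \<ge> p (R n) (x - (1/3)^n *\<^sub>R h n)
    then x + (1/3)^n *\<^sub>R h n else x - (1/3)^n *\<^sub>R h n)" for n :: nat and x
  define x where "x = rec_nat (0::'h) nxt"
  have x0: "x 0 = 0" and xS: "x (Suc n) = nxt n (x n)" for n by (simp_all add: x_def)
  have xD: "x n \<in> D" for n
    by (induction n) (auto simp: x0 xS nxt_def D_zero D_add D_diff D_scale h(1))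
  have step: "\<nu> (x (Suc n) - x n) \<le> (1/3)^n" for n
  proof -
    have "q (x (Suc n) - x n) (x (Suc n) - x n) = ((1/3)^n)\<^sup>2 * q (h n) (h n)"
      using h(1)[of n] D_scale[OF h(1)[of n]]
      by (auto simp: xS nxt_def scale_left scale_right minus_left minus_right D_scale power2_eq_square
          subspace_neg[OF subspace_D])
    then have "\<nu> (x (Suc n) - x n) = (1/3)^n * \<nu> (h n)" by (simp add: \<nu>_def real_sqrt_mult)
    then show ?thesis using h(2)[of n] by (simp add: mult_left_le)
  qed
  have large: "p (R n) (x (Suc n)) \<ge> 3 / 4 * s (R n) * (1/3)^n" for n
  proof -
    \<comment> \<open>The two candidates differ by twice the step, so by the triangle inequality the
      larger of their seminorms is at least that of the step.\<close>
    let ?a = "x n + (1/3)^n *\<^sub>R h n" and ?b = "x n - (1/3)^n *\<^sub>R h n"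
    have D: "?a \<in> D" "?b \<in> D" by (auto intro: D_add D_diff D_scale xD h(1))
    have "2 * ((1/3)^n * p (R n) (h n)) = p (R n) ((2 * (1/3)^n) *\<^sub>R h n)"
      using scale[OF h(1), of "R n" "2 * (1/3)^n" n] by (simp add: abs_mult)
    also have "(2 * (1/3)^n) *\<^sub>R h n = ?a + (-1) *\<^sub>R ?b" by (simp add: scaleR_2[symmetric])
    also have "p (R n) \<dots> \<le> p (R n) ?a + p (R n) ((-1) *\<^sub>R ?b)" by (rule tri[OF D(1) D_scale[OF D(2)]])
    also have "p (R n) ((-1) *\<^sub>R ?b) = p (R n) ?b" using scale[OF D(2), of "R n" "-1"] by simp
    finally have "(1/3)^n * p (R n) (h n) \<le> p (R n) (x (Suc n))" by (auto simp: xS nxt_def)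
    moreover have "(1/3)^n * (3 / 4 * s (R n)) \<le> (1/3)^n * p (R n) (h n)"
      using h(3)[of n] by (intro mult_left_mono) auto
    moreover have "3 / 4 * s (R n) * (1/3)^n = (1/3)^n * (3 / 4 * s (R n))" by (rule mult.commute)
    ultimately show ?thesis by linarith
  qed
  \<comment> \<open>The constant 3 / 2 is the sum of the geometric series with ratio 1 / 3.\<close>
  have tail: "\<nu> (x (n + k) - x n) \<le> 3 / 2 * (1/3)^n" for n k
  proof -
    have "\<nu> (x (n + k) - x n) \<le> 3 / 2 * ((1/3)^n - (1/3)^(n + k))"
    proof (induction k)
      case 0
      then show ?case by (simp add: \<nu>0)
    next
      case (Suc k)
      have "x (n + Suc k) - x n = (x (Suc (n + k)) - x (n + k)) + (x (n + k) - x n)" by simp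
      then have "\<nu> (x (n + Suc k) - x n) \<le> \<nu> (x (Suc (n + k)) - x (n + k)) + \<nu> (x (n + k) - x n)"
        unfolding \<nu>_def using triangle[OF D_diff[OF xD xD] D_diff[OF xD xD]] by metis
      also have "\<dots> \<le> (1/3)^(n + k) + 3 / 2 * ((1/3)^n - (1/3)^(n + k))"
        by (intro add_mono step Suc)
      also have "\<dots> = 3 / 2 * ((1/3)^n - (1/3)^(n + Suc k))" by (simp add: algebra_simps)
      finally show ?case .
    qed
    also have "\<dots> \<le> 3 / 2 * (1/3)^n" by simp
    finally show ?thesis .
  qed
  have "\<exists>N. \<forall>i\<ge>N. \<forall>j\<ge>N. q (x i - x j) (x i - x j) < e" if e: "e > 0" for e
  proof -
    obtain N where N: "(1/3::real)^N < sqrt e / 4" using real_arch_pow_inv[of "sqrt e / 4" "1/3"] e by auto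
    have "q (x i - x j) (x i - x j) < e" if "i \<ge> N" "j \<ge> N" for i j
    proof -
      have i: "\<nu> (x i - x N) \<le> 3 / 2 * (1/3)^N" and j: "\<nu> (x j - x N) \<le> 3 / 2 * (1/3)^N"
        using tail[of N "i - N"] tail[of N "j - N"] that by simp_all
      have "x i - x j = (x i - x N) + (x N - x j)" by simp
      then have "\<nu> (x i - x j) \<le> \<nu> (x i - x N) + \<nu> (x N - x j)"
        unfolding \<nu>_def using triangle[OF D_diff[OF xD xD] D_diff[OF xD xD]] by metis
      moreover have "\<nu> (x N - x j) = \<nu> (x j - x N)"
        unfolding \<nu>_def using diff_commute[OF xD xD] by simp
      moreover have "(0::real) \<le> (1/3)^N" by simp
      ultimately have "\<nu> (x i - x j) < sqrt e" using i j N by linarith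
      then show ?thesis by (simp add: \<nu>_def)
    qed
    then show ?thesis by blast
  qed
  then obtain y where y: "y \<in> D" "(\<lambda>j. q (x j - y) (x j - y)) \<longlonglongrightarrow> 0"
    using complete[unfolded form_complete_def, rule_format, of x] xD by blast
  have close: "\<nu> (x (Suc n) - y) \<le> 1 / 2 * (1/3)^n" for n
  proof -
    have lim: "(\<lambda>k. 3 / 2 * (1/3)^Suc n + \<nu> (x (Suc n + k) - y)) \<longlonglongrightarrow> 3 / 2 * (1/3)^Suc n + sqrt 0"
      unfolding \<nu>_def using LIMSEQ_ignore_initial_segment[OF y(2), of "Suc n"]
      by (intro tendsto_intros) (simp add: add.commute)
    have "\<nu> (x (Suc n) - y) \<le> 3 / 2 * (1/3)^Suc n + \<nu> (x (Suc n + k) - y)" for k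
    proof -
      have "x (Suc n) - y = (x (Suc n) - x (Suc n + k)) + (x (Suc n + k) - y)" by simp
      then have "\<nu> (x (Suc n) - y) \<le> \<nu> (x (Suc n) - x (Suc n + k)) + \<nu> (x (Suc n + k) - y)"
        unfolding \<nu>_def using triangle[OF D_diff[OF xD xD] D_diff[OF xD y(1)]] by metis
      moreover have "\<nu> (x (Suc n) - x (Suc n + k)) = \<nu> (x (Suc n + k) - x (Suc n))"
        unfolding \<nu>_def using diff_commute[OF xD xD] by simp
      ultimately show ?thesis using tail[of "Suc n" k] by linarith
    qed
    then have "\<nu> (x (Suc n) - y) \<le> 3 / 2 * (1/3)^Suc n + sqrt 0"
      by (intro LIMSEQ_le_const[OF lim]) blast
    then show ?thesis by simp
  qed
  have grow: "p (R n) y \<ge> 1 / 4 * (4/3)^n" for n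
  proof -
    have "x (Suc n) = y + (x (Suc n) - y)" by simp
    then have "p (R n) (x (Suc n)) \<le> p (R n) y + p (R n) (x (Suc n) - y)"
      using tri[OF y(1) D_diff[OF xD y(1)]] by metis
    moreover have "p (R n) (x (Suc n) - y) \<le> s (R n) * (1 / 2 * (1/3)^n)"
      using s_bound[OF D_diff[OF xD y(1)], of "R n" "Suc n"] mult_left_mono[OF close[of n] s_nonneg[of "R n"]] by linarith
    ultimately have "1 / 4 * (s (R n) * (1/3)^n) \<le> p (R n) y" using large[of n] by (simp add: algebra_simps)
    moreover have "4 ^ n * (1/3)^n \<le> s (R n) * (1/3)^n" using R[of n] by (intro mult_right_mono) auto
    moreover have "(4/3::real)^n = 4 ^ n * (1/3)^n" by (simp add: power_divide)
    ultimately show ?thesis by linarith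
  qed
  obtain C where C: "\<And>R. p R y \<le> C" using ptwise[OF y(1)] by blast
  obtain n where "4 * C < (4/3::real)^n" using real_arch_pow[of "4/3" "4 * C"] by auto
  then show False using grow[of n] C[of "R n"] by linarith
qed

section \<open>Test functions\<close>

text \<open>Integration by parts exchanges one factor of \<open>s\<close> for one factor of the
  polynomial that vanishes at both end points. The derivative brings in other polynomial factors, so
  the induction runs over all \<open>p\<close>.\<close>

lemma bump_Fourier_decay:
  fixes p :: "real poly" and r :: real
  assumes r: "r > 0"
  shows "\<exists>C. \<forall>s. \<bar>s\<bar> ^ N * cmod (\<integral>t. indicator {-r..r} t *\<^sub>R (of_real (poly (p * [:r\<^sup>2, 0, -1:] ^ N) t) * cis (- (s * t))) \<partial>lborel) \<le> C"
proof (induction N arbitrary: p)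
  case 0
  let ?C = "\<integral>t. \<bar>indicator {-r..r} t * poly p t\<bar> \<partial>lborel"
  have "cmod (\<integral>t. indicator {-r..r} t *\<^sub>R (of_real (poly p t) * cis (- (s * t))) \<partial>lborel) \<le> ?C" for s
  proof -
    have "cmod (\<integral>t. indicator {-r..r} t *\<^sub>R (of_real (poly p t) * cis (- (s * t))) \<partial>lborel)
        \<le> (\<integral>t. cmod (indicator {-r..r} t *\<^sub>R (of_real (poly p t) * cis (- (s * t)))) \<partial>lborel)"
      by (rule integral_norm_bound)
    also have "\<dots> = ?C" by (simp add: norm_mult abs_mult)
    finally show ?thesis .
  qed
  then show ?case by auto
next
  case (Suc N)
  define w where "w = [:r\<^sup>2, 0, -1:]"
  \<comment> \<open>Chosen so that the derivative of \<open>p * w ^ Suc N\<close> is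
    \<open>p1 * w ^ N\<close>.\<close>
  define p1 where "p1 = pderiv p * w + smult (of_nat (Suc N)) (p * pderiv w)"
  obtain C where C: "\<And>s. \<bar>s\<bar> ^ N * cmod (\<integral>t. indicator {-r..r} t *\<^sub>R (of_real (poly (p1 * w ^ N) t) * cis (- (s * t))) \<partial>lborel) \<le> C"
    using Suc[of p1] unfolding w_def by blast
  have pd: "pderiv (p * w ^ Suc N) = p1 * w ^ N"
    unfolding pderiv_mult pderiv_power_Suc p1_def by (simp add: algebra_simps)
  have wr: "poly w r = 0" "poly w (- r) = 0" by (simp_all add: w_def power2_eq_square)
  have "\<bar>s\<bar> ^ Suc N * cmod (\<integral>t. indicator {-r..r} t *\<^sub>R (of_real (poly (p * w ^ Suc N) t) * cis (- (s * t))) \<partial>lborel) \<le> C" for s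
  proof -
    let ?G = "\<lambda>t. complex_of_real (poly (p * w ^ Suc N) t) * cis (- (s * t))"
    let ?H = "\<lambda>t. complex_of_real (poly (p1 * w ^ N) t) * cis (- (s * t))"
    have cis_deriv: "((\<lambda>t. cis (- (s * t))) has_vector_derivative (- \<i> * of_real s * cis (- (s * t)))) (at t within {-r..r})" for t
    proof -
      have "((\<lambda>z. exp (\<i> * of_real (- s) * z)) has_field_derivative (\<i> * of_real (- s)) * exp (\<i> * of_real (- s) * of_real t)) (at (of_real t))"
        by (auto intro!: derivative_eq_intros)
      from has_vector_derivative_real_field[OF this, of "{-r..r}"]
      show ?thesis by (simp add: cis_conv_exp mult_ac)
    qed
    have poly_deriv: "((\<lambda>t. complex_of_real (poly (p * w ^ Suc N) t)) has_vector_derivative of_real (poly (p1 * w ^ N) t)) (at t within {-r..r})" for t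
    proof -
      have "(poly (p * w ^ Suc N) has_real_derivative poly (p1 * w ^ N) t) (at t within {-r..r})"
        unfolding pd[symmetric] by (rule has_field_derivative_at_within[OF poly_DERIV])
      then have "(poly (p * w ^ Suc N) has_vector_derivative poly (p1 * w ^ N) t) (at t within {-r..r})"
        by (simp only: has_real_derivative_iff_has_vector_derivative)
      from bounded_linear.has_vector_derivative[OF bounded_linear_of_real this] show ?thesis .
    qed
    have der: "(?G has_vector_derivative (?H t - \<i> * of_real s * ?G t)) (at t within {-r..r})" for t
      using has_vector_derivative_mult[OF poly_deriv cis_deriv, of t] by (simp add: algebra_simps)
    have cont: "continuous_on {-r..r} ?G" "continuous_on {-r..r} ?H"
      by (intro continuous_intros continuous_on_cis)+
    have int: "integrable lborel (\<lambda>t. indicator {-r..r} t *\<^sub>R ?G t)" "integrable lborel (\<lambda>t. indicator {-r..r} t *\<^sub>R ?H t)"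
      using borel_integrable_compact[OF compact_Icc cont(1)] borel_integrable_compact[OF compact_Icc cont(2)] by auto
    have "(\<integral>t. indicator {-r..r} t *\<^sub>R (?H t - \<i> * of_real s * ?G t) \<partial>lborel) = ?G r - ?G (- r)"
      by (rule integral_FTC_Icc) (use r der cont in \<open>auto intro!: continuous_intros\<close>)
    also have "\<dots> = 0" by (simp add: wr)
    finally have "(\<integral>t. indicator {-r..r} t *\<^sub>R ?H t \<partial>lborel) = \<i> * of_real s * (\<integral>t. indicator {-r..r} t *\<^sub>R ?G t \<partial>lborel)"
      using int by (simp add: scaleR_diff_right mult_scaleR_right[symmetric] del: mult_scaleR_right)
    then have "\<bar>s\<bar> * cmod (\<integral>t. indicator {-r..r} t *\<^sub>R ?G t \<partial>lborel) = cmod (\<integral>t. indicator {-r..r} t *\<^sub>R ?H t \<partial>lborel)"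
      by (simp add: norm_mult)
    then show ?thesis using C[of s] by (simp only: power_Suc2 mult.assoc)
  qed
  then show ?case unfolding w_def by blast
qed

text \<open>A bump of finite smoothness. Its Fourier integral decays like the N-th inverse power of
  the frequency, which suffices for Sobolev order up to \<open>N - 1\<close> and needs only
  polynomials.\<close>

definition bump1 :: "real \<Rightarrow> nat \<Rightarrow> real \<Rightarrow> real" where
  "bump1 r N t = indicator {-r..r} t * (r\<^sup>2 - t\<^sup>2) ^ N"

lemma borel_measurable_bump1 [measurable]: "bump1 r N \<in> borel_measurable borel"
  unfolding bump1_def[abs_def] by measurable

lemma bump1_bounds: "r > 0 \<Longrightarrow> 0 \<le> bump1 r N t" "r > 0 \<Longrightarrow> bump1 r N t \<le> (r\<^sup>2) ^ N"
  "\<bar>t\<bar> < r \<Longrightarrow> 0 < bump1 r N t" "\<bar>t\<bar> > r \<Longrightarrow> bump1 r N t = 0"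
proof -
  have sq: "t\<^sup>2 \<le> r\<^sup>2" if "r > 0" "t \<in> {-r..r}" using that by (auto intro!: abs_le_square_iff[THEN iffD1])
  show "0 \<le> bump1 r N t" if "r > 0" using sq[OF that] by (auto simp: bump1_def indicator_def)
  show "bump1 r N t \<le> (r\<^sup>2) ^ N" if "r > 0"
    using sq[OF that] by (auto simp: bump1_def indicator_def intro!: power_mono)
  show "0 < bump1 r N t" if "\<bar>t\<bar> < r"
    using that power_strict_mono[of "\<bar>t\<bar>" r 2] by (auto simp: bump1_def indicator_def abs_less_iff)
  show "bump1 r N t = 0" if "\<bar>t\<bar> > r" using that by (auto simp: bump1_def indicator_def)
qed

lemma integrable_bump1: "r > 0 \<Longrightarrow> integrable lborel (\<lambda>t. of_real (bump1 r N t) * cis (- (s * t)))"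
proof -
  assume r: "r > 0"
  show ?thesis
  proof (rule Bochner_Integration.integrable_bound)
    show "integrable lborel (\<lambda>t. (r\<^sup>2) ^ N * indicator {-r..r} t)"
      using r by (intro integrable_mult_right integrable_real_indicator) auto
    show "AE t in lborel. cmod (of_real (bump1 r N t) * cis (- (s * t))) \<le> norm ((r\<^sup>2) ^ N * indicator {-r..r} t)"
      using bump1_bounds(1,2)[OF r, of N] bump1_bounds(4)[of r] by (auto simp: norm_mult indicator_def abs_le_iff not_le)
  qed measurable
qed

definition bump1_hat :: "real \<Rightarrow> nat \<Rightarrow> real \<Rightarrow> complex" where
  "bump1_hat r N s = (\<integral>t. of_real (bump1 r N t) * cis (- (s * t)) \<partial>lborel)"

lemma borel_measurable_bump1_hat [measurable]: "bump1_hat r N \<in> borel_measurable borel"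
  unfolding bump1_hat_def[abs_def] by (rule lborel.borel_measurable_lebesgue_integral) measurable

lemma bump1_hat_decay:
  assumes r: "r > 0"
  shows "\<exists>C. \<forall>s. (1 + s\<^sup>2) ^ N * (cmod (bump1_hat r N s))\<^sup>2 \<le> C"
proof -
  have eq: "bump1_hat r N s = (\<integral>t. indicator {-r..r} t *\<^sub>R (of_real (poly (1 * [:r\<^sup>2, 0, -1:] ^ N) t) * cis (- (s * t))) \<partial>lborel)" for s
    unfolding bump1_hat_def
    by (rule Bochner_Integration.integral_cong) (auto simp: bump1_def indicator_def poly_power power2_eq_square)
  \<comment> \<open>All factors are counted into the polynomial \<open>p\<close>, so that the case
    of exponent 0 gives the bound used for small \<open>s\<close>.\<close>
  have eq0: "bump1_hat r N s = (\<integral>t. indicator {-r..r} t *\<^sub>R (of_real (poly ([:r\<^sup>2, 0, -1:] ^ N * [:r\<^sup>2, 0, -1:] ^ 0) t) * cis (- (s * t))) \<partial>lborel)" for s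
    unfolding eq by simp
  obtain C1 where C1: "\<And>s. \<bar>s\<bar> ^ N * cmod (bump1_hat r N s) \<le> C1"
    using bump_Fourier_decay[OF r, of N 1] unfolding eq by blast
  obtain C0 where C0: "\<And>s. cmod (bump1_hat r N s) \<le> C0"
    using bump_Fourier_decay[OF r, of 0 "[:r\<^sup>2, 0, -1:] ^ N"] unfolding eq0 by auto
  have "(1 + s\<^sup>2) ^ N * (cmod (bump1_hat r N s))\<^sup>2 \<le> 2 ^ N * (C0\<^sup>2 + C1\<^sup>2)" for s
  proof (cases "\<bar>s\<bar> \<le> 1")
    case True
    then have "s\<^sup>2 \<le> 1" by (simp add: abs_square_le_1)
    then have "(1 + s\<^sup>2) ^ N * (cmod (bump1_hat r N s))\<^sup>2 \<le> 2 ^ N * C0\<^sup>2"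
      using C0[of s] by (intro mult_mono power_mono) auto
    also have "\<dots> \<le> 2 ^ N * (C0\<^sup>2 + C1\<^sup>2)" by simp
    finally show ?thesis .
  next
    case False
    then have "1 \<le> s\<^sup>2" using abs_square_le_1[of s] abs_le_square_iff[of 1 s] by simp
    then have "(1 + s\<^sup>2) ^ N \<le> (2 * s\<^sup>2) ^ N" by (intro power_mono) auto
    then have "(1 + s\<^sup>2) ^ N * (cmod (bump1_hat r N s))\<^sup>2 \<le> (2 * s\<^sup>2) ^ N * (cmod (bump1_hat r N s))\<^sup>2"
      by (rule mult_right_mono) simp
    also have "\<dots> = 2 ^ N * (\<bar>s\<bar> ^ N * cmod (bump1_hat r N s))\<^sup>2"
      by (simp add: power_mult_distrib power_mult[symmetric] mult.commute[of 2] power_even_abs)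
    also have "\<dots> \<le> 2 ^ N * C1\<^sup>2" using C1[of s] by (intro mult_left_mono power_mono) auto
    also have "\<dots> \<le> 2 ^ N * (C0\<^sup>2 + C1\<^sup>2)" by simp
    finally show ?thesis .
  qed
  then show ?thesis by blast
qed

text \<open>Peetre's inequality compares the weight at a frequency with the weight at the frequency
  shifted by \<open>k\<close>, as modulation requires.\<close>

lemma Peetre_real: "1 + x\<^sup>2 \<le> 2 * (1 + k\<^sup>2) * (1 + (x - k)\<^sup>2)" for x k :: real
proof -
  have "x\<^sup>2 \<le> 2 * (x - k)\<^sup>2 + 2 * k\<^sup>2"
    using sum_squares_bound[of "x - k" k] by (simp add: power2_eq_square algebra_simps)
  moreover have "0 \<le> k\<^sup>2 * (x - k)\<^sup>2" by simp
  moreover have "2 * (1 + k\<^sup>2) * (1 + (x - k)\<^sup>2) = 2 + 2 * k\<^sup>2 + 2 * (x - k)\<^sup>2 + 2 * (k\<^sup>2 * (x - k)\<^sup>2)"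
    by (simp add: algebra_simps)
  ultimately show ?thesis by linarith
qed

lemma integrable_inverse_1_plus_square_real: "integrable lborel (\<lambda>x::real. inverse (1 + x\<^sup>2))"
  using integrable_inverse_1_plus_square by (simp add: set_integrable_def)

definition bump :: "real \<Rightarrow> nat \<Rightarrow> 'a::euclidean_space \<Rightarrow> real" where
  "bump r N x = (\<Prod>b\<in>Basis. bump1 r N (x \<bullet> b))"

lemma borel_measurable_bump [measurable]: "bump r N \<in> borel_measurable borel"
  unfolding bump_def[abs_def] by (intro borel_measurable_prod) measurable

lemma bump_bounds:
  fixes x :: "'a::euclidean_space"
  shows "r > 0 \<Longrightarrow> 0 \<le> bump r N x" "r > 0 \<Longrightarrow> bump r N x \<le> ((r\<^sup>2) ^ N) ^ DIM('a)"
  "norm x < r \<Longrightarrow> 0 < bump r N x" "norm x > r * DIM('a) \<Longrightarrow> bump r N x = 0"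
proof -
  show "0 \<le> bump r N x" if "r > 0" unfolding bump_def using bump1_bounds(1)[OF that] by (intro prod_nonneg) auto
  show "bump r N x \<le> ((r\<^sup>2) ^ N) ^ DIM('a)" if "r > 0"
  proof -
    have "bump r N x \<le> (\<Prod>b\<in>(Basis :: 'a set). (r\<^sup>2) ^ N)"
      unfolding bump_def by (intro prod_mono conjI bump1_bounds that)
    then show ?thesis by simp
  qed
  show "0 < bump r N x" if "norm x < r"
    unfolding bump_def
    by (intro prod_pos ballI bump1_bounds(3)) (use that Basis_le_norm le_less_trans in blast)
  show "bump r N x = 0" if "norm x > r * DIM('a)"
  proof -
    have "\<exists>b\<in>Basis. \<bar>x \<bullet> b\<bar> > r"
    proof (rule ccontr)
      assume "\<not> ?thesis"
      then have "(\<Sum>b\<in>Basis. \<bar>x \<bullet> b\<bar>) \<le> (\<Sum>b\<in>(Basis :: 'a set). r)" by (intro sum_mono) force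
      then show False using norm_le_l1[of x] that by (simp add: mult.commute)
    qed
    then show ?thesis unfolding bump_def using bump1_bounds(4)[of r] by (auto intro!: prod_zero)
  qed
qed

text \<open>The weight on the whole space is dominated by a product of weights in one variable, so
  that integrals over frequency factorise.\<close>

lemma one_plus_norm_le_prod: "1 + (norm (x::'a::euclidean_space))\<^sup>2 \<le> (\<Prod>b\<in>Basis. 1 + (x \<bullet> b)\<^sup>2)"
proof -
  have "(norm x)\<^sup>2 = (\<Sum>b\<in>Basis. (x \<bullet> b)\<^sup>2)"
    unfolding power2_norm_eq_inner by (subst euclidean_inner) (simp add: power2_eq_square)
  moreover have "finite I \<Longrightarrow> 1 + (\<Sum>b\<in>I. (x \<bullet> b)\<^sup>2) \<le> (\<Prod>b\<in>I. 1 + (x \<bullet> b)\<^sup>2)" for I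
  proof (induction I rule: finite_induct)
    case (insert b I)
    have "0 \<le> (x \<bullet> b)\<^sup>2 * (\<Sum>b\<in>I. (x \<bullet> b)\<^sup>2)" by (intro mult_nonneg_nonneg sum_nonneg) auto
    then have "1 + (\<Sum>b\<in>insert b I. (x \<bullet> b)\<^sup>2) \<le> (1 + (x \<bullet> b)\<^sup>2) * (1 + (\<Sum>b\<in>I. (x \<bullet> b)\<^sup>2))"
      using insert by (simp add: algebra_simps)
    also have "\<dots> \<le> (1 + (x \<bullet> b)\<^sup>2) * (\<Prod>b\<in>I. 1 + (x \<bullet> b)\<^sup>2)"
      by (intro mult_left_mono insert) simp
    finally show ?case using insert by simp
  qed simp
  ultimately show ?thesis by simp
qed

lemma bump_hat:
  assumes r: "r > 0"
  shows "integrable lborel (\<lambda>x::'a::euclidean_space. complex_of_real (bump r N x) * cis (- (\<eta> \<bullet> x)))"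
    and "(\<integral>x. complex_of_real (bump r N x) * cis (- (\<eta> \<bullet> x)) \<partial>lborel) = (\<Prod>b\<in>Basis. bump1_hat r N (\<eta> \<bullet> b))"
proof -
  have eq: "complex_of_real (bump r N x) * cis (- (\<eta> \<bullet> x))
      = (\<Prod>b\<in>Basis. of_real (bump1 r N (x \<bullet> b)) * cis (- ((\<eta> \<bullet> b) * (x \<bullet> b))))" for x :: 'a
  proof -
    have "\<eta> \<bullet> x = (\<Sum>b\<in>Basis. (\<eta> \<bullet> b) * (x \<bullet> b))" by (rule euclidean_inner)
    then show ?thesis
      by (simp add: bump_def prod.distrib of_real_prod cis_sum[symmetric] sum_negf)
  qed
  show "integrable lborel (\<lambda>x::'a. complex_of_real (bump r N x) * cis (- (\<eta> \<bullet> x)))"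
    unfolding eq by (rule integrable_lborel_Basis_prod(1)) (rule integrable_bump1[OF r])
  show "(\<integral>x. complex_of_real (bump r N x) * cis (- (\<eta> \<bullet> x)) \<partial>lborel) = (\<Prod>b\<in>Basis. bump1_hat r N (\<eta> \<bullet> b))"
    unfolding eq bump1_hat_def by (rule integrable_lborel_Basis_prod(2)) (rule integrable_bump1[OF r])
qed

text \<open>In each coordinate the decay provides N powers of \<open>1 + x\<^sup>2\<close>: one pays
  for integrability, the other \<open>N - 1\<close> dominate the Sobolev weight since
  \<open>m \<le> N - 1\<close>.\<close>

lemma integrable_weighted_bump_hat:
  fixes k :: "'a::euclidean_space"
  assumes r: "r > 0" and m: "0 \<le> m" "m + 1 \<le> real N"
  shows "integrable lborel (\<lambda>\<xi>. (1 + (norm \<xi>)\<^sup>2) powr m * (cmod (\<Prod>b\<in>Basis. bump1_hat r N ((\<xi> - k) \<bullet> b)))\<^sup>2)"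
proof -
  obtain C where C: "\<And>s. (1 + s\<^sup>2) ^ N * (cmod (bump1_hat r N s))\<^sup>2 \<le> C" using bump1_hat_decay[OF r] by blast
  define c where "c b = (2 * (1 + (k \<bullet> b)\<^sup>2)) ^ N * C" for b
  have one: "(1 + x\<^sup>2) powr real (N - 1) * (cmod (bump1_hat r N (x - k \<bullet> b)))\<^sup>2 \<le> c b * inverse (1 + x\<^sup>2)" if N': "N \<ge> 1" for x b
  proof -
    let ?h = "(cmod (bump1_hat r N (x - k \<bullet> b)))\<^sup>2"
    have p: "1 + x\<^sup>2 > 0" by (simp add: add_pos_nonneg)
    have "(1 + x\<^sup>2) ^ N * ?h \<le> (2 * (1 + (k \<bullet> b)\<^sup>2) * (1 + (x - k \<bullet> b)\<^sup>2)) ^ N * ?h"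
      by (intro mult_right_mono power_mono Peetre_real) (use p in auto)
    also have "\<dots> = (2 * (1 + (k \<bullet> b)\<^sup>2)) ^ N * ((1 + (x - k \<bullet> b)\<^sup>2) ^ N * ?h)"
      by (simp add: power_mult_distrib)
    also have "\<dots> \<le> c b" unfolding c_def by (intro mult_left_mono C) (simp add: add_nonneg_nonneg)
    finally have *: "(1 + x\<^sup>2) ^ N * ?h \<le> c b" .
    have eq: "(1 + x\<^sup>2) powr real (N - 1) * (1 + x\<^sup>2) = (1 + x\<^sup>2) ^ N"
    proof -
      obtain M where "N = Suc M" using N' by (cases N) auto
      then show ?thesis by (simp only: diff_Suc_1 powr_realpow[OF p] power_Suc2)
    qed
    have "(1 + x\<^sup>2) powr real (N - 1) * ?h * (1 + x\<^sup>2) = (1 + x\<^sup>2) powr real (N - 1) * (1 + x\<^sup>2) * ?h"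
      by (simp only: mult_ac)
    also have "\<dots> = (1 + x\<^sup>2) ^ N * ?h" by (simp only: eq)
    finally have "(1 + x\<^sup>2) powr real (N - 1) * ?h * (1 + x\<^sup>2) \<le> c b" using * by linarith
    then show ?thesis using p by (simp add: divide_inverse[symmetric] pos_le_divide_eq)
  qed
  have N1: "N \<ge> 1" using m by (cases N) auto
    have intc: "integrable lborel (\<lambda>x::'a. \<Prod>b\<in>Basis. complex_of_real (c b * inverse (1 + (x \<bullet> b)\<^sup>2)))"
      by (rule integrable_lborel_Basis_prod(1))
         (intro integrable_of_real integrable_mult_right integrable_inverse_1_plus_square_real)
    show ?thesis
    proof (rule Bochner_Integration.integrable_bound[OF intc], measurable, rule AE_I2)
      fix \<xi> :: 'a
      let ?h = "\<lambda>b. (cmod (bump1_hat r N (\<xi> \<bullet> b - k \<bullet> b)))\<^sup>2"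
      have P1: "1 \<le> (\<Prod>b\<in>Basis. 1 + (\<xi> \<bullet> b)\<^sup>2)" by (rule prod_ge_1) simp
      have "(1 + (norm \<xi>)\<^sup>2) powr m \<le> (1 + (norm \<xi>)\<^sup>2) powr real (N - 1)"
        using m N1 by (intro powr_mono) (auto simp: of_nat_diff)
      also have "\<dots> \<le> (\<Prod>b\<in>Basis. 1 + (\<xi> \<bullet> b)\<^sup>2) powr real (N - 1)"
        by (intro powr_mono2 one_plus_norm_le_prod) auto
      also have "\<dots> = (\<Prod>b\<in>Basis. (1 + (\<xi> \<bullet> b)\<^sup>2) powr real (N - 1))"
        by (rule prod_powr_distrib)
      finally have A: "(1 + (norm \<xi>)\<^sup>2) powr m \<le> (\<Prod>b\<in>Basis. (1 + (\<xi> \<bullet> b)\<^sup>2) powr real (N - 1))" .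
      have "(1 + (norm \<xi>)\<^sup>2) powr m * (cmod (\<Prod>b\<in>Basis. bump1_hat r N ((\<xi> - k) \<bullet> b)))\<^sup>2
          \<le> (\<Prod>b\<in>Basis. (1 + (\<xi> \<bullet> b)\<^sup>2) powr real (N - 1)) * (\<Prod>b\<in>Basis. ?h b)"
        using A by (simp add: prod_norm[symmetric] prod_power_distrib inner_diff_left mult_right_mono prod_nonneg)
      also have "\<dots> = (\<Prod>b\<in>Basis. (1 + (\<xi> \<bullet> b)\<^sup>2) powr real (N - 1) * ?h b)" by (simp add: prod.distrib)
      also have "\<dots> \<le> (\<Prod>b\<in>Basis. c b * inverse (1 + (\<xi> \<bullet> b)\<^sup>2))"
        by (intro prod_mono conjI one[OF N1]) simp
      also have "\<dots> \<le> cmod (\<Prod>b\<in>Basis. complex_of_real (c b * inverse (1 + (\<xi> \<bullet> b)\<^sup>2)))"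
        by (simp only: of_real_prod[symmetric] norm_of_real)
      finally show "norm ((1 + (norm \<xi>)\<^sup>2) powr m * (cmod (\<Prod>b\<in>Basis. bump1_hat r N ((\<xi> - k) \<bullet> b)))\<^sup>2)
          \<le> cmod (\<Prod>b\<in>Basis. complex_of_real (c b * inverse (1 + (\<xi> \<bullet> b)\<^sup>2)))" by simp
    qed
qed

text \<open>Every bump is centred at the origin; totality comes from the radius \<open>r\<close>,
  the frequency \<open>k\<close> and the direction \<open>e\<close>, which range freely.\<close>

definition test_function :: "real \<Rightarrow> nat \<Rightarrow> real^'n \<Rightarrow> 'e::finite_dim_hilbert \<Rightarrow> real^'n \<Rightarrow> 'e" where
  "test_function r N k e x = cis (k \<bullet> x) *\<^sub>C (bump r N x *\<^sub>R e)"

lemma borel_measurable_test_function [measurable]: "test_function r N k e \<in> borel_measurable borel"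
  unfolding test_function_def[abs_def] by measurable

lemma norm_test_function_le:
  fixes x :: "real^'n"
  assumes r: "r > 0"
  shows "norm (test_function r N k e x) \<le> ((r\<^sup>2) ^ N) ^ CARD('n) * norm e * indicator (cball 0 (r * CARD('n))) x"
proof (cases "norm x > r * CARD('n)")
  case True
  then show ?thesis using bump_bounds(4)[of r x N] r by (simp add: test_function_def norm_scaleC)
next
  case False
  then show ?thesis using bump_bounds(1,2)[OF r, where N=N and x=x]
    by (simp add: test_function_def norm_scaleC mult_right_mono)
qed

lemma square_integrable_test_function:
  fixes k :: "real^'n"
  assumes r: "r > 0"
  shows "integrable lborel (test_function r N k e)" "square_integrable (test_function r N k e)"
proof -
  let ?c = "((r\<^sup>2) ^ N) ^ CARD('n) * norm e" and ?B = "cball (0::real^'n) (r * CARD('n))"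
  have c: "?c \<ge> 0" by simp
  have int: "integrable lborel (indicator ?B :: _ \<Rightarrow> real)"
    using emeasure_bounded_finite[OF bounded_cball] by (intro integrable_real_indicator) auto
  show "integrable lborel (test_function r N k e)"
  proof (rule Bochner_Integration.integrable_bound)
    show "integrable lborel (\<lambda>x. ?c * indicator ?B x)" by (intro integrable_mult_right int)
    show "AE x in lborel. norm (test_function r N k e x) \<le> norm (?c * indicator ?B x)"
      using norm_test_function_le[OF r, of N k e] by (intro AE_I2) (simp add: abs_mult)
  qed simp
  have "integrable lborel (\<lambda>x. (norm (test_function r N k e x))\<^sup>2)"
  proof (rule Bochner_Integration.integrable_bound)
    show "integrable lborel (\<lambda>x. ?c\<^sup>2 * indicator ?B x)" by (intro integrable_mult_right int)
    show "AE x in lborel. norm ((norm (test_function r N k e x))\<^sup>2) \<le> norm (?c\<^sup>2 * indicator ?B x)"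
    proof (rule AE_I2)
      fix x :: "real^'n"
      have "(norm (test_function r N k e x))\<^sup>2 \<le> (?c * indicator ?B x)\<^sup>2"
        by (intro power_mono norm_test_function_le r) simp
      then show "norm ((norm (test_function r N k e x))\<^sup>2) \<le> norm (?c\<^sup>2 * indicator ?B x)"
        by (cases "x \<in> ?B") (auto simp: power_mult_distrib)
    qed
  qed measurable
  then show "square_integrable (test_function r N k e)" by (simp add: square_integrable_def)
qed

lemma test_function_sobolev:
  fixes k :: "real^'n"
  assumes r: "r > 0" and m: "0 \<le> m" "m + 1 \<le> real N"
  shows "abs_L2 (test_function r N k e) \<in> sobolev m"
proof -
  let ?\<phi> = "test_function r N k e"
  define c where "c = (2 * pi) powr (- real CARD('n) / 2)"
  \<comment> \<open>Modulation by \<open>k\<close> shifts the Fourier integral, hence the argument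
    \<open>\<xi> - k\<close>.\<close>
  have FI: "fourier_integral ?\<phi> \<xi> = c *\<^sub>R ((\<Prod>b\<in>Basis. bump1_hat r N ((\<xi> - k) \<bullet> b)) *\<^sub>C e)" for \<xi>
  proof -
    have "(\<integral>x. cis (- (\<xi> \<bullet> x)) *\<^sub>C ?\<phi> x \<partial>lborel)
        = (\<integral>x. (complex_of_real (bump r N x) * cis (- ((\<xi> - k) \<bullet> x))) *\<^sub>C e \<partial>lborel)"
    proof (rule Bochner_Integration.integral_cong[OF refl])
      fix x
      show "cis (- (\<xi> \<bullet> x)) *\<^sub>C ?\<phi> x = (complex_of_real (bump r N x) * cis (- ((\<xi> - k) \<bullet> x))) *\<^sub>C e"
      proof -
        have "cis (- ((\<xi> - k) \<bullet> x)) = cis (- (\<xi> \<bullet> x)) * cis (k \<bullet> x)"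
          by (simp add: cis_mult inner_diff_left)
        then show ?thesis
          by (simp add: test_function_def scaleC_scaleC scaleC_of_real[symmetric] mult_ac)
      qed
    qed
    also have "\<dots> = (\<integral>x. complex_of_real (bump r N x) * cis (- ((\<xi> - k) \<bullet> x)) \<partial>lborel) *\<^sub>C e"
    proof (rule integral_bounded_linear)
      show "bounded_linear (\<lambda>a. a *\<^sub>C e)"
        by (rule bounded_linear_intro[where K = "norm e"])
           (simp_all add: scaleC_add_left scaleR_conv_of_real scaleC_scaleC[symmetric] scaleC_of_real norm_scaleC)
    qed (rule bump_hat(1)[OF r])
    finally show ?thesis
      unfolding fourier_integral_def c_def bump_hat(2)[OF r] by simp
  qed
  have "integrable lborel (rep_L2 (abs_L2 ?\<phi>))"
    by (rule integrable_rep_abs_L2[OF square_integrable_test_function(2,1)[OF r]])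
  then have "AE \<xi> in lborel. rep_L2 (fourier (abs_L2 ?\<phi>)) \<xi> = fourier_integral (rep_L2 (abs_L2 ?\<phi>)) \<xi>"
    by (rule fourier_eq_fourier_integral)
  moreover have "fourier_integral (rep_L2 (abs_L2 ?\<phi>)) = fourier_integral ?\<phi>"
    by (rule fourier_integral_cong_AE[OF rep_abs_L2[OF square_integrable_test_function(2)[OF r]]]) measurable
  ultimately have F: "AE \<xi> in lborel. rep_L2 (fourier (abs_L2 ?\<phi>)) \<xi> = c *\<^sub>R ((\<Prod>b\<in>Basis. bump1_hat r N ((\<xi> - k) \<bullet> b)) *\<^sub>C e)"
    by (simp add: FI)
  have "integrable lborel (\<lambda>\<xi>. (c * norm e)\<^sup>2 * ((1 + (norm \<xi>)\<^sup>2) powr m * (cmod (\<Prod>b\<in>Basis. bump1_hat r N ((\<xi> - k) \<bullet> b)))\<^sup>2))"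
    by (intro integrable_mult_right integrable_weighted_bump_hat r m)
  then have "integrable lborel (\<lambda>\<xi>. (1 + (norm \<xi>)\<^sup>2) powr m * (norm (rep_L2 (fourier (abs_L2 ?\<phi>)) \<xi>))\<^sup>2)"
  proof (rule integrable_cong_AE_imp)
    show "AE \<xi> in lborel. (c * norm e)\<^sup>2 * ((1 + (norm \<xi>)\<^sup>2) powr m * (cmod (\<Prod>b\<in>Basis. bump1_hat r N ((\<xi> - k) \<bullet> b)))\<^sup>2)
        = (1 + (norm \<xi>)\<^sup>2) powr m * (norm (rep_L2 (fourier (abs_L2 ?\<phi>)) \<xi>))\<^sup>2"
      using F by eventually_elim (simp add: norm_scaleC power_mult_distrib)
  qed measurable
  then show ?thesis by (simp add: sobolev_def)
qed

text \<open>Orthogonality for all frequencies and directions says that the Fourier integral of the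
  bump times \<open>v\<close> vanishes. By Plancherel that product is zero, and the bump is positive
  on the ball of radius \<open>r\<close>.\<close>

lemma test_functions_total:
  fixes v :: "('n::finite, 'e::finite_dim_hilbert) L2"
  assumes orth: "\<And>r k e. r > 0 \<Longrightarrow> cinner (abs_L2 (test_function r N k e)) v = 0"
  shows "v = 0"
proof -
  have "AE x in lborel. norm x < real (Suc j) \<longrightarrow> rep_L2 v x = 0" for j
  proof -
    define r where "r = real (Suc j)"
    have r: "r > 0" by (simp add: r_def)
    let ?b = "\<lambda>x::real^'n. bump r N x"
    let ?B = "cball (0::real^'n) (r * CARD('n))"
    let ?c = "((r\<^sup>2) ^ N) ^ CARD('n)"
    define g where "g x = ?b x *\<^sub>R rep_L2 v x" for x
    have [measurable]: "g \<in> borel_measurable borel" unfolding g_def by measurable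
    have b: "\<bar>?b x\<bar> \<le> ?c * indicator ?B x" for x
      using bump_bounds(1,2)[OF r, where N=N and x=x] bump_bounds(4)[of r x N] by (cases "x \<in> ?B") (auto simp: indicator_def)
    have gb: "norm (g x) \<le> ?c * norm (indicator ?B x *\<^sub>R rep_L2 v x)" for x
      using mult_right_mono[OF b[of x], of "norm (rep_L2 v x)"] by (simp add: g_def mult.assoc)
    have gi: "integrable lborel g"
    proof (rule Bochner_Integration.integrable_bound)
      show "integrable lborel (\<lambda>x. ?c * norm (indicator ?B x *\<^sub>R rep_L2 v x))"
        by (intro integrable_mult_right integrable_norm integrable_indicator_rep) auto
      show "AE x in lborel. norm (g x) \<le> norm (?c * norm (indicator ?B x *\<^sub>R rep_L2 v x))"
        using gb by (intro AE_I2) (metis abs_of_nonneg mult_nonneg_nonneg norm_ge_zero real_norm_def zero_le_power2 zero_le_power)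
    qed simp
    have gs: "square_integrable g"
      unfolding square_integrable_def
    proof
      show "integrable lborel (\<lambda>x. (norm (g x))\<^sup>2)"
      proof (rule Bochner_Integration.integrable_bound)
        show "integrable lborel (\<lambda>x. ?c\<^sup>2 * (norm (rep_L2 v x))\<^sup>2)"
          by (intro integrable_mult_right integrable_norm_rep_L2)
        show "AE x in lborel. norm ((norm (g x))\<^sup>2) \<le> norm (?c\<^sup>2 * (norm (rep_L2 v x))\<^sup>2)"
        proof (rule AE_I2)
          fix x
          have "norm (g x) \<le> ?c * norm (rep_L2 v x)"
            using gb[of x] by (cases "x \<in> ?B") auto
          then have "(norm (g x))\<^sup>2 \<le> (?c * norm (rep_L2 v x))\<^sup>2" by (rule power_mono) simp
          then show "norm ((norm (g x))\<^sup>2) \<le> norm (?c\<^sup>2 * (norm (rep_L2 v x))\<^sup>2)" by (simp add: power_mult_distrib)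
        qed
      qed measurable
    qed simp
    have "(\<integral>x. cis (- (k \<bullet> x)) *\<^sub>C g x \<partial>lborel) = 0" for k
    proof -
      have int: "integrable lborel (\<lambda>x. cis (- (k \<bullet> x)) *\<^sub>C g x)" by (rule integrable_cis_scaleC[OF gi]) simp
      have "cinner e (\<integral>x. cis (- (k \<bullet> x)) *\<^sub>C g x \<partial>lborel) = 0" for e
      proof -
        have "cinner e (\<integral>x. cis (- (k \<bullet> x)) *\<^sub>C g x \<partial>lborel) = (\<integral>x. cinner e (cis (- (k \<bullet> x)) *\<^sub>C g x) \<partial>lborel)"
          by (rule integral_bounded_linear[OF bounded_linear_cinner_right int, symmetric])
        also have "\<dots> = (\<integral>x. cinner (rep_L2 (abs_L2 (test_function r N k e)) x) (rep_L2 v x) \<partial>lborel)"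
        proof (rule integral_cong_AE)
          show "AE x in lborel. cinner e (cis (- (k \<bullet> x)) *\<^sub>C g x)
              = cinner (rep_L2 (abs_L2 (test_function r N k e)) x) (rep_L2 v x)"
            using rep_abs_L2[OF square_integrable_test_function(2)[OF r, of N k e]]
          proof eventually_elim
            fix x assume "rep_L2 (abs_L2 (test_function r N k e)) x = test_function r N k e x"
            then show "cinner e (cis (- (k \<bullet> x)) *\<^sub>C g x) = cinner (rep_L2 (abs_L2 (test_function r N k e)) x) (rep_L2 v x)"
              by (simp add: test_function_def g_def scaleC_of_real[symmetric] cinner_scaleC_left cinner_scaleC_right cis_cnj)
          qed
        qed measurable
        also have "\<dots> = 0" using orth[OF r, of k e] by (simp add: cinner_L2_eq)
        finally show ?thesis .
      qed
      from this[of "\<integral>x. cis (- (k \<bullet> x)) *\<^sub>C g x \<partial>lborel"] show ?thesis by (simp add: cinner_self)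
    qed
    then have FI0: "fourier_integral g = (\<lambda>\<xi>. 0)" by (simp add: fourier_integral_def fun_eq_iff)
    have "fourier_integral (rep_L2 (abs_L2 g)) = fourier_integral g"
      by (rule fourier_integral_cong_AE[OF rep_abs_L2[OF gs]]) measurable
    then have "ennreal ((norm (abs_L2 g))\<^sup>2) = 0"
      using Plancherel[OF integrable_rep_abs_L2[OF gs gi]] FI0 by simp
    then have "abs_L2 g = 0" by simp
    then have "AE x in lborel. rep_L2 (abs_L2 g) x = 0" by (simp add: L2_eq_0_iff)
    then have "AE x in lborel. g x = 0" using rep_abs_L2[OF gs] by eventually_elim simp
    then show ?thesis
    proof eventually_elim
      fix x assume "g x = 0"
      then show "norm x < real (Suc j) \<longrightarrow> rep_L2 v x = 0"
        using bump_bounds(3)[of x r N] by (auto simp: g_def r_def)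
    qed
  qed
  then have "AE x in lborel. \<forall>j. norm x < real (Suc j) \<longrightarrow> rep_L2 v x = 0"
    unfolding AE_all_countable by blast
  then have "AE x in lborel. rep_L2 v x = 0"
  proof eventually_elim
    fix x :: "real^'n" assume *: "\<forall>j. norm x < real (Suc j) \<longrightarrow> rep_L2 v x = 0"
    obtain j :: nat where "norm x < real j" using reals_Archimedean2 by blast
    then show "rep_L2 v x = 0" using *[rule_format, of j] by simp
  qed
  then show ?thesis by (simp add: L2_eq_0_iff)
qed

section \<open>Sobolev bounds and equicontinuity\<close>

lemma cmod_cis_diff_1_le: "(cmod (cis t - 1))\<^sup>2 \<le> t\<^sup>2"
proof -
  have "(cmod (cis t - 1))\<^sup>2 = (sin t)\<^sup>2 + (cos t)\<^sup>2 + 1 - 2 * cos t"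
    unfolding cmod_power2 by (simp add: power2_eq_square algebra_simps)
  also have "\<dots> = 2 - 2 * cos (2 * (t / 2))" by simp
  also have "\<dots> = 4 * (sin (t / 2))\<^sup>2" unfolding cos_double_sin by simp
  also have "\<dots> \<le> 4 * (t / 2)\<^sup>2"
    using abs_sin_x_le_abs_x[of "t / 2"] unfolding abs_le_square_iff by (intro mult_left_mono) auto
  finally show ?thesis by (simp add: power_divide)
qed

text \<open>On the Fourier side the difference is multiplication by
  \<open>cis (h \<bullet> \<xi>) - 1\<close>. This is at most \<open>norm h * R\<close> for
  frequencies up to \<open>R\<close> and at most 2 beyond, where the Sobolev weight is at least
  \<open>(1 + R\<^sup>2) powr m\<close>.\<close>

lemma translation_diff_le:
  fixes f :: "('n::finite, 'e::finite_dim_hilbert) L2"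
  assumes K: "(\<integral>\<^sup>+\<xi>. ennreal ((1 + (norm \<xi>)\<^sup>2) powr m * (norm (rep_L2 (fourier f) \<xi>))\<^sup>2) \<partial>lborel) \<le> ennreal K"
    and m: "m \<ge> 0" and K0: "K \<ge> 0" and R: "R \<ge> 0"
  shows "(norm (translation h f - f))\<^sup>2 \<le> (norm h * R)\<^sup>2 * (norm f)\<^sup>2 + 4 * (1 + R\<^sup>2) powr (- m) * K"
proof -
  let ?F = "rep_L2 (fourier f)"
  let ?w = "\<lambda>\<xi>::real^'n. (1 + (norm \<xi>)\<^sup>2) powr m"
  have "norm (translation h f - f) = norm (modulation h (fourier f) - fourier f)"
    by (metis norm_fourier fourier_diff fourier_translation)
  then have "ennreal ((norm (translation h f - f))\<^sup>2)
      = (\<integral>\<^sup>+\<xi>. ennreal ((norm (rep_L2 (modulation h (fourier f) - fourier f) \<xi>))\<^sup>2) \<partial>lborel)"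
    by (simp add: nn_integral_norm_L2)
  also have "\<dots> = (\<integral>\<^sup>+\<xi>. ennreal ((cmod (cis (h \<bullet> \<xi>) - 1))\<^sup>2 * (norm (?F \<xi>))\<^sup>2) \<partial>lborel)"
  proof (rule nn_integral_cong_AE, use rep_L2_diff[of "modulation h (fourier f)" "fourier f"] rep_modulation[of h "fourier f"] in eventually_elim)
    fix \<xi> assume *: "rep_L2 (modulation h (fourier f) - fourier f) \<xi> = rep_L2 (modulation h (fourier f)) \<xi> - ?F \<xi>"
      "rep_L2 (modulation h (fourier f)) \<xi> = cis (h \<bullet> \<xi>) *\<^sub>C ?F \<xi>"
    have "cis (h \<bullet> \<xi>) *\<^sub>C ?F \<xi> - ?F \<xi> = (cis (h \<bullet> \<xi>) - 1) *\<^sub>C ?F \<xi>"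
      using scaleC_add_left[of "cis (h \<bullet> \<xi>)" "-1" "?F \<xi>"] by (simp add: scaleC_minus1)
    then show "ennreal ((norm (rep_L2 (modulation h (fourier f) - fourier f) \<xi>))\<^sup>2)
        = ennreal ((cmod (cis (h \<bullet> \<xi>) - 1))\<^sup>2 * (norm (?F \<xi>))\<^sup>2)"
      by (simp add: * norm_scaleC power_mult_distrib)
  qed
  also have "\<dots> \<le> (\<integral>\<^sup>+\<xi>. ennreal ((norm h * R)\<^sup>2) * ennreal ((norm (?F \<xi>))\<^sup>2)
      + ennreal (4 * (1 + R\<^sup>2) powr (- m)) * ennreal (?w \<xi> * (norm (?F \<xi>))\<^sup>2) \<partial>lborel)"
  proof (rule nn_integral_mono)
    fix \<xi> :: "real^'n"
    have "(cmod (cis (h \<bullet> \<xi>) - 1))\<^sup>2 \<le> (norm h * R)\<^sup>2 + 4 * (1 + R\<^sup>2) powr (- m) * ?w \<xi>"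
    proof (cases "norm \<xi> \<le> R")
      case True
      have "\<bar>h \<bullet> \<xi>\<bar> \<le> norm h * R"
        using Cauchy_Schwarz_ineq2[of h \<xi>] mult_left_mono[OF True, of "norm h"] by simp
      then have "(h \<bullet> \<xi>)\<^sup>2 \<le> (norm h * R)\<^sup>2" using power_mono[of "\<bar>h \<bullet> \<xi>\<bar>" "norm h * R" 2] by simp
      moreover have "0 \<le> 4 * (1 + R\<^sup>2) powr (- m) * ?w \<xi>" by simp
      ultimately show ?thesis using cmod_cis_diff_1_le[of "h \<bullet> \<xi>"] by linarith
    next
      case False
      have "cmod (cis (h \<bullet> \<xi>) - 1) \<le> 2" using norm_triangle_ineq4[of "cis (h \<bullet> \<xi>)" 1] by simp
      then have 1: "(cmod (cis (h \<bullet> \<xi>) - 1))\<^sup>2 \<le> 4" using power_mono[of "cmod (cis (h \<bullet> \<xi>) - 1)" 2 2] by simp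
      have "R\<^sup>2 \<le> (norm \<xi>)\<^sup>2" using False R by (intro power_mono) auto
      then have "(1 + R\<^sup>2) powr m \<le> ?w \<xi>" using m by (intro powr_mono2) auto
      then have "(1 + R\<^sup>2) powr (- m) * (1 + R\<^sup>2) powr m \<le> (1 + R\<^sup>2) powr (- m) * ?w \<xi>"
        by (intro mult_left_mono) auto
      moreover have "1 + R\<^sup>2 > 0" by (simp add: add_pos_nonneg)
      then have "(1 + R\<^sup>2) powr (- m) * (1 + R\<^sup>2) powr m = 1" by (simp flip: powr_add)
      moreover have "0 \<le> (norm h * R)\<^sup>2" by simp
      ultimately show ?thesis using 1 by linarith
    qed
    then have "(cmod (cis (h \<bullet> \<xi>) - 1))\<^sup>2 * (norm (?F \<xi>))\<^sup>2
        \<le> (norm h * R)\<^sup>2 * (norm (?F \<xi>))\<^sup>2 + 4 * (1 + R\<^sup>2) powr (- m) * (?w \<xi> * (norm (?F \<xi>))\<^sup>2)"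
      using mult_right_mono[of _ _ "(norm (?F \<xi>))\<^sup>2"] by (fastforce simp: algebra_simps)
    then have "ennreal ((cmod (cis (h \<bullet> \<xi>) - 1))\<^sup>2 * (norm (?F \<xi>))\<^sup>2)
        \<le> ennreal ((norm h * R)\<^sup>2 * (norm (?F \<xi>))\<^sup>2 + 4 * (1 + R\<^sup>2) powr (- m) * (?w \<xi> * (norm (?F \<xi>))\<^sup>2))"
      by (rule ennreal_leI)
    also have "\<dots> = ennreal ((norm h * R)\<^sup>2) * ennreal ((norm (?F \<xi>))\<^sup>2)
        + ennreal (4 * (1 + R\<^sup>2) powr (- m)) * ennreal (?w \<xi> * (norm (?F \<xi>))\<^sup>2)"
      by (simp only: ennreal_mult[symmetric] zero_le_power2 mult_nonneg_nonneg powr_ge_zero zero_le_numeral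
          ennreal_plus[symmetric])
    finally show "ennreal ((cmod (cis (h \<bullet> \<xi>) - 1))\<^sup>2 * (norm (?F \<xi>))\<^sup>2)
        \<le> ennreal ((norm h * R)\<^sup>2) * ennreal ((norm (?F \<xi>))\<^sup>2)
          + ennreal (4 * (1 + R\<^sup>2) powr (- m)) * ennreal (?w \<xi> * (norm (?F \<xi>))\<^sup>2)" .
  qed
  also have "\<dots> = ennreal ((norm h * R)\<^sup>2) * ennreal ((norm f)\<^sup>2)
      + ennreal (4 * (1 + R\<^sup>2) powr (- m)) * (\<integral>\<^sup>+\<xi>. ennreal (?w \<xi> * (norm (?F \<xi>))\<^sup>2) \<partial>lborel)"
    by (simp add: nn_integral_add nn_integral_cmult nn_integral_norm_L2 norm_fourier)
  also have "\<dots> \<le> ennreal ((norm h * R)\<^sup>2) * ennreal ((norm f)\<^sup>2) + ennreal (4 * (1 + R\<^sup>2) powr (- m)) * ennreal K"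
    by (intro add_left_mono mult_left_mono K) simp
  also have "\<dots> = ennreal ((norm h * R)\<^sup>2 * (norm f)\<^sup>2 + 4 * (1 + R\<^sup>2) powr (- m) * K)"
    using K0 by (simp add: ennreal_mult)
  finally show ?thesis using K0 by (subst (asm) ennreal_le_iff) auto
qed

text \<open>Positivity of \<open>m\<close> lets a large \<open>R\<close> absorb the high frequencies
  uniformly in \<open>S\<close>; a small \<open>h\<close> then takes care of the low ones.\<close>

lemma sobolev_bounded_equicontinuous:
  fixes S :: "('n::finite, 'e::finite_dim_hilbert) L2 set"
  assumes bound: "\<And>f. f \<in> S \<Longrightarrow> norm f \<le> C"
    and K: "\<And>f. f \<in> S \<Longrightarrow> (\<integral>\<^sup>+\<xi>. ennreal ((1 + (norm \<xi>)\<^sup>2) powr m * (norm (rep_L2 (fourier f) \<xi>))\<^sup>2) \<partial>lborel) \<le> ennreal K"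
    and m: "m > 0" and \<epsilon>: "\<epsilon> > 0"
  shows "\<exists>\<delta>>0. \<forall>f\<in>S. \<forall>h. norm h < \<delta> \<longrightarrow> norm (translation h f - f) \<le> \<epsilon>"
proof -
  define K' where "K' = \<bar>K\<bar>"
  have K': "K' \<ge> 0" "f \<in> S \<Longrightarrow> (\<integral>\<^sup>+\<xi>. ennreal ((1 + (norm \<xi>)\<^sup>2) powr m * (norm (rep_L2 (fourier f) \<xi>))\<^sup>2) \<partial>lborel) \<le> ennreal K'" for f
    using K[of f] order_trans[OF _ ennreal_leI[of K "\<bar>K\<bar>"]] by (auto simp: K'_def)
  have "((\<lambda>R::real. 4 * (1 + R\<^sup>2) powr (- m) * K') \<longlongrightarrow> 4 * 0 * K') at_top"
  proof (intro tendsto_mult tendsto_const)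
    have "LIM R at_top. 1 + (R::real)\<^sup>2 :> at_top"
      by (rule filterlim_tendsto_add_at_top[OF tendsto_const filterlim_pow_at_top[OF _ filterlim_ident]]) simp
    then show "((\<lambda>R::real. (1 + R\<^sup>2) powr (- m)) \<longlongrightarrow> 0) at_top"
      using m by (intro tendsto_neg_powr) auto
  qed
  then have "\<forall>\<^sub>F R in at_top. 4 * (1 + R\<^sup>2) powr (- m) * K' < \<epsilon>\<^sup>2 / 2"
    using \<epsilon> by (intro order_tendstoD(2)) auto
  then have "\<forall>\<^sub>F R in at_top. 4 * (1 + R\<^sup>2) powr (- m) * K' < \<epsilon>\<^sup>2 / 2 \<and> R \<ge> 0"
    by (intro eventually_conj eventually_ge_at_top)
  then obtain R where R: "4 * (1 + R\<^sup>2) powr (- m) * K' < \<epsilon>\<^sup>2 / 2" "R \<ge> 0"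
    using eventually_happens[of _ "at_top :: real filter"] by auto
  \<comment> \<open>Then \<open>norm h < \<epsilon> / d\<close> gives
    \<open>norm h * R * norm f \<le> \<epsilon> / 2\<close>; the summands 1 keep \<open>d\<close>
    positive.\<close>
  define d where "d = 2 * ((R + 1) * (\<bar>C\<bar> + 1))"
  have d: "d > 0" using R(2) by (auto simp: d_def intro!: mult_pos_pos add_nonneg_pos)
  have "norm (translation h f - f) \<le> \<epsilon>" if f: "f \<in> S" and h: "norm h < \<epsilon> / d" for f h
  proof -
    have "norm h * R * norm f \<le> norm h * ((R + 1) * (\<bar>C\<bar> + 1))"
      unfolding mult.assoc using bound[OF f] R(2) by (intro mult_left_mono mult_mono) auto
    also have "\<dots> \<le> \<epsilon> / 2" using h d by (simp add: d_def pos_less_divide_eq mult_ac)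
    finally have "(norm h * R * norm f)\<^sup>2 \<le> (\<epsilon> / 2)\<^sup>2" using R(2) by (intro power_mono) auto
    also have "\<dots> \<le> \<epsilon>\<^sup>2 / 2" by (simp add: power_divide)
    finally have "(norm h * R)\<^sup>2 * (norm f)\<^sup>2 \<le> \<epsilon>\<^sup>2 / 2" by (simp add: power_mult_distrib)
    then have "(norm (translation h f - f))\<^sup>2 \<le> \<epsilon>\<^sup>2"
      using translation_diff_le[OF K'(2)[OF f] less_imp_le[OF m] K'(1) R(2), of h] R(1) by linarith
    then show ?thesis by (rule power2_le_imp_le) (use \<epsilon> in simp)
  qed
  then show ?thesis using d \<epsilon> by (intro exI[of _ "\<epsilon> / d"]) auto
qed

section \<open>Truncated weights and the Sobolev bound on the form ball\<close>

definition mult_L2 :: "(real^'n \<Rightarrow> real) \<Rightarrow> ('n::finite, 'e::finite_dim_hilbert) L2 \<Rightarrow> ('n, 'e) L2" where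
  "mult_L2 w g = abs_L2 (\<lambda>x. w x *\<^sub>R rep_L2 g x)"

context
  fixes w :: "real^'n \<Rightarrow> real" and M :: real
  assumes w: "w \<in> borel_measurable borel" "\<And>x. \<bar>w x\<bar> \<le> M"
begin

lemma square_integrable_mult: "square_integrable (\<lambda>x. w x *\<^sub>R rep_L2 g x)"
proof -
  note [measurable] = w(1)
  have "integrable lborel (\<lambda>x. (norm (w x *\<^sub>R rep_L2 g x))\<^sup>2)"
  proof (rule Bochner_Integration.integrable_bound)
    show "integrable lborel (\<lambda>x. M\<^sup>2 * (norm (rep_L2 g x))\<^sup>2)"
      by (intro integrable_mult_right integrable_norm_rep_L2)
    show "AE x in lborel. norm ((norm (w x *\<^sub>R rep_L2 g x))\<^sup>2) \<le> norm (M\<^sup>2 * (norm (rep_L2 g x))\<^sup>2)"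
    proof (rule AE_I2)
      fix x
      have "\<bar>w x\<bar>\<^sup>2 \<le> M\<^sup>2" by (intro power_mono w) simp
      then show "norm ((norm (w x *\<^sub>R rep_L2 g x))\<^sup>2) \<le> norm (M\<^sup>2 * (norm (rep_L2 g x))\<^sup>2)"
        by (simp add: power_mult_distrib mult_right_mono)
    qed
  qed measurable
  then show ?thesis by (simp add: square_integrable_def)
qed

lemma rep_mult_L2: "AE x in lborel. rep_L2 (mult_L2 w g) x = w x *\<^sub>R rep_L2 g x"
  unfolding mult_L2_def by (rule rep_abs_L2[OF square_integrable_mult])

lemma mult_L2_add: "mult_L2 w (f + g) = mult_L2 w f + mult_L2 w g"
  by (rule L2_eqI)
     (use rep_L2_add[of f g] rep_L2_add[of "mult_L2 w f" "mult_L2 w g"] rep_mult_L2[of f] rep_mult_L2[of g]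
        rep_mult_L2[of "f + g"] in eventually_elim, simp add: scaleR_add_right)

lemma mult_L2_scaleR: "mult_L2 w (c *\<^sub>R f) = c *\<^sub>R mult_L2 w f"
  by (rule L2_eqI)
     (use rep_L2_scaleR[of c f] rep_L2_scaleR[of c "mult_L2 w f"] rep_mult_L2[of f] rep_mult_L2[of "c *\<^sub>R f"]
        in eventually_elim, simp)

lemma norm_mult_L2_le: "M \<ge> 0 \<Longrightarrow> norm (mult_L2 w f) \<le> M * norm f"
proof -
  assume M: "M \<ge> 0"
  have "ennreal ((norm (mult_L2 w f))\<^sup>2) = (\<integral>\<^sup>+x. ennreal ((norm (w x *\<^sub>R rep_L2 f x))\<^sup>2) \<partial>lborel)"
    unfolding mult_L2_def by (rule nn_integral_abs_L2[OF square_integrable_mult])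
  also have "\<dots> \<le> (\<integral>\<^sup>+x. ennreal (M\<^sup>2) * ennreal ((norm (rep_L2 f x))\<^sup>2) \<partial>lborel)"
  proof (rule nn_integral_mono)
    fix x
    have "\<bar>w x\<bar>\<^sup>2 \<le> M\<^sup>2" by (intro power_mono w) simp
    then show "ennreal ((norm (w x *\<^sub>R rep_L2 f x))\<^sup>2) \<le> ennreal (M\<^sup>2) * ennreal ((norm (rep_L2 f x))\<^sup>2)"
      by (simp add: ennreal_mult[symmetric] power_mult_distrib mult_right_mono ennreal_leI)
  qed
  also have "\<dots> = ennreal (M\<^sup>2) * ennreal ((norm f)\<^sup>2)"
    by (simp add: nn_integral_cmult nn_integral_norm_L2)
  also have "\<dots> = ennreal ((M * norm f)\<^sup>2)"
    by (simp add: ennreal_mult[symmetric] power_mult_distrib)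
  finally have "(norm (mult_L2 w f))\<^sup>2 \<le> (M * norm f)\<^sup>2" by simp
  then show ?thesis by (rule power2_le_imp_le) (use M in simp)
qed

end

text \<open>The seminorms \<open>p j\<close> measure the Fourier transform with a bounded weight.
  Each is bounded in the form norm through \<open>Q_lower\<close>, and for fixed \<open>f\<close>
  all are bounded by the Sobolev norm, which is finite by the assumption on the domain.\<close>

lemma sobolev_form_bound:
  fixes A :: "(('n::finite, 'e::finite_dim_hilbert) L2 \<times> ('n, 'e) L2) set"
  assumes "semibounded_operator A c" and dom: "form_domain A = sobolev m" and m: "m \<ge> 0"
  shows "\<exists>K\<ge>0. \<forall>f\<in>form_domain A. Re (semibounded_operator.Q A c f f) \<le> 1 \<longrightarrow>
    (\<integral>\<^sup>+\<xi>. ennreal ((1 + (norm \<xi>)\<^sup>2) powr m * (norm (rep_L2 (fourier f) \<xi>))\<^sup>2) \<partial>lborel) \<le> ennreal K"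
proof -
  interpret semibounded_operator A c by fact
  \<comment> \<open>The exponent is halved because the L2 norm squares the weight; the cut-off at
    radius \<open>j\<close> keeps it below \<open>M j\<close>.\<close>
  define w where "w j \<xi> = (if norm \<xi> < real j then (1 + (norm \<xi>)\<^sup>2) powr (m / 2) else 0)" for j :: nat and \<xi> :: "real^'n"
  define M where "M j = (1 + (real j)\<^sup>2) powr (m / 2)" for j :: nat
  have w: "w j \<in> borel_measurable borel" for j
    unfolding w_def[abs_def] by measurable
  have wM: "\<bar>w j \<xi>\<bar> \<le> M j" for j \<xi>
  proof (cases "norm \<xi> < real j")
    case True
    then have "(norm \<xi>)\<^sup>2 \<le> (real j)\<^sup>2" by (intro power_mono) auto
    then show ?thesis using m by (auto simp: w_def M_def indicator_def intro!: powr_mono2)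
  qed (simp add: w_def M_def)
  have M0: "M j \<ge> 0" for j by (simp add: M_def)
  have pw: "((1 + (norm \<xi>)\<^sup>2) powr (m / 2))\<^sup>2 = (1 + (norm \<xi>)\<^sup>2) powr m" for \<xi> :: "real^'n"
    by (simp add: power2_eq_square flip: powr_add)
  define p :: "nat \<Rightarrow> ('n, 'e) L2 \<Rightarrow> real" where "p j f = norm (mult_L2 (w j) (fourier f))" for j f
  have p_nn: "ennreal ((p j f)\<^sup>2) = (\<integral>\<^sup>+\<xi>. ennreal ((norm (w j \<xi> *\<^sub>R rep_L2 (fourier f) \<xi>))\<^sup>2) \<partial>lborel)" for j f
    unfolding p_def mult_L2_def by (rule nn_integral_abs_L2[OF square_integrable_mult[OF w wM]])
  have "\<exists>C. \<forall>j. \<forall>f\<in>FD. sqrt (Re (Q f f)) \<le> 1 \<longrightarrow> p j f \<le> C"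
  proof (rule F.uniform_boundedness[OF form_complete_Q])
    fix j f g a
    show "p j (f + g) \<le> p j f + p j g"
      unfolding p_def fourier_add mult_L2_add[OF w wM] by (rule norm_triangle_ineq)
    show "p j (a *\<^sub>R f) = \<bar>a\<bar> * p j f"
      unfolding p_def fourier_scaleR mult_L2_scaleR[OF w wM] by simp
  next
    fix j
    have "p j f \<le> M j * sqrt (Re (Q f f))" if "f \<in> FD" for f
    proof -
      have "p j f \<le> M j * norm f"
        using norm_mult_L2_le[OF w wM M0, of j "fourier f"] by (simp add: p_def norm_fourier)
      also have "\<dots> \<le> M j * sqrt (Re (Q f f))"
        using Q_lower[OF that] by (intro mult_left_mono M0 real_le_rsqrt)
      finally show ?thesis .
    qed
    then show "\<exists>a. \<forall>f\<in>FD. p j f \<le> a * sqrt (Re (Q f f))" by blast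
  next
    fix f assume "f \<in> FD"
    then have int: "integrable lborel (\<lambda>\<xi>. (1 + (norm \<xi>)\<^sup>2) powr m * (norm (rep_L2 (fourier f) \<xi>))\<^sup>2)"
      using dom by (simp add: sobolev_def)
    let ?I = "\<integral>\<xi>. (1 + (norm \<xi>)\<^sup>2) powr m * (norm (rep_L2 (fourier f) \<xi>))\<^sup>2 \<partial>lborel"
    have "p j f \<le> sqrt ?I" for j
    proof -
      have "ennreal ((p j f)\<^sup>2) \<le> (\<integral>\<^sup>+\<xi>. ennreal ((1 + (norm \<xi>)\<^sup>2) powr m * (norm (rep_L2 (fourier f) \<xi>))\<^sup>2) \<partial>lborel)"
        unfolding p_nn
      proof (intro nn_integral_mono ennreal_leI)
        fix \<xi> :: "real^'n"
        have "(w j \<xi>)\<^sup>2 \<le> (1 + (norm \<xi>)\<^sup>2) powr m"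
          by (simp add: w_def pw)
        then show "(norm (w j \<xi> *\<^sub>R rep_L2 (fourier f) \<xi>))\<^sup>2 \<le> (1 + (norm \<xi>)\<^sup>2) powr m * (norm (rep_L2 (fourier f) \<xi>))\<^sup>2"
          by (simp add: power_mult_distrib mult_right_mono)
      qed
      also have "\<dots> = ennreal ?I" by (rule nn_integral_eq_integral[OF int]) simp
      finally have "(p j f)\<^sup>2 \<le> ?I" by (subst (asm) ennreal_le_iff) (auto intro!: Bochner_Integration.integral_nonneg)
      then show ?thesis by (rule real_le_rsqrt)
    qed
    then show "\<exists>C. \<forall>j. p j f \<le> C" by blast
  qed
  then obtain C where C: "\<And>j f. f \<in> FD \<Longrightarrow> sqrt (Re (Q f f)) \<le> 1 \<Longrightarrow> p j f \<le> C" by blast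
  have "(\<integral>\<^sup>+\<xi>. ennreal ((1 + (norm \<xi>)\<^sup>2) powr m * (norm (rep_L2 (fourier f) \<xi>))\<^sup>2) \<partial>lborel) \<le> ennreal (C\<^sup>2)"
    if f: "f \<in> FD" and q: "Re (Q f f) \<le> 1" for f
  proof -
    have "(\<integral>\<^sup>+\<xi>. ennreal ((norm ((1 + (norm \<xi>)\<^sup>2) powr (m / 2) *\<^sub>R rep_L2 (fourier f) \<xi>))\<^sup>2) \<partial>lborel) \<le> ennreal (C\<^sup>2)"
    \<comment> \<open>At each \<xi> the truncated weight equals the full one from some
      \<open>j\<close> on, so Fatou transfers the uniform bound to the full weight.\<close>
    proof (rule nn_integral_norm_AE_limit[where u = "\<lambda>j \<xi>. w j \<xi> *\<^sub>R rep_L2 (fourier f) \<xi>" and N = 0])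
      show "(\<lambda>\<xi>. w j \<xi> *\<^sub>R rep_L2 (fourier f) \<xi>) \<in> borel_measurable lborel" for j
        using w[of j] by measurable
      show "AE \<xi> in lborel. (\<lambda>j. w j \<xi> *\<^sub>R rep_L2 (fourier f) \<xi>) \<longlonglongrightarrow> (1 + (norm \<xi>)\<^sup>2) powr (m / 2) *\<^sub>R rep_L2 (fourier f) \<xi>"
      proof (rule AE_I2, rule tendsto_eventually)
        fix \<xi> :: "real^'n"
        obtain N where N: "norm \<xi> < real N" using reals_Archimedean2 by blast
        have "w j \<xi> = (1 + (norm \<xi>)\<^sup>2) powr (m / 2)" if "j \<ge> N" for j
          using N that by (simp add: w_def)
        then show "\<forall>\<^sub>F j in sequentially. w j \<xi> *\<^sub>R rep_L2 (fourier f) \<xi> = (1 + (norm \<xi>)\<^sup>2) powr (m / 2) *\<^sub>R rep_L2 (fourier f) \<xi>"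
          unfolding eventually_sequentially by (intro exI[of _ N]) simp
      qed
      fix j
      have "(p j f)\<^sup>2 \<le> C\<^sup>2" using C[OF f, of j] q by (intro power_mono) (auto simp: p_def)
      then show "(\<integral>\<^sup>+\<xi>. ennreal ((norm (w j \<xi> *\<^sub>R rep_L2 (fourier f) \<xi>))\<^sup>2) \<partial>lborel) \<le> ennreal (C\<^sup>2)"
        unfolding p_nn[symmetric] by (rule ennreal_leI)
    qed
    then show ?thesis by (simp add: power_mult_distrib pw)
  qed
  then show ?thesis by (intro exI[of _ "C\<^sup>2"]) auto
qed

section \<open>The form of the potential\<close>

definition potential_form :: "(real^'n \<Rightarrow> real) \<Rightarrow> ('n::finite, 'e::finite_dim_hilbert) L2 \<Rightarrow> ('n, 'e) L2 \<Rightarrow> complex" where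
  "potential_form W f g = (\<integral>x. of_real (W x) * cinner (rep_L2 f x) (rep_L2 g x) \<partial>lborel)"

definition potential_domain :: "(real^'n \<Rightarrow> real) \<Rightarrow> ('n::finite, 'e::finite_dim_hilbert) L2 set" where
  "potential_domain W = {f. integrable lborel (\<lambda>x. W x * (norm (rep_L2 f x))\<^sup>2)}"

locale potential =
  fixes W :: "real^'n \<Rightarrow> real"
  assumes W_borel [measurable]: "W \<in> borel_measurable borel" and W_nonneg: "\<And>x. 0 \<le> W x"
begin

text \<open>Extended values turn membership in the domain of the potential into finiteness and make
  Fatou's lemma applicable.\<close>

definition energy :: "('n, 'e::finite_dim_hilbert) L2 \<Rightarrow> ennreal" where
  "energy f = (\<integral>\<^sup>+x. ennreal (W x) * ennreal ((norm (rep_L2 f x))\<^sup>2) \<partial>lborel)"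

lemma energy_eq: "energy f = (\<integral>\<^sup>+x. ennreal (W x * (norm (rep_L2 f x))\<^sup>2) \<partial>lborel)"
  unfolding energy_def by (simp add: ennreal_mult W_nonneg)

lemma potential_domain_iff: "f \<in> potential_domain W \<longleftrightarrow> energy f < \<infinity>"
  by (simp add: potential_domain_def integrable_iff_bounded energy_eq W_nonneg abs_mult)

lemma energy_eq_potential_form: "f \<in> potential_domain W \<Longrightarrow> energy f = ennreal (Re (potential_form W f f))"
proof -
  assume "f \<in> potential_domain W"
  then have int: "integrable lborel (\<lambda>x. W x * (norm (rep_L2 f x))\<^sup>2)" by (simp add: potential_domain_def)
  have "potential_form W f f = (\<integral>x. complex_of_real (W x * (norm (rep_L2 f x))\<^sup>2) \<partial>lborel)"
    by (simp add: potential_form_def cinner_self)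
  also have "\<dots> = of_real (\<integral>x. W x * (norm (rep_L2 f x))\<^sup>2 \<partial>lborel)" by (rule integral_complex_of_real)
  finally show ?thesis
    unfolding energy_eq using nn_integral_eq_integral[OF int] W_nonneg by simp
qed

lemma potential_form_nonneg: "0 \<le> Re (potential_form W f f)"
proof -
  have "potential_form W f f = (\<integral>x. complex_of_real (W x * (norm (rep_L2 f x))\<^sup>2) \<partial>lborel)"
    by (simp add: potential_form_def cinner_self)
  also have "\<dots> = of_real (\<integral>x. W x * (norm (rep_L2 f x))\<^sup>2 \<partial>lborel)" by (rule integral_complex_of_real)
  finally show ?thesis using W_nonneg by (simp add: Bochner_Integration.integral_nonneg)
qed

lemma integrable_potential_form:
  assumes "f \<in> potential_domain W" "g \<in> potential_domain W"
  shows "integrable lborel (\<lambda>x. of_real (W x) * cinner (rep_L2 f x) (rep_L2 g x))"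
proof (rule Bochner_Integration.integrable_bound)
  show "integrable lborel (\<lambda>x. W x * (norm (rep_L2 f x))\<^sup>2 + W x * (norm (rep_L2 g x))\<^sup>2)"
    using assms by (simp add: potential_domain_def)
  show "AE x in lborel. norm (complex_of_real (W x) * cinner (rep_L2 f x) (rep_L2 g x))
      \<le> norm (W x * (norm (rep_L2 f x))\<^sup>2 + W x * (norm (rep_L2 g x))\<^sup>2)"
  proof (rule AE_I2)
    fix x
    let ?a = "norm (rep_L2 f x)" and ?b = "norm (rep_L2 g x)"
    have "cmod (cinner (rep_L2 f x) (rep_L2 g x)) \<le> ?a * ?b" by (rule cmod_cinner_le)
    also have "\<dots> \<le> ?a\<^sup>2 + ?b\<^sup>2" using sum_squares_bound[of ?a ?b] mult_nonneg_nonneg[OF norm_ge_zero[of "rep_L2 f x"] norm_ge_zero[of "rep_L2 g x"]]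
      by (simp only: mult.assoc)
    finally have "W x * cmod (cinner (rep_L2 f x) (rep_L2 g x)) \<le> W x * (?a\<^sup>2 + ?b\<^sup>2)"
      by (intro mult_left_mono W_nonneg)
    then show "norm (complex_of_real (W x) * cinner (rep_L2 f x) (rep_L2 g x)) \<le> norm (W x * ?a\<^sup>2 + W x * ?b\<^sup>2)"
      using W_nonneg[of x] by (simp add: norm_mult distrib_left)
  qed
qed measurable

lemma csubspace_potential_domain: "csubspace (potential_domain W :: ('n, 'e::finite_dim_hilbert) L2 set)"
  unfolding csubspace_def
proof (intro conjI ballI allI)
  have "energy (0 :: ('n, 'e) L2) = (\<integral>\<^sup>+x. 0 \<partial>(lborel :: (real^'n) measure))"
    unfolding energy_eq by (rule nn_integral_cong_AE) (use rep_L2_zero[where 'n='n and 'e='e] in eventually_elim, simp)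
  then show "(0 :: ('n, 'e) L2) \<in> potential_domain W" by (simp add: potential_domain_iff)
next
  fix f g :: "('n, 'e) L2" assume f: "f \<in> potential_domain W" "g \<in> potential_domain W"
  have "energy (f + g) \<le> (\<integral>\<^sup>+x. ennreal (W x * (2 * (norm (rep_L2 f x))\<^sup>2 + 2 * (norm (rep_L2 g x))\<^sup>2)) \<partial>lborel)"
    unfolding energy_eq
  proof (rule nn_integral_mono_AE, use rep_L2_add[of f g] in eventually_elim)
    fix x assume *: "rep_L2 (f + g) x = rep_L2 f x + rep_L2 g x"
    have "(norm (rep_L2 f x + rep_L2 g x))\<^sup>2 \<le> (norm (rep_L2 f x) + norm (rep_L2 g x))\<^sup>2"
      by (intro power_mono norm_triangle_ineq) simp
    also have "\<dots> \<le> 2 * (norm (rep_L2 f x))\<^sup>2 + 2 * (norm (rep_L2 g x))\<^sup>2"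
      using sum_squares_bound[of "norm (rep_L2 f x)" "norm (rep_L2 g x)"] by (simp add: power2_sum)
    finally show "ennreal (W x * (norm (rep_L2 (f + g) x))\<^sup>2)
        \<le> ennreal (W x * (2 * (norm (rep_L2 f x))\<^sup>2 + 2 * (norm (rep_L2 g x))\<^sup>2))"
      unfolding * by (intro ennreal_leI mult_left_mono W_nonneg)
  qed
  also have "\<dots> = (\<integral>\<^sup>+x. 2 * ennreal (W x * (norm (rep_L2 f x))\<^sup>2) + 2 * ennreal (W x * (norm (rep_L2 g x))\<^sup>2) \<partial>lborel)"
  proof (rule nn_integral_cong)
    fix x
    have "W x * (2 * (norm (rep_L2 f x))\<^sup>2 + 2 * (norm (rep_L2 g x))\<^sup>2)
        = 2 * (W x * (norm (rep_L2 f x))\<^sup>2) + 2 * (W x * (norm (rep_L2 g x))\<^sup>2)" by (simp add: algebra_simps)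
    then show "ennreal (W x * (2 * (norm (rep_L2 f x))\<^sup>2 + 2 * (norm (rep_L2 g x))\<^sup>2))
        = 2 * ennreal (W x * (norm (rep_L2 f x))\<^sup>2) + 2 * ennreal (W x * (norm (rep_L2 g x))\<^sup>2)"
      using W_nonneg[of x] by (simp add: ennreal_plus ennreal_mult)
  qed
  also have "\<dots> = 2 * energy f + 2 * energy g"
    unfolding energy_eq by (simp add: nn_integral_add nn_integral_cmult)
  also have "\<dots> < \<infinity>" using f by (simp add: potential_domain_iff ennreal_mult_less_top)
  finally show "f + g \<in> potential_domain W" by (simp add: potential_domain_iff)
next
  fix f :: "('n, 'e) L2" and a assume f: "f \<in> potential_domain W"
  have "energy (a *\<^sub>C f) = (\<integral>\<^sup>+x. ennreal ((cmod a)\<^sup>2) * ennreal (W x * (norm (rep_L2 f x))\<^sup>2) \<partial>lborel)"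
    unfolding energy_eq
  proof (rule nn_integral_cong_AE, use rep_L2_scaleC[of a f] in eventually_elim)
    fix x assume *: "rep_L2 (a *\<^sub>C f) x = a *\<^sub>C rep_L2 f x"
    show "ennreal (W x * (norm (rep_L2 (a *\<^sub>C f) x))\<^sup>2) = ennreal ((cmod a)\<^sup>2) * ennreal (W x * (norm (rep_L2 f x))\<^sup>2)"
      unfolding * using W_nonneg[of x] by (simp add: norm_scaleC power_mult_distrib ennreal_mult[symmetric] mult_ac)
  qed
  also have "\<dots> = ennreal ((cmod a)\<^sup>2) * energy f" unfolding energy_eq by (simp add: nn_integral_cmult)
  also have "\<dots> < \<infinity>" using f by (simp add: potential_domain_iff ennreal_mult_less_top)
  finally show "a *\<^sub>C f \<in> potential_domain W" by (simp add: potential_domain_iff)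
qed

lemma potential_form_add:
  assumes "f \<in> potential_domain W" "g \<in> potential_domain W" "h \<in> potential_domain W"
  shows "potential_form W f (g + h) = potential_form W f g + potential_form W f h"
proof -
  have "potential_form W f (g + h) = (\<integral>x. of_real (W x) * cinner (rep_L2 f x) (rep_L2 g x)
      + of_real (W x) * cinner (rep_L2 f x) (rep_L2 h x) \<partial>lborel)"
    unfolding potential_form_def
    by (rule integral_cong_AE)
       (measurable, use rep_L2_add[of g h] in eventually_elim, simp add: cinner_add_right algebra_simps)
  then show ?thesis
    by (simp add: potential_form_def integrable_potential_form assms)
qed

lemma potential_form_scaleC: "potential_form W f (a *\<^sub>C g) = a * potential_form W f g"
proof -
  have "potential_form W f (a *\<^sub>C g) = (\<integral>x. a * (of_real (W x) * cinner (rep_L2 f x) (rep_L2 g x)) \<partial>lborel)"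
    unfolding potential_form_def
    by (rule integral_cong_AE)
       (measurable, use rep_L2_scaleC[of a g] in eventually_elim, simp add: cinner_scaleC_right algebra_simps)
  then show ?thesis by (simp add: potential_form_def)
qed

lemma potential_form_sym: "potential_form W f g = cnj (potential_form W g f)"
  unfolding potential_form_def Bochner_Integration.integral_cnj[symmetric]
  by (rule Bochner_Integration.integral_cong[OF refl]) (metis cinner_commute complex_cnj_complex_of_real complex_cnj_mult)

text \<open>Lower semicontinuity of the energy under norm convergence: Fatou along a subsequence
  converging almost everywhere, with \<open>sqrt (W x)\<close> absorbed into the function.\<close>

lemma energy_diff_limit:
  assumes lim: "X \<longlonglongrightarrow> f" and e: "\<And>i. i \<ge> N \<Longrightarrow> energy (X i - g) \<le> ennreal e"
  shows "energy (f - g) \<le> ennreal e"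
proof -
  obtain r where r: "strict_mono r" "AE x in lborel. (\<lambda>i. rep_L2 (X (r i)) x) \<longlonglongrightarrow> rep_L2 f x"
    by (rule L2_limit_AE_subseq[OF lim])
  have eq: "energy (h - g) = (\<integral>\<^sup>+x. ennreal ((norm (sqrt (W x) *\<^sub>R (rep_L2 h x - rep_L2 g x)))\<^sup>2) \<partial>lborel)" for h
    unfolding energy_eq
    by (rule nn_integral_cong_AE)
       (use rep_L2_diff[of h g] in eventually_elim, simp add: power_mult_distrib W_nonneg)
  show ?thesis
    unfolding eq
  proof (rule nn_integral_norm_AE_limit[where N = N])
    show "AE x in lborel. (\<lambda>i. sqrt (W x) *\<^sub>R (rep_L2 (X (r i)) x - rep_L2 g x)) \<longlonglongrightarrow> sqrt (W x) *\<^sub>R (rep_L2 f x - rep_L2 g x)"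
      using r(2) by eventually_elim (intro tendsto_intros)
    fix i assume "i \<ge> N"
    then have "r i \<ge> N" using seq_suble[OF r(1), of i] by simp
    then show "(\<integral>\<^sup>+x. ennreal ((norm (sqrt (W x) *\<^sub>R (rep_L2 (X (r i)) x - rep_L2 g x)))\<^sup>2) \<partial>lborel) \<le> ennreal e"
      using e[of "r i"] unfolding eq by simp
  qed measurable
qed

end

section \<open>The form sum\<close>

lemma csubspace_Int: "csubspace M \<Longrightarrow> csubspace N \<Longrightarrow> csubspace (M \<inter> N)"
  by (simp add: csubspace_def)

text \<open>Both summands are nonnegative after the shift, so a Cauchy sequence for the sum is
  Cauchy for each. Completeness for \<open>Q\<close> provides the limit \<open>f\<close>, which is
  also the norm limit, and lower semicontinuity of the energy gives convergence for the
  potential.\<close>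

lemma closed_form_sum:
  fixes A :: "(('n::finite, 'e::finite_dim_hilbert) L2 \<times> ('n, 'e) L2) set"
  assumes A: "semibounded_operator A c" and W: "potential W"
  shows "closed_form (form_domain A \<inter> potential_domain W) (\<lambda>f g. form_of A f g + potential_form W f g) (1 - c)"
proof -
  interpret semibounded_operator A c by fact
  interpret potential W by fact
  let ?D = "FD \<inter> potential_domain W"
  have q: "Re (form_of A f g + potential_form W f g) + (1 - c) * inner f g = Re (Q f g) + Re (potential_form W f g)" for f g
    by (simp add: Q_def Re_cinner)
  have sub: "csubspace ?D" by (intro csubspace_Int csubspace_form_domain csubspace_potential_domain)
  show ?thesis
  proof
    show "csubspace ?D" by (rule sub)
    fix f g h a assume f: "f \<in> ?D" and g: "g \<in> ?D"
    show "form_of A f (a *\<^sub>C g) + potential_form W f (a *\<^sub>C g) = a * (form_of A f g + potential_form W f g)"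
      using f g by (simp add: form_of_scaleC potential_form_scaleC distrib_left)
    show "form_of A f g + potential_form W f g = cnj (form_of A g f + potential_form W g f)"
      using f g form_of_sym[of f g] potential_form_sym[of f g] by simp
    show "(norm f)\<^sup>2 \<le> Re (form_of A f f + potential_form W f f) + (1 - c) * (norm f)\<^sup>2"
      using Q_lower[of f] potential_form_nonneg[of f] f q[of f f] by (simp add: power2_norm_eq_inner)
    assume h: "h \<in> ?D"
    show "form_of A f (g + h) + potential_form W f (g + h)
        = form_of A f g + potential_form W f g + (form_of A f h + potential_form W f h)"
      using f g h by (simp add: form_of_add potential_form_add)
  next
    show "form_complete ?D (\<lambda>f g. Re (form_of A f g + potential_form W f g) + (1 - c) * inner f g)"
      unfolding q form_complete_def
    proof (intro allI impI)
      fix X :: "nat \<Rightarrow> ('n, 'e) L2"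
      assume X: "range X \<subseteq> ?D"
        and C: "\<forall>e>0. \<exists>N. \<forall>i\<ge>N. \<forall>j\<ge>N. Re (Q (X i - X j) (X i - X j)) + Re (potential_form W (X i - X j) (X i - X j)) < e"
      have XD: "X j \<in> FD" "X j \<in> potential_domain W" for j using X by auto
      have XX: "X i - X j \<in> ?D" for i j
        using subspace_diff[OF csubspace_imp_subspace[OF sub]] X by blast
      have Qpos: "0 \<le> Re (Q (X i - X j) (X i - X j))" for i j using F.nonneg XX by blast
      have "\<exists>N. \<forall>i\<ge>N. \<forall>j\<ge>N. Re (Q (X i - X j) (X i - X j)) < e" if e: "e > 0" for e
      proof -
        obtain N where N: "\<And>i j. i \<ge> N \<Longrightarrow> j \<ge> N \<Longrightarrow> Re (Q (X i - X j) (X i - X j)) + Re (potential_form W (X i - X j) (X i - X j)) < e"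
          using C[rule_format, OF e] by blast
        have "Re (Q (X i - X j) (X i - X j)) < e" if "i \<ge> N" "j \<ge> N" for i j
          using N[OF that] potential_form_nonneg[of "X i - X j"] by linarith
        then show ?thesis by blast
      qed
      then obtain f where f: "f \<in> FD" and Qf: "(\<lambda>j. Re (Q (X j - f) (X j - f))) \<longlonglongrightarrow> 0"
        using form_complete_Q[unfolded form_complete_def, rule_format, of X] XD(1) by blast
      have "X \<longlonglongrightarrow> f"
      proof -
        have "norm (X j - f) \<le> sqrt (Re (Q (X j - f) (X j - f)))" for j
          using Q_lower[OF F.D_diff[OF XD(1) f]] by (rule real_le_rsqrt)
        moreover have "(\<lambda>j. sqrt (Re (Q (X j - f) (X j - f)))) \<longlonglongrightarrow> sqrt 0" by (intro tendsto_intros Qf)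
        ultimately have "(\<lambda>j. X j - f) \<longlonglongrightarrow> 0"
          by (intro Lim_null_comparison[of "\<lambda>j. X j - f" "\<lambda>j. sqrt (Re (Q (X j - f) (X j - f)))"]) auto
        then show ?thesis by (simp add: LIM_zero_iff)
      qed
      have en: "\<exists>N. \<forall>j\<ge>N. energy (f - X j) \<le> ennreal e" if e: "e > 0" for e
      proof -
        obtain N where N: "\<And>i j. i \<ge> N \<Longrightarrow> j \<ge> N \<Longrightarrow> Re (Q (X i - X j) (X i - X j)) + Re (potential_form W (X i - X j) (X i - X j)) < e"
          using C[rule_format, OF e] by blast
        have "energy (f - X j) \<le> ennreal e" if j: "j \<ge> N" for j
        proof (rule energy_diff_limit[OF \<open>X \<longlonglongrightarrow> f\<close>, of N])
          fix i assume "i \<ge> N"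
          then have "Re (potential_form W (X i - X j) (X i - X j)) \<le> e"
            using N[of i j] j Qpos[of i j] by linarith
          then show "energy (X i - X j) \<le> ennreal e"
            using energy_eq_potential_form[of "X i - X j"] XX[of i j] by (simp add: ennreal_leI)
        qed
        then show ?thesis by blast
      qed
      have fX: "\<exists>N. \<forall>j\<ge>N. f - X j \<in> potential_domain W"
      proof -
        obtain N where N: "\<And>j. j \<ge> N \<Longrightarrow> energy (f - X j) \<le> ennreal 1" using en[of 1] by auto
        have "energy (f - X j) < \<infinity>" if "j \<ge> N" for j
          using le_less_trans[OF N[OF that] ennreal_less_top] by simp
        then show ?thesis unfolding potential_domain_iff by blast
      qed
      have subW: "subspace (potential_domain W :: ('n, 'e) L2 set)"
        by (rule csubspace_imp_subspace[OF csubspace_potential_domain])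
      \<comment> \<open>A single finite energy difference suffices, since \<open>f\<close> is the
        sum of \<open>f - X N\<close> and \<open>X N\<close>.\<close>
      obtain N where "f - X N \<in> potential_domain W" using fX by blast
      from subspace_add[OF subW this XD(2)[of N]] have fW: "f \<in> potential_domain W" by simp
      have "(\<lambda>j. Re (potential_form W (X j - f) (X j - f))) \<longlonglongrightarrow> 0"
      proof (rule LIMSEQ_I)
        fix e :: real assume e: "e > 0"
        then obtain N where N: "\<And>j. j \<ge> N \<Longrightarrow> energy (f - X j) \<le> ennreal (e/2)" using en[of "e/2"] by auto
        have "Re (potential_form W (X j - f) (X j - f)) < e" if "j \<ge> N" for j
        proof -
          have "energy (X j - f) = energy (f - X j)"
            unfolding energy_eq
            by (rule nn_integral_cong_AE)
               (use rep_L2_diff[of "X j" f] rep_L2_diff[of f "X j"] in eventually_elim, simp add: norm_minus_commute)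
          then have "ennreal (Re (potential_form W (X j - f) (X j - f))) \<le> ennreal (e/2)"
            using energy_eq_potential_form[OF subspace_diff[OF subW XD(2) fW], of j] N[OF that] by simp
          then show ?thesis using e by (simp add: ennreal_le_iff)
        qed
        then show "\<exists>no. \<forall>n\<ge>no. norm (Re (potential_form W (X n - f) (X n - f)) - 0) < e"
          by (intro exI[of _ N]) (simp add: abs_of_nonneg[OF potential_form_nonneg])
      qed
      from tendsto_add[OF Qf this]
      show "\<exists>f\<in>?D. (\<lambda>j. Re (Q (X j - f) (X j - f)) + Re (potential_form W (X j - f) (X j - f))) \<longlonglongrightarrow> 0"
        using f fW by auto
    qed
  qed
qed

lemma form_sum_compact:
  fixes A :: "(('n::finite, 'e::finite_dim_hilbert) L2 \<times> ('n, 'e) L2) set"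
  assumes A: "semibounded_operator A c" and W: "potential W"
    and dom: "form_domain A = sobolev m" and m: "m > 0"
    and thin: "\<And>c. c > 0 \<Longrightarrow> ((\<lambda>a. measure lborel {x \<in> cball a 1. W x < c}) \<longlongrightarrow> 0) at_infinity"
  shows "compact (closure {f \<in> form_domain A \<inter> potential_domain W.
    Re (form_of A f f + potential_form W f f) + (1 - c) * inner f f \<le> M})"
proof -
  interpret semibounded_operator A c by fact
  interpret potential W by fact
  let ?S = "{f \<in> FD \<inter> potential_domain W. Re (form_of A f f + potential_form W f f) + (1 - c) * inner f f \<le> M}"
  \<comment> \<open>A positive bound, so that \<open>f\<close> can be scaled by
    \<open>1 / sqrt M'\<close>.\<close>
  define M' where "M' = max M 1"
  have M': "M' > 0" by (simp add: M'_def)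
  have S: "f \<in> FD" "f \<in> potential_domain W" "Re (Q f f) \<le> M'" "Re (potential_form W f f) \<le> M'" if "f \<in> ?S" for f
  proof -
    show f: "f \<in> FD" "f \<in> potential_domain W" using that by auto
    have "Re (Q f f) + Re (potential_form W f f) \<le> M'" using that by (auto simp: Q_def Re_cinner M'_def)
    then show "Re (Q f f) \<le> M'" "Re (potential_form W f f) \<le> M'"
      using F.nonneg[OF f(1)] potential_form_nonneg[of f] by linarith+
  qed
  obtain K where K: "K \<ge> 0" "\<And>f. f \<in> FD \<Longrightarrow> Re (Q f f) \<le> 1 \<Longrightarrow>
      (\<integral>\<^sup>+\<xi>. ennreal ((1 + (norm \<xi>)\<^sup>2) powr m * (norm (rep_L2 (fourier f) \<xi>))\<^sup>2) \<partial>lborel) \<le> ennreal K"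
    using sobolev_form_bound[OF A dom] m by auto
  have norm: "norm f \<le> sqrt M'" if "f \<in> ?S" for f
    using Q_lower[OF S(1)[OF that]] S(3)[OF that] by (intro real_le_rsqrt) linarith
  have sob: "(\<integral>\<^sup>+\<xi>. ennreal ((1 + (norm \<xi>)\<^sup>2) powr m * (norm (rep_L2 (fourier f) \<xi>))\<^sup>2) \<partial>lborel) \<le> ennreal (M' * K)"
    if f: "f \<in> ?S" for f
  proof -
    \<comment> \<open>Scaling by \<open>s\<close> moves \<open>f\<close> into the unit ball of the
      form norm, where \<open>K\<close> applies; undoing it costs the factor
      \<open>M'\<close>.\<close>
    define s where "s = 1 / sqrt M'"
    have s: "s\<^sup>2 = 1 / M'" using M' by (simp add: s_def power_divide)
    have "Re (Q (s *\<^sub>R f) (s *\<^sub>R f)) = s\<^sup>2 * Re (Q f f)"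
      using S(1)[OF f] F.D_scale[OF S(1)[OF f], of s] by (simp add: F.scale_left F.scale_right power2_eq_square)
    also have "\<dots> \<le> 1" using S(3)[OF f] M' by (simp add: s)
    finally have "(\<integral>\<^sup>+\<xi>. ennreal ((1 + (norm \<xi>)\<^sup>2) powr m * (norm (rep_L2 (fourier (s *\<^sub>R f)) \<xi>))\<^sup>2) \<partial>lborel) \<le> ennreal K"
      by (intro K(2) F.D_scale S(1)[OF f])
    also have "(\<integral>\<^sup>+\<xi>. ennreal ((1 + (norm \<xi>)\<^sup>2) powr m * (norm (rep_L2 (fourier (s *\<^sub>R f)) \<xi>))\<^sup>2) \<partial>lborel)
        = (\<integral>\<^sup>+\<xi>. ennreal (1 / M') * ennreal ((1 + (norm \<xi>)\<^sup>2) powr m * (norm (rep_L2 (fourier f) \<xi>))\<^sup>2) \<partial>lborel)"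
      unfolding fourier_scaleR
      by (rule nn_integral_cong_AE)
         (use rep_L2_scaleR[of s "fourier f"] in eventually_elim,
          use M' in \<open>simp add: ennreal_mult[symmetric] power_mult_distrib s\<close>)
    also have "\<dots> = ennreal (1 / M') * (\<integral>\<^sup>+\<xi>. ennreal ((1 + (norm \<xi>)\<^sup>2) powr m * (norm (rep_L2 (fourier f) \<xi>))\<^sup>2) \<partial>lborel)"
      by (rule nn_integral_cmult) measurable
    finally have "ennreal M' * (ennreal (1 / M') * (\<integral>\<^sup>+\<xi>. ennreal ((1 + (norm \<xi>)\<^sup>2) powr m * (norm (rep_L2 (fourier f) \<xi>))\<^sup>2) \<partial>lborel))
        \<le> ennreal M' * ennreal K"
      by (rule mult_left_mono) simp
    moreover have "ennreal M' * ennreal (1 / M') = 1" using M' by (simp add: ennreal_mult[symmetric])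
    ultimately show ?thesis using M' K(1) by (simp add: mult.assoc[symmetric] ennreal_mult)
  qed
  show ?thesis
  proof (rule compact_closure_equicontinuous_weighted[where W = W and C = "sqrt M'" and D = M'])
    show "norm f \<le> sqrt M'" if "f \<in> ?S" for f by (rule norm[OF that])
    show "\<exists>\<delta>>0. \<forall>f\<in>?S. \<forall>h. norm h < \<delta> \<longrightarrow> norm (translation h f - f) \<le> \<epsilon>" if "\<epsilon> > 0" for \<epsilon>
      by (rule sobolev_bounded_equicontinuous[OF norm sob m that])
    show "(\<integral>\<^sup>+x. ennreal (W x) * ennreal ((norm (rep_L2 f x))\<^sup>2) \<partial>lborel) \<le> ennreal M'" if "f \<in> ?S" for f
      using energy_eq_potential_form[OF S(2)[OF that]] S(4)[OF that] unfolding energy_def by (simp add: ennreal_leI)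
  qed (use thin W_borel in auto)
qed

text \<open>Measurability on the whole space is recovered from integrability on balls of growing
  radius; the maximum with 0 makes the Borel representative nonnegative at every point.\<close>

lemma Borel_version:
  fixes V :: "'a::euclidean_space \<Rightarrow> real"
  assumes loc: "\<And>K. compact K \<Longrightarrow> V absolutely_integrable_on K" and pos: "AE x in lebesgue. 0 \<le> V x"
  shows "V \<in> borel_measurable lebesgue"
    and "\<exists>W. W \<in> borel_measurable borel \<and> (\<forall>x. 0 \<le> W x) \<and> (AE x in lebesgue. V x = W x)"
proof -
  show V: "V \<in> borel_measurable lebesgue"
  proof (rule borel_measurable_LIMSEQ_real)
    fix j :: nat
    have "set_integrable lebesgue (cball 0 (real j)) V" by (rule loc) simp
    then show "(\<lambda>x. indicator (cball 0 (real j)) x * V x) \<in> borel_measurable lebesgue"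
      unfolding set_integrable_def by (auto dest: borel_measurable_integrable)
  next
    fix x :: 'a
    obtain N where N: "norm x \<le> real N" using real_arch_simple by blast
    have "indicator (cball 0 (real j)) x * V x = V x" if "j \<ge> N" for j using N that by simp
    then show "(\<lambda>j. indicator (cball 0 (real j)) x * V x) \<longlonglongrightarrow> V x"
      by (intro tendsto_eventually) (auto simp: eventually_sequentially)
  qed
  obtain W0 where W0: "W0 \<in> borel_measurable lborel" "AE x in lborel. V x = W0 x"
    using completion_ex_borel_measurable_real[OF V] by blast
  have "AE x in lebesgue. V x = W0 x" using W0(2) by (rule AE_completion)
  then have "AE x in lebesgue. V x = max 0 (W0 x)" using pos by eventually_elim simp
  then show "\<exists>W. W \<in> borel_measurable borel \<and> (\<forall>x. 0 \<le> W x) \<and> (AE x in lebesgue. V x = W x)"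
    using W0(1) by (intro exI[of _ "\<lambda>x. max 0 (W0 x)"]) auto
qed

lemma measurable_rep_L2_lebesgue [measurable]: "rep_L2 f \<in> borel_measurable lebesgue"
  by (rule measurable_completion) simp

text \<open>A change on a null set does not affect integrals, and for Borel integrands the completed
  measure may be replaced by \<open>lborel\<close>.\<close>

lemma form_sum_Borel:
  fixes A :: "(('n::finite, 'e::finite_dim_hilbert) L2 \<times> ('n, 'e) L2) set"
  assumes V[measurable]: "V \<in> borel_measurable lebesgue" and W: "potential W" and VW: "AE x in lebesgue. V x = W x"
  shows "form_sum A V = (\<lambda>f g. form_of A f g + potential_form W f g)"
    and "form_sum_domain A V = form_domain A \<inter> potential_domain W"
proof -
  interpret potential W by fact
  have Wl[measurable]: "W \<in> borel_measurable lebesgue" by (rule measurable_completion) simp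
  show "form_sum A V = (\<lambda>f g. form_of A f g + potential_form W f g)"
  proof (intro ext)
    fix f g :: "('n, 'e) L2"
    have "(\<integral>x. complex_of_real (V x) * cinner (rep_L2 f x) (rep_L2 g x) \<partial>lebesgue)
        = (\<integral>x. complex_of_real (W x) * cinner (rep_L2 f x) (rep_L2 g x) \<partial>lebesgue)"
    proof (rule integral_cong_AE)
      show "AE x in lebesgue. complex_of_real (V x) * cinner (rep_L2 f x) (rep_L2 g x)
          = complex_of_real (W x) * cinner (rep_L2 f x) (rep_L2 g x)"
        using VW by eventually_elim simp
    qed measurable
    also have "\<dots> = potential_form W f g"
      unfolding potential_form_def by (rule integral_completion) measurable
    finally show "form_sum A V f g = form_of A f g + potential_form W f g" by (simp add: form_sum_def)
  qed
  have "integrable lebesgue (\<lambda>x. (norm (sqrt (V x) *\<^sub>R rep_L2 f x))\<^sup>2) \<longleftrightarrow> f \<in> potential_domain W" for f :: "('n, 'e) L2"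
  proof -
    have "integrable lebesgue (\<lambda>x. (norm (sqrt (V x) *\<^sub>R rep_L2 f x))\<^sup>2)
        \<longleftrightarrow> integrable lebesgue (\<lambda>x. W x * (norm (rep_L2 f x))\<^sup>2)"
    proof (rule integrable_cong_AE)
      show "AE x in lebesgue. (norm (sqrt (V x) *\<^sub>R rep_L2 f x))\<^sup>2 = W x * (norm (rep_L2 f x))\<^sup>2"
        using VW by eventually_elim (simp add: power_mult_distrib W_nonneg)
    qed measurable
    also have "\<dots> \<longleftrightarrow> integrable lborel (\<lambda>x. W x * (norm (rep_L2 f x))\<^sup>2)"
      by (rule integrable_completion) measurable
    finally show ?thesis by (simp add: potential_domain_def)
  qed
  then show "form_sum_domain A V = form_domain A \<inter> potential_domain W"
    by (auto simp: form_sum_domain_def)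
qed

text \<open>A test function is bounded with support in a compact ball, so local integrability of W
  suffices.\<close>

lemma test_function_potential_domain:
  assumes W: "potential W" and r: "r > 0"
    and loc: "\<And>K. compact K \<Longrightarrow> integrable lborel (\<lambda>x. indicator K x * W x)"
  shows "abs_L2 (test_function r N k e) \<in> potential_domain W"
proof -
  interpret potential W by fact
  let ?c = "((r\<^sup>2) ^ N) ^ CARD('a) * norm e" and ?B = "cball (0::real^'a) (r * CARD('a))"
  have "integrable lborel (\<lambda>x. W x * (norm (test_function r N k e x))\<^sup>2)"
  proof (rule Bochner_Integration.integrable_bound)
    show "integrable lborel (\<lambda>x. ?c\<^sup>2 * (indicator ?B x * W x))" by (intro integrable_mult_right loc) simp
    show "AE x in lborel. norm (W x * (norm (test_function r N k e x))\<^sup>2) \<le> norm (?c\<^sup>2 * (indicator ?B x * W x))"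
    proof (rule AE_I2)
      fix x :: "real^'a"
      have "(norm (test_function r N k e x))\<^sup>2 \<le> (?c * indicator ?B x)\<^sup>2"
        by (intro power_mono norm_test_function_le r) simp
      also have "\<dots> = ?c\<^sup>2 * indicator ?B x" by (simp add: power_mult_distrib indicator_def)
      finally have "W x * (norm (test_function r N k e x))\<^sup>2 \<le> W x * (?c\<^sup>2 * indicator ?B x)"
        by (intro mult_left_mono W_nonneg)
      then show "norm (W x * (norm (test_function r N k e x))\<^sup>2) \<le> norm (?c\<^sup>2 * (indicator ?B x * W x))"
        using W_nonneg[of x] by (simp add: abs_mult mult_ac)
    qed
  qed measurable
  then have "integrable lborel (\<lambda>x. W x * (norm (rep_L2 (abs_L2 (test_function r N k e)) x))\<^sup>2)"
  proof (rule integrable_cong_AE_imp)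
    show "AE x in lborel. W x * (norm (test_function r N k e x))\<^sup>2
        = W x * (norm (rep_L2 (abs_L2 (test_function r N k e)) x))\<^sup>2"
      using rep_abs_L2[OF square_integrable_test_function(2)[OF r], of N k e] by eventually_elim simp
  qed measurable
  then show ?thesis by (simp add: potential_domain_def)
qed

theorem proposition8:
  fixes H0 :: "(('n::finite, 'e::finite_dim_hilbert) L2 \<times> ('n, 'e) L2) set"
    and m :: real
    and V :: "real^'n \<Rightarrow> real"
  assumes "self_adjoint H0"
    and "bounded_from_below H0"
    and "m > 0"
    and "form_domain H0 = sobolev m"
    and "((\<lambda>k. sobolev_operator_norm m
            (\<lambda>g f. modulation_conj k (form_extension H0) g f - form_extension H0 g f))
          \<longlongrightarrow> 0) (at 0)"
    and "AE x in lebesgue. 0 \<le> V x"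
    and "\<And>K. compact K \<Longrightarrow> V absolutely_integrable_on K"
    and "\<And>c. c > 0 \<Longrightarrow>
          ((\<lambda>a. measure lebesgue {x \<in> cball a 1. V x < c}) \<longlongrightarrow> 0) at_infinity"
  shows "self_adjoint (form_sum_operator H0 V) \<and>
         purely_discrete_spectrum (form_sum_operator H0 V)"
proof -
  obtain c where "\<And>f u. (f, u) \<in> H0 \<Longrightarrow> c * (norm f)\<^sup>2 \<le> Re (cinner f u)"
    using assms(2) by (auto simp: bounded_from_below_def)
  then have A: "semibounded_operator H0 c" using assms(1) by (simp add: semibounded_operator_def)
  note V = Borel_version(1)[OF assms(7,6)]
  obtain W where W_borel[measurable]: "W \<in> borel_measurable borel" and W0: "\<And>x. 0 \<le> W x"
    and VW: "AE x in lebesgue. V x = W x"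
    using Borel_version(2)[OF assms(7,6)] by blast
  have W: "potential W" using W_borel W0 by (simp add: potential_def)
  have Wl[measurable]: "W \<in> borel_measurable lebesgue" by (rule measurable_completion) simp
  have loc: "integrable lborel (\<lambda>x. indicator K x * W x)" if K: "compact K" for K
  proof -
    have [measurable]: "K \<in> sets borel" using K by (simp add: borel_compact)
    have "integrable lebesgue (\<lambda>x. indicator K x *\<^sub>R V x)"
      using assms(7)[OF K] by (simp add: set_integrable_def)
    then have "integrable lebesgue (\<lambda>x. indicator K x * W x)"
    proof (rule integrable_cong_AE_imp)
      show "(\<lambda>x. indicator K x * W x) \<in> borel_measurable lebesgue"
        by (intro borel_measurable_times borel_measurable_indicator Wl) simp
      show "AE x in lebesgue. indicator K x *\<^sub>R V x = indicator K x * W x" using VW by eventually_elim simp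
    qed
    then show ?thesis by (subst (asm) integrable_completion) auto
  qed
  have thin: "((\<lambda>a. measure lborel {x \<in> cball a 1. W x < l}) \<longlongrightarrow> 0) at_infinity" if l: "l > 0" for l
  proof -
    have "measure lebesgue {x \<in> cball a 1. V x < l} = measure lborel {x \<in> cball a 1. W x < l}" for a
    proof -
      have Ws: "{x \<in> cball a 1. W x < l} \<in> sets borel" by measurable
      have "{x \<in> cball a 1. V x < l} = cball a 1 \<inter> {x \<in> space lebesgue. V x < l}" by auto
      moreover have "{x \<in> space lebesgue. V x < l} \<in> sets lebesgue" using V by measurable
      ultimately have Vs: "{x \<in> cball a 1. V x < l} \<in> sets lebesgue" by auto
      \<comment> \<open>The sublevel sets of V and W differ by a null set, so the thinness
        hypothesis carries over to the Borel representative.\<close>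
      have "measure lebesgue {x \<in> cball a 1. V x < l} = measure lebesgue {x \<in> cball a 1. W x < l}"
        by (rule measure_eq_AE) (use VW in \<open>eventually_elim, simp\<close>, use Vs Ws in auto)
      then show ?thesis using Ws by simp
    qed
    then show ?thesis using assms(8)[OF l] by simp
  qed
  have form: "form_sum H0 V = (\<lambda>f g. form_of H0 f g + potential_form W f g)"
    by (rule form_sum_Borel(1)[OF V W VW])
  have domain: "form_sum_domain H0 V = form_domain H0 \<inter> potential_domain W"
    by (rule form_sum_Borel(2)[OF V W VW])
  interpret closed_form "form_domain H0 \<inter> potential_domain W" "\<lambda>f g. form_of H0 f g + potential_form W f g" "1 - c"
    by (rule closed_form_sum[OF A W])
  have sa: "self_adjoint (form_operator (form_domain H0 \<inter> potential_domain W) (\<lambda>f g. form_of H0 f g + potential_form W f g))"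
  proof (rule form_operator_self_adjoint)
    fix v :: "('n, 'e) L2"
    assume v: "\<And>f. f \<in> form_domain H0 \<inter> potential_domain W \<Longrightarrow> cinner f v = 0"
    \<comment> \<open>Enough smoothness for Sobolev order \<open>m\<close> together with one spare
      power for integrability over frequency.\<close>
    define N where "N = nat \<lceil>m + 1\<rceil>"
    have N: "m + 1 \<le> real N" unfolding N_def by (rule real_nat_ceiling_ge)
    show "v = 0"
    proof (rule test_functions_total[of N], rule v)
      fix r k and e :: 'e assume r: "(r::real) > 0"
      show "abs_L2 (test_function r N k e) \<in> form_domain H0 \<inter> potential_domain W"
        unfolding assms(4)
        using test_function_sobolev[OF r _ N] test_function_potential_domain[OF W r loc] assms(3) by auto
    qed
  qed
  moreover have "purely_discrete_spectrum (form_operator (form_domain H0 \<inter> potential_domain W) (\<lambda>f g. form_of H0 f g + potential_form W f g))"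
    by (rule form_operator_purely_discrete[OF sa form_sum_compact[OF A W assms(4,3) thin]])
  ultimately show ?thesis by (simp add: form_sum_operator_def form domain)
qed

end
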